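(* The functors $\mathrm{B2E}\colon\mathbf{Bsys}\to\mathbf{Esys}_s$ and $\mathrm{E2B}\colon\mathbf{Esys}_s\to\mathbf{Bsys}$ described in the context, between the category of B-systems and the category of stratified E-systems and stratified E-homomorphisms, form an equivalence of categories.
   Context: **Strict categories, stratification.** A strict category is a (small) category regarded as an algebraic structure, so that equality of objects is meaningful. Let $\mathcal C$ be a strict category with a chosen terminal object $1$. A stratification of $\mathcal C$ is a functor $L\colon\mathcal C\to(\mathbb N,\ge)$ such that (1) $L(X)=0$ iff $X=1$; (2) for any $f\colon X\to Y$, $L(X)=L(Y)$ iff $X=Y$ and $f=\mathrm{id}_X$; (3) every $f\colon X\to Y$ with $L(X)=n+m+1$, $L(Y)=n$ has a unique factorization $X=X_{m+1}\to X_m\to\cdots\to X_1\to X_0=Y$ with $L(X_i)=n+i$. Stratifications are unique when they exist. A functor $F$ between stratified categories is stratified if $L_{\mathcal C}=L_{\mathcal D}\circ F$. Slices $\mathcal C/X$ of a stratified category (chosen terminal object $\mathrm{id}_X$) are stratified by $L_X(f\colon Y\to X)=L(Y)-L(X)$. An arrow $f\colon X\to Y$ is indecomposable if $L(X)=L(Y)+1$; every $X$ with $L(X)>0$ is the domain of exactly one indecomposable arrow, denoted $\overline X$. **Slice notation.** For a strict category $\mathcal F$ and object $\Gamma$, $A\in\mathcal F/\Gamma$ means $A$ is an object of the slice, i.e. an arrow $A\colon\Gamma.A\to\Gamma$. For $P\in\mathcal F/\Gamma.A$, $A.P:=A\circ P\in\mathcal F/\Gamma$. We identify $(\mathcal F/\Gamma)/A$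 with $\mathcal F/\Gamma.A$. **E-systems.** A term structure on a strict category $\mathcal F$ is a family of sets $T(A)$ indexed by all arrows $A$ of $\mathcal F$; a functor with term structure is a functor $G$ with functions $T(A)\to T(G(A))$ for all arrows $A$. Slices $\mathcal F/\Gamma$ inherit the term structure (the terms of an arrow of $\mathcal F/\Gamma$ are those of the underlying arrow of $\mathcal F$); $G$ induces $G/\Gamma\colon\mathcal F/\Gamma\to\mathcal D/G(\Gamma)$. Equalities between functors with term structure are on objects, arrows and terms. A pre-E-system $\mathbb E$ is a strict category $\mathcal F$ with term structure $T$, a chosen terminal object $[\,]$, and: for each $A\in\mathcal F/\Gamma$ and $x\in T(A)$ a functor with term structure $S_x\colon\mathcal F/\Gamma.A\to\mathcal F/\Gamma$ with $S_x(\mathrm{id}_{\Gamma.A})=\mathrm{id}_\Gamma$; for each $A\in\mathcal F/\Gamma$ a functor with term structure $W_A\colon\mathcal F/\Gamma\to\mathcal F/\Gamma.A$ with $W_{\mathrm{id}_\Gamma}=\mathrm{id}$, $W_{A.P}=W_P\circ W_A$, $W_A(\mathrm{id}_\Gamma)=\mathrm{id}_{\Gamma.A}$; for each $A\in\mathcal F/\Gamma$ an element $\mathsf{idtm}_A\in T(W_A(A))$. A pre-E-homomorphism is a functor with term structure $H$ with $H([\,])=[\,]$, $(H/\Gamma)\circ S_x=S_{H(x)}\circ(H/\Gamma.A)$, $(H/\Gamma.A)\circ W_A=W_{H(A)}\circ(H/\Gamma)$, $H(\mathsf{idtm}_A)=\mathsf{idtm}_{H(A)}$. The slice $\mathbb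 E/\Gamma$ is $\mathcal F/\Gamma$ with chosen terminal object $\mathrm{id}_\Gamma$ and the structure inherited from $\mathbb E$. An E-system is a pre-E-system in which (1) each $S_x$ and (2) each $W_A$ is a pre-E-homomorphism (between slices), (3) $S_x\circ W_A=\mathrm{id}_{\mathbb E/\Gamma}$, (4) $S_x(\mathsf{idtm}_A)=x$ for $x\in T(A)$, (5) $S_{\mathsf{idtm}_A}\circ(W_A/A)=\mathrm{id}_{\mathbb E/\Gamma.A}$. E-homomorphisms are pre-E-homomorphisms between E-systems. An E-system is stratified if $\mathcal F$ is stratified and all $W_A$, $S_x$ are stratified; an E-homomorphism is stratified if its underlying functor is. $\mathbf{Esys}_s$ is the category of stratified E-systems and stratified E-homomorphisms. **B-systems.** A B-frame $\mathbb B$ consists of sets $B_n$, $\tilde B_{n+1}$ ($n\in\mathbb N$), with $B_0=\{*\}$ a singleton, and functions $\mathsf{ft}\colon B_{n+1}\to B_n$, $\partial\colon\tilde B_{n+1}\to B_{n+1}$; $\mathsf{ft}^m\colon B_{n+m}\to B_n$ is the $m$-fold composite. A homomorphism $H$ of B-frames consists of functions $H\colon B_n\to A_n$, $\tilde H\colon\tilde B_{n+1}\to\tilde A_{n+1}$ commuting with $\mathsf{ft}$ and $\partial$. For $X\in B_n$ the slice $\mathbb B/X$ has $(B/X)_m=\{Y\in B_{n+m}\mid\mathsf{ft}^m(Y)=X\}$, $(\tilde B/X)_{m+1}=\{y\in\tilde B_{n+m+1}\mid\mathsf{ft}^{m+1}(\partial y)=X\}$; $H$ induces $H/X\colon\mathbb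 B/X\to\mathbb A/H(X)$; $(\mathbb B/X)/Y$ is identified with $\mathbb B/Y$. A pre-B-system is a B-frame with homomorphisms of B-frames $S_x\colon\mathbb B/\partial(x)\to\mathbb B/\mathsf{ft}(\partial(x))$ for $x\in\tilde B_{n+1}$, $W_X\colon\mathbb B/\mathsf{ft}(X)\to\mathbb B/X$ for $X\in B_{n+1}$, and functions $\delta\colon B_{n+1}\to\tilde B_{n+2}$ with $\partial(\delta(X))=W_X(X)$. Slices inherit this structure. A pre-B-homomorphism is a homomorphism of B-frames $H$ with $(H/\mathsf{ft}(\partial x))\circ S_x=S_{\tilde H(x)}\circ(H/\partial x)$, $(H/X)\circ W_X=W_{H(X)}\circ(H/\mathsf{ft}(X))$, $\tilde H(\delta(X))=\delta(H(X))$. A B-system is a pre-B-system such that all $S_x$ and all $W_X$ are pre-B-homomorphisms, $S_x\circ W_{\partial(x)}=\mathrm{id}$, $\tilde S_x(\delta(\partial(x)))=x$, and $S_{\delta(X)}\circ(W_X/X)=\mathrm{id}_{\mathbb B/X}$. B-homomorphisms are pre-B-homomorphisms between B-systems. $\mathbf{Bsys}$ is the resulting category. **The functor $\mathrm{B2E}\colon\mathbf{Bsys}\to\mathbf{Esys}_s$.** For a B-system $\mathbb B$, the underlying category $\mathcal F_{\mathbb B}$ is the free category on the graph with vertices $(n,X)$, $X\in B_n$, and edges $(n+1,X)\to(n,\mathsf{ft}(X))$; its arrows are $(X,k)\colon(n+k,X)\to(n,\mathsf{ft}^k(X))$; the terminal object is $(0,* )$. Terms and homomorphisms $S^k_t\colon\mathbb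 B/X\to\mathbb B/\mathsf{ft}^k(X)$ for $t\in T(X,k)$ are defined by: $T(X,0)=\{*\}$, $S^0_*=\mathrm{id}$; $T(X,1)=\partial^{-1}(X)$, $S^1_x=S_x$; for $k\ge1$, $T(X,k+1)=\coprod_{t\in T(\mathsf{ft}(X),k)}T(S^k_t(X),1)$, $S^{k+1}_{(t,x)}=S_x\circ(S^k_t/X)$. A homomorphism $H$ of B-frames preserving the $S_x$ acts by $(n,X)\mapsto(n,H(X))$, $(X,k)\mapsto(H(X),k)$, and componentwise by $\tilde H$ on terms $(t_1,\dots,t_k)$. Identifying $\mathcal F_{\mathbb B}/(n,X)$ with $\mathcal F_{\mathbb B/X}$, substitution by $t\in T(X,k)$ is the functor with term structure induced by $S^k_t$, weakening by $(X,k)$ is the one induced by $W^k_X=W_X\circ W_{\mathsf{ft}(X)}\circ\cdots\circ W_{\mathsf{ft}^{k-1}(X)}$ ($W_X^0=\mathrm{id}$), and $\mathsf{idtm}_{(X,0)}=*$, $\mathsf{idtm}_{(X,1)}=\delta(X)$, $\mathsf{idtm}_{(X,k+1)}=(\tilde W_X(\mathsf{idtm}_{(\mathsf{ft}(X),k)}),\delta(X))$, with $\tilde W_X$ applied componentwise. **The functor $\mathrm{E2B}\colon\mathbf{Esys}_s\to\mathbf{Bsys}$.** For a stratified E-system: $B_n=\{X\in\mathrm{Ob}(\mathcal F)\mid L(X)=n\}$, $\tilde B_{n+1}=\coprod_{X\in B_{n+1}}T(\overline X)$, $\mathsf{ft}(X)=\mathrm{cod}(\overline X)$, $\partial(X,x)=X$.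 A stratified functor with term structure $F$ induces the homomorphism $X\mapsto F(X)$, $(X,t)\mapsto(F(X),F(t))$. Identifying the B-frame of a slice $\mathcal F/X$ with the slice B-frame over $X$, $S_{(X,t)}$ is induced by $S_t$, $W_X$ is induced by $W_{\overline X}$, and $\delta(X)=(W_X(X),\mathsf{idtm}_{\overline X})$. *)

theory Defs
  imports "HOL-Library.FuncSet"
begin

section \<open>Categories, functors, equivalences\<close>

text \<open>Composition is written in application order: \<open>Comp C g f\<close> is \<open>g\<close> after \<open>f\<close>.\<close>

record ('o, 'm) cat =
  Ob :: "'o set"
  Ar :: "'m set"
  Dom :: "'m \<Rightarrow> 'o"
  Cod :: "'m \<Rightarrow> 'o"
  Idt :: "'o \<Rightarrow> 'm"
  Comp :: "'m \<Rightarrow> 'm \<Rightarrow> 'm"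

definition category :: "('o, 'm, 'z) cat_scheme \<Rightarrow> bool" where
  "category C \<longleftrightarrow>
     (\<forall>f\<in>Ar C. Dom C f \<in> Ob C \<and> Cod C f \<in> Ob C) \<and>
     (\<forall>X\<in>Ob C. Idt C X \<in> Ar C \<and> Dom C (Idt C X) = X \<and> Cod C (Idt C X) = X) \<and>
     (\<forall>f\<in>Ar C. \<forall>g\<in>Ar C. Cod C f = Dom C g \<longrightarrow>
        Comp C g f \<in> Ar C \<and> Dom C (Comp C g f) = Dom C f \<and> Cod C (Comp C g f) = Cod C g) \<and>
     (\<forall>f\<in>Ar C. Comp C f (Idt C (Dom C f)) = f \<and> Comp C (Idt C (Cod C f)) f = f) \<and>
     (\<forall>f\<in>Ar C. \<forall>g\<in>Ar C. \<forall>h\<in>Ar C. Cod C f = Dom C g \<and> Cod C g = Dom C h \<longrightarrow>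
        Comp C h (Comp C g f) = Comp C (Comp C h g) f)"

definition terminal :: "('o, 'm, 'z) cat_scheme \<Rightarrow> 'o \<Rightarrow> bool" where
  "terminal C t \<longleftrightarrow> t \<in> Ob C \<and> (\<forall>X\<in>Ob C. \<exists>!f. f \<in> Ar C \<and> Dom C f = X \<and> Cod C f = t)"

definition iso :: "('o, 'm, 'z) cat_scheme \<Rightarrow> 'm \<Rightarrow> bool" where
  "iso C f \<longleftrightarrow> f \<in> Ar C \<and> (\<exists>g\<in>Ar C. Dom C g = Cod C f \<and> Cod C g = Dom C f \<and>
     Comp C g f = Idt C (Dom C f) \<and> Comp C f g = Idt C (Cod C f))"

record ('o1, 'm1, 'o2, 'm2) ftor =
  onO :: "'o1 \<Rightarrow> 'o2"
  onA :: "'m1 \<Rightarrow> 'm2"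

definition is_functor ::
  "('o1, 'm1, 'y1) cat_scheme \<Rightarrow> ('o2, 'm2, 'y2) cat_scheme \<Rightarrow> ('o1, 'm1, 'o2, 'm2, 'z) ftor_scheme \<Rightarrow> bool" where
  "is_functor C D F \<longleftrightarrow>
     (\<forall>X\<in>Ob C. onO F X \<in> Ob D) \<and>
     (\<forall>f\<in>Ar C. onA F f \<in> Ar D \<and> Dom D (onA F f) = onO F (Dom C f) \<and> Cod D (onA F f) = onO F (Cod C f)) \<and>
     (\<forall>X\<in>Ob C. onA F (Idt C X) = Idt D (onO F X)) \<and>
     (\<forall>f\<in>Ar C. \<forall>g\<in>Ar C. Cod C f = Dom C g \<longrightarrow> onA F (Comp C g f) = Comp D (onA F g) (onA F f))"

definition id_ftor :: "('o, 'm, 'o, 'm) ftor" where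
  "id_ftor = \<lparr>onO = \<lambda>X. X, onA = \<lambda>f. f\<rparr>"

definition comp_ftor ::
  "('o2, 'm2, 'o3, 'm3) ftor \<Rightarrow> ('o1, 'm1, 'o2, 'm2) ftor \<Rightarrow> ('o1, 'm1, 'o3, 'm3) ftor" where
  "comp_ftor G F = \<lparr>onO = \<lambda>X. onO G (onO F X), onA = \<lambda>f. onA G (onA F f)\<rparr>"

definition natural_iso ::
  "('o1, 'm1) cat \<Rightarrow> ('o2, 'm2) cat \<Rightarrow> ('o1, 'm1, 'o2, 'm2) ftor \<Rightarrow> ('o1, 'm1, 'o2, 'm2) ftor
     \<Rightarrow> ('o1 \<Rightarrow> 'm2) \<Rightarrow> bool" where
  "natural_iso C D F G \<eta> \<longleftrightarrow>
     (\<forall>X\<in>Ob C. iso D (\<eta> X) \<and> Dom D (\<eta> X) = onO F X \<and> Cod D (\<eta> X) = onO G X) \<and>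
     (\<forall>f\<in>Ar C. Comp D (\<eta> (Cod C f)) (onA F f) = Comp D (onA G f) (\<eta> (Dom C f)))"

definition equivalence_of_categories ::
  "('o1, 'm1) cat \<Rightarrow> ('o2, 'm2) cat \<Rightarrow> ('o1, 'm1, 'o2, 'm2) ftor \<Rightarrow> ('o2, 'm2, 'o1, 'm1) ftor \<Rightarrow> bool" where
  "equivalence_of_categories C D F G \<longleftrightarrow>
     category C \<and> category D \<and> is_functor C D F \<and> is_functor D C G \<and>
     (\<exists>\<eta>. natural_iso C C id_ftor (comp_ftor G F) \<eta>) \<and>
     (\<exists>\<epsilon>. natural_iso D D (comp_ftor F G) id_ftor \<epsilon>)"


section \<open>Stratified categories\<close>

text \<open>\<open>chain C X fs Y\<close>: the list \<open>fs = [f\<^sub>0, \<dots>, f\<^sub>m]\<close> is a composable sequence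
  \<open>X = X\<^sub>m\<^sub>+\<^sub>1 \<rightarrow> X\<^sub>m \<rightarrow> \<dots> \<rightarrow> X\<^sub>1 \<rightarrow> X\<^sub>0 = Y\<close> with \<open>f\<^sub>i : X\<^sub>i\<^sub>+\<^sub>1 \<rightarrow> X\<^sub>i\<close>.\<close>

fun chain :: "('o, 'm, 'z) cat_scheme \<Rightarrow> 'o \<Rightarrow> 'm list \<Rightarrow> 'o \<Rightarrow> bool" where
  "chain C X [] Y \<longleftrightarrow> X \<in> Ob C \<and> X = Y"
| "chain C X (f # fs) Y \<longleftrightarrow> f \<in> Ar C \<and> Cod C f = Y \<and> chain C X fs (Dom C f)"

fun chain_comp :: "('o, 'm, 'z) cat_scheme \<Rightarrow> 'm list \<Rightarrow> 'o \<Rightarrow> 'm" where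
  "chain_comp C [] Y = Idt C Y"
| "chain_comp C (f # fs) Y = Comp C f (chain_comp C fs (Dom C f))"

text \<open>\<open>extensional\<close> makes the level function, unique on objects, unique as a HOL function.\<close>

definition stratification :: "('o, 'm, 'z) cat_scheme \<Rightarrow> 'o \<Rightarrow> ('o \<Rightarrow> nat) \<Rightarrow> bool" where
  "stratification C t L \<longleftrightarrow>
     L \<in> extensional (Ob C) \<and>
     (\<forall>f\<in>Ar C. L (Dom C f) \<ge> L (Cod C f)) \<and>
     (\<forall>X\<in>Ob C. L X = 0 \<longleftrightarrow> X = t) \<and>
     (\<forall>f\<in>Ar C. L (Dom C f) = L (Cod C f) \<longleftrightarrow> Dom C f = Cod C f \<and> f = Idt C (Dom C f)) \<and>
     (\<forall>f\<in>Ar C. \<forall>n m. L (Dom C f) = n + m + 1 \<and> L (Cod C f) = n \<longrightarrow>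
        (\<exists>!fs. length fs = m + 1 \<and> chain C (Dom C f) fs (Cod C f) \<and>
               chain_comp C fs (Cod C f) = f \<and>
               (\<forall>i<m + 1. L (Dom C (fs ! i)) = n + i + 1 \<and> L (Cod C (fs ! i)) = n + i)))"

text \<open>The arrow out of \<open>X\<close> that is indecomposable with respect to the level function \<open>L\<close>
  (\<open>X\<close> with an overline in the mathematical notation).\<close>

definition indec :: "('o, 'm, 'z) cat_scheme \<Rightarrow> ('o \<Rightarrow> nat) \<Rightarrow> 'o \<Rightarrow> 'm" where
  "indec C L X = (THE f. f \<in> Ar C \<and> Dom C f = X \<and> L X = L (Cod C f) + 1)"


section \<open>Term structures and slices\<close>

record ('o, 'm, 't) tcat = "('o, 'm) cat" +
  Tm :: "'m \<Rightarrow> 't set"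

record ('o1, 'm1, 't1, 'o2, 'm2, 't2) tftor = "('o1, 'm1, 'o2, 'm2) ftor" +
  onT :: "'m1 \<Rightarrow> 't1 \<Rightarrow> 't2"

definition is_tfunctor ::
  "('o1, 'm1, 't1, 'y1) tcat_scheme \<Rightarrow> ('o2, 'm2, 't2, 'y2) tcat_scheme
     \<Rightarrow> ('o1, 'm1, 't1, 'o2, 'm2, 't2) tftor \<Rightarrow> bool" where
  "is_tfunctor C D F \<longleftrightarrow> is_functor C D F \<and>
     (\<forall>f\<in>Ar C. \<forall>t\<in>Tm C f. onT F f t \<in> Tm D (onA F f))"

definition tid :: "('o, 'm, 't, 'o, 'm, 't) tftor" where
  "tid = \<lparr>onO = \<lambda>X. X, onA = \<lambda>f. f, onT = \<lambda>f t. t\<rparr>"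

definition tcomp ::
  "('o2, 'm2, 't2, 'o3, 'm3, 't3) tftor \<Rightarrow> ('o1, 'm1, 't1, 'o2, 'm2, 't2) tftor
     \<Rightarrow> ('o1, 'm1, 't1, 'o3, 'm3, 't3) tftor" (infixr "\<circ>\<^sub>T" 55) where
  "G \<circ>\<^sub>T F = \<lparr>onO = \<lambda>X. onO G (onO F X), onA = \<lambda>f. onA G (onA F f),
              onT = \<lambda>f t. onT G (onA F f) (onT F f t)\<rparr>"

definition teq ::
  "('o1, 'm1, 't1, 'y) tcat_scheme \<Rightarrow> ('o1, 'm1, 't1, 'o2, 'm2, 't2) tftor
     \<Rightarrow> ('o1, 'm1, 't1, 'o2, 'm2, 't2) tftor \<Rightarrow> bool" where
  "teq C F G \<longleftrightarrow> (\<forall>X\<in>Ob C. onO F X = onO G X) \<and> (\<forall>f\<in>Ar C. onA F f = onA G f) \<and>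
     (\<forall>f\<in>Ar C. \<forall>t\<in>Tm C f. onT F f t = onT G f t)"

text \<open>The canonical representative of a functor on \<open>C\<close>: undefined off \<open>C\<close>.\<close>

definition tres ::
  "('o1, 'm1, 't1, 'y) tcat_scheme \<Rightarrow> ('o1, 'm1, 't1, 'o2, 'm2, 't2) tftor
     \<Rightarrow> ('o1, 'm1, 't1, 'o2, 'm2, 't2) tftor" where
  "tres C F = \<lparr>onO = restrict (onO F) (Ob C), onA = restrict (onA F) (Ar C),
               onT = restrict (\<lambda>f. restrict (onT F f) (Tm C f)) (Ar C)\<rparr>"

text \<open>An object of the slice over \<open>X\<close> is an arrow \<open>A\<close> into \<open>X\<close>.  An arrow of the slice into \<open>A\<close>
  is a pair \<open>(f, A)\<close> with \<open>f\<close> an arrow into the domain of \<open>A\<close>; its source is the composite of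
  \<open>A\<close> and \<open>f\<close>.\<close>

definition slice :: "('o, 'm, 't, 'z) tcat_scheme \<Rightarrow> 'o \<Rightarrow> ('m, 'm \<times> 'm, 't) tcat" where
  "slice C X = \<lparr>Ob = {A \<in> Ar C. Cod C A = X},
     Ar = {(f, A). A \<in> Ar C \<and> Cod C A = X \<and> f \<in> Ar C \<and> Cod C f = Dom C A},
     Dom = \<lambda>(f, A). Comp C A f,
     Cod = \<lambda>(f, A). A,
     Idt = \<lambda>A. (Idt C (Dom C A), A),
     Comp = \<lambda>(g, B) (f, A). (Comp C g f, B),
     Tm = \<lambda>(f, A). Tm C f\<rparr>"

definition slice_functor ::
  "('o1, 'm1, 't1, 'o2, 'm2, 't2) tftor \<Rightarrow> ('m1, 'm1 \<times> 'm1, 't1, 'm2, 'm2 \<times> 'm2, 't2) tftor" where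
  "slice_functor G = \<lparr>onO = onA G, onA = \<lambda>(f, A). (onA G f, onA G A), onT = \<lambda>(f, A). onT G f\<rparr>"

text \<open>For an arrow \<open>A\<close> into \<open>X\<close>, the identification of the slice of \<open>slice C X\<close> over \<open>A\<close> with the
  slice of \<open>C\<close> over the domain of \<open>A\<close>, in both directions.\<close>

definition unnest :: "('m \<times> 'm, ('m \<times> 'm) \<times> ('m \<times> 'm), 't, 'm, 'm \<times> 'm, 't) tftor" where
  "unnest = \<lparr>onO = \<lambda>(p, A). p, onA = \<lambda>((f, B), (p, A)). (f, p), onT = \<lambda>f t. t\<rparr>"

definition nest :: "('o, 'm, 'z) cat_scheme \<Rightarrow> 'm
    \<Rightarrow> ('m, 'm \<times> 'm, 't, 'm \<times> 'm, ('m \<times> 'm) \<times> ('m \<times> 'm), 't) tftor" where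
  "nest C A = \<lparr>onO = \<lambda>p. (p, A), onA = \<lambda>(f, p). ((f, Comp C A p), (p, A)), onT = \<lambda>f t. t\<rparr>"

definition slice_level :: "('o, 'm, 'z) cat_scheme \<Rightarrow> ('o \<Rightarrow> nat) \<Rightarrow> 'o \<Rightarrow> 'm \<Rightarrow> nat" where
  "slice_level C L X A = L (Dom C A) - L X"


section \<open>E-systems\<close>

text \<open>\<open>Sub E A x\<close> is substitution by \<open>x \<in> Tm E A\<close>, \<open>Wk E A\<close> is weakening by \<open>A\<close>.\<close>

record ('o, 'm, 't) esys = "('o, 'm, 't) tcat" +
  Top :: 'o
  Sub :: "'m \<Rightarrow> 't \<Rightarrow> ('m, 'm \<times> 'm, 't, 'm, 'm \<times> 'm, 't) tftor"
  Wk :: "'m \<Rightarrow> ('m, 'm \<times> 'm, 't, 'm, 'm \<times> 'm, 't) tftor"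
  idtm :: "'m \<Rightarrow> 't"

definition pre_esystem :: "('o, 'm, 't) esys \<Rightarrow> bool" where
  "pre_esystem E \<longleftrightarrow>
     category E \<and> terminal E (Top E) \<and>
     (\<forall>A\<in>Ar E. \<forall>x\<in>Tm E A.
        is_tfunctor (slice E (Dom E A)) (slice E (Cod E A)) (Sub E A x) \<and>
        onO (Sub E A x) (Idt E (Dom E A)) = Idt E (Cod E A)) \<and>
     (\<forall>A\<in>Ar E.
        is_tfunctor (slice E (Cod E A)) (slice E (Dom E A)) (Wk E A) \<and>
        onO (Wk E A) (Idt E (Cod E A)) = Idt E (Dom E A)) \<and>
     (\<forall>X\<in>Ob E. teq (slice E X) (Wk E (Idt E X)) tid) \<and>
     (\<forall>A\<in>Ar E. \<forall>P\<in>Ar E. Cod E P = Dom E A \<longrightarrow>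
        teq (slice E (Cod E A)) (Wk E (Comp E A P)) (Wk E P \<circ>\<^sub>T Wk E A)) \<and>
     (\<forall>A\<in>Ar E. idtm E A \<in> Tm E (onO (Wk E A) A))"

definition pre_ehom ::
  "('o1, 'm1, 't1) esys \<Rightarrow> ('o2, 'm2, 't2) esys \<Rightarrow> ('o1, 'm1, 't1, 'o2, 'm2, 't2) tftor \<Rightarrow> bool" where
  "pre_ehom E D H \<longleftrightarrow>
     is_tfunctor E D H \<and> onO H (Top E) = Top D \<and>
     (\<forall>A\<in>Ar E. \<forall>x\<in>Tm E A. teq (slice E (Dom E A))
        (slice_functor H \<circ>\<^sub>T Sub E A x) (Sub D (onA H A) (onT H A x) \<circ>\<^sub>T slice_functor H)) \<and>
     (\<forall>A\<in>Ar E. teq (slice E (Cod E A))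
        (slice_functor H \<circ>\<^sub>T Wk E A) (Wk D (onA H A) \<circ>\<^sub>T slice_functor H)) \<and>
     (\<forall>A\<in>Ar E. onT H (onO (Wk E A) A) (idtm E A) = idtm D (onA H A))"

definition eslice :: "('o, 'm, 't) esys \<Rightarrow> 'o \<Rightarrow> ('m, 'm \<times> 'm, 't) esys" where
  "eslice E X = tcat.extend (slice E X) (esys.fields
     (Idt E X)
     (\<lambda>(a, A) x. nest E A \<circ>\<^sub>T Sub E a x \<circ>\<^sub>T unnest)
     (\<lambda>(a, A). nest E (Comp E A a) \<circ>\<^sub>T Wk E a \<circ>\<^sub>T unnest)
     (\<lambda>(a, A). idtm E a))"

definition esystem :: "('o, 'm, 't) esys \<Rightarrow> bool" where
  "esystem E \<longleftrightarrow> pre_esystem E \<and>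
     (\<forall>A\<in>Ar E. \<forall>x\<in>Tm E A. pre_ehom (eslice E (Dom E A)) (eslice E (Cod E A)) (Sub E A x)) \<and>
     (\<forall>A\<in>Ar E. pre_ehom (eslice E (Cod E A)) (eslice E (Dom E A)) (Wk E A)) \<and>
     (\<forall>A\<in>Ar E. \<forall>x\<in>Tm E A. teq (slice E (Cod E A)) (Sub E A x \<circ>\<^sub>T Wk E A) tid) \<and>
     (\<forall>A\<in>Ar E. \<forall>x\<in>Tm E A.
        onT (Sub E A x) (onO (Wk E A) A, Idt E (Dom E A)) (idtm E A) = x) \<and>
     (\<forall>A\<in>Ar E. teq (slice E (Dom E A))
        (Sub E (onO (Wk E A) A) (idtm E A) \<circ>\<^sub>T (unnest \<circ>\<^sub>T slice_functor (Wk E A) \<circ>\<^sub>T nest E A)) tid)"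

definition level :: "('o, 'm, 't) esys \<Rightarrow> 'o \<Rightarrow> nat" where
  "level E = (THE L. stratification E (Top E) L)"

definition stratified_esystem :: "('o, 'm, 't) esys \<Rightarrow> bool" where
  "stratified_esystem E \<longleftrightarrow> esystem E \<and> (\<exists>L. stratification E (Top E) L) \<and>
     (\<forall>A\<in>Ar E. \<forall>x\<in>Tm E A. \<forall>P\<in>Ob (slice E (Dom E A)).
        slice_level E (level E) (Cod E A) (onO (Sub E A x) P) = slice_level E (level E) (Dom E A) P) \<and>
     (\<forall>A\<in>Ar E. \<forall>P\<in>Ob (slice E (Cod E A)).
        slice_level E (level E) (Dom E A) (onO (Wk E A) P) = slice_level E (level E) (Cod E A) P)"

definition stratified_ehom ::
  "('o, 'm, 't) esys \<Rightarrow> ('o, 'm, 't) esys \<Rightarrow> ('o, 'm, 't, 'o, 'm, 't) tftor \<Rightarrow> bool" where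
  "stratified_ehom E D H \<longleftrightarrow> pre_ehom E D H \<and> (\<forall>X\<in>Ob E. level D (onO H X) = level E X)"


section \<open>B-systems\<close>

text \<open>\<open>Bo B n\<close> is the set of sort \<open>n\<close>, while \<open>Bt B n\<close> is the set of elements of index \<open>n + 1\<close>
  (\<open>B\<close> with a tilde); likewise \<open>ft B n : Bo B (n + 1) \<rightarrow> Bo B n\<close> and
  \<open>bd B n : Bt B n \<rightarrow> Bo B (n + 1)\<close> (the boundary).  \<open>Sb B n x\<close> is substitution by \<open>x \<in> Bt B n\<close>;
  \<open>Wb B n X\<close> and \<open>dl B n X \<in> Bt B (n + 1)\<close> are weakening by, and the generic element of,
  \<open>X \<in> Bo B (n + 1)\<close>.  The same shift applies to the components \<open>hT H n\<close> of a homomorphism.\<close>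

record ('a, 'b) bframe =
  Bo :: "nat \<Rightarrow> 'a set"
  Bt :: "nat \<Rightarrow> 'b set"
  ft :: "nat \<Rightarrow> 'a \<Rightarrow> 'a"
  bd :: "nat \<Rightarrow> 'b \<Rightarrow> 'a"

record ('a, 'b) bhom =
  hB :: "nat \<Rightarrow> 'a \<Rightarrow> 'a"
  hT :: "nat \<Rightarrow> 'b \<Rightarrow> 'b"

record ('a, 'b) bsys = "('a, 'b) bframe" +
  Sb :: "nat \<Rightarrow> 'b \<Rightarrow> ('a, 'b) bhom"
  Wb :: "nat \<Rightarrow> 'a \<Rightarrow> ('a, 'b) bhom"
  dl :: "nat \<Rightarrow> 'a \<Rightarrow> 'b"

definition is_bframe :: "('a, 'b, 'z) bframe_scheme \<Rightarrow> bool" where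
  "is_bframe B \<longleftrightarrow> (\<exists>s. Bo B 0 = {s}) \<and>
     (\<forall>n. \<forall>X\<in>Bo B (Suc n). ft B n X \<in> Bo B n) \<and>
     (\<forall>n. \<forall>x\<in>Bt B n. bd B n x \<in> Bo B (Suc n))"

definition frame_hom ::
  "('a, 'b, 'y) bframe_scheme \<Rightarrow> ('a, 'b, 'z) bframe_scheme \<Rightarrow> ('a, 'b) bhom \<Rightarrow> bool" where
  "frame_hom B A H \<longleftrightarrow>
     (\<forall>n. \<forall>X\<in>Bo B n. hB H n X \<in> Bo A n) \<and>
     (\<forall>n. \<forall>x\<in>Bt B n. hT H n x \<in> Bt A n) \<and>
     (\<forall>n. \<forall>X\<in>Bo B (Suc n). ft A n (hB H (Suc n) X) = hB H n (ft B n X)) \<and>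
     (\<forall>n. \<forall>x\<in>Bt B n. bd A n (hT H n x) = hB H (Suc n) (bd B n x))"

definition bid :: "('a, 'b) bhom" where
  "bid = \<lparr>hB = \<lambda>n X. X, hT = \<lambda>n x. x\<rparr>"

definition bcomp :: "('a, 'b) bhom \<Rightarrow> ('a, 'b) bhom \<Rightarrow> ('a, 'b) bhom" (infixr "\<circ>\<^sub>B" 55) where
  "K \<circ>\<^sub>B H = \<lparr>hB = \<lambda>n X. hB K n (hB H n X), hT = \<lambda>n x. hT K n (hT H n x)\<rparr>"

definition beq :: "('a, 'b, 'z) bframe_scheme \<Rightarrow> ('a, 'b) bhom \<Rightarrow> ('a, 'b) bhom \<Rightarrow> bool" where
  "beq B H K \<longleftrightarrow> (\<forall>n. \<forall>X\<in>Bo B n. hB H n X = hB K n X) \<and> (\<forall>n. \<forall>x\<in>Bt B n. hT H n x = hT K n x)"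

text \<open>The canonical representative of a homomorphism on \<open>B\<close>: undefined off \<open>B\<close>.\<close>

definition bres :: "('a, 'b, 'z) bframe_scheme \<Rightarrow> ('a, 'b) bhom \<Rightarrow> ('a, 'b) bhom" where
  "bres B H = \<lparr>hB = \<lambda>n. restrict (hB H n) (Bo B n), hT = \<lambda>n. restrict (hT H n) (Bt B n)\<rparr>"

fun ftm :: "('a, 'b, 'z) bframe_scheme \<Rightarrow> nat \<Rightarrow> nat \<Rightarrow> 'a \<Rightarrow> 'a" where
  "ftm B n 0 X = X"
| "ftm B n (Suc m) X = ftm B n m (ft B (n + m) X)"

text \<open>\<open>bslice B n X\<close> is the slice over \<open>X \<in> Bo B n\<close>.  The slice over \<open>Y\<close> of the slice over \<open>X\<close> and
  the slice over \<open>Y\<close> have the same sets, with the same indexing.\<close>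

definition bslice :: "('a, 'b) bsys \<Rightarrow> nat \<Rightarrow> 'a \<Rightarrow> ('a, 'b) bsys" where
  "bslice B n X = \<lparr>Bo = \<lambda>m. {Y \<in> Bo B (n + m). ftm B n m Y = X},
     Bt = \<lambda>m. {y \<in> Bt B (n + m). ftm B n (Suc m) (bd B (n + m) y) = X},
     ft = \<lambda>m. ft B (n + m),
     bd = \<lambda>m. bd B (n + m),
     Sb = \<lambda>m. Sb B (n + m),
     Wb = \<lambda>m. Wb B (n + m),
     dl = \<lambda>m. dl B (n + m)\<rparr>"

text \<open>The homomorphism induced by \<open>H\<close> between slices over elements of sort \<open>n\<close>.\<close>

definition bslice_hom :: "nat \<Rightarrow> ('a, 'b) bhom \<Rightarrow> ('a, 'b) bhom" where
  "bslice_hom n H = \<lparr>hB = \<lambda>m. hB H (n + m), hT = \<lambda>m. hT H (n + m)\<rparr>"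

definition pre_bsystem :: "('a, 'b) bsys \<Rightarrow> bool" where
  "pre_bsystem B \<longleftrightarrow> is_bframe B \<and>
     (\<forall>n. \<forall>x\<in>Bt B n. frame_hom (bslice B (Suc n) (bd B n x)) (bslice B n (ft B n (bd B n x))) (Sb B n x)) \<and>
     (\<forall>n. \<forall>X\<in>Bo B (Suc n). frame_hom (bslice B n (ft B n X)) (bslice B (Suc n) X) (Wb B n X)) \<and>
     (\<forall>n. \<forall>X\<in>Bo B (Suc n). dl B n X \<in> Bt B (Suc n) \<and> bd B (Suc n) (dl B n X) = hB (Wb B n X) 1 X)"

definition pre_bhom :: "('a, 'b) bsys \<Rightarrow> ('a, 'b) bsys \<Rightarrow> ('a, 'b) bhom \<Rightarrow> bool" where
  "pre_bhom B A H \<longleftrightarrow> frame_hom B A H \<and>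
     (\<forall>n. \<forall>x\<in>Bt B n. beq (bslice B (Suc n) (bd B n x))
        (bslice_hom n H \<circ>\<^sub>B Sb B n x) (Sb A n (hT H n x) \<circ>\<^sub>B bslice_hom (Suc n) H)) \<and>
     (\<forall>n. \<forall>X\<in>Bo B (Suc n). beq (bslice B n (ft B n X))
        (bslice_hom (Suc n) H \<circ>\<^sub>B Wb B n X) (Wb A n (hB H (Suc n) X) \<circ>\<^sub>B bslice_hom n H)) \<and>
     (\<forall>n. \<forall>X\<in>Bo B (Suc n). hT H (Suc n) (dl B n X) = dl A n (hB H (Suc n) X))"

definition bsystem :: "('a, 'b) bsys \<Rightarrow> bool" where
  "bsystem B \<longleftrightarrow> pre_bsystem B \<and>
     (\<forall>n. \<forall>x\<in>Bt B n. pre_bhom (bslice B (Suc n) (bd B n x)) (bslice B n (ft B n (bd B n x))) (Sb B n x)) \<and>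
     (\<forall>n. \<forall>X\<in>Bo B (Suc n). pre_bhom (bslice B n (ft B n X)) (bslice B (Suc n) X) (Wb B n X)) \<and>
     (\<forall>n. \<forall>x\<in>Bt B n. beq (bslice B n (ft B n (bd B n x))) (Sb B n x \<circ>\<^sub>B Wb B n (bd B n x)) bid) \<and>
     (\<forall>n. \<forall>x\<in>Bt B n. hT (Sb B n x) 0 (dl B n (bd B n x)) = x) \<and>
     (\<forall>n. \<forall>X\<in>Bo B (Suc n). beq (bslice B (Suc n) X)
        (Sb B (Suc n) (dl B n X) \<circ>\<^sub>B bslice_hom 1 (Wb B n X)) bid)"


section \<open>The categories of B-systems and of stratified E-systems\<close>

text \<open>The universe of small sets: a small set is a set of elements of \<open>'a univ\<close>, for an arbitrary
  type \<open>'a\<close> of atoms.  The constructors \<open>Num\<close> and \<open>Tup\<close> make the universe closed under the pairs,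
  tuples and coproducts used by the two functors; \<open>Atom\<close> embeds every set of atoms.\<close>

datatype 'a univ = Atom 'a | Num nat | Tup "'a univ list"

type_synonym 'a bsystem = "('a univ, 'a univ) bsys"
type_synonym 'a bmor = "'a bsystem \<times> ('a univ, 'a univ) bhom \<times> 'a bsystem"
type_synonym 'a esystem = "('a univ, 'a univ, 'a univ) esys"
type_synonym 'a etftor = "('a univ, 'a univ, 'a univ, 'a univ, 'a univ, 'a univ) tftor"
type_synonym 'a emor = "'a esystem \<times> 'a etftor \<times> 'a esystem"

text \<open>Morphisms carry their source and target and are given by their canonical representatives, so
  that equality of morphisms is equality of their actions on the carriers.\<close>

definition Bsys :: "('a bsystem, 'a bmor) cat" where
  "Bsys = \<lparr>Ob = {B. bsystem B},
     Ar = {(B, H, A). bsystem B \<and> bsystem A \<and> pre_bhom B A H \<and> bres B H = H},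
     Dom = \<lambda>(B, H, A). B,
     Cod = \<lambda>(B, H, A). A,
     Idt = \<lambda>B. (B, bres B bid, B),
     Comp = \<lambda>(A, K, A') (B, H, B'). (B, bres B (K \<circ>\<^sub>B H), A')\<rparr>"

definition Esys\<^sub>s :: "('a esystem, 'a emor) cat" where
  "Esys\<^sub>s = \<lparr>Ob = {E. stratified_esystem E},
     Ar = {(E, F, D). stratified_esystem E \<and> stratified_esystem D \<and> stratified_ehom E D F \<and> tres E F = F},
     Dom = \<lambda>(E, F, D). E,
     Cod = \<lambda>(E, F, D). D,
     Idt = \<lambda>E. (E, tres E tid, E),
     Comp = \<lambda>(D, G, D') (E, F, E'). (E, tres E (G \<circ>\<^sub>T F), D')\<rparr>"


section \<open>From B-systems to E-systems\<close>

text \<open>\<open>vtx n X\<close> encodes the vertex \<open>(n, X)\<close>, and \<open>arr n X k\<close> the arrow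
  \<open>(X, k) : (n + k, X) \<rightarrow> (n, ft\<^sup>k X)\<close>.\<close>

definition vtx :: "nat \<Rightarrow> 'a univ \<Rightarrow> 'a univ" where
  "vtx n X = Tup [Num n, X]"

definition arr :: "nat \<Rightarrow> 'a univ \<Rightarrow> nat \<Rightarrow> 'a univ" where
  "arr n X k = Tup [Num n, X, Num k]"

fun on_vtx :: "(nat \<Rightarrow> 'a univ \<Rightarrow> 'c) \<Rightarrow> 'a univ \<Rightarrow> 'c" where
  "on_vtx c (Tup [Num n, X]) = c n X"

fun on_arr :: "(nat \<Rightarrow> 'a univ \<Rightarrow> nat \<Rightarrow> 'c) \<Rightarrow> 'a univ \<Rightarrow> 'c" where
  "on_arr c (Tup [Num n, X, Num k]) = c n X k"

fun on_tup :: "('a univ list \<Rightarrow> 'c) \<Rightarrow> 'a univ \<Rightarrow> 'c" where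
  "on_tup c (Tup ts) = c ts"

text \<open>Terms of \<open>(X, k)\<close> are tuples \<open>(t\<^sub>1, \<dots>, t\<^sub>k)\<close>, for \<open>k = 0\<close> the empty tuple \<open>*\<close>.
  \<open>sub_list B n [t\<^sub>1, \<dots>, t\<^sub>k]\<close> is the substitution along this term, composed of the \<open>Sb B n t\<^sub>i\<close>
  with \<open>t\<^sub>k\<close> applied last; and \<open>terms B n k X\<close> is the set of terms of \<open>arr n X k\<close>.\<close>

definition sub_list :: "('a, 'b) bsys \<Rightarrow> nat \<Rightarrow> 'b list \<Rightarrow> ('a, 'b) bhom" where
  "sub_list B n ts = fold (\<lambda>x S. Sb B n x \<circ>\<^sub>B bslice_hom 1 S) ts bid"

fun terms :: "('a, 'b) bsys \<Rightarrow> nat \<Rightarrow> nat \<Rightarrow> 'a \<Rightarrow> 'b list set" where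
  "terms B n 0 X = {[]}"
| "terms B n (Suc k) X = {ts @ [x] |ts x. ts \<in> terms B n k (ft B (n + k) X) \<and>
     x \<in> Bt B n \<and> bd B n x = hB (sub_list B n ts) 1 X}"

text \<open>\<open>wk_list B n k X\<close> is weakening by \<open>arr n X k\<close>, and \<open>id_list B n k X\<close> is its generic term.\<close>

fun wk_list :: "('a, 'b) bsys \<Rightarrow> nat \<Rightarrow> nat \<Rightarrow> 'a \<Rightarrow> ('a, 'b) bhom" where
  "wk_list B n 0 X = bid"
| "wk_list B n (Suc k) X = Wb B (n + k) X \<circ>\<^sub>B wk_list B n k (ft B (n + k) X)"

fun id_list :: "('a, 'b) bsys \<Rightarrow> nat \<Rightarrow> nat \<Rightarrow> 'a \<Rightarrow> 'b list" where
  "id_list B n 0 X = []"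
| "id_list B n (Suc k) X =
     map (hT (Wb B (n + k) X) 0) (id_list B n k (ft B (n + k) X)) @ [dl B (n + k) X]"

definition B2E_hom :: "('a univ, 'a univ) bhom \<Rightarrow> 'a etftor" where
  "B2E_hom H = \<lparr>onO = on_vtx (\<lambda>n X. vtx n (hB H n X)),
     onA = on_arr (\<lambda>n X k. arr n (hB H (n + k) X) k),
     onT = on_arr (\<lambda>n X k. on_tup (\<lambda>ts. Tup (map (hT H n) ts)))\<rparr>"

text \<open>The identification of the category of the B-system \<open>B\<close> sliced over \<open>(n, X)\<close> with the category
  of the slice of \<open>B\<close> over \<open>X\<close>, in both directions.\<close>

definition to_bslice :: "('a univ, 'a univ \<times> 'a univ, 'a univ, 'a univ, 'a univ, 'a univ) tftor" where
  "to_bslice = \<lparr>onO = on_arr (\<lambda>n Y m. vtx m Y),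
     onA = (\<lambda>(f, p). on_arr (\<lambda>n Z m. on_arr (\<lambda>nm Y j. arr m Y j) f) p),
     onT = (\<lambda>f t. t)\<rparr>"

definition from_bslice :: "('a univ, 'a univ) bsys \<Rightarrow> nat
    \<Rightarrow> ('a univ, 'a univ, 'a univ, 'a univ, 'a univ \<times> 'a univ, 'a univ) tftor" where
  "from_bslice B n = \<lparr>onO = on_vtx (\<lambda>m Y. arr n Y m),
     onA = on_arr (\<lambda>m Y j. (arr (n + m) Y j, arr n (ftm B (n + m) j Y) m)),
     onT = (\<lambda>f t. t)\<rparr>"

definition B2E_obj :: "'a bsystem \<Rightarrow> 'a esystem" where
  "B2E_obj B = \<lparr>Ob = {vtx n X |n X. X \<in> Bo B n},
     Ar = {arr n X k |n X k. X \<in> Bo B (n + k)},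
     Dom = on_arr (\<lambda>n X k. vtx (n + k) X),
     Cod = on_arr (\<lambda>n X k. vtx n (ftm B n k X)),
     Idt = on_vtx (\<lambda>n X. arr n X 0),
     Comp = (\<lambda>g f. on_arr (\<lambda>n Y k. on_arr (\<lambda>nk X l. arr n X (k + l)) f) g),
     Tm = on_arr (\<lambda>n X k. Tup ` terms B n k X),
     Top = vtx 0 (the_elem (Bo B 0)),
     Sub = on_arr (\<lambda>n X k. on_tup (\<lambda>ts.
             from_bslice B n \<circ>\<^sub>T B2E_hom (sub_list B n ts) \<circ>\<^sub>T to_bslice)),
     Wk = on_arr (\<lambda>n X k. from_bslice B (n + k) \<circ>\<^sub>T B2E_hom (wk_list B n k X) \<circ>\<^sub>T to_bslice),
     idtm = on_arr (\<lambda>n X k. Tup (id_list B n k X))\<rparr>"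

definition B2E :: "('a bsystem, 'a bmor, 'a esystem, 'a emor) ftor" where
  "B2E = \<lparr>onO = B2E_obj, onA = \<lambda>(B, H, A). (B2E_obj B, tres (B2E_obj B) (B2E_hom H), B2E_obj A)\<rparr>"


section \<open>From E-systems to B-systems\<close>

text \<open>The element \<open>(X, x)\<close> of the coproduct of the sets of terms is encoded as \<open>Tup [X, x]\<close>.
  \<open>E2B_hom C L F\<close> is the homomorphism of B-frames induced by the stratified functor \<open>F\<close> on the
  category \<open>C\<close> with stratification \<open>L\<close>.\<close>

fun on_pair :: "('a univ \<Rightarrow> 'a univ \<Rightarrow> 'c) \<Rightarrow> 'a univ \<Rightarrow> 'c" where
  "on_pair c (Tup [X, x]) = c X x"

definition E2B_hom :: "('a univ, 'm, 'a univ, 'z) tcat_scheme \<Rightarrow> ('a univ \<Rightarrow> nat)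
    \<Rightarrow> ('a univ, 'm, 'a univ, 'a univ, 'm, 'a univ) tftor \<Rightarrow> ('a univ, 'a univ) bhom" where
  "E2B_hom C L F = \<lparr>hB = \<lambda>n X. onO F X,
     hT = \<lambda>n. on_pair (\<lambda>X x. Tup [onO F X, onT F (indec C L X) x])\<rparr>"

text \<open>The identification of the B-frame of the slice category over \<open>X\<close> with the slice over \<open>X\<close> of
  the B-frame of the category, in both directions: an object \<open>Y \<rightarrow> X\<close> corresponds to its domain
  \<open>Y\<close>, as there is at most one arrow between two objects of a stratified category.\<close>

definition from_frame :: "'a esystem \<Rightarrow> ('a univ, 'a univ) bhom" where
  "from_frame E = \<lparr>hB = \<lambda>n A. Dom E A, hT = \<lambda>n. on_pair (\<lambda>A x. Tup [Dom E A, x])\<rparr>"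

definition to_frame :: "'a esystem \<Rightarrow> 'a univ \<Rightarrow> ('a univ, 'a univ) bhom" where
  "to_frame E X = (let over = \<lambda>Y. THE A. A \<in> Ar E \<and> Dom E A = Y \<and> Cod E A = X in
     \<lparr>hB = \<lambda>n Y. over Y, hT = \<lambda>n. on_pair (\<lambda>Y x. Tup [over Y, x])\<rparr>)"

text \<open>The homomorphism of slice B-frames induced by a functor defined on the slice over \<open>X\<close>.\<close>

definition E2B_slice_hom :: "'a esystem \<Rightarrow> 'a univ
    \<Rightarrow> ('a univ, 'a univ \<times> 'a univ, 'a univ, 'a univ, 'a univ \<times> 'a univ, 'a univ) tftor
    \<Rightarrow> ('a univ, 'a univ) bhom" where
  "E2B_slice_hom E X F =
     from_frame E \<circ>\<^sub>B E2B_hom (slice E X) (slice_level E (level E) X) F \<circ>\<^sub>B to_frame E X"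

definition E2B_wk :: "'a esystem \<Rightarrow> 'a univ \<Rightarrow> ('a univ, 'a univ) bhom" where
  "E2B_wk E X = (let A = indec E (level E) X in E2B_slice_hom E (Cod E A) (Wk E A))"

definition E2B_obj :: "'a esystem \<Rightarrow> 'a bsystem" where
  "E2B_obj E = \<lparr>Bo = \<lambda>n. {X \<in> Ob E. level E X = n},
     Bt = \<lambda>n. {Tup [X, x] |X x. X \<in> Ob E \<and> level E X = Suc n \<and> x \<in> Tm E (indec E (level E) X)},
     ft = \<lambda>n X. Cod E (indec E (level E) X),
     bd = \<lambda>n. on_pair (\<lambda>X x. X),
     Sb = \<lambda>n. on_pair (\<lambda>X x. E2B_slice_hom E X (Sub E (indec E (level E) X) x)),
     Wb = \<lambda>n X. E2B_wk E X,
     dl = \<lambda>n X. Tup [hB (E2B_wk E X) 1 X, idtm E (indec E (level E) X)]\<rparr>"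

definition E2B :: "('a esystem, 'a emor, 'a bsystem, 'a bmor) ftor" where
  "E2B = \<lparr>onO = E2B_obj,
     onA = \<lambda>(E, F, D). (E2B_obj E, bres (E2B_obj E) (E2B_hom E (level E) F), E2B_obj D)\<rparr>"

end

theory Submission
  imports Defs
begin

text \<open>There is an evident natural isomorphism \<open>\<eta>\<^sub>B : B \<rightarrow> E2B (B2E B)\<close>, so it suffices that \<open>E2B\<close>
  is fully faithful.  In an E-system the terms of a composite arrow \<open>A.P\<close> are pairs: \<open>t\<close> corresponds to
  \<open>x = S\<^sub>t(W\<^sub>P(idtm\<^sub>A))\<close> and \<open>u = S\<^sub>t(idtm\<^sub>P)\<close>, and conversely \<open>(x, u)\<close> to \<open>S\<^sub>u(S\<^sub>x(idtm))\<close> for the generic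
  term \<open>idtm\<close> of \<open>A.P\<close>; moreover \<open>S\<^sub>t = S\<^sub>u \<circ> S\<^sub>x\<close>.  Pairing is defined from substitution and generic
  terms, so E-homomorphisms preserve it.  In the stratified case every term is thus a tuple of terms
  of indecomposable arrows, and a homomorphism of B-systems, which acts on the latter, extends in
  exactly one way to an E-homomorphism.\<close>

text \<open>Full faithfulness of \<open>E2B\<close> spares writing down the counit and its inverse,
  which would have to turn arbitrary terms of a stratified E-system into lists. Two obstacles shape
  the argument. The axioms speak of slices of slices, where an object is a nested pair of arrows;
  since a stratified category turns out to be thin, they are restated for objects and terms alone,
  and the action of a homomorphism on arrows is forced. Moreover the object on which the second
  component of a pair lives depends on the first component, so membership and substitution have to
  be extended together, one indecomposable arrow at a time. The source of pairing is a converse to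
  S_x W_A = id: a homomorphism that cancels W_A is substitution by its value at idtm_A. The
  recursion ends at identity arrows, whose sets of terms the axioms force to be singletons. That
  \<open>B2E\<close> yields E-systems is a separate induction on tuples, in which the two encodings
  of a slice, by arrows and by vertices, have to be compared.\<close>

text \<open>The counit at \<open>E\<close> is the preimage under \<open>G\<close> of the inverse of \<open>\<eta>\<close> at \<open>G E\<close>.\<close>

lemma equivalence_if_fully_faithful:
  assumes C: "category C" and D: "category D" and F: "is_functor C D F" and G: "is_functor D C G"
    and \<eta>: "natural_iso C C id_ftor (comp_ftor G F) \<eta>"
    and faithful: "\<And>f g. \<lbrakk>f \<in> Ar D; g \<in> Ar D; Dom D f = Dom D g; Cod D f = Cod D g; onA G f = onA G g\<rbrakk> \<Longrightarrow> f = g"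
    and full: "\<And>X Y h. \<lbrakk>X \<in> Ob D; Y \<in> Ob D; h \<in> Ar C; Dom C h = onO G X; Cod C h = onO G Y\<rbrakk>
      \<Longrightarrow> \<exists>f\<in>Ar D. Dom D f = X \<and> Cod D f = Y \<and> onA G f = h"
  shows "equivalence_of_categories C D F G"
proof -
  have GO: "onO G X \<in> Ob C" if "X \<in> Ob D" for X using G that unfolding is_functor_def by blast
  have FO: "onO F X \<in> Ob D" if "X \<in> Ob C" for X using F that unfolding is_functor_def by blast
  have GA: "onA G f \<in> Ar C \<and> Dom C (onA G f) = onO G (Dom D f) \<and> Cod C (onA G f) = onO G (Cod D f)"
    if "f \<in> Ar D" for f using G that unfolding is_functor_def by blast
  have FA: "onA F f \<in> Ar D \<and> Dom D (onA F f) = onO F (Dom C f) \<and> Cod D (onA F f) = onO F (Cod C f)"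
    if "f \<in> Ar C" for f using F that unfolding is_functor_def by blast
  have GI: "onA G (Idt D X) = Idt C (onO G X)" if "X \<in> Ob D" for X using G that unfolding is_functor_def by blast
  have GC: "onA G (Comp D g f) = Comp C (onA G g) (onA G f)"
    if "f \<in> Ar D" "g \<in> Ar D" "Cod D f = Dom D g" for f g using G that unfolding is_functor_def by blast
  have DC: "Comp D g f \<in> Ar D" "Dom D (Comp D g f) = Dom D f" "Cod D (Comp D g f) = Cod D g"
    if "f \<in> Ar D" "g \<in> Ar D" "Cod D f = Dom D g" for f g using D that unfolding category_def by blast+
  have CC: "Comp C g f \<in> Ar C" "Dom C (Comp C g f) = Dom C f" "Cod C (Comp C g f) = Cod C g"
    if "f \<in> Ar C" "g \<in> Ar C" "Cod C f = Dom C g" for f g using C that unfolding category_def by blast+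
  have DI: "Idt D X \<in> Ar D" "Dom D (Idt D X) = X" "Cod D (Idt D X) = X" if "X \<in> Ob D" for X
    using D that unfolding category_def by blast+
  have DO: "Dom D f \<in> Ob D" "Cod D f \<in> Ob D" if "f \<in> Ar D" for f
    using D that unfolding category_def by blast+
  have assC: "Comp C h (Comp C g f) = Comp C (Comp C h g) f"
    if "f \<in> Ar C" "g \<in> Ar C" "h \<in> Ar C" "Cod C f = Dom C g" "Cod C g = Dom C h" for f g h
    using C that unfolding category_def by blast
  have unitC: "Comp C f (Idt C (Dom C f)) = f" "Comp C (Idt C (Cod C f)) f = f" if "f \<in> Ar C" for f
    using C that unfolding category_def by blast+
  have eta_iso: "iso C (\<eta> X)" "Dom C (\<eta> X) = X" "Cod C (\<eta> X) = onO G (onO F X)" if "X \<in> Ob C" for X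
    using \<eta> that unfolding natural_iso_def by (auto simp: id_ftor_def comp_ftor_def)
  have etaA: "\<eta> X \<in> Ar C" if "X \<in> Ob C" for X using eta_iso[OF that] by (auto simp: iso_def)
  have eta_nat: "Comp C (\<eta> (Cod C f)) f = Comp C (onA G (onA F f)) (\<eta> (Dom C f))" if "f \<in> Ar C" for f
    using \<eta> that unfolding natural_iso_def by (auto simp: id_ftor_def comp_ftor_def)
  define P where "P E e \<longleftrightarrow> e \<in> Ar D \<and> Dom D e = onO F (onO G E) \<and> Cod D e = E \<and>
    Comp C (onA G e) (\<eta> (onO G E)) = Idt C (onO G E) \<and>
    Comp C (\<eta> (onO G E)) (onA G e) = Idt C (onO G (onO F (onO G E)))" for E e
  have "\<exists>e. P E e" if E: "E \<in> Ob D" for E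
  proof -
    obtain g where g: "g \<in> Ar C" "Dom C g = onO G (onO F (onO G E))" "Cod C g = onO G E"
      "Comp C g (\<eta> (onO G E)) = Idt C (onO G E)"
      "Comp C (\<eta> (onO G E)) g = Idt C (onO G (onO F (onO G E)))"
      using eta_iso[OF GO[OF E]] unfolding iso_def by auto
    from full[OF FO[OF GO[OF E]] E g(1-3)] g(4,5) show ?thesis unfolding P_def by blast
  qed
  then obtain \<epsilon> where \<epsilon>: "\<And>E. E \<in> Ob D \<Longrightarrow> P E (\<epsilon> E)" by metis
  have "iso D (\<epsilon> E)" if E: "E \<in> Ob D" for E
  proof -
    note e = \<epsilon>[OF E, unfolded P_def]
    let ?h = "\<eta> (onO G E)"
    have h: "?h \<in> Ar C" "Dom C ?h = onO G E" "Cod C ?h = onO G (onO F (onO G E))"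
      using etaA eta_iso GO[OF E] by auto
    obtain g where g: "g \<in> Ar D" "Dom D g = E" "Cod D g = onO F (onO G E)" "onA G g = ?h"
      using full[OF E FO[OF GO[OF E]] h] by blast
    \<comment> \<open>Both composites with the preimage \<open>g\<close> of \<eta> become identities
      under \<open>G\<close>, and faithfulness reflects this.\<close>
    have "Comp D g (\<epsilon> E) = Idt D (Dom D (\<epsilon> E))"
      using e g DC[of "\<epsilon> E" g] GC[of "\<epsilon> E" g] DI[OF DO(1), of "\<epsilon> E"] GI[OF DO(1), of "\<epsilon> E"] by (intro faithful) auto
    moreover have "Comp D (\<epsilon> E) g = Idt D (Cod D (\<epsilon> E))"
      using e g DC[of g "\<epsilon> E"] GC[of g "\<epsilon> E"] DI[OF DO(2), of "\<epsilon> E"] GI[OF DO(2), of "\<epsilon> E"] by (intro faithful) auto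
    ultimately show ?thesis unfolding iso_def using e g by auto
  qed
  moreover have "Comp D (\<epsilon> (Cod D f)) (onA F (onA G f)) = Comp D f (\<epsilon> (Dom D f))" if f: "f \<in> Ar D" for f
  proof -
    let ?X = "Dom D f" and ?Y = "Cod D f"
    have X: "?X \<in> Ob D" "?Y \<in> Ob D" using DO f by auto
    note ex = \<epsilon>[OF X(1), unfolded P_def] and ey = \<epsilon>[OF X(2), unfolded P_def]
    let ?gf = "onA G f" and ?hx = "\<eta> (onO G ?X)" and ?hy = "\<eta> (onO G ?Y)"
    let ?gx = "onA G (\<epsilon> ?X)" and ?gy = "onA G (\<epsilon> ?Y)" and ?ff = "onA G (onA F (onA G f))"
    have A: "?gf \<in> Ar C" "Dom C ?gf = onO G ?X" "Cod C ?gf = onO G ?Y" using GA[OF f] by auto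
    have H: "?hx \<in> Ar C" "?hy \<in> Ar C" "Dom C ?hx = onO G ?X" "Dom C ?hy = onO G ?Y"
      "Cod C ?hx = onO G (onO F (onO G ?X))" "Cod C ?hy = onO G (onO F (onO G ?Y))"
      using etaA eta_iso GO X by auto
    have K: "?gx \<in> Ar C" "?gy \<in> Ar C" "Cod C ?gx = onO G ?X" "Cod C ?gy = onO G ?Y"
      "Dom C ?gx = onO G (onO F (onO G ?X))" "Dom C ?gy = onO G (onO F (onO G ?Y))"
      using GA ex ey by auto
    have L: "onA F ?gf \<in> Ar D" "Dom D (onA F ?gf) = onO F (onO G ?X)" "Cod D (onA F ?gf) = onO F (onO G ?Y)"
      using FA[OF A(1)] A by auto
    have M: "?ff \<in> Ar C" "Dom C ?ff = onO G (onO F (onO G ?X))" "Cod C ?ff = onO G (onO F (onO G ?Y))"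
      using GA[OF L(1)] L by auto
    \<comment> \<open>Naturality is compared after applying \<open>G\<close>: the identity composite
      of \<open>?hx\<close> and \<open>?gx\<close> is inserted, naturality of \<eta> moves
      \<open>?ff\<close> across, and \<open>?gy\<close> cancels \<open>?hy\<close>.\<close>
    have "Comp C ?gy ?ff = Comp C ?gy (Comp C ?ff (Comp C ?hx ?gx))"
      using ex unitC(1)[OF M(1)] M(2) by simp
    also have "\<dots> = Comp C ?gy (Comp C (Comp C ?ff ?hx) ?gx)"
      using assC[of ?gx ?hx ?ff] H K M by simp
    also have "\<dots> = Comp C ?gy (Comp C (Comp C ?hy ?gf) ?gx)"
      using eta_nat[OF A(1)] A by simp
    also have "\<dots> = Comp C ?gy (Comp C ?hy (Comp C ?gf ?gx))"
      using assC[of ?gx ?gf ?hy] A H K by simp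
    also have "\<dots> = Comp C (Comp C ?gy ?hy) (Comp C ?gf ?gx)"
      using assC[of "Comp C ?gf ?gx" ?hy ?gy] CC[of ?gx ?gf] A H K by simp
    also have "\<dots> = Comp C ?gf ?gx"
      using ey unitC(2)[of "Comp C ?gf ?gx"] CC[of ?gx ?gf] A K by simp
    finally have "onA G (Comp D (\<epsilon> ?Y) (onA F ?gf)) = onA G (Comp D f (\<epsilon> ?X))"
      using GC[of "onA F ?gf" "\<epsilon> ?Y"] GC[of "\<epsilon> ?X" f] L ex ey f by simp
    then show ?thesis
      using DC[of "onA F ?gf" "\<epsilon> ?Y"] DC[of "\<epsilon> ?X" f] L ex ey f by (intro faithful) auto
  qed
  ultimately have "natural_iso D D (comp_ftor F G) id_ftor \<epsilon>"
    using \<epsilon> unfolding natural_iso_def P_def by (auto simp: id_ftor_def comp_ftor_def)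
  then show ?thesis using C D F G \<eta> unfolding equivalence_of_categories_def by blast
qed

section \<open>Homomorphisms of B-systems and their slices\<close>

lemma ftm_add: "ftm B n (m + k) X = ftm B n m (ftm B (n + m) k X)"
  by (induction k arbitrary: X) (simp_all add: add.assoc)

lemma bslice_simps [simp]:
  "Bo (bslice B n X) m = {Y \<in> Bo B (n + m). ftm B n m Y = X}"
  "Bt (bslice B n X) m = {y \<in> Bt B (n + m). ftm B n (Suc m) (bd B (n + m) y) = X}"
  "ft (bslice B n X) m = ft B (n + m)"
  "bd (bslice B n X) m = bd B (n + m)"
  "Sb (bslice B n X) m = Sb B (n + m)"
  "Wb (bslice B n X) m = Wb B (n + m)"
  "dl (bslice B n X) m = dl B (n + m)"
  by (simp_all add: bslice_def)

lemma bslice_hom_simps [simp]: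
  "hB (bslice_hom n H) m = hB H (n + m)" "hT (bslice_hom n H) m = hT H (n + m)"
  by (simp_all add: bslice_hom_def)

lemma bcomp_simps [simp]:
  "hB (K \<circ>\<^sub>B H) n X = hB K n (hB H n X)" "hT (K \<circ>\<^sub>B H) n x = hT K n (hT H n x)"
  by (simp_all add: bcomp_def)

lemma bid_simps [simp]: "hB bid n X = X" "hT bid n x = x"
  by (simp_all add: bid_def)

lemma bslice_hom_bid [simp]: "bslice_hom n bid = bid"
  by (simp add: bslice_hom_def bid_def)

lemma bslice_hom_0 [simp]: "bslice_hom 0 H = H"
  by (simp add: bslice_hom_def)

lemma bcomp_bid [simp]: "H \<circ>\<^sub>B bid = H" "bid \<circ>\<^sub>B H = H"
  by (simp_all add: bcomp_def bid_def)

lemma ftm_bslice [simp]: "ftm (bslice B n X) m k Y = ftm B (n + m) k Y"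
  by (induction k arbitrary: Y) (simp_all add: add.assoc)

text \<open>Lying over \<open>Y\<close> implies lying over \<open>X\<close>, so the inner condition
  is absorbed. With indices counted from the base, the identification of iterated slices is an
  equality of records, and facts about slices apply to slices of slices without transport.\<close>

lemma bslice_bslice:
  assumes "ftm B n m Y = X"
  shows "bslice (bslice B n X) m Y = bslice B (n + m) Y"
proof -
  have "{Z \<in> Bo B (n + (m + k)). ftm B n (m + k) Z = X \<and> ftm B (n + m) k Z = Y}
      = {Z \<in> Bo B (n + (m + k)). ftm B (n + m) k Z = Y}" for k
    using assms by (auto simp: ftm_add)
  moreover have "{z \<in> Bt B (n + (m + k)). ftm B n (m + k) (ft B (n + (m + k)) (bd B (n + (m + k)) z)) = X \<and>
        ftm B (n + m) k (ft B (n + (m + k)) (bd B (n + (m + k)) z)) = Y}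
      = {z \<in> Bt B (n + (m + k)). ftm B (n + m) k (ft B (n + (m + k)) (bd B (n + (m + k)) z)) = Y}" for k
    using assms by (auto simp: ftm_add)
  ultimately show ?thesis
    by (simp add: bslice_def[of "bslice B n X"] bslice_def[of B "n + m"] add.assoc conj_assoc)
qed

lemma is_bframe_ft: "\<lbrakk>is_bframe B; X \<in> Bo B (Suc n)\<rbrakk> \<Longrightarrow> ft B n X \<in> Bo B n"
  by (simp add: is_bframe_def)

lemma is_bframe_bd: "\<lbrakk>is_bframe B; x \<in> Bt B n\<rbrakk> \<Longrightarrow> bd B n x \<in> Bo B (Suc n)"
  by (simp add: is_bframe_def)

lemma is_bframe_ftm: "\<lbrakk>is_bframe B; X \<in> Bo B (n + m)\<rbrakk> \<Longrightarrow> ftm B n m X \<in> Bo B n"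
  by (induction m arbitrary: X) (simp_all add: is_bframe_ft)

lemma is_bframe_bslice:
  assumes B: "is_bframe B" and X: "X \<in> Bo B n"
  shows "is_bframe (bslice B n X)"
  using assms by (auto simp: is_bframe_def)

text \<open>Level 0 has a single element and everything lies over it. Hence a result on slices such
  as \<open>thom_pre_bhom\<close> also covers homomorphisms between whole B-systems.\<close>

lemma bslice_0:
  assumes B: "is_bframe B" and X: "X \<in> Bo B 0"
  shows "bslice B 0 X = B"
proof -
  have "ftm B 0 m Y = X" if "Y \<in> Bo B m" for m Y
    using is_bframe_ftm[OF B, of Y 0 m] that X B by (auto simp: is_bframe_def)
  moreover have "ftm B 0 m (ft B m (bd B m y)) = X" if "y \<in> Bt B m" for m y
    using is_bframe_ftm[OF B, of "bd B m y" 0 "Suc m"] is_bframe_bd[OF B that] X B by (auto simp: is_bframe_def)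
  ultimately have "{Y \<in> Bo B m. ftm B 0 m Y = X} = Bo B m"
    "{y \<in> Bt B m. ftm B 0 m (ft B m (bd B m y)) = X} = Bt B m" for m
    by auto
  then show ?thesis by (simp add: bslice_def)
qed

lemma frame_homD:
  assumes "frame_hom B A H"
  shows "X \<in> Bo B n \<Longrightarrow> hB H n X \<in> Bo A n"
    and "x \<in> Bt B n \<Longrightarrow> hT H n x \<in> Bt A n"
    and "X \<in> Bo B (Suc n) \<Longrightarrow> ft A n (hB H (Suc n) X) = hB H n (ft B n X)"
    and "x \<in> Bt B n \<Longrightarrow> bd A n (hT H n x) = hB H (Suc n) (bd B n x)"
  using assms by (simp_all add: frame_hom_def)

lemma frame_hom_ftm:
  assumes "is_bframe B" "frame_hom B A H" "X \<in> Bo B (n + m)"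
  shows "ftm A n m (hB H (n + m) X) = hB H n (ftm B n m X)"
  using assms(3)
proof (induction m arbitrary: X)
  case (Suc m)
  then show ?case using is_bframe_ft[OF assms(1), of X "n + m"] frame_homD(3)[OF assms(2), of X "n + m"] by simp
qed simp

lemma frame_hom_bslice:
  assumes B: "is_bframe B" and H: "frame_hom B A H" and X': "X' = hB H n X"
  shows "frame_hom (bslice B n X) (bslice A n X') (bslice_hom n H)"
  unfolding frame_hom_def X'
  using frame_homD[OF H] frame_hom_ftm[OF B H] is_bframe_bd[OF B] is_bframe_ft[OF B] by auto

lemma frame_hom_comp:
  "\<lbrakk>frame_hom B A H; frame_hom A C K\<rbrakk> \<Longrightarrow> frame_hom B C (K \<circ>\<^sub>B H)"
  by (simp add: frame_hom_def)

lemma frame_hom_cong: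
  assumes B: "is_bframe B" and "frame_hom B A H" "beq B H K"
  shows "frame_hom B A K"
  using assms(2,3) is_bframe_ft[OF B] is_bframe_bd[OF B] unfolding frame_hom_def beq_def by (metis (no_types))

lemma beqI:
  "\<lbrakk>\<And>n X. X \<in> Bo B n \<Longrightarrow> hB H n X = hB K n X; \<And>n x. x \<in> Bt B n \<Longrightarrow> hT H n x = hT K n x\<rbrakk> \<Longrightarrow> beq B H K"
  by (simp add: beq_def)

lemma beqD:
  assumes "beq B H K"
  shows "X \<in> Bo B n \<Longrightarrow> hB H n X = hB K n X" "x \<in> Bt B n \<Longrightarrow> hT H n x = hT K n x"
  using assms by (simp_all add: beq_def)

lemma beq_sym: "beq B H K \<Longrightarrow> beq B K H"
  by (simp add: beq_def)

lemma beq_trans: "beq B H K \<Longrightarrow> beq B K L \<Longrightarrow> beq B H L"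
  by (simp add: beq_def)

lemma beq_bcomp_left: "frame_hom B A H \<Longrightarrow> beq A K L \<Longrightarrow> beq B (K \<circ>\<^sub>B H) (L \<circ>\<^sub>B H)"
  by (simp add: frame_hom_def beq_def)

lemma beq_bcomp_right: "beq B K L \<Longrightarrow> beq B (H \<circ>\<^sub>B K) (H \<circ>\<^sub>B L)"
  by (simp add: beq_def)

lemma beq_bslice_hom: "beq B H K \<Longrightarrow> beq (bslice B n X) (bslice_hom n H) (bslice_hom n K)"
  by (simp add: beq_def)

lemma bcomp_assoc: "(L \<circ>\<^sub>B K) \<circ>\<^sub>B H = L \<circ>\<^sub>B K \<circ>\<^sub>B H"
  by (simp add: bcomp_def)

lemma bslice_hom_bcomp: "bslice_hom n (K \<circ>\<^sub>B H) = bslice_hom n K \<circ>\<^sub>B bslice_hom n H"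
  by (simp add: bslice_hom_def bcomp_def)

lemma bslice_hom_bslice_hom: "bslice_hom n (bslice_hom m H) = bslice_hom (m + n) H"
  by (simp add: bslice_hom_def add.assoc)

lemma pre_bhomD:
  assumes "pre_bhom B A H"
  shows "frame_hom B A H"
    and "\<lbrakk>x \<in> Bt B n; X = bd B n x\<rbrakk> \<Longrightarrow> beq (bslice B (Suc n) X)
      (bslice_hom n H \<circ>\<^sub>B Sb B n x) (Sb A n (hT H n x) \<circ>\<^sub>B bslice_hom (Suc n) H)"
    and "\<lbrakk>X \<in> Bo B (Suc n); Y = ft B n X\<rbrakk> \<Longrightarrow> beq (bslice B n Y)
      (bslice_hom (Suc n) H \<circ>\<^sub>B Wb B n X) (Wb A n (hB H (Suc n) X) \<circ>\<^sub>B bslice_hom n H)"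
    and "X \<in> Bo B (Suc n) \<Longrightarrow> hT H (Suc n) (dl B n X) = dl A n (hB H (Suc n) X)"
  using assms by (auto simp: pre_bhom_def)

lemma pre_bhom_bid: "pre_bhom B B bid"
  by (simp add: pre_bhom_def frame_hom_def beq_def)

lemma pre_bhom_comp:
  assumes B: "is_bframe B" and H: "pre_bhom B A H" and K: "pre_bhom A C K"
  shows "pre_bhom B C (K \<circ>\<^sub>B H)"
  unfolding pre_bhom_def
proof (intro conjI allI ballI)
  show "frame_hom B C (K \<circ>\<^sub>B H)"
    using frame_hom_comp pre_bhomD(1)[OF H] pre_bhomD(1)[OF K] .
next
  fix n x assume x: "x \<in> Bt B n"
  note fH = pre_bhomD(1)[OF H]
  have 1: "beq (bslice B (Suc n) (bd B n x)) (bslice_hom n K \<circ>\<^sub>B bslice_hom n H \<circ>\<^sub>B Sb B n x)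
     (bslice_hom n K \<circ>\<^sub>B Sb A n (hT H n x) \<circ>\<^sub>B bslice_hom (Suc n) H)"
    by (rule beq_bcomp_right, rule pre_bhomD(2)[OF H x refl])
  have 2: "beq (bslice B (Suc n) (bd B n x)) ((bslice_hom n K \<circ>\<^sub>B Sb A n (hT H n x)) \<circ>\<^sub>B bslice_hom (Suc n) H)
     ((Sb C n (hT K n (hT H n x)) \<circ>\<^sub>B bslice_hom (Suc n) K) \<circ>\<^sub>B bslice_hom (Suc n) H)"
    by (rule beq_bcomp_left[OF frame_hom_bslice[OF B fH refl] pre_bhomD(2)[OF K]])
      (use frame_homD[OF fH] x in auto)
  show "beq (bslice B (Suc n) (bd B n x)) (bslice_hom n (K \<circ>\<^sub>B H) \<circ>\<^sub>B Sb B n x)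
     (Sb C n (hT (K \<circ>\<^sub>B H) n x) \<circ>\<^sub>B bslice_hom (Suc n) (K \<circ>\<^sub>B H))"
    using beq_trans[OF 1 2[unfolded bcomp_assoc]] by (simp add: bslice_hom_bcomp bcomp_assoc)
next
  fix n X assume X: "X \<in> Bo B (Suc n)"
  note fH = pre_bhomD(1)[OF H]
  have 1: "beq (bslice B n (ft B n X)) (bslice_hom (Suc n) K \<circ>\<^sub>B bslice_hom (Suc n) H \<circ>\<^sub>B Wb B n X)
     (bslice_hom (Suc n) K \<circ>\<^sub>B Wb A n (hB H (Suc n) X) \<circ>\<^sub>B bslice_hom n H)"
    by (rule beq_bcomp_right, rule pre_bhomD(3)[OF H X refl])
  have 2: "beq (bslice B n (ft B n X)) ((bslice_hom (Suc n) K \<circ>\<^sub>B Wb A n (hB H (Suc n) X)) \<circ>\<^sub>B bslice_hom n H)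
     ((Wb C n (hB K (Suc n) (hB H (Suc n) X)) \<circ>\<^sub>B bslice_hom n K) \<circ>\<^sub>B bslice_hom n H)"
    by (rule beq_bcomp_left[OF frame_hom_bslice[OF B fH refl] pre_bhomD(3)[OF K]])
      (use frame_homD[OF fH] X in auto)
  show "beq (bslice B n (ft B n X)) (bslice_hom (Suc n) (K \<circ>\<^sub>B H) \<circ>\<^sub>B Wb B n X)
     (Wb C n (hB (K \<circ>\<^sub>B H) (Suc n) X) \<circ>\<^sub>B bslice_hom n (K \<circ>\<^sub>B H))"
    using beq_trans[OF 1 2[unfolded bcomp_assoc]] by (simp add: bslice_hom_bcomp bcomp_assoc)
  show "hT (K \<circ>\<^sub>B H) (Suc n) (dl B n X) = dl C n (hB (K \<circ>\<^sub>B H) (Suc n) X)"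
    using pre_bhomD(4)[OF H X] pre_bhomD(4)[OF K] frame_homD(1)[OF fH X] by simp
qed

text \<open>Substitution and weakening in a slice are those of \<open>B\<close> at an index shifted
  by \<open>n\<close>, and a slice of the slice is a slice of \<open>B\<close>. So each condition is
  an instance of one for \<open>H\<close>.\<close>

lemma pre_bhom_bslice:
  assumes B: "is_bframe B" and H: "pre_bhom B A H" and X': "X' = hB H n X"
  shows "pre_bhom (bslice B n X) (bslice A n X') (bslice_hom n H)"
  unfolding pre_bhom_def
proof (intro conjI allI ballI)
  note fH = pre_bhomD(1)[OF H]
  show "frame_hom (bslice B n X) (bslice A n X') (bslice_hom n H)"
    using frame_hom_bslice[OF B fH X'] .
next
  fix m x assume x: "x \<in> Bt (bslice B n X) m"
  then show "beq (bslice (bslice B n X) (Suc m) (bd (bslice B n X) m x))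
     (bslice_hom m (bslice_hom n H) \<circ>\<^sub>B Sb (bslice B n X) m x)
     (Sb (bslice A n X') m (hT (bslice_hom n H) m x) \<circ>\<^sub>B bslice_hom (Suc m) (bslice_hom n H))"
    using pre_bhomD(2)[OF H, of x "n + m" "bd B (n + m) x"] by (simp add: bslice_bslice bslice_hom_bslice_hom)
next
  fix m Y assume Y: "Y \<in> Bo (bslice B n X) (Suc m)"
  then show "beq (bslice (bslice B n X) m (ft (bslice B n X) m Y))
     (bslice_hom (Suc m) (bslice_hom n H) \<circ>\<^sub>B Wb (bslice B n X) m Y)
     (Wb (bslice A n X') m (hB (bslice_hom n H) (Suc m) Y) \<circ>\<^sub>B bslice_hom m (bslice_hom n H))"
    using pre_bhomD(3)[OF H, of Y "n + m"] by (simp add: bslice_bslice bslice_hom_bslice_hom)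
  show "hT (bslice_hom n H) (Suc m) (dl (bslice B n X) m Y) = dl (bslice A n X') m (hB (bslice_hom n H) (Suc m) Y)"
    using pre_bhomD(4)[OF H, of Y "n + m"] Y by simp
qed

lemma bsystemD:
  assumes "bsystem B"
  shows "is_bframe B"
    and "\<lbrakk>x \<in> Bt B n; X = bd B n x; Y = ft B n X\<rbrakk> \<Longrightarrow> pre_bhom (bslice B (Suc n) X) (bslice B n Y) (Sb B n x)"
    and "\<lbrakk>X \<in> Bo B (Suc n); Y = ft B n X\<rbrakk> \<Longrightarrow> pre_bhom (bslice B n Y) (bslice B (Suc n) X) (Wb B n X)"
    and "\<lbrakk>x \<in> Bt B n; X = bd B n x; Y = ft B n X\<rbrakk> \<Longrightarrow> beq (bslice B n Y) (Sb B n x \<circ>\<^sub>B Wb B n X) bid"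
    and "\<lbrakk>x \<in> Bt B n; X = bd B n x\<rbrakk> \<Longrightarrow> hT (Sb B n x) 0 (dl B n X) = x"
    and "X \<in> Bo B (Suc n) \<Longrightarrow> beq (bslice B (Suc n) X) (Sb B (Suc n) (dl B n X) \<circ>\<^sub>B bslice_hom 1 (Wb B n X)) bid"
    and "X \<in> Bo B (Suc n) \<Longrightarrow> dl B n X \<in> Bt B (Suc n)"
    and "X \<in> Bo B (Suc n) \<Longrightarrow> bd B (Suc n) (dl B n X) = hB (Wb B n X) 1 X"
  using assms by (auto simp: bsystem_def pre_bsystem_def)

text \<open>The axioms are instances of those of \<open>B\<close>, shifted by \<open>n\<close>. What
  has to be seen is that \<delta>(Y) again lies over \<open>X\<close>: its boundary W_Y(Y) lies over
  \<open>Y\<close>. The result lets S_x and W_X count as homomorphisms between B-systems, so that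
  lemmas on such homomorphisms apply to them.\<close>

lemma bsystem_bslice:
  assumes B: "bsystem B" and X: "X \<in> Bo B n"
  shows "bsystem (bslice B n X)"
proof -
  note fr = bsystemD(1)[OF B]
  let ?S = "bslice B n X"
  have sl: "bslice ?S (Suc m) Y = bslice B (Suc (n + m)) Y" if "ftm B n (Suc m) Y = X" for m Y
    using bslice_bslice[OF that] by simp
  have sl': "bslice ?S m (ft B (n + m) Y) = bslice B (n + m) (ft B (n + m) Y)" if "ftm B n (Suc m) Y = X" for m Y
    using bslice_bslice[of B n m "ft B (n + m) Y" X] that by simp
  have frS: "is_bframe ?S" using is_bframe_bslice[OF fr X] .
  have S: "pre_bhom (bslice ?S (Suc m) (bd ?S m x)) (bslice ?S m (ft ?S m (bd ?S m x))) (Sb ?S m x)"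
    if "x \<in> Bt ?S m" for m x
    using that bsystemD(2)[OF B _ refl refl, of x "n + m"] by (simp add: sl sl')
  have W: "pre_bhom (bslice ?S m (ft ?S m Y)) (bslice ?S (Suc m) Y) (Wb ?S m Y)"
    if "Y \<in> Bo ?S (Suc m)" for m Y
    using that bsystemD(3)[OF B _ refl, of Y "n + m"] by (simp add: sl sl')
  have d: "dl ?S m Y \<in> Bt ?S (Suc m)" "bd ?S (Suc m) (dl ?S m Y) = hB (Wb ?S m Y) 1 Y"
    if Y: "Y \<in> Bo ?S (Suc m)" for m Y
  proof -
    have "hB (Wb ?S m Y) 1 Y \<in> Bo (bslice ?S (Suc m) Y) 1"
      by (rule frame_homD(1)[OF pre_bhomD(1)[OF W[OF Y]]]) (use Y in simp)
    then show "dl ?S m Y \<in> Bt ?S (Suc m)" "bd ?S (Suc m) (dl ?S m Y) = hB (Wb ?S m Y) 1 Y"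
      using Y bsystemD(7,8)[OF B, of Y "n + m"] by auto
  qed
  have "beq (bslice ?S m (ft ?S m (bd ?S m x))) (Sb ?S m x \<circ>\<^sub>B Wb ?S m (bd ?S m x)) bid"
    "hT (Sb ?S m x) 0 (dl ?S m (bd ?S m x)) = x" if "x \<in> Bt ?S m" for m x
    using that bsystemD(4)[OF B _ refl refl, of x "n + m"] bsystemD(5)[OF B _ refl, of x "n + m"] by (simp_all add: sl')
  moreover have "beq (bslice ?S (Suc m) Y) (Sb ?S (Suc m) (dl ?S m Y) \<circ>\<^sub>B bslice_hom 1 (Wb ?S m Y)) bid"
    if "Y \<in> Bo ?S (Suc m)" for m Y
    using that bsystemD(6)[OF B, of Y "n + m"] by (simp add: sl)
  ultimately show ?thesis
    unfolding bsystem_def pre_bsystem_def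
    using frS S W d pre_bhomD(1)[OF S] pre_bhomD(1)[OF W] by blast
qed

text \<open>Each compatibility equation evaluates \<open>H\<close> on carriers only, because S_x and
  W_X of \<open>B\<close> map slices of \<open>B\<close> into slices of \<open>B\<close>. This
  allows the passage to the restricted representative of a homomorphism.\<close>

lemma pre_bhom_cong:
  assumes B: "bsystem B" and H: "pre_bhom B A H" and e: "beq B H K"
  shows "pre_bhom B A K"
  unfolding pre_bhom_def
proof (intro conjI allI ballI)
  note fr = bsystemD(1)[OF B]
  show "frame_hom B A K" using frame_hom_cong[OF fr pre_bhomD(1)[OF H] e] .
next
  fix n x assume x: "x \<in> Bt B n"
  let ?X = "bd B n x"
  have eT: "hT H n x = hT K n x" using beqD(2)[OF e x] .
  have 1: "beq (bslice B (Suc n) ?X) (bslice_hom n K \<circ>\<^sub>B Sb B n x) (bslice_hom n H \<circ>\<^sub>B Sb B n x)"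
    using beq_bcomp_left[OF pre_bhomD(1)[OF bsystemD(2)[OF B x refl refl]] beq_bslice_hom[OF beq_sym[OF e]]] .
  have 2: "beq (bslice B (Suc n) ?X) (bslice_hom n H \<circ>\<^sub>B Sb B n x) (Sb A n (hT K n x) \<circ>\<^sub>B bslice_hom (Suc n) H)"
    using pre_bhomD(2)[OF H x refl] by (simp add: eT)
  have 3: "beq (bslice B (Suc n) ?X) (Sb A n (hT K n x) \<circ>\<^sub>B bslice_hom (Suc n) H) (Sb A n (hT K n x) \<circ>\<^sub>B bslice_hom (Suc n) K)"
    using beq_bcomp_right[OF beq_bslice_hom[OF e]] .
  show "beq (bslice B (Suc n) ?X) (bslice_hom n K \<circ>\<^sub>B Sb B n x) (Sb A n (hT K n x) \<circ>\<^sub>B bslice_hom (Suc n) K)"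
    using beq_trans[OF beq_trans[OF 1 2] 3] .
next
  fix n X assume X: "X \<in> Bo B (Suc n)"
  have eB: "hB H (Suc n) X = hB K (Suc n) X" using beqD(1)[OF e X] .
  have 1: "beq (bslice B n (ft B n X)) (bslice_hom (Suc n) K \<circ>\<^sub>B Wb B n X) (bslice_hom (Suc n) H \<circ>\<^sub>B Wb B n X)"
    using beq_bcomp_left[OF pre_bhomD(1)[OF bsystemD(3)[OF B X refl]] beq_bslice_hom[OF beq_sym[OF e]]] .
  have 2: "beq (bslice B n (ft B n X)) (bslice_hom (Suc n) H \<circ>\<^sub>B Wb B n X) (Wb A n (hB K (Suc n) X) \<circ>\<^sub>B bslice_hom n H)"
    using pre_bhomD(3)[OF H X refl] by (simp add: eB)
  have 3: "beq (bslice B n (ft B n X)) (Wb A n (hB K (Suc n) X) \<circ>\<^sub>B bslice_hom n H) (Wb A n (hB K (Suc n) X) \<circ>\<^sub>B bslice_hom n K)"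
    using beq_bcomp_right[OF beq_bslice_hom[OF e]] .
  show "beq (bslice B n (ft B n X)) (bslice_hom (Suc n) K \<circ>\<^sub>B Wb B n X) (Wb A n (hB K (Suc n) X) \<circ>\<^sub>B bslice_hom n K)"
    using beq_trans[OF beq_trans[OF 1 2] 3] .
  show "hT K (Suc n) (dl B n X) = dl A n (hB K (Suc n) X)"
    using pre_bhomD(4)[OF H X] beqD(2)[OF e bsystemD(7)[OF B X]] eB by simp
qed

section \<open>Iterated substitution and weakening in B-systems\<close>

lemma sub_list_Nil [simp]: "sub_list B n [] = bid"
  by (simp add: sub_list_def)

lemma sub_list_snoc [simp]: "sub_list B n (ts @ [x]) = Sb B n x \<circ>\<^sub>B bslice_hom 1 (sub_list B n ts)"
  by (simp add: sub_list_def)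

lemma sub_list_bslice [simp]: "sub_list (bslice B n X) m ts = sub_list B (n + m) ts"
  by (simp add: sub_list_def)

lemma wk_list_bslice [simp]: "wk_list (bslice B n X) m k Y = wk_list B (n + m) k Y"
  by (induction k arbitrary: Y) (simp_all add: add.assoc)

lemma id_list_bslice [simp]: "id_list (bslice B n X) m k Y = id_list B (n + m) k Y"
  by (induction k arbitrary: Y) (simp_all add: add.assoc)

text \<open>For a tuple \<open>us @ [x]\<close>, substitution along \<open>us\<close> sends
  \<open>X\<close> to the boundary of \<open>x\<close>. Restricted to the slice over
  \<open>X\<close> it therefore ends exactly where S_x starts.\<close>

lemma sub_list_hom:
  assumes B: "bsystem B"
  shows "\<lbrakk>X \<in> Bo B (n + k); ts \<in> terms B n k X\<rbrakk>
    \<Longrightarrow> pre_bhom (bslice B (n + k) X) (bslice B n (ftm B n k X)) (sub_list B n ts)"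
proof (induction k arbitrary: X ts)
  case 0
  then show ?case using pre_bhom_bid by simp
next
  case (Suc k)
  note fr = bsystemD(1)[OF B]
  from Suc.prems(2) obtain us x where ts: "ts = us @ [x]" and us: "us \<in> terms B n k (ft B (n + k) X)"
    and x: "x \<in> Bt B n" "bd B n x = hB (sub_list B n us) 1 X" by auto
  let ?Y = "ft B (n + k) X"
  have Y: "?Y \<in> Bo B (n + k)" using Suc.prems(1) is_bframe_ft[OF fr] by simp
  note IH = Suc.IH[OF Y us]
  have 1: "pre_bhom (bslice B (Suc (n + k)) X) (bslice B (Suc n) (bd B n x)) (bslice_hom 1 (sub_list B n us))"
  proof -
    have X: "X \<in> Bo (bslice B (n + k) ?Y) 1" using Suc.prems(1) by simp
    note b = frame_homD(1)[OF pre_bhomD(1)[OF IH] X]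
    have "pre_bhom (bslice (bslice B (n + k) ?Y) 1 X) (bslice (bslice B n (ftm B n k ?Y)) 1 (bd B n x))
      (bslice_hom 1 (sub_list B n us))"
      using pre_bhom_bslice[OF is_bframe_bslice[OF fr Y] IH, of "bd B n x" 1 X] x by simp
    then show ?thesis using x b by (simp add: bslice_bslice)
  qed
  have "ft B n (bd B n x) = ftm B n (Suc k) X"
    using x frame_homD(1)[OF pre_bhomD(1)[OF IH], of X 1] Suc.prems(1) by simp
  then have 2: "pre_bhom (bslice B (Suc n) (bd B n x)) (bslice B n (ftm B n (Suc k) X)) (Sb B n x)"
    using bsystemD(2)[OF B x(1) refl] by simp
  show ?case
    using pre_bhom_comp[OF is_bframe_bslice[OF fr] 1 2] Suc.prems(1) unfolding ts by simp
qed

text \<open>The slice adds the condition that the entries lie over \<open>X\<close>. It holds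
  automatically: substitution along the earlier entries maps into a slice whose base lies over
  \<open>X\<close>, and the boundary of the next entry is a value of it.\<close>

lemma terms_bslice:
  assumes B: "bsystem B"
  shows "\<lbrakk>Y \<in> Bo B (n + (m + k)); ftm B n (m + k) Y = X\<rbrakk> \<Longrightarrow> terms (bslice B n X) m k Y = terms B (n + m) k Y"
proof (induction k arbitrary: Y)
  case (Suc k)
  let ?Z = "ft B (n + m + k) Y"
  have Z: "?Z \<in> Bo B (n + (m + k))"
    using is_bframe_ft[OF bsystemD(1)[OF B], of Y "n + m + k"] Suc.prems by (simp add: add.assoc)
  have "ft B (n + m) (hB (sub_list B (n + m) ts) (Suc 0) Y) = ftm B (n + m) k ?Z"
    if "ts \<in> terms B (n + m) k ?Z" for ts
    using frame_homD(1)[OF pre_bhomD(1)[OF sub_list_hom[OF B, of ?Z "n + m" k ts]], of Y 1] Z that Suc.prems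
    by (simp add: add.assoc)
  then show ?case using Suc.IH[of ?Z] Z Suc.prems by (auto simp: add.assoc ftm_add)
qed simp

lemma set_terms: "ts \<in> terms B n k X \<Longrightarrow> set ts \<subseteq> Bt B n"
  by (induction k arbitrary: X ts) fastforce+

text \<open>The two claims are proved together: the boundary required of the last entry is computed
  by substitution along the earlier ones, so membership for length \<open>k + 1\<close> uses the
  commutation for length \<open>k\<close>.\<close>

lemma hom_terms:
  assumes B: "bsystem B" and A: "bsystem A" and H: "pre_bhom B A H"
  shows "\<lbrakk>X \<in> Bo B (n + k); ts \<in> terms B n k X\<rbrakk> \<Longrightarrow>
    map (hT H n) ts \<in> terms A n k (hB H (n + k) X) \<and>
    beq (bslice B (n + k) X) (bslice_hom n H \<circ>\<^sub>B sub_list B n ts)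
      (sub_list A n (map (hT H n) ts) \<circ>\<^sub>B bslice_hom (n + k) H)"
proof (induction k arbitrary: X ts)
  case 0
  then show ?case by (simp add: beq_def)
next
  case (Suc k)
  note fr = bsystemD(1)[OF B] and fH = pre_bhomD(1)[OF H]
  from Suc.prems(2) obtain us x where ts: "ts = us @ [x]" and us: "us \<in> terms B n k (ft B (n + k) X)"
    and x: "x \<in> Bt B n" "bd B n x = hB (sub_list B n us) 1 X" by auto
  let ?Y = "ft B (n + k) X"
  have Y: "?Y \<in> Bo B (n + k)" using Suc.prems(1) is_bframe_ft[OF fr] by simp
  have X: "X \<in> Bo (bslice B (n + k) ?Y) 1" using Suc.prems(1) by simp
  note IH = conjunct1[OF Suc.IH[OF Y us]] and IH2 = conjunct2[OF Suc.IH[OF Y us]]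
  note fs = pre_bhomD(1)[OF sub_list_hom[OF B Y us]]
  have hx: "hT H n x \<in> Bt A n" "bd A n (hT H n x) = hB (sub_list A n (map (hT H n) us)) 1 (hB H (Suc (n + k)) X)"
    using frame_homD[OF fH] x beqD(1)[OF IH2 X] by auto
  have 1: "map (hT H n) ts \<in> terms A n (Suc k) (hB H (n + Suc k) X)"
    unfolding ts using IH hx frame_homD(3)[OF fH, of X "n + k"] Suc.prems(1) by auto
  have fs1: "frame_hom (bslice B (Suc (n + k)) X) (bslice B (Suc n) (bd B n x)) (bslice_hom 1 (sub_list B n us))"
    using frame_hom_bslice[OF is_bframe_bslice[OF fr Y] fs x(2), unfolded x(2)] x frame_homD(1)[OF fs X] X
    by (simp add: bslice_bslice)
  have 2: "beq (bslice B (Suc (n + k)) X) (bslice_hom n H \<circ>\<^sub>B Sb B n x \<circ>\<^sub>B bslice_hom 1 (sub_list B n us))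
     (Sb A n (hT H n x) \<circ>\<^sub>B bslice_hom (Suc n) H \<circ>\<^sub>B bslice_hom 1 (sub_list B n us))"
    using beq_bcomp_left[OF fs1 pre_bhomD(2)[OF H x(1) refl]] by (simp add: bcomp_assoc)
  have 3: "beq (bslice B (Suc (n + k)) X) (Sb A n (hT H n x) \<circ>\<^sub>B bslice_hom (Suc n) H \<circ>\<^sub>B bslice_hom 1 (sub_list B n us))
     (Sb A n (hT H n x) \<circ>\<^sub>B bslice_hom 1 (sub_list A n (map (hT H n) us)) \<circ>\<^sub>B bslice_hom (Suc (n + k)) H)"
    using beq_bcomp_right[OF beq_bslice_hom[OF IH2, of 1 X]] X
    by (simp add: bslice_bslice bslice_hom_bcomp bslice_hom_bslice_hom)
  show ?case using 1 beq_trans[OF 2 3] unfolding ts by (simp add: bcomp_assoc)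
qed

lemma wk_list_hom:
  assumes B: "bsystem B"
  shows "X \<in> Bo B (n + k) \<Longrightarrow> pre_bhom (bslice B n (ftm B n k X)) (bslice B (n + k) X) (wk_list B n k X)"
proof (induction k arbitrary: X)
  case 0
  then show ?case using pre_bhom_bid by simp
next
  case (Suc k)
  note fr = bsystemD(1)[OF B]
  have Y: "ft B (n + k) X \<in> Bo B (n + k)" using Suc.prems is_bframe_ft[OF fr] by simp
  show ?case
    using pre_bhom_comp[OF is_bframe_bslice[OF fr is_bframe_ftm[OF fr Y]] Suc.IH[OF Y] bsystemD(3)[OF B _ refl]] Suc.prems
    by simp
qed

lemma hom_wk_list:
  assumes B: "bsystem B" and H: "pre_bhom B A H"
  shows "X \<in> Bo B (n + k) \<Longrightarrow> beq (bslice B n (ftm B n k X)) (bslice_hom (n + k) H \<circ>\<^sub>B wk_list B n k X)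
    (wk_list A n k (hB H (n + k) X) \<circ>\<^sub>B bslice_hom n H)"
proof (induction k arbitrary: X)
  case 0
  then show ?case by (simp add: beq_def)
next
  case (Suc k)
  note fr = bsystemD(1)[OF B] and fH = pre_bhomD(1)[OF H]
  let ?Y = "ft B (n + k) X"
  have Y: "?Y \<in> Bo B (n + k)" using Suc.prems is_bframe_ft[OF fr] by simp
  have 1: "beq (bslice B n (ftm B n k ?Y)) (bslice_hom (Suc (n + k)) H \<circ>\<^sub>B Wb B (n + k) X \<circ>\<^sub>B wk_list B n k ?Y)
    (Wb A (n + k) (hB H (Suc (n + k)) X) \<circ>\<^sub>B bslice_hom (n + k) H \<circ>\<^sub>B wk_list B n k ?Y)"
    using beq_bcomp_left[OF pre_bhomD(1)[OF wk_list_hom[OF B Y]] pre_bhomD(3)[OF H _ refl]] Suc.prems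
    by (simp add: bcomp_assoc)
  have 2: "beq (bslice B n (ftm B n k ?Y)) (Wb A (n + k) (hB H (Suc (n + k)) X) \<circ>\<^sub>B bslice_hom (n + k) H \<circ>\<^sub>B wk_list B n k ?Y)
    (Wb A (n + k) (hB H (Suc (n + k)) X) \<circ>\<^sub>B wk_list A n k (hB H (n + k) ?Y) \<circ>\<^sub>B bslice_hom n H)"
    by (rule beq_bcomp_right[OF Suc.IH[OF Y]])
  show ?case using beq_trans[OF 1 2] frame_homD(3)[OF fH, of X "n + k"] Suc.prems by (simp add: bcomp_assoc)
qed

text \<open>Substitution along \<open>us\<close> is a homomorphism, so it moves past W_X and turns
  it into weakening by the boundary of \<open>x\<close>. It then cancels the remaining weakening by
  induction, and S_x cancels the weakening by its own boundary.\<close>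

lemma sub_list_wk_list:
  assumes B: "bsystem B"
  shows "\<lbrakk>X \<in> Bo B (n + k); ts \<in> terms B n k X\<rbrakk>
    \<Longrightarrow> beq (bslice B n (ftm B n k X)) (sub_list B n ts \<circ>\<^sub>B wk_list B n k X) bid"
proof (induction k arbitrary: X ts)
  case 0
  then show ?case by (simp add: beq_def)
next
  case (Suc k)
  note fr = bsystemD(1)[OF B]
  from Suc.prems(2) obtain us x where ts: "ts = us @ [x]" and us: "us \<in> terms B n k (ft B (n + k) X)"
    and x: "x \<in> Bt B n" "bd B n x = hB (sub_list B n us) 1 X" by auto
  let ?Y = "ft B (n + k) X"
  have Y: "?Y \<in> Bo B (n + k)" using Suc.prems is_bframe_ft[OF fr] by simp
  let ?D = "ftm B n k ?Y"
  have X: "X \<in> Bo (bslice B (n + k) ?Y) 1" using Suc.prems(1) by simp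
  note hs = sub_list_hom[OF B Y us] and hw = wk_list_hom[OF B Y]
  have D: "ft B n (bd B n x) = ?D" using frame_homD(1)[OF pre_bhomD(1)[OF hs] X] x by simp
  have 1: "beq (bslice B (n + k) ?Y) (bslice_hom 1 (sub_list B n us) \<circ>\<^sub>B Wb B (n + k) X)
     (Wb B n (bd B n x) \<circ>\<^sub>B sub_list B n us)"
    using pre_bhomD(3)[OF hs, of X 0 ?Y] X x by (simp add: bslice_bslice)
  have 2: "beq (bslice B n ?D) (Sb B n x \<circ>\<^sub>B bslice_hom 1 (sub_list B n us) \<circ>\<^sub>B Wb B (n + k) X \<circ>\<^sub>B wk_list B n k ?Y)
     (Sb B n x \<circ>\<^sub>B Wb B n (bd B n x) \<circ>\<^sub>B sub_list B n us \<circ>\<^sub>B wk_list B n k ?Y)"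
    using beq_bcomp_right[OF beq_bcomp_left[OF pre_bhomD(1)[OF hw] 1]] by (simp add: bcomp_assoc)
  have 3: "beq (bslice B n ?D) (Sb B n x \<circ>\<^sub>B Wb B n (bd B n x) \<circ>\<^sub>B sub_list B n us \<circ>\<^sub>B wk_list B n k ?Y)
     (Sb B n x \<circ>\<^sub>B Wb B n (bd B n x))"
    using beq_bcomp_right[OF Suc.IH[OF Y us], of "Sb B n x \<circ>\<^sub>B Wb B n (bd B n x)"] by (simp add: bcomp_assoc)
  have 4: "beq (bslice B n ?D) (Sb B n x \<circ>\<^sub>B Wb B n (bd B n x)) bid"
    using bsystemD(4)[OF B x(1) refl D[symmetric]] .
  show ?case using beq_trans[OF beq_trans[OF 2 3] 4] unfolding ts by (simp add: bcomp_assoc)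
qed

text \<open>W_X is applied to the induction hypothesis over \<open>ft X\<close>: substitution along
  the weakened generic tuple, after the whole weakening, is W_X (fact \<open>A5\<close>). This makes
  \<delta>(X), whose boundary is W_X(X), an admissible last entry; and restricted to the slice over
  \<open>X\<close> it reduces the second claim to the axiom that substitution by \<delta>(X) cancels
  W_X.\<close>

lemma id_list_terms:
  assumes B: "bsystem B"
  shows "X \<in> Bo B (n + k) \<Longrightarrow> id_list B n k X \<in> terms B (n + k) k (hB (wk_list B n k X) k X) \<and>
    beq (bslice B (n + k) X) (sub_list B (n + k) (id_list B n k X) \<circ>\<^sub>B bslice_hom k (wk_list B n k X)) bid"
proof (induction k arbitrary: X)
  case 0
  then show ?case by (simp add: beq_def)
next
  case (Suc k)
  note fr = bsystemD(1)[OF B]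
  let ?Y = "ft B (n + k) X" and ?W = "Wb B (n + k) X"
  have Y: "?Y \<in> Bo B (n + k)" using Suc.prems is_bframe_ft[OF fr] by simp
  let ?wk = "wk_list B n k ?Y" and ?id = "id_list B n k ?Y"
  let ?N = "n + k" and ?M = "Suc (n + k)"
  have X: "X \<in> Bo B ?M" using Suc.prems by simp
  have X1: "X \<in> Bo (bslice B ?N ?Y) 1" using X by simp
  have Xk: "X \<in> Bo (bslice B n (ftm B n k ?Y)) (Suc k)" using X by simp
  note hw = wk_list_hom[OF B Y] and hW = bsystemD(3)[OF B X refl]
  note fw = pre_bhomD(1)[OF hw] and fW = pre_bhomD(1)[OF hW]
  note IH1 = conjunct1[OF Suc.IH[OF Y]] and IH2 = conjunct2[OF Suc.IH[OF Y]]
  let ?wX = "hB ?wk (Suc k) X" and ?wY = "hB ?wk k ?Y"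
  have wY: "?wY \<in> Bo (bslice B ?N ?Y) k" using frame_homD(1)[OF fw, of ?Y k] Y by simp
  have wX: "?wX \<in> Bo (bslice B ?N ?Y) (Suc k)" using frame_homD(1)[OF fw, of X "Suc k"] Xk by simp
  have ftwX: "ft B (?N + k) ?wX = ?wY" using frame_homD(3)[OF fw, of X k] Xk by (simp add: add.assoc)
  note bN = bsystem_bslice[OF B Y] and bM = bsystem_bslice[OF B X]
  \<comment> \<open>\<open>hom_terms\<close> is about homomorphisms of B-systems, so W_X is read as
    one from the slice over \<open>ft X\<close> to the slice over \<open>X\<close>, and the generic
    tuple as a tuple of that slice.\<close>
  have t: "terms (bslice B ?N ?Y) 0 k ?wY = terms B ?N k ?wY"
    using terms_bslice[OF B, of ?wY ?N 0 k ?Y] wY by simp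
  have H: "map (hT ?W 0) ?id \<in> terms (bslice B ?M X) 0 k (hB ?W k ?wY) \<and>
    beq (bslice (bslice B ?N ?Y) k ?wY) (?W \<circ>\<^sub>B sub_list B ?N ?id) (sub_list B ?M (map (hT ?W 0) ?id) \<circ>\<^sub>B bslice_hom k ?W)"
    using hom_terms[OF bN bM hW, of ?wY 0 k ?id] IH1 t wY by simp
  have WwY: "hB ?W k ?wY \<in> Bo (bslice B ?M X) k" using frame_homD(1)[OF fW wY] .
  have WwX: "hB ?W (Suc k) ?wX \<in> Bo (bslice B ?M X) (Suc k)" using frame_homD(1)[OF fW wX] .
  have ftWwX: "ft B (?M + k) (hB ?W (Suc k) ?wX) = hB ?W k ?wY" using frame_homD(3)[OF fW wX] ftwX by simp
  have A1: "map (hT ?W 0) ?id \<in> terms B ?M k (hB ?W k ?wY)"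
    using H terms_bslice[OF B, of "hB ?W k ?wY" ?M 0 k X] WwY by simp
  have A2: "beq (bslice B (?N + k) ?wY) (?W \<circ>\<^sub>B sub_list B ?N ?id) (sub_list B ?M (map (hT ?W 0) ?id) \<circ>\<^sub>B bslice_hom k ?W)"
    using H wY by (simp add: bslice_bslice)
  have fwk: "frame_hom (bslice B ?N ?Y) (bslice B (?N + k) ?wY) (bslice_hom k ?wk)"
    using frame_hom_bslice[OF is_bframe_bslice[OF fr] fw, of ?wY k ?Y] Y wY is_bframe_ftm[OF fr Y]
    by (simp add: bslice_bslice)
  have A3: "beq (bslice B ?N ?Y) (?W \<circ>\<^sub>B sub_list B ?N ?id \<circ>\<^sub>B bslice_hom k ?wk)
     (sub_list B ?M (map (hT ?W 0) ?id) \<circ>\<^sub>B bslice_hom k ?W \<circ>\<^sub>B bslice_hom k ?wk)"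
    using beq_bcomp_left[OF fwk A2] by (simp add: bcomp_assoc)
  have A4: "beq (bslice B ?N ?Y) (?W \<circ>\<^sub>B sub_list B ?N ?id \<circ>\<^sub>B bslice_hom k ?wk) ?W"
    using beq_bcomp_right[OF IH2, of ?W] by simp
  have A5: "beq (bslice B ?N ?Y) (sub_list B ?M (map (hT ?W 0) ?id) \<circ>\<^sub>B bslice_hom k ?W \<circ>\<^sub>B bslice_hom k ?wk) ?W"
    using beq_trans[OF beq_sym[OF A3] A4] .
  have d: "dl B ?N X \<in> Bt B ?M" "bd B ?M (dl B ?N X) = hB ?W 1 X"
    using bsystemD(7,8)[OF B X] by auto
  have "bd B ?M (dl B ?N X) = hB (sub_list B ?M (map (hT ?W 0) ?id)) 1 (hB ?W (Suc k) ?wX)"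
    using beqD(1)[OF A5 X1] d by simp
  then have T: "id_list B n (Suc k) X \<in> terms B (n + Suc k) (Suc k) (hB (wk_list B n (Suc k) X) (Suc k) X)"
    using A1 d(1) ftWwX by auto
  have A6: "beq (bslice B ?M X) (bslice_hom 1 (sub_list B ?M (map (hT ?W 0) ?id)) \<circ>\<^sub>B bslice_hom (Suc k) ?W \<circ>\<^sub>B bslice_hom (Suc k) ?wk)
     (bslice_hom 1 ?W)"
    using beq_bslice_hom[OF A5, of 1 X] X1 by (simp add: bslice_bslice bslice_hom_bcomp bslice_hom_bslice_hom)
  have A7: "beq (bslice B ?M X) (Sb B ?M (dl B ?N X) \<circ>\<^sub>B bslice_hom 1 (sub_list B ?M (map (hT ?W 0) ?id)) \<circ>\<^sub>B bslice_hom (Suc k) ?W \<circ>\<^sub>B bslice_hom (Suc k) ?wk)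
     bid"
    using beq_trans[OF beq_bcomp_right[OF A6] bsystemD(6)[OF B X]] .
  show ?case using T A7 by (simp add: bcomp_assoc bslice_hom_bcomp)
qed

text \<open>The equations for W_X and for substitutions hold on elements over \<open>Y\<close> only.
  They apply to the entries of the generic tuple because this tuple is a term inside the slice over
  \<open>Y\<close>.\<close>

lemma id_list_Bt:
  assumes B: "bsystem B" and Y: "Y \<in> Bo B (n + k)" and y: "y \<in> set (id_list B n k Y)"
  shows "y \<in> Bt (bslice B (n + k) Y) 0"
proof -
  let ?Z = "hB (wk_list B n k Y) k Y"
  have "?Z \<in> Bo (bslice B (n + k) Y) k"
    using frame_homD(1)[OF pre_bhomD(1)[OF wk_list_hom[OF B Y]], of Y k] Y by simp
  then have "id_list B n k Y \<in> terms (bslice B (n + k) Y) 0 k ?Z"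
    using terms_bslice[OF B, of ?Z "n + k" 0 k Y] id_list_terms[OF B Y] by simp
  from set_terms[OF this] y show ?thesis by (simp del: bslice_simps add: subset_iff)
qed

lemma hom_id_list:
  assumes B: "bsystem B" and H: "pre_bhom B A H"
  shows "X \<in> Bo B (n + k) \<Longrightarrow> map (hT H (n + k)) (id_list B n k X) = id_list A n k (hB H (n + k) X)"
proof (induction k arbitrary: X)
  case (Suc k)
  note fr = bsystemD(1)[OF B] and fH = pre_bhomD(1)[OF H]
  let ?Y = "ft B (n + k) X"
  have X: "X \<in> Bo B (Suc (n + k))" using Suc.prems by simp
  have Y: "?Y \<in> Bo B (n + k)" using X is_bframe_ft[OF fr] by simp
  have "hT H (Suc (n + k)) (hT (Wb B (n + k) X) 0 y)
      = hT (Wb A (n + k) (hB H (Suc (n + k)) X)) 0 (hT H (n + k) y)" if "y \<in> set (id_list B n k ?Y)" for y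
    using beqD(2)[OF pre_bhomD(3)[OF H X refl], of y 0] id_list_Bt[OF B Y that] by simp
  then have "map (hT H (Suc (n + k))) (map (hT (Wb B (n + k) X) 0) (id_list B n k ?Y))
     = map (hT (Wb A (n + k) (hB H (Suc (n + k)) X)) 0) (map (hT H (n + k)) (id_list B n k ?Y))"
    by simp
  then show ?case using Suc.IH[OF Y] pre_bhomD(4)[OF H X] frame_homD(3)[OF fH X] by simp
qed simp

text \<open>An entry before the last is a weakening by \<open>X\<close>; substitution along
  \<open>us\<close> turns it into a weakening by the boundary of \<open>x\<close>, which S_x
  cancels. The last entry \<delta>(X) goes to the generic element of that boundary and hence to
  \<open>x\<close>.\<close>

lemma sub_list_id_list:
  assumes B: "bsystem B"
  shows "\<lbrakk>X \<in> Bo B (n + k); ts \<in> terms B n k X\<rbrakk> \<Longrightarrow> map (hT (sub_list B n ts) 0) (id_list B n k X) = ts"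
proof (induction k arbitrary: X ts)
  case (Suc k)
  note fr = bsystemD(1)[OF B]
  from Suc.prems(2) obtain us x where ts: "ts = us @ [x]" and us: "us \<in> terms B n k (ft B (n + k) X)"
    and x: "x \<in> Bt B n" "bd B n x = hB (sub_list B n us) 1 X" by auto
  let ?Y = "ft B (n + k) X"
  have X: "X \<in> Bo B (Suc (n + k))" using Suc.prems by simp
  have Y: "?Y \<in> Bo B (n + k)" using X is_bframe_ft[OF fr] by simp
  have X1: "X \<in> Bo (bslice B (n + k) ?Y) 1" using X by simp
  note hs = sub_list_hom[OF B Y us] and W = wk_list_hom[OF B Y]
  note fs = pre_bhomD(1)[OF hs]
  have D: "ft B n (bd B n x) = ftm B n k ?Y" using frame_homD(1)[OF fs X1] x by simp
  note yt = id_list_Bt[OF B Y]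
  have "hT (Sb B n x) 0 (hT (sub_list B n us) (Suc 0) (hT (Wb B (n + k) X) 0 y)) = hT (sub_list B n us) 0 y"
    if "y \<in> set (id_list B n k ?Y)" for y
  proof -
    have "hT (sub_list B n us) (Suc 0) (hT (Wb B (n + k) X) 0 y) = hT (Wb B n (bd B n x)) 0 (hT (sub_list B n us) 0 y)"
      using beqD(2)[OF pre_bhomD(3)[OF hs, of X 0 ?Y], of y 0] X1 x yt[OF that] by (simp add: bslice_bslice)
    moreover have "hT (sub_list B n us) 0 y \<in> Bt (bslice B n (ftm B n k ?Y)) 0"
      using frame_homD(2)[OF fs yt[OF that]] .
    ultimately show ?thesis using beqD(2)[OF bsystemD(4)[OF B x(1) refl D[symmetric]], of _ 0] by simp
  qed
  moreover have "hT (sub_list B n us) (Suc 0) (dl B (n + k) X) = dl B n (bd B n x)"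
    using pre_bhomD(4)[OF hs, of X 0] X1 x by simp
  moreover have "map (hT (sub_list B n us) 0) (id_list B n k ?Y) = us" using Suc.IH[OF Y us] .
  ultimately show ?case unfolding ts
    using bsystemD(5)[OF B x(1) refl] by (simp add: map_idI cong: map_cong)
qed simp

section \<open>The category of B-systems\<close>

lemma bres_simps [simp]:
  "X \<in> Bo B n \<Longrightarrow> hB (bres B H) n X = hB H n X" "x \<in> Bt B n \<Longrightarrow> hT (bres B H) n x = hT H n x"
  by (simp_all add: bres_def)

lemma beq_bres: "beq B (bres B H) H"
  by (simp add: beq_def)

lemma bres_bres [simp]: "bres B (bres B H) = bres B H"
  by (simp add: bres_def restrict_restrict)

lemma bres_eq_iff: "bres B H = bres B K \<longleftrightarrow> beq B H K"
proof
  assume "bres B H = bres B K"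
  then show "beq B H K" by (metis beq_bres beq_sym beq_trans)
next
  assume "beq B H K"
  then show "bres B H = bres B K" by (auto simp: bres_def beq_def intro!: ext restrict_ext)
qed

lemma pre_bhom_bres: "\<lbrakk>bsystem B; pre_bhom B A H\<rbrakk> \<Longrightarrow> pre_bhom B A (bres B H)"
  using pre_bhom_cong beq_sym[OF beq_bres] by blast

lemma Bsys_simps [simp]:
  "Ob Bsys = {B. bsystem B}"
  "(B, H, A) \<in> Ar Bsys \<longleftrightarrow> bsystem B \<and> bsystem A \<and> pre_bhom B A H \<and> bres B H = H"
  "Dom Bsys (B, H, A) = B" "Cod Bsys (B, H, A) = A" "Idt Bsys B = (B, bres B bid, B)"
  "Comp Bsys (A', K, C) (B, H, A) = (B, bres B (K \<circ>\<^sub>B H), C)"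
  by (simp_all add: Bsys_def)

text \<open>Restriction changes \<open>K\<close> only off the carriers of \<open>A\<close>, and
  \<open>H\<close> maps the carriers of \<open>B\<close> into them.\<close>

lemma bres_comp_left: "pre_bhom B A H \<Longrightarrow> bres B (bres A K \<circ>\<^sub>B H) = bres B (K \<circ>\<^sub>B H)"
  unfolding bres_eq_iff using beq_bcomp_left[OF pre_bhomD(1) beq_bres] .

lemma bres_comp_right [simp]: "bres B (K \<circ>\<^sub>B bres B H) = bres B (K \<circ>\<^sub>B H)"
  unfolding bres_eq_iff by (rule beq_bcomp_right[OF beq_bres])

lemma Comp_Bsys:
  assumes "(B, H, A) \<in> Ar Bsys" "(A, K, C) \<in> Ar Bsys"
  shows "(B, bres B (K \<circ>\<^sub>B H), C) \<in> Ar Bsys"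
  using assms pre_bhom_bres[OF _ pre_bhom_comp[OF bsystemD(1)]] by auto

lemma Bsys_triple: "f \<in> Ar Bsys \<Longrightarrow> \<exists>B H A. f = (B, H, A) \<and> bsystem B \<and> bsystem A \<and> pre_bhom B A H \<and> bres B H = H"
  by (auto simp: Bsys_def)

lemma category_Bsys: "category Bsys"
  unfolding category_def
proof (intro conjI ballI impI)
  fix f assume "f \<in> Ar Bsys"
  then obtain B H A where f: "f = (B, H, A)" "bsystem B" "bsystem A" "pre_bhom B A H" "bres B H = H"
    using Bsys_triple by blast
  then show "Dom Bsys f \<in> Ob Bsys" "Cod Bsys f \<in> Ob Bsys"
    "Comp Bsys f (Idt Bsys (Dom Bsys f)) = f" "Comp Bsys (Idt Bsys (Cod Bsys f)) f = f"
    using bres_comp_left[OF f(4), of bid] by simp_all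
next
  fix B :: "'a bsystem" assume "B \<in> Ob Bsys"
  then show "Idt Bsys B \<in> Ar Bsys" "Dom Bsys (Idt Bsys B) = B" "Cod Bsys (Idt Bsys B) = B"
    using pre_bhom_bres[OF _ pre_bhom_bid] by simp_all
next
  fix f g :: "'a bmor" assume *: "f \<in> Ar Bsys" "g \<in> Ar Bsys" "Cod Bsys f = Dom Bsys g"
  then obtain B H A C K where "f = (B, H, A)" "g = (A, K, C)" using Bsys_triple[of f] Bsys_triple[of g] by auto
  with * show "Comp Bsys g f \<in> Ar Bsys" "Dom Bsys (Comp Bsys g f) = Dom Bsys f" "Cod Bsys (Comp Bsys g f) = Cod Bsys g"
    using Comp_Bsys[of B H A K C] by (simp_all del: Bsys_simps(2))
next
  fix f g h :: "'a bmor"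
  assume *: "f \<in> Ar Bsys" "g \<in> Ar Bsys" "h \<in> Ar Bsys" "Cod Bsys f = Dom Bsys g \<and> Cod Bsys g = Dom Bsys h"
  then obtain B H A C K M L where "f = (B, H, A)" "g = (A, K, C)" "h = (C, L, M)" "pre_bhom B A H" "pre_bhom A C K"
    using Bsys_triple[of f] Bsys_triple[of g] Bsys_triple[of h] by auto
  then show "Comp Bsys h (Comp Bsys g f) = Comp Bsys (Comp Bsys h g) f"
    using bres_comp_left[of B A H "L \<circ>\<^sub>B K"]
    by (simp add: bcomp_assoc)
qed

text \<open>Each equation for \<open>K\<close> is one for \<open>H\<close> conjugated by
  \<open>K\<close>, where the composites of \<open>H\<close> and \<open>K\<close> cancel at both
  ends. The values of \<open>inv_into\<close> off the carriers are harmless, as all conditions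
  quantify over carriers.\<close>

lemma pre_bhom_inverse:
  assumes B: "bsystem B" and A: "bsystem A" and H: "pre_bhom B A H"
    and bO: "\<And>n. bij_betw (hB H n) (Bo B n) (Bo A n)" and bT: "\<And>n. bij_betw (hT H n) (Bt B n) (Bt A n)"
  defines "K \<equiv> \<lparr>hB = \<lambda>n. inv_into (Bo B n) (hB H n), hT = \<lambda>n. inv_into (Bt B n) (hT H n)\<rparr>"
  shows "pre_bhom A B K" "beq B (K \<circ>\<^sub>B H) bid" "beq A (H \<circ>\<^sub>B K) bid"
proof -
  note fH = pre_bhomD(1)[OF H] and fr = bsystemD(1)[OF B] and frA = bsystemD(1)[OF A]
  show KH: "beq B (K \<circ>\<^sub>B H) bid" and HK: "beq A (H \<circ>\<^sub>B K) bid"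
    unfolding beq_def by (simp_all add: K_def bij_betw_inv_into_left[OF bO] bij_betw_inv_into_left[OF bT]
      bij_betw_inv_into_right[OF bO] bij_betw_inv_into_right[OF bT])
  have HK1: "hB H n (hB K n X) = X" if "X \<in> Bo A n" for n X using beqD(1)[OF HK that] by simp
  have HK2: "hT H n (hT K n x) = x" if "x \<in> Bt A n" for n x using beqD(2)[OF HK that] by simp
  have KH1: "hB K n (hB H n X) = X" if "X \<in> Bo B n" for n X using beqD(1)[OF KH that] by simp
  have KH2: "hT K n (hT H n x) = x" if "x \<in> Bt B n" for n x using beqD(2)[OF KH that] by simp
  have K1: "hB K n X \<in> Bo B n" if "X \<in> Bo A n" for n X
    using that bij_betwE[OF bij_betw_inv_into[OF bO]] by (auto simp: K_def)
  have K2: "hT K n x \<in> Bt B n" if "x \<in> Bt A n" for n x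
    using that bij_betwE[OF bij_betw_inv_into[OF bT]] by (auto simp: K_def)
  have ft: "ft B n (hB K (Suc n) X) = hB K n (ft A n X)" if "X \<in> Bo A (Suc n)" for n X
    using frame_homD(3)[OF fH K1[OF that]] HK1[OF that] KH1[OF is_bframe_ft[OF fr K1[OF that]]] by simp
  have bd: "bd B n (hT K n x) = hB K (Suc n) (bd A n x)" if "x \<in> Bt A n" for n x
    using frame_homD(4)[OF fH K2[OF that]] HK2[OF that] KH1[OF is_bframe_bd[OF fr K2[OF that]]] by simp
  have fK: "frame_hom A B K" using K1 K2 ft bd by (simp add: frame_hom_def)
  show "pre_bhom A B K"
    unfolding pre_bhom_def
  proof (intro conjI allI ballI)
    show "frame_hom A B K" by (rule fK)
  next
    fix n x assume x: "x \<in> Bt A n"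
    let ?x = "hT K n x"
    have x': "?x \<in> Bt B n" using K2[OF x] .
    let ?X = "bd A n x" and ?Y = "bd B n (hT K n x)"
    have fKs: "frame_hom (bslice A (Suc n) ?X) (bslice B (Suc n) ?Y) (bslice_hom (Suc n) K)"
      using frame_hom_bslice[OF frA fK] bd[OF x] by simp
    have fSK: "frame_hom (bslice A (Suc n) ?X) (bslice B n (ft B n ?Y)) (Sb B n ?x \<circ>\<^sub>B bslice_hom (Suc n) K)"
      using frame_hom_comp[OF fKs pre_bhomD(1)[OF bsystemD(2)[OF B x' refl refl]]] .
    have 1: "beq (bslice A (Suc n) ?X) (bslice_hom n K \<circ>\<^sub>B bslice_hom n H \<circ>\<^sub>B Sb B n ?x \<circ>\<^sub>B bslice_hom (Suc n) K)
       (bslice_hom n K \<circ>\<^sub>B Sb A n (hT H n ?x) \<circ>\<^sub>B bslice_hom (Suc n) H \<circ>\<^sub>B bslice_hom (Suc n) K)"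
      using beq_bcomp_right[OF beq_bcomp_left[OF fKs pre_bhomD(2)[OF H x' refl]]] by (simp add: bcomp_assoc)
    have 2: "beq (bslice A (Suc n) ?X) (bslice_hom n K \<circ>\<^sub>B bslice_hom n H \<circ>\<^sub>B Sb B n ?x \<circ>\<^sub>B bslice_hom (Suc n) K)
       (Sb B n ?x \<circ>\<^sub>B bslice_hom (Suc n) K)"
      using beq_bcomp_left[OF fSK beq_bslice_hom[OF KH]] by (simp add: bslice_hom_bcomp bcomp_assoc)
    have 3: "beq (bslice A (Suc n) ?X)
       (bslice_hom n K \<circ>\<^sub>B Sb A n (hT H n ?x) \<circ>\<^sub>B bslice_hom (Suc n) H \<circ>\<^sub>B bslice_hom (Suc n) K)
       (bslice_hom n K \<circ>\<^sub>B Sb A n x)"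
      using beq_bcomp_right[OF beq_bslice_hom[OF HK], of "Suc n" ?X "bslice_hom n K \<circ>\<^sub>B Sb A n x"] HK2[OF x]
      by (simp add: bslice_hom_bcomp bcomp_assoc)
    show "beq (bslice A (Suc n) ?X) (bslice_hom n K \<circ>\<^sub>B Sb A n x) (Sb B n ?x \<circ>\<^sub>B bslice_hom (Suc n) K)"
      using beq_trans[OF beq_sym[OF 3] beq_trans[OF beq_sym[OF 1] 2]] .
  next
    fix n X assume X: "X \<in> Bo A (Suc n)"
    let ?X = "hB K (Suc n) X" and ?S = "bslice A n (ft A n X)"
    have X': "?X \<in> Bo B (Suc n)" using K1[OF X] .
    have fKs: "frame_hom ?S (bslice B n (ft B n ?X)) (bslice_hom n K)"
      using frame_hom_bslice[OF frA fK] ft[OF X] by simp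
    have fWK: "frame_hom ?S (bslice B (Suc n) ?X) (Wb B n ?X \<circ>\<^sub>B bslice_hom n K)"
      using frame_hom_comp[OF fKs pre_bhomD(1)[OF bsystemD(3)[OF B X' refl]]] .
    have 1: "beq ?S (bslice_hom (Suc n) K \<circ>\<^sub>B bslice_hom (Suc n) H \<circ>\<^sub>B Wb B n ?X \<circ>\<^sub>B bslice_hom n K)
       (bslice_hom (Suc n) K \<circ>\<^sub>B Wb A n (hB H (Suc n) ?X) \<circ>\<^sub>B bslice_hom n H \<circ>\<^sub>B bslice_hom n K)"
      using beq_bcomp_right[OF beq_bcomp_left[OF fKs pre_bhomD(3)[OF H X' refl]]] by (simp add: bcomp_assoc)
    have 2: "beq ?S (bslice_hom (Suc n) K \<circ>\<^sub>B bslice_hom (Suc n) H \<circ>\<^sub>B Wb B n ?X \<circ>\<^sub>B bslice_hom n K)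
       (Wb B n ?X \<circ>\<^sub>B bslice_hom n K)"
      using beq_bcomp_left[OF fWK beq_bslice_hom[OF KH]] by (simp add: bslice_hom_bcomp bcomp_assoc)
    have 3: "beq ?S (bslice_hom (Suc n) K \<circ>\<^sub>B Wb A n (hB H (Suc n) ?X) \<circ>\<^sub>B bslice_hom n H \<circ>\<^sub>B bslice_hom n K)
       (bslice_hom (Suc n) K \<circ>\<^sub>B Wb A n X)"
      using beq_bcomp_right[OF beq_bslice_hom[OF HK], of n "ft A n X" "bslice_hom (Suc n) K \<circ>\<^sub>B Wb A n X"] HK1[OF X]
      by (simp add: bslice_hom_bcomp bcomp_assoc)
    show "beq ?S (bslice_hom (Suc n) K \<circ>\<^sub>B Wb A n X) (Wb B n ?X \<circ>\<^sub>B bslice_hom n K)"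
      using beq_trans[OF beq_sym[OF 3] beq_trans[OF beq_sym[OF 1] 2]] .
    show "hT K (Suc n) (dl A n X) = dl B n ?X"
      using pre_bhomD(4)[OF H X'] HK1[OF X] KH2[OF bsystemD(7)[OF B X']] by simp
  qed
qed

lemma iso_Bsys:
  assumes B: "bsystem B" and A: "bsystem A" and H: "pre_bhom B A H"
    and bO: "\<And>n. bij_betw (hB H n) (Bo B n) (Bo A n)" and bT: "\<And>n. bij_betw (hT H n) (Bt B n) (Bt A n)"
  shows "iso Bsys (B, bres B H, A)"
proof -
  define K where "K = \<lparr>hB = \<lambda>n. inv_into (Bo B n) (hB H n), hT = \<lambda>n. inv_into (Bt B n) (hT H n)\<rparr>"
  note K = pre_bhom_inverse[OF assms, folded K_def]
  note f = pre_bhom_bres[OF B H] and g = pre_bhom_bres[OF A K(1)]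
  have "Comp Bsys (A, bres A K, B) (B, bres B H, A) = Idt Bsys B"
    "Comp Bsys (B, bres B H, A) (A, bres A K, B) = Idt Bsys A"
    using K bres_comp_left[OF H, of K] bres_comp_left[OF K(1), of H] bres_comp_left[OF f, of K]
      bres_comp_left[OF g, of H] by (auto simp: bres_eq_iff intro: beq_trans)
  moreover have "(B, bres B H, A) \<in> Ar Bsys" "(A, bres A K, B) \<in> Ar Bsys"
    using f g A B by simp_all
  ultimately show ?thesis unfolding iso_def
    by (intro conjI bexI[of _ "(A, bres A K, B)"]) simp_all
qed

section \<open>Stratified categories\<close>

lemma categoryD:
  assumes "category C"
  shows "f \<in> Ar C \<Longrightarrow> Dom C f \<in> Ob C" "f \<in> Ar C \<Longrightarrow> Cod C f \<in> Ob C"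
    "X \<in> Ob C \<Longrightarrow> Idt C X \<in> Ar C" "X \<in> Ob C \<Longrightarrow> Dom C (Idt C X) = X" "X \<in> Ob C \<Longrightarrow> Cod C (Idt C X) = X"
    "\<lbrakk>f \<in> Ar C; g \<in> Ar C; Cod C f = Dom C g\<rbrakk> \<Longrightarrow> Comp C g f \<in> Ar C"
    "\<lbrakk>f \<in> Ar C; g \<in> Ar C; Cod C f = Dom C g\<rbrakk> \<Longrightarrow> Dom C (Comp C g f) = Dom C f"
    "\<lbrakk>f \<in> Ar C; g \<in> Ar C; Cod C f = Dom C g\<rbrakk> \<Longrightarrow> Cod C (Comp C g f) = Cod C g"
    "f \<in> Ar C \<Longrightarrow> Comp C f (Idt C (Dom C f)) = f" "f \<in> Ar C \<Longrightarrow> Comp C (Idt C (Cod C f)) f = f"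
    "\<lbrakk>f \<in> Ar C; g \<in> Ar C; h \<in> Ar C; Cod C f = Dom C g; Cod C g = Dom C h\<rbrakk>
      \<Longrightarrow> Comp C h (Comp C g f) = Comp C (Comp C h g) f"
  using assms unfolding category_def by blast+

lemma chain_snoc:
  assumes "category C"
  shows "chain C X (gs @ [f]) Y \<longleftrightarrow> f \<in> Ar C \<and> Dom C f = X \<and> chain C (Cod C f) gs Y"
  by (induction gs arbitrary: Y) (auto simp: categoryD[OF assms])

lemma chain_comp_arrow:
  assumes "category C"
  shows "chain C X fs Y \<Longrightarrow> chain_comp C fs Y \<in> Ar C \<and> Dom C (chain_comp C fs Y) = X \<and> Cod C (chain_comp C fs Y) = Y"
  by (induction fs arbitrary: Y) (auto simp: categoryD[OF assms])

lemma chain_comp_snoc: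
  assumes C: "category C"
  shows "\<lbrakk>chain C (Cod C f) gs Y; f \<in> Ar C\<rbrakk> \<Longrightarrow> chain_comp C (gs @ [f]) Y = Comp C (chain_comp C gs Y) f"
proof (induction gs arbitrary: Y)
  case Nil
  then show ?case using categoryD(9,10)[OF C] by auto
next
  case (Cons g gs)
  then show ?case
    using categoryD(11)[OF C, of f "chain_comp C gs (Dom C g)" g] chain_comp_arrow[OF C, of "Cod C f" gs "Dom C g"] by auto
qed

lemma chain_levels:
  assumes "chain C X fs Y" "\<And>f. f \<in> set fs \<Longrightarrow> L (Dom C f) = Suc (L (Cod C f))"
  shows "L X = L Y + length fs"
    and "i < length fs \<Longrightarrow> L (Dom C (fs ! i)) = L Y + i + 1 \<and> L (Cod C (fs ! i)) = L Y + i"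
proof -
  have "L X = L Y + length fs \<and> (\<forall>i<length fs. L (Dom C (fs ! i)) = L Y + i + 1 \<and> L (Cod C (fs ! i)) = L Y + i)"
    using assms
  proof (induction fs arbitrary: Y)
    case (Cons f fs)
    then show ?case by (auto simp: less_Suc_eq_0_disj)
  qed auto
  then show "L X = L Y + length fs"
    "i < length fs \<Longrightarrow> L (Dom C (fs ! i)) = L Y + i + 1 \<and> L (Cod C (fs ! i)) = L Y + i" by auto
qed

text \<open>Factorizations are produced by peeling off one arrow at the domain, by induction on the
  level of the domain. They are unique because an object is the domain of at most one arrow that
  lowers the level by one, so two chains of equal length agree entry by entry from the domain
  on.\<close>

lemma stratificationI:
  assumes C: "category C" and ext: "L \<in> extensional (Ob C)"
    and ge: "\<And>f. f \<in> Ar C \<Longrightarrow> L (Cod C f) \<le> L (Dom C f)"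
    and zero: "\<And>X. X \<in> Ob C \<Longrightarrow> L X = 0 \<longleftrightarrow> X = t"
    and eq: "\<And>f. \<lbrakk>f \<in> Ar C; L (Dom C f) = L (Cod C f)\<rbrakk> \<Longrightarrow> Dom C f = Cod C f \<and> f = Idt C (Dom C f)"
    and unique: "\<And>f g. \<lbrakk>f \<in> Ar C; g \<in> Ar C; Dom C f = Dom C g; L (Dom C f) = Suc (L (Cod C f));
      L (Dom C g) = Suc (L (Cod C g))\<rbrakk> \<Longrightarrow> f = g"
    and factor: "\<And>f. \<lbrakk>f \<in> Ar C; L (Cod C f) < L (Dom C f)\<rbrakk> \<Longrightarrow> \<exists>g\<in>Ar C. \<exists>h\<in>Ar C. Dom C g = Dom C f \<and>
      Cod C g = Dom C h \<and> f = Comp C h g \<and> L (Dom C g) = Suc (L (Cod C g))"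
  shows "stratification C t L"
proof -
  have ex: "\<exists>fs. chain C (Dom C f) fs (Cod C f) \<and> chain_comp C fs (Cod C f) = f \<and>
      (\<forall>g\<in>set fs. L (Dom C g) = Suc (L (Cod C g)))" if "f \<in> Ar C" for f
    using that
  proof (induction "L (Dom C f)" arbitrary: f rule: less_induct)
    case less
    show ?case
    proof (cases "L (Dom C f) = L (Cod C f)")
      case True
      then have "Dom C f = Cod C f" "f = Idt C (Dom C f)" using eq[OF less.prems] by auto
      then show ?thesis using categoryD(1)[OF C less.prems] by (intro exI[of _ "[]"]) auto
    next
      case False
      then have "L (Cod C f) < L (Dom C f)" using ge[OF less.prems] by simp
      then obtain g h where gh: "g \<in> Ar C" "h \<in> Ar C" "Dom C g = Dom C f" "Cod C g = Dom C h" "f = Comp C h g"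
        "L (Dom C g) = Suc (L (Cod C g))" using factor[OF less.prems] by blast
      then obtain fs where fs: "chain C (Dom C h) fs (Cod C h)" "chain_comp C fs (Cod C h) = h"
        "\<forall>g\<in>set fs. L (Dom C g) = Suc (L (Cod C g))"
        using less.hyps[OF _ gh(2)] by (metis lessI)
      have "Cod C f = Cod C h" using gh categoryD(8)[OF C] by simp
      \<comment> \<open>Chains are listed from the codomain, so the arrow out of the domain of
        \<open>f\<close> is appended at the end.\<close>
      then show ?thesis using fs gh chain_snoc[OF C, of "Dom C f" fs g "Cod C h"] chain_comp_snoc[OF C, of g fs "Cod C h"]
        by (intro exI[of _ "fs @ [g]"]) auto
    qed
  qed
  have un: "fs = gs" if "chain C X fs Y" "chain C X gs Y" "length fs = length gs"
    "\<forall>g\<in>set fs. L (Dom C g) = Suc (L (Cod C g))" "\<forall>g\<in>set gs. L (Dom C g) = Suc (L (Cod C g))" for X Y fs gs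
    using that
  proof (induction fs arbitrary: X gs rule: rev_induct)
    case (snoc f fs)
    then obtain g hs where gs: "gs = hs @ [g]" by (metis append_is_Nil_conv length_0_conv list.distinct(1) rev_exhaust)
    have "f = g" using snoc.prems unfolding gs chain_snoc[OF C] by (intro unique) auto
    then show ?case using snoc.IH[of "Cod C f" hs] snoc.prems unfolding gs chain_snoc[OF C] by simp
  qed simp
  have "\<exists>!fs. length fs = m + 1 \<and> chain C (Dom C f) fs (Cod C f) \<and> chain_comp C fs (Cod C f) = f \<and>
      (\<forall>i<m + 1. L (Dom C (fs ! i)) = n + i + 1 \<and> L (Cod C (fs ! i)) = n + i)"
    if f: "f \<in> Ar C" "L (Dom C f) = n + m + 1" "L (Cod C f) = n" for f n m
  proof -
    obtain fs where fs: "chain C (Dom C f) fs (Cod C f)" "chain_comp C fs (Cod C f) = f"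
      "\<forall>g\<in>set fs. L (Dom C g) = Suc (L (Cod C g))" using ex[OF f(1)] by blast
    have len: "length fs = m + 1" using chain_levels(1)[OF fs(1), of L] fs(3) f by auto
    show ?thesis
    proof (rule ex1I[of _ fs])
      show "length fs = m + 1 \<and> chain C (Dom C f) fs (Cod C f) \<and> chain_comp C fs (Cod C f) = f \<and>
        (\<forall>i<m + 1. L (Dom C (fs ! i)) = n + i + 1 \<and> L (Cod C (fs ! i)) = n + i)"
        using fs len chain_levels(2)[OF fs(1), of L] f by auto
    next
      fix gs assume gs: "length gs = m + 1 \<and> chain C (Dom C f) gs (Cod C f) \<and> chain_comp C gs (Cod C f) = f \<and>
        (\<forall>i<m + 1. L (Dom C (gs ! i)) = n + i + 1 \<and> L (Cod C (gs ! i)) = n + i)"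
      then have "\<forall>g\<in>set gs. L (Dom C g) = Suc (L (Cod C g))" by (auto simp: in_set_conv_nth)
      then show "gs = fs" using un[of "Dom C f" gs "Cod C f" fs] fs gs len by auto
    qed
  qed
  moreover have "L (Dom C f) = L (Cod C f) \<longleftrightarrow> Dom C f = Cod C f \<and> f = Idt C (Dom C f)" if "f \<in> Ar C" for f
    using eq[OF that] by metis
  ultimately show ?thesis unfolding stratification_def using ext ge zero by (intro conjI) simp_all
qed

section \<open>Thinness of stratified categories and uniqueness of the stratification\<close>

definition over :: "('o, 'm, 'z) cat_scheme \<Rightarrow> 'o \<Rightarrow> 'o \<Rightarrow> bool" where
  "over C X Y \<longleftrightarrow> (\<exists>f\<in>Ar C. Dom C f = X \<and> Cod C f = Y)"

text \<open>By \<open>thin\<close> a stratified category has at most one arrow between two objects,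
  so the description is determined whenever \<open>over C X Y\<close> holds, and arrows can be
  handled through their end points.\<close>

definition arrow :: "('o, 'm, 'z) cat_scheme \<Rightarrow> 'o \<Rightarrow> 'o \<Rightarrow> 'm" where
  "arrow C X Y = (THE f. f \<in> Ar C \<and> Dom C f = X \<and> Cod C f = Y)"

locale strat_cat =
  fixes C :: "('o, 'm, 'z) cat_scheme" and t :: 'o and L :: "'o \<Rightarrow> nat"
  assumes cat: "category C" and terminal_top: "terminal C t" and strat: "stratification C t L"
begin

lemma level_ge: "f \<in> Ar C \<Longrightarrow> L (Cod C f) \<le> L (Dom C f)"
  using strat by (simp add: stratification_def)

lemma level_zero: "X \<in> Ob C \<Longrightarrow> L X = 0 \<longleftrightarrow> X = t"
  using strat by (simp add: stratification_def)

lemma level_eq: "\<lbrakk>f \<in> Ar C; L (Dom C f) = L (Cod C f)\<rbrakk> \<Longrightarrow> Dom C f = Cod C f \<and> f = Idt C (Dom C f)"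
  using strat unfolding stratification_def by metis

lemma top: "t \<in> Ob C" "X \<in> Ob C \<Longrightarrow> \<exists>!f. f \<in> Ar C \<and> Dom C f = X \<and> Cod C f = t"
  using terminal_top by (auto simp: terminal_def)

lemma level_top: "L t = 0" using level_zero top by blast

lemma graded_factorization:
  assumes "f \<in> Ar C" "L (Cod C f) < L (Dom C f)"
  shows "\<exists>!fs. chain C (Dom C f) fs (Cod C f) \<and> chain_comp C fs (Cod C f) = f \<and> (\<forall>g\<in>set fs. L (Dom C g) = Suc (L (Cod C g)))"
proof -
  \<comment> \<open>The axiom speaks of a drop by \<open>m + 1\<close>, hence the subtraction of
    one; it is exact because the level drops strictly.\<close>
  define n m where "n = L (Cod C f)" and "m = L (Dom C f) - L (Cod C f) - 1"
  have m: "L (Dom C f) = n + m + 1" "L (Cod C f) = n" using assms unfolding n_def m_def by auto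
  have "(length fs = m + 1 \<and> chain C (Dom C f) fs (Cod C f) \<and> chain_comp C fs (Cod C f) = f \<and>
        (\<forall>i<m + 1. L (Dom C (fs ! i)) = n + i + 1 \<and> L (Cod C (fs ! i)) = n + i)) \<longleftrightarrow>
    (chain C (Dom C f) fs (Cod C f) \<and> chain_comp C fs (Cod C f) = f \<and> (\<forall>g\<in>set fs. L (Dom C g) = Suc (L (Cod C g))))"
    (is "?l \<longleftrightarrow> ?r") for fs
  proof
    assume ?l then show ?r by (auto simp: in_set_conv_nth)
  next
    assume ?r then show ?l using chain_levels[of C "Dom C f" fs "Cod C f" L] m by auto
  qed
  moreover have "\<exists>!fs. length fs = m + 1 \<and> chain C (Dom C f) fs (Cod C f) \<and> chain_comp C fs (Cod C f) = f \<and>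
        (\<forall>i<m + 1. L (Dom C (fs ! i)) = n + i + 1 \<and> L (Cod C (fs ! i)) = n + i)"
    using strat[unfolded stratification_def, THEN conjunct2, THEN conjunct2, THEN conjunct2, THEN conjunct2, rule_format, OF assms(1), of n m] m by simp
  ultimately show ?thesis by simp
qed

lemma factor:
  assumes "f \<in> Ar C" "L (Cod C f) < L (Dom C f)"
  shows "\<exists>g\<in>Ar C. \<exists>h\<in>Ar C. Dom C g = Dom C f \<and> Cod C g = Dom C h \<and> Cod C h = Cod C f \<and> f = Comp C h g
    \<and> L (Dom C g) = Suc (L (Cod C g))"
proof -
  obtain fs where fs: "chain C (Dom C f) fs (Cod C f)" "chain_comp C fs (Cod C f) = f"
    "\<forall>g\<in>set fs. L (Dom C g) = Suc (L (Cod C g))" using graded_factorization[OF assms] by blast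
  have "fs \<noteq> []" using fs(1) assms(2) by auto
  then obtain gs g where gs: "fs = gs @ [g]" by (metis rev_exhaust)
  have g: "g \<in> Ar C" "Dom C g = Dom C f" "chain C (Cod C g) gs (Cod C f)"
    using fs(1) unfolding gs chain_snoc[OF cat] by auto
  note h = chain_comp_arrow[OF cat g(3)]
  have "f = Comp C (chain_comp C gs (Cod C f)) g" using fs(2) chain_comp_snoc[OF cat g(3,1)] gs by simp
  then show ?thesis using g h fs(3) gs by (intro bexI[of _ g] bexI[of _ "chain_comp C gs (Cod C f)"]) auto
qed

text \<open>The arrow to the terminal object is unique. Continuing \<open>f\<close> and
  \<open>g\<close> by graded factorizations from their codomains down to \<open>t\<close> gives two
  graded factorizations of that one arrow; these coincide, and \<open>f\<close> and \<open>g\<close>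
  are their last entries.\<close>

lemma indec_unique:
  assumes fg: "f \<in> Ar C" "g \<in> Ar C" "Dom C f = Dom C g"
    and l: "L (Dom C f) = Suc (L (Cod C f))" "L (Dom C g) = Suc (L (Cod C g))"
  shows "f = g"
proof -
  have ch: "\<exists>fs. chain C Z fs t \<and> (\<forall>g\<in>set fs. L (Dom C g) = Suc (L (Cod C g)))" if Z: "Z \<in> Ob C" for Z
  proof (cases "L Z = 0")
    case True
    then show ?thesis using level_zero[OF Z] top by (intro exI[of _ "[]"]) simp
  next
    case False
    obtain h where h: "h \<in> Ar C" "Dom C h = Z" "Cod C h = t" using top(2)[OF Z] by blast
    then show ?thesis using graded_factorization[of h] False level_top by auto
  qed
  obtain fs gs where fs: "chain C (Cod C f) fs t" "\<forall>g\<in>set fs. L (Dom C g) = Suc (L (Cod C g))"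
    and gs: "chain C (Cod C g) gs t" "\<forall>g\<in>set gs. L (Dom C g) = Suc (L (Cod C g))"
    using ch categoryD(2)[OF cat] fg by metis
  let ?X = "Dom C f"
  obtain h where h: "h \<in> Ar C" "Dom C h = ?X" "Cod C h = t" using top(2)[OF categoryD(1)[OF cat fg(1)]] by blast
  have F: "chain C ?X (fs @ [f]) t" "chain C ?X (gs @ [g]) t" using fs gs fg chain_snoc[OF cat] by auto
  have grad: "\<forall>g\<in>set (fs @ [f]). L (Dom C g) = Suc (L (Cod C g))" "\<forall>f\<in>set (gs @ [g]). L (Dom C f) = Suc (L (Cod C f))"
    using fs(2) gs(2) l by auto
  then have "chain_comp C (fs @ [f]) t = h" "chain_comp C (gs @ [g]) t = h"
    using chain_comp_arrow[OF cat F(1)] chain_comp_arrow[OF cat F(2)] h top(2)[OF categoryD(1)[OF cat fg(1)]] by metis+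
  moreover have "\<exists>!fs. chain C ?X fs t \<and> chain_comp C fs t = h \<and> (\<forall>g\<in>set fs. L (Dom C g) = Suc (L (Cod C g)))"
    using graded_factorization[OF h(1)] h l level_top by simp
  ultimately have "fs @ [f] = gs @ [g]" using F grad by (metis (no_types))
  then show ?thesis by simp
qed

text \<open>Induction on the level of the domain. An arrow between equal levels is an identity;
  otherwise both arrows begin with the same indecomposable arrow, and what remains is a parallel
  pair with domain of lower level.\<close>

lemma thin:
  assumes "f \<in> Ar C" "g \<in> Ar C" "Dom C f = Dom C g" "Cod C f = Cod C g"
  shows "f = g"
  using assms
proof (induction "L (Dom C f)" arbitrary: f g rule: less_induct)
  case less
  show ?case
  proof (cases "L (Dom C f) = L (Cod C f)")
    case True
    then show ?thesis using level_eq less.prems by metis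
  next
    case False
    then have l: "L (Cod C f) < L (Dom C f)" using level_ge[OF less.prems(1)] by simp
    obtain g1 h1 where 1: "g1 \<in> Ar C" "h1 \<in> Ar C" "Dom C g1 = Dom C f" "Cod C g1 = Dom C h1" "Cod C h1 = Cod C f"
      "f = Comp C h1 g1" "L (Dom C g1) = Suc (L (Cod C g1))" using factor[OF less.prems(1) l] by blast
    obtain g2 h2 where 2: "g2 \<in> Ar C" "h2 \<in> Ar C" "Dom C g2 = Dom C g" "Cod C g2 = Dom C h2" "Cod C h2 = Cod C g"
      "g = Comp C h2 g2" "L (Dom C g2) = Suc (L (Cod C g2))"
      using factor[OF less.prems(2)] l less.prems(3,4) by auto
    have g: "g1 = g2" using indec_unique[OF 1(1) 2(1)] 1 2 less.prems by simp
    have "L (Dom C h1) < L (Dom C f)" using 1(3,4,7) by simp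
    moreover have "Dom C h1 = Dom C h2" "Cod C h1 = Cod C h2" using 1(4,5) 2(4,5) g less.prems(4) by simp_all
    ultimately have "h1 = h2" by (rule less.hyps[OF _ 1(2) 2(2)])
    then show ?thesis using 1 2 g by simp
  qed
qed

text \<open>An arrow that lowers \<open>L\<close> by one is no identity, so it lowers
  \<open>L'\<close> as well. The descent from \<open>X\<close> to the terminal object thus gives
  \<open>L X\<close> strict drops of \<open>L'\<close>. Exchanging the two stratifications yields
  equality.\<close>

lemma level_le_any:
  assumes L': "stratification C t L'" and X: "X \<in> Ob C"
  shows "L X \<le> L' X"
  using X
proof (induction "L X" arbitrary: X)
  case (Suc n)
  interpret S: strat_cat C t L' using cat terminal_top L' by unfold_locales
  obtain f where f: "f \<in> Ar C" "Dom C f = X" "Cod C f = t" using top(2)[OF Suc.prems] by blast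
  have "L (Cod C f) < L (Dom C f)" using f level_top Suc.hyps(2) by simp
  from factor[OF f(1) this] f(2) obtain g where g: "g \<in> Ar C" "Dom C g = X" "L (Dom C g) = Suc (L (Cod C g))"
    by metis
  have "n \<le> L' (Cod C g)" using Suc.hyps(1)[of "Cod C g"] g Suc.hyps(2) categoryD(2)[OF cat g(1)] by simp
  moreover have "L' (Cod C g) \<noteq> L' X" using S.level_eq[OF g(1)] g by auto
  ultimately show ?case using S.level_ge[OF g(1)] g Suc.hyps(2) by simp
qed simp

lemma overD: "over C X Y \<Longrightarrow> X \<in> Ob C" "over C X Y \<Longrightarrow> Y \<in> Ob C"
  using categoryD(1,2)[OF cat] by (auto simp: over_def)

lemma over_refl: "X \<in> Ob C \<Longrightarrow> over C X X"
  unfolding over_def using categoryD(3-5)[OF cat] by blast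

lemma over_trans: "over C X Y \<Longrightarrow> over C Y Z \<Longrightarrow> over C X Z"
  unfolding over_def using categoryD(6-8)[OF cat] by metis

lemma over_top: "X \<in> Ob C \<Longrightarrow> over C X t"
  unfolding over_def using top(2) by blast

lemma over_level: "over C X Y \<Longrightarrow> L Y \<le> L X"
  using level_ge by (auto simp: over_def)

lemma over_eq: "\<lbrakk>over C X Y; L X = L Y\<rbrakk> \<Longrightarrow> X = Y"
  using level_eq by (auto simp: over_def)

lemma arrow_eq: "\<lbrakk>f \<in> Ar C; Dom C f = X; Cod C f = Y\<rbrakk> \<Longrightarrow> arrow C X Y = f"
  unfolding arrow_def using thin by (intro the_equality) auto

lemma arrow:
  assumes "over C X Y"
  shows "arrow C X Y \<in> Ar C" "Dom C (arrow C X Y) = X" "Cod C (arrow C X Y) = Y"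
proof -
  obtain f where "f \<in> Ar C" "Dom C f = X" "Cod C f = Y" using assms over_def by metis
  then show "arrow C X Y \<in> Ar C" "Dom C (arrow C X Y) = X" "Cod C (arrow C X Y) = Y"
    using arrow_eq[of f X Y] by simp_all
qed

lemma arrow_comp: "\<lbrakk>over C X Y; over C Y Z\<rbrakk> \<Longrightarrow> Comp C (arrow C Y Z) (arrow C X Y) = arrow C X Z"
  by (rule sym, rule arrow_eq) (use arrow categoryD[OF cat] in auto)

lemma arrow_id: "X \<in> Ob C \<Longrightarrow> arrow C X X = Idt C X"
  by (rule arrow_eq) (use categoryD[OF cat] in auto)

lemma indec:
  assumes "X \<in> Ob C" "L X = Suc n"
  shows "indec C L X \<in> Ar C" "Dom C (indec C L X) = X" "L (Cod C (indec C L X)) = n"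
proof -
  obtain f where f: "f \<in> Ar C" "Dom C f = X" "Cod C f = t" using top(2)[OF assms(1)] by blast
  obtain g where g: "g \<in> Ar C" "Dom C g = X" "L X = L (Cod C g) + 1"
    using factor[OF f(1)] f level_top assms by auto
  have "indec C L X = g" unfolding indec_def
    by (rule the_equality) (use g indec_unique in auto)
  then show "indec C L X \<in> Ar C" "Dom C (indec C L X) = X" "L (Cod C (indec C L X)) = n" using g assms by auto
qed

lemma over_indec: "\<lbrakk>X \<in> Ob C; L X = Suc n\<rbrakk> \<Longrightarrow> over C X (Cod C (indec C L X))"
  unfolding over_def using indec by blast

lemma indec_eq: "\<lbrakk>over C X Y; L X = Suc (L Y)\<rbrakk> \<Longrightarrow> indec C L X = arrow C X Y"
  using arrow[of X Y] overD[of X Y] indec[of X "L Y"] by (intro indec_unique) auto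

lemma indec_cod_over:
  assumes "over C X Y" "L Y < L X"
  shows "over C (Cod C (indec C L X)) Y"
proof -
  obtain f where f: "f \<in> Ar C" "Dom C f = X" "Cod C f = Y" using assms over_def by metis
  then obtain g h where 1: "g \<in> Ar C" "h \<in> Ar C" "Dom C g = X" "Cod C g = Dom C h" "Cod C h = Y"
    "L (Dom C g) = Suc (L (Cod C g))" using factor[OF f(1)] assms by auto
  have "indec C L X = g" using indec[OF overD(1)[OF assms(1)], of "L (Cod C g)"] 1 by (intro indec_unique) auto
  then show ?thesis unfolding over_def using 1 by auto
qed

end

text \<open>The description in \<open>level\<close> is determined: two stratifications bound each
  other on objects by \<open>level_le_any\<close>, and \<open>extensional\<close> fixes the values
  elsewhere.\<close>

lemma level_stratification:
  assumes "category E" "terminal E (Top E)" "stratification E (Top E) L"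
  shows "level E = L"
  unfolding level_def
proof (rule the_equality)
  fix L' assume L': "stratification E (Top E) L'"
  interpret S: strat_cat E "Top E" L using assms by unfold_locales
  interpret S': strat_cat E "Top E" L' using assms L' by unfold_locales
  show "L' = L"
  proof (rule extensionalityI)
    show "L' \<in> extensional (Ob E)" "L \<in> extensional (Ob E)" using L' assms by (auto simp: stratification_def)
  next
    fix X assume X: "X \<in> Ob E"
    show "L' X = L X" using S.level_le_any[OF L' X] S'.level_le_any[OF assms(3) X] by simp
  qed
qed (rule assms)

section \<open>Functors with term structure and E-homomorphisms\<close>

lemma tcomp_simps [simp]:
  "onO (G \<circ>\<^sub>T F) X = onO G (onO F X)" "onA (G \<circ>\<^sub>T F) f = onA G (onA F f)"
  "onT (G \<circ>\<^sub>T F) f t = onT G (onA F f) (onT F f t)"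
  by (simp_all add: tcomp_def)

lemma tid_simps [simp]: "onO tid X = X" "onA tid f = f" "onT tid f t = t"
  by (simp_all add: tid_def)

lemma slice_simps [simp]:
  "Ob (slice C X) = {A \<in> Ar C. Cod C A = X}"
  "(f, A) \<in> Ar (slice C X) \<longleftrightarrow> A \<in> Ar C \<and> Cod C A = X \<and> f \<in> Ar C \<and> Cod C f = Dom C A"
  "Dom (slice C X) (f, A) = Comp C A f" "Cod (slice C X) (f, A) = A"
  "Idt (slice C X) A = (Idt C (Dom C A), A)" "Comp (slice C X) (g, B) (f, A) = (Comp C g f, B)"
  "Tm (slice C X) (f, A) = Tm C f"
  by (simp_all add: slice_def)

lemma slice_functor_simps [simp]:
  "onO (slice_functor G) A = onA G A" "onA (slice_functor G) (f, A) = (onA G f, onA G A)"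
  "onT (slice_functor G) (f, A) = onT G f"
  by (simp_all add: slice_functor_def)

lemma eslice_simps [simp]:
  "Ob (eslice E X) = {A \<in> Ar E. Cod E A = X}"
  "(f, A) \<in> Ar (eslice E X) \<longleftrightarrow> A \<in> Ar E \<and> Cod E A = X \<and> f \<in> Ar E \<and> Cod E f = Dom E A"
  "Dom (eslice E X) (f, A) = Comp E A f" "Cod (eslice E X) (f, A) = A"
  "Idt (eslice E X) A = (Idt E (Dom E A), A)" "Comp (eslice E X) (g, B) (f, A) = (Comp E g f, B)"
  "Tm (eslice E X) (f, A) = Tm E f"
  "Top (eslice E X) = Idt E X"
  "Sub (eslice E X) (a, A) = (\<lambda>x. nest E A \<circ>\<^sub>T Sub E a x \<circ>\<^sub>T unnest)"
  "Wk (eslice E X) (a, A) = nest E (Comp E A a) \<circ>\<^sub>T Wk E a \<circ>\<^sub>T unnest"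
  "idtm (eslice E X) (a, A) = idtm E a"
  by (simp_all add: eslice_def slice_def tcat.extend_def esys.fields_def)

lemma eslice_eqs:
  "Ob (eslice E X) = Ob (slice E X)" "Ar (eslice E X) = Ar (slice E X)" "Dom (eslice E X) = Dom (slice E X)"
  "Cod (eslice E X) = Cod (slice E X)" "Idt (eslice E X) = Idt (slice E X)" "Comp (eslice E X) = Comp (slice E X)"
  "Tm (eslice E X) = Tm (slice E X)"
  by (simp_all add: eslice_def slice_def tcat.extend_def esys.fields_def)

lemma is_tfunctor_eslice: "is_tfunctor (eslice E X) (eslice D Y) F = is_tfunctor (slice E X) (slice D Y) F"
  unfolding is_tfunctor_def is_functor_def eslice_eqs ..

lemma nest_simps [simp]:
  "onO (nest C A) p = (p, A)" "onA (nest C A) (f, p) = ((f, Comp C A p), (p, A))" "onT (nest C A) g t = t"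
  by (simp_all add: nest_def)

lemma unnest_simps [simp]:
  "onO unnest (p, A) = p" "onA unnest ((f, B), (p, A)) = (f, p)" "onT unnest g t = t"
  by (simp_all add: unnest_def)

lemma tcomp_assoc: "(L \<circ>\<^sub>T K) \<circ>\<^sub>T H = L \<circ>\<^sub>T K \<circ>\<^sub>T H"
  by (simp add: tcomp_def)

lemma tcomp_tid [simp]: "F \<circ>\<^sub>T tid = F" "tid \<circ>\<^sub>T F = F"
  by (simp_all add: tcomp_def tid_def)

lemma slice_functor_tcomp: "slice_functor (G \<circ>\<^sub>T F) = slice_functor G \<circ>\<^sub>T slice_functor F"
  by (simp add: slice_functor_def tcomp_def fun_eq_iff)

lemma is_functorD:
  assumes "is_functor C D F"
  shows "X \<in> Ob C \<Longrightarrow> onO F X \<in> Ob D" "f \<in> Ar C \<Longrightarrow> onA F f \<in> Ar D"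
    "f \<in> Ar C \<Longrightarrow> Dom D (onA F f) = onO F (Dom C f)" "f \<in> Ar C \<Longrightarrow> Cod D (onA F f) = onO F (Cod C f)"
    "X \<in> Ob C \<Longrightarrow> onA F (Idt C X) = Idt D (onO F X)"
    "\<lbrakk>f \<in> Ar C; g \<in> Ar C; Cod C f = Dom C g\<rbrakk> \<Longrightarrow> onA F (Comp C g f) = Comp D (onA F g) (onA F f)"
  using assms by (simp_all add: is_functor_def)

lemma is_tfunctorD:
  assumes "is_tfunctor C D F"
  shows "is_functor C D F" "\<lbrakk>f \<in> Ar C; t \<in> Tm C f\<rbrakk> \<Longrightarrow> onT F f t \<in> Tm D (onA F f)"
  using assms by (simp_all add: is_tfunctor_def)

lemma is_functor_comp: "\<lbrakk>is_functor C D F; is_functor D E G\<rbrakk> \<Longrightarrow> is_functor C E (G \<circ>\<^sub>T F)"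
  unfolding is_functor_def tcomp_simps by metis

lemma is_tfunctor_comp: "\<lbrakk>is_tfunctor C D F; is_tfunctor D E G\<rbrakk> \<Longrightarrow> is_tfunctor C E (G \<circ>\<^sub>T F)"
  unfolding is_tfunctor_def using is_functor_comp by (auto simp: is_functor_def)

lemma is_tfunctor_slice:
  assumes C: "category C" and F: "is_tfunctor C D F" and Y: "Y = onO F X"
  shows "is_tfunctor (slice C X) (slice D Y) (slice_functor F)"
  unfolding is_tfunctor_def is_functor_def Y
  using is_functorD[OF is_tfunctorD(1)[OF F]] is_tfunctorD(2)[OF F] categoryD[OF C] by auto

lemma teq_tcomp_left: "\<lbrakk>is_tfunctor C D K; teq D F G\<rbrakk> \<Longrightarrow> teq C (F \<circ>\<^sub>T K) (G \<circ>\<^sub>T K)"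
  by (simp add: teq_def is_tfunctor_def is_functor_def)

lemma teq_tcomp_right: "teq C F G \<Longrightarrow> teq C (K \<circ>\<^sub>T F) (K \<circ>\<^sub>T G)"
  by (simp add: teq_def)

lemma teq_sym: "teq C F G \<Longrightarrow> teq C G F"
  by (simp add: teq_def)

lemma teq_trans: "\<lbrakk>teq C F G; teq C G H\<rbrakk> \<Longrightarrow> teq C F H"
  by (simp add: teq_def)

lemma pre_ehomD:
  assumes "pre_ehom E D H"
  shows "is_tfunctor E D H" "onO H (Top E) = Top D"
    "\<lbrakk>A \<in> Ar E; x \<in> Tm E A; X = Dom E A\<rbrakk> \<Longrightarrow> teq (slice E X)
        (slice_functor H \<circ>\<^sub>T Sub E A x) (Sub D (onA H A) (onT H A x) \<circ>\<^sub>T slice_functor H)"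
    "\<lbrakk>A \<in> Ar E; X = Cod E A\<rbrakk> \<Longrightarrow> teq (slice E X)
        (slice_functor H \<circ>\<^sub>T Wk E A) (Wk D (onA H A) \<circ>\<^sub>T slice_functor H)"
    "A \<in> Ar E \<Longrightarrow> onT H (onO (Wk E A) A) (idtm E A) = idtm D (onA H A)"
  using assms by (simp_all add: pre_ehom_def)

lemma pre_ehom_tid: "pre_ehom E E tid"
proof -
  have [simp]: "slice_functor tid = tid" by (simp add: slice_functor_def tid_def fun_eq_iff)
  show ?thesis by (simp add: pre_ehom_def is_tfunctor_def is_functor_def teq_def)
qed

lemma pre_ehom_comp:
  assumes E: "category E" and F: "pre_ehom E D F" and G: "pre_ehom D C G"
  shows "pre_ehom E C (G \<circ>\<^sub>T F)"
  unfolding pre_ehom_def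
proof (intro conjI ballI)
  note tF = pre_ehomD(1)[OF F] and tG = pre_ehomD(1)[OF G]
  note fF = is_functorD[OF is_tfunctorD(1)[OF tF]]
  show "is_tfunctor E C (G \<circ>\<^sub>T F)" using is_tfunctor_comp[OF tF tG] .
  show "onO (G \<circ>\<^sub>T F) (Top E) = Top C" using pre_ehomD(2)[OF F] pre_ehomD(2)[OF G] by simp
  fix A assume A: "A \<in> Ar E"
  have FA: "onA F A \<in> Ar D" using fF(2)[OF A] .
  {
    fix x assume x: "x \<in> Tm E A"
    have Fx: "onT F A x \<in> Tm D (onA F A)" using is_tfunctorD(2)[OF tF A x] .
    have 1: "teq (slice E (Dom E A)) (slice_functor G \<circ>\<^sub>T slice_functor F \<circ>\<^sub>T Sub E A x)
      (slice_functor G \<circ>\<^sub>T Sub D (onA F A) (onT F A x) \<circ>\<^sub>T slice_functor F)"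
      by (rule teq_tcomp_right[OF pre_ehomD(3)[OF F A x refl]])
    have 2: "teq (slice E (Dom E A)) ((slice_functor G \<circ>\<^sub>T Sub D (onA F A) (onT F A x)) \<circ>\<^sub>T slice_functor F)
      ((Sub C (onA G (onA F A)) (onT G (onA F A) (onT F A x)) \<circ>\<^sub>T slice_functor G) \<circ>\<^sub>T slice_functor F)"
      using teq_tcomp_left[OF is_tfunctor_slice[OF E tF] pre_ehomD(3)[OF G FA Fx]] fF(3)[OF A] by simp
    show "teq (slice E (Dom E A)) (slice_functor (G \<circ>\<^sub>T F) \<circ>\<^sub>T Sub E A x)
      (Sub C (onA (G \<circ>\<^sub>T F) A) (onT (G \<circ>\<^sub>T F) A x) \<circ>\<^sub>T slice_functor (G \<circ>\<^sub>T F))"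
      using teq_trans[OF 1 2[unfolded tcomp_assoc]] by (simp add: slice_functor_tcomp tcomp_assoc)
  }
  have 1: "teq (slice E (Cod E A)) (slice_functor G \<circ>\<^sub>T slice_functor F \<circ>\<^sub>T Wk E A)
      (slice_functor G \<circ>\<^sub>T Wk D (onA F A) \<circ>\<^sub>T slice_functor F)"
    by (rule teq_tcomp_right[OF pre_ehomD(4)[OF F A refl]])
  have 2: "teq (slice E (Cod E A)) ((slice_functor G \<circ>\<^sub>T Wk D (onA F A)) \<circ>\<^sub>T slice_functor F)
      ((Wk C (onA G (onA F A)) \<circ>\<^sub>T slice_functor G) \<circ>\<^sub>T slice_functor F)"
    using teq_tcomp_left[OF is_tfunctor_slice[OF E tF] pre_ehomD(4)[OF G FA]] fF(4)[OF A] by simp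
  show "teq (slice E (Cod E A)) (slice_functor (G \<circ>\<^sub>T F) \<circ>\<^sub>T Wk E A)
      (Wk C (onA (G \<circ>\<^sub>T F) A) \<circ>\<^sub>T slice_functor (G \<circ>\<^sub>T F))"
    using teq_trans[OF 1 2[unfolded tcomp_assoc]] by (simp add: slice_functor_tcomp tcomp_assoc)
  have "onA F (onO (Wk E A) A) = onO (Wk D (onA F A)) (onA F A)"
    using pre_ehomD(4)[OF F A refl] A by (simp add: teq_def)
  then show "onT (G \<circ>\<^sub>T F) (onO (Wk E A) A) (idtm E A) = idtm C (onA (G \<circ>\<^sub>T F) A)"
    using pre_ehomD(5)[OF F A] pre_ehomD(5)[OF G FA] by simp
qed

section \<open>The E-system of a B-system\<close>

lemma vtx_inject [simp]: "vtx n X = vtx m Y \<longleftrightarrow> n = m \<and> X = Y"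
  by (simp add: vtx_def)

lemma arr_inject [simp]: "arr n X k = arr m Y l \<longleftrightarrow> n = m \<and> X = Y \<and> k = l"
  by (auto simp: arr_def)

lemma on_vtx_vtx [simp]: "on_vtx c (vtx n X) = c n X"
  by (simp add: vtx_def)

lemma on_arr_arr [simp]: "on_arr c (arr n X k) = c n X k"
  by (simp add: arr_def)

lemma B2E_hom_simps [simp]:
  "onO (B2E_hom H) (vtx n X) = vtx n (hB H n X)"
  "onA (B2E_hom H) (arr n X k) = arr n (hB H (n + k) X) k"
  "onT (B2E_hom H) (arr n X k) (Tup ts) = Tup (map (hT H n) ts)"
  by (simp_all add: B2E_hom_def)

lemma to_bslice_simps [simp]:
  "onO to_bslice (arr n Y m) = vtx m Y"
  "onA to_bslice (arr nm Y j, arr n Z m) = arr m Y j"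
  "onT to_bslice f t = t"
  by (simp_all add: to_bslice_def)

lemma from_bslice_simps [simp]:
  "onO (from_bslice B n) (vtx m Y) = arr n Y m"
  "onA (from_bslice B n) (arr m Y j) = (arr (n + m) Y j, arr n (ftm B (n + m) j Y) m)"
  "onT (from_bslice B n) f t = t"
  by (simp_all add: from_bslice_def)

lemma B2E_obj_simps [simp]:
  "Ob (B2E_obj B) = {vtx n X |n X. X \<in> Bo B n}"
  "vtx n X \<in> Ob (B2E_obj B) \<longleftrightarrow> X \<in> Bo B n"
  "arr n X k \<in> Ar (B2E_obj B) \<longleftrightarrow> X \<in> Bo B (n + k)"
  "Dom (B2E_obj B) (arr n X k) = vtx (n + k) X"
  "Cod (B2E_obj B) (arr n X k) = vtx n (ftm B n k X)"
  "Idt (B2E_obj B) (vtx n X) = arr n X 0"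
  "Comp (B2E_obj B) (arr n Y k) (arr nk X l) = arr n X (k + l)"
  "Tm (B2E_obj B) (arr n X k) = Tup ` terms B n k X"
  "Top (B2E_obj B) = vtx 0 (the_elem (Bo B 0))"
  "Sub (B2E_obj B) (arr n X k) (Tup ts) = from_bslice B n \<circ>\<^sub>T B2E_hom (sub_list B n ts) \<circ>\<^sub>T to_bslice"
  "Wk (B2E_obj B) (arr n X k) = from_bslice B (n + k) \<circ>\<^sub>T B2E_hom (wk_list B n k X) \<circ>\<^sub>T to_bslice"
  "idtm (B2E_obj B) (arr n X k) = Tup (id_list B n k X)"
  by (auto simp: B2E_obj_def)

declare B2E_obj_simps(1) [simp del]

lemma B2E_obj_ObE:
  assumes "v \<in> Ob (B2E_obj B)"
  obtains n X where "v = vtx n X" "X \<in> Bo B n"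
  using assms by (auto simp: B2E_obj_simps(1))

lemma B2E_obj_ArE:
  assumes "f \<in> Ar (B2E_obj B)"
  obtains n X k where "f = arr n X k" "X \<in> Bo B (n + k)"
  using assms by (auto simp: B2E_obj_def)

text \<open>An arrow of the slice is a composable pair, and the domain of the second arrow is forced
  to be the codomain of the first. So the domain \<open>Y\<close> and the two lengths are all the
  data, and equations between functors on the slice can be checked by evaluation.\<close>

lemma B2E_slice_ArE:
  assumes "f \<in> Ar (slice (B2E_obj B) (vtx n X))"
  obtains m j Y where "f = (arr (n + m) Y j, arr n (ftm B (n + m) j Y) m)" "Y \<in> Bo B (n + m + j)"
    "ftm B (n + m) j Y \<in> Bo B (n + m)" "ftm B n m (ftm B (n + m) j Y) = X"
proof -
  obtain a A where f: "f = (a, A)" "A \<in> Ar (B2E_obj B)" "Cod (B2E_obj B) A = vtx n X" "a \<in> Ar (B2E_obj B)"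
    "Cod (B2E_obj B) a = Dom (B2E_obj B) A" using assms by (cases f) auto
  obtain k Z m where A: "A = arr k Z m" "Z \<in> Bo B (k + m)" using B2E_obj_ArE[OF f(2)] .
  obtain k' Y j where a: "a = arr k' Y j" "Y \<in> Bo B (k' + j)" using B2E_obj_ArE[OF f(4)] .
  show ?thesis using that[of m Y j] f A a by auto
qed

lemma B2E_slice_ObE:
  assumes "A \<in> Ob (slice (B2E_obj B) (vtx n X))"
  obtains m Y where "A = arr n Y m" "Y \<in> Bo B (n + m)" "ftm B n m Y = X"
proof -
  have A': "A \<in> Ar (B2E_obj B)" "Cod (B2E_obj B) A = vtx n X" using assms by auto
  obtain k Z m where A: "A = arr k Z m" "Z \<in> Bo B (k + m)" using B2E_obj_ArE[OF A'(1)] .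
  show ?thesis using that[of Z m] A' A by auto
qed

text \<open>Functors between slices act on pairs of encoded arrows and on encoded tuples; on these
  normal forms the defining equations of the functors can be applied.\<close>

lemma teq_B2E_slice:
  assumes "\<And>m Y. \<lbrakk>Y \<in> Bo B (n + m); ftm B n m Y = X\<rbrakk> \<Longrightarrow> onO F (arr n Y m) = onO G (arr n Y m)"
    and "\<And>m j Y. \<lbrakk>Y \<in> Bo B (n + m + j); ftm B (n + m) j Y \<in> Bo B (n + m); ftm B n m (ftm B (n + m) j Y) = X\<rbrakk>
      \<Longrightarrow> onA F (arr (n + m) Y j, arr n (ftm B (n + m) j Y) m) = onA G (arr (n + m) Y j, arr n (ftm B (n + m) j Y) m)"
    and "\<And>m j Y ts. \<lbrakk>Y \<in> Bo B (n + m + j); ftm B (n + m) j Y \<in> Bo B (n + m); ftm B n m (ftm B (n + m) j Y) = X;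
        ts \<in> terms B (n + m) j Y\<rbrakk>
      \<Longrightarrow> onT F (arr (n + m) Y j, arr n (ftm B (n + m) j Y) m) (Tup ts)
        = onT G (arr (n + m) Y j, arr n (ftm B (n + m) j Y) m) (Tup ts)"
  shows "teq (slice (B2E_obj B) (vtx n X)) F G"
  unfolding teq_def
proof (intro conjI ballI)
  fix A assume "A \<in> Ob (slice (B2E_obj B) (vtx n X))"
  then show "onO F A = onO G A" using assms(1) by (elim B2E_slice_ObE) simp
next
  fix f assume "f \<in> Ar (slice (B2E_obj B) (vtx n X))"
  then show "onA F f = onA G f" using assms(2) by (elim B2E_slice_ArE) simp
next
  fix f t assume "f \<in> Ar (slice (B2E_obj B) (vtx n X))" "t \<in> Tm (slice (B2E_obj B) (vtx n X)) f"
  then show "onT F f t = onT G f t" using assms(3) by (elim B2E_slice_ArE) auto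
qed

lemma category_B2E_obj:
  assumes B: "is_bframe B"
  shows "category (B2E_obj B)"
  unfolding category_def
proof (intro conjI ballI impI)
  fix f assume "f \<in> Ar (B2E_obj B)"
  then show "Dom (B2E_obj B) f \<in> Ob (B2E_obj B)" "Cod (B2E_obj B) f \<in> Ob (B2E_obj B)"
    "Comp (B2E_obj B) f (Idt (B2E_obj B) (Dom (B2E_obj B) f)) = f"
    "Comp (B2E_obj B) (Idt (B2E_obj B) (Cod (B2E_obj B) f)) f = f"
    using is_bframe_ftm[OF B] by (auto elim!: B2E_obj_ArE)
next
  fix v assume "v \<in> Ob (B2E_obj B)"
  then show "Idt (B2E_obj B) v \<in> Ar (B2E_obj B)" "Dom (B2E_obj B) (Idt (B2E_obj B) v) = v"
    "Cod (B2E_obj B) (Idt (B2E_obj B) v) = v" by (auto elim!: B2E_obj_ObE)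
next
  fix f g assume "f \<in> Ar (B2E_obj B)" "g \<in> Ar (B2E_obj B)" "Cod (B2E_obj B) f = Dom (B2E_obj B) g"
  then show "Comp (B2E_obj B) g f \<in> Ar (B2E_obj B)" "Dom (B2E_obj B) (Comp (B2E_obj B) g f) = Dom (B2E_obj B) f"
    "Cod (B2E_obj B) (Comp (B2E_obj B) g f) = Cod (B2E_obj B) g"
    by (auto elim!: B2E_obj_ArE simp: add.assoc ftm_add)
next
  fix f g h assume "f \<in> Ar (B2E_obj B)" "g \<in> Ar (B2E_obj B)" "h \<in> Ar (B2E_obj B)"
  then show "Comp (B2E_obj B) h (Comp (B2E_obj B) g f) = Comp (B2E_obj B) (Comp (B2E_obj B) h g) f"
    by (auto elim!: B2E_obj_ArE simp: add.assoc)
qed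

lemma is_bframe_base:
  assumes "is_bframe B" shows "Bo B 0 = {the_elem (Bo B 0)}"
  using assms by (auto simp: is_bframe_def)

lemma terminal_B2E_obj:
  assumes B: "is_bframe B"
  shows "terminal (B2E_obj B) (Top (B2E_obj B))"
  unfolding terminal_def
proof (intro conjI ballI)
  note b = is_bframe_base[OF B]
  show "Top (B2E_obj B) \<in> Ob (B2E_obj B)" using b by auto
  fix v assume "v \<in> Ob (B2E_obj B)"
  then obtain n X where v: "v = vtx n X" "X \<in> Bo B n" by (rule B2E_obj_ObE)
  have "ftm B 0 n X = the_elem (Bo B 0)" using is_bframe_ftm[OF B, of X 0 n] v b by auto
  then show "\<exists>!f. f \<in> Ar (B2E_obj B) \<and> Dom (B2E_obj B) f = v \<and> Cod (B2E_obj B) f = Top (B2E_obj B)"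
    using v by (intro ex1I[of _ "arr 0 X n"]) (auto elim!: B2E_obj_ArE)
qed

text \<open>In the free category an arrow of length \<open>k\<close> lowers the level by
  \<open>k\<close>, and there is one arrow of length one out of a vertex of positive level. Cutting
  it off gives the factorization that \<open>stratificationI\<close> asks for.\<close>

lemma stratification_B2E_obj:
  assumes B: "is_bframe B"
  shows "stratification (B2E_obj B) (Top (B2E_obj B)) (restrict (on_vtx (\<lambda>n X. n)) (Ob (B2E_obj B)))"
proof -
  let ?E = "B2E_obj B"
  define L where "L = restrict (on_vtx (\<lambda>n X. n)) (Ob ?E)"
  have L: "L (vtx n X) = n" if "X \<in> Bo B n" for n X using that by (simp add: L_def)
  note fr = is_bframe_ftm[OF B] is_bframe_ftm[OF B, where m = 1, simplified]
  note C = category_B2E_obj[OF B]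
  have LD: "L (Dom ?E (arr n X k)) = n + k" "L (Cod ?E (arr n X k)) = n" if "X \<in> Bo B (n + k)" for n X k
    using that L fr by auto
  show ?thesis
    unfolding L_def[symmetric]
  proof (rule stratificationI[OF C])
    show "L \<in> extensional (Ob ?E)" by (simp add: L_def)
  next
    fix f assume "f \<in> Ar ?E"
    then show "L (Cod ?E f) \<le> L (Dom ?E f)" by (elim B2E_obj_ArE) (simp add: LD del: B2E_obj_simps)
  next
    fix v assume "v \<in> Ob ?E"
    then show "L v = 0 \<longleftrightarrow> v = Top ?E" using is_bframe_base[OF B] by (elim B2E_obj_ObE) (auto simp: L)
  next
    fix f assume "f \<in> Ar ?E" and l: "L (Dom ?E f) = L (Cod ?E f)"
    then obtain n X k where f: "f = arr n X k" "X \<in> Bo B (n + k)" by (elim B2E_obj_ArE)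
    then show "Dom ?E f = Cod ?E f \<and> f = Idt ?E (Dom ?E f)" using l LD[of X n k] by (auto simp del: B2E_obj_simps(4,5)) auto
  next
    fix f g assume fg: "f \<in> Ar ?E" "g \<in> Ar ?E" "Dom ?E f = Dom ?E g" and
      l: "L (Dom ?E f) = Suc (L (Cod ?E f))" "L (Dom ?E g) = Suc (L (Cod ?E g))"
    from fg obtain n X k m Y j where f: "f = arr n X k" "X \<in> Bo B (n + k)" "g = arr m Y j" "Y \<in> Bo B (m + j)"
      by (elim B2E_obj_ArE)
    then show "f = g" using l LD[of X n k] LD[of Y m j] fg by auto
  next
    fix f assume "f \<in> Ar ?E" and l: "L (Cod ?E f) < L (Dom ?E f)"
    then obtain n X k where f: "f = arr n X k" "X \<in> Bo B (n + k)" by (elim B2E_obj_ArE)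
    then obtain k' where k: "k = Suc k'" using l LD[of X n k] by (cases k) auto
    have "ft B (n + k') X \<in> Bo B (n + k')" using f k is_bframe_ft[OF B] by simp
    then show "\<exists>g\<in>Ar ?E. \<exists>h\<in>Ar ?E. Dom ?E g = Dom ?E f \<and> Cod ?E g = Dom ?E h \<and> f = Comp ?E h g \<and>
       L (Dom ?E g) = Suc (L (Cod ?E g))"
      using f k by (intro bexI[of _ "arr (n + k') X 1"] bexI[of _ "arr n (ft B (n + k') X) k'"]) (auto simp: L)
  qed
qed

lemma level_B2E_obj:
  assumes "is_bframe B" "X \<in> Bo B n"
  shows "level (B2E_obj B) (vtx n X) = n"
  using level_stratification[OF category_B2E_obj terminal_B2E_obj stratification_B2E_obj, OF assms(1) assms(1) assms(1)] assms by simp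

lemma terms_hom:
  assumes "bsystem B" "bsystem A" "pre_bhom B A H" "X \<in> Bo B (n + k)" "ts \<in> terms B n k X"
  shows "map (hT H n) ts \<in> terms A n k (hB H (n + k) X)"
  using hom_terms[OF assms] by simp

lemma is_tfunctor_B2E_hom:
  assumes B: "bsystem B" and A: "bsystem A" and H: "pre_bhom B A H"
  shows "is_tfunctor (B2E_obj B) (B2E_obj A) (B2E_hom H)"
proof -
  note fH = pre_bhomD(1)[OF H] and fr = bsystemD(1)[OF B]
  note s = frame_homD(1)[OF fH] frame_hom_ftm[OF fr fH]
  show ?thesis
    unfolding is_tfunctor_def is_functor_def
  proof (intro conjI ballI impI)
    fix v assume "v \<in> Ob (B2E_obj B)"
    then show "onO (B2E_hom H) v \<in> Ob (B2E_obj A)"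
      "onA (B2E_hom H) (Idt (B2E_obj B) v) = Idt (B2E_obj A) (onO (B2E_hom H) v)"
      by (auto elim!: B2E_obj_ObE simp: s)
  next
    fix f assume f: "f \<in> Ar (B2E_obj B)"
    then show "onA (B2E_hom H) f \<in> Ar (B2E_obj A)"
      "Dom (B2E_obj A) (onA (B2E_hom H) f) = onO (B2E_hom H) (Dom (B2E_obj B) f)"
      "Cod (B2E_obj A) (onA (B2E_hom H) f) = onO (B2E_hom H) (Cod (B2E_obj B) f)"
      by (auto elim!: B2E_obj_ArE simp: s)
    fix t assume "t \<in> Tm (B2E_obj B) f"
    then show "onT (B2E_hom H) f t \<in> Tm (B2E_obj A) (onA (B2E_hom H) f)"
      using f terms_hom[OF B A H] by (auto elim!: B2E_obj_ArE)
  next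
    fix f g assume "f \<in> Ar (B2E_obj B)" "g \<in> Ar (B2E_obj B)" "Cod (B2E_obj B) f = Dom (B2E_obj B) g"
    then show "onA (B2E_hom H) (Comp (B2E_obj B) g f) = Comp (B2E_obj A) (onA (B2E_hom H) g) (onA (B2E_hom H) f)"
      by (auto elim!: B2E_obj_ArE simp: s add.assoc)
  qed
qed

text \<open>By \<open>terms_bslice\<close> the tuple is also one of the slice over \<open>X\<close>,
  so its entries are elements on which \<open>H\<close> and \<open>K\<close> agree.\<close>

lemma beq_terms:
  assumes B: "bsystem B" and e: "beq (bslice B n X) H K"
    and Y: "Y \<in> Bo B (n + m + j)" "ftm B n m (ftm B (n + m) j Y) = X" and ts: "ts \<in> terms B (n + m) j Y"
  shows "map (hT H m) ts = map (hT K m) ts"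
proof -
  have "ts \<in> terms (bslice B n X) m j Y"
    using terms_bslice[OF B, of Y n m j X] Y ts by (simp add: add.assoc ftm_add)
  from set_terms[OF this] show ?thesis using beqD(2)[OF e] by (auto simp del: bslice_simps)
qed

lemma beq_slice_ob:
  assumes e: "beq (bslice B n X) H K" and Y: "Y \<in> Bo B (n + m)" "ftm B n m Y = X"
  shows "hB H m Y = hB K m Y"
  using beqD(1)[OF e] Y by simp

text \<open>The equations are known for tuples from \<open>hom_terms\<close>,
  \<open>hom_wk_list\<close> and \<open>hom_id_list\<close>. An arrow of a slice also records its
  codomain, whose image is found by commuting \<open>ftm\<close> with homomorphisms.\<close>

lemma pre_ehom_B2E_hom:
  assumes B: "bsystem B" and A: "bsystem A" and H: "pre_bhom B A H"
  shows "pre_ehom (B2E_obj B) (B2E_obj A) (B2E_hom H)"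
  unfolding pre_ehom_def
proof (intro conjI ballI)
  note fH = pre_bhomD(1)[OF H] and fr = bsystemD(1)[OF B] and frA = bsystemD(1)[OF A]
  note s = frame_homD(1)[OF fH] frame_hom_ftm[OF fr fH]
  show "is_tfunctor (B2E_obj B) (B2E_obj A) (B2E_hom H)" by (rule is_tfunctor_B2E_hom[OF assms])
  show "onO (B2E_hom H) (Top (B2E_obj B)) = Top (B2E_obj A)"
    using s(1)[of "the_elem (Bo B 0)" 0] is_bframe_base[OF fr] is_bframe_base[OF frA] by auto
  fix a assume a: "a \<in> Ar (B2E_obj B)"
  then obtain n X k where X: "a = arr n X k" "X \<in> Bo B (n + k)" by (rule B2E_obj_ArE)
  {
    fix t assume "t \<in> Tm (B2E_obj B) a"
    then obtain ts where t: "t = Tup ts" "ts \<in> terms B n k X" using X by auto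
    note e = conjunct2[OF hom_terms[OF assms X(2) t(2)]]
    note fs = pre_bhomD(1)[OF sub_list_hom[OF B X(2) t(2)]]
    have F: "hB (sub_list B n ts) m Y \<in> Bo B (n + m)" if "Y \<in> Bo B (n + k + m)" "ftm B (n + k) m Y = X" for Y m
      using frame_homD(1)[OF fs, of Y m] that by simp
    show "teq (slice (B2E_obj B) (Dom (B2E_obj B) a)) (slice_functor (B2E_hom H) \<circ>\<^sub>T Sub (B2E_obj B) a t)
      (Sub (B2E_obj A) (onA (B2E_hom H) a) (onT (B2E_hom H) a t) \<circ>\<^sub>T slice_functor (B2E_hom H))"
      unfolding X(1) t(1) B2E_obj_simps
    proof (rule teq_B2E_slice, goal_cases)
      case (1 m Y)
      then show ?case using beq_slice_ob[OF e 1] by simp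
    next
      case (2 m j Y)
      have Y: "Y \<in> Bo B (n + k + (m + j))" "ftm B (n + k) (m + j) Y = X" using 2 by (auto simp: add.assoc ftm_add)
      show ?case using beq_slice_ob[OF e Y] s(2)[of "hB (sub_list B n ts) (m + j) Y" "n + m" j] F[OF Y]
        by (simp add: add.assoc)
    next
      case (3 m j Y us)
      show ?case using beq_terms[OF B e 3(1,3,4)] by simp
    qed
  }
  note e = hom_wk_list[OF B H X(2)]
  note fs = pre_bhomD(1)[OF wk_list_hom[OF B X(2)]]
  have F: "hB (wk_list B n k X) m Y \<in> Bo B (n + k + m)" if "Y \<in> Bo B (n + m)" "ftm B n m Y = ftm B n k X" for Y m
    using frame_homD(1)[OF fs, of Y m] that by simp
  show "teq (slice (B2E_obj B) (Cod (B2E_obj B) a)) (slice_functor (B2E_hom H) \<circ>\<^sub>T Wk (B2E_obj B) a)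
    (Wk (B2E_obj A) (onA (B2E_hom H) a) \<circ>\<^sub>T slice_functor (B2E_hom H))"
    unfolding X(1) B2E_obj_simps
  proof (rule teq_B2E_slice, goal_cases)
    case (1 m Y)
    then show ?case using beq_slice_ob[OF e 1] by simp
  next
    case (2 m j Y)
    have Y: "Y \<in> Bo B (n + (m + j))" "ftm B n (m + j) Y = ftm B n k X" using 2 by (auto simp: add.assoc ftm_add)
    show ?case using beq_slice_ob[OF e Y] s(2)[of "hB (wk_list B n k X) (m + j) Y" "n + k + m" j] F[OF Y]
      by (simp add: add.assoc)
  next
    case (3 m j Y us)
    show ?case using beq_terms[OF B e 3(1,3,4)] by simp
  qed
  show "onT (B2E_hom H) (onO (Wk (B2E_obj B) a) a) (idtm (B2E_obj B) a) = idtm (B2E_obj A) (onA (B2E_hom H) a)"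
    using hom_id_list[OF B H X(2)] X(1) by simp
qed

section \<open>Comparison of the two encodings of a slice\<close>

lemma teq_B2E_eslice:
  assumes ob: "\<And>l V. \<lbrakk>V \<in> Bo B (n + m + l); ftm B (n + m) l V = Y\<rbrakk>
      \<Longrightarrow> onO F (arr (n + m) V l, arr n Y m) = onO G (arr (n + m) V l, arr n Y m)"
    and ar: "\<And>l j V Z. \<lbrakk>V \<in> Bo B (n + m + l + j); Z = ftm B (n + m + l) j V; Z \<in> Bo B (n + m + l); ftm B (n + m) l Z = Y\<rbrakk>
      \<Longrightarrow> onA F ((arr (n + m + l) V j, arr n Z (m + l)), (arr (n + m) Z l, arr n Y m))
        = onA G ((arr (n + m + l) V j, arr n Z (m + l)), (arr (n + m) Z l, arr n Y m))"
    and tm: "\<And>l j V Z ts. \<lbrakk>V \<in> Bo B (n + m + l + j); Z = ftm B (n + m + l) j V; Z \<in> Bo B (n + m + l); ftm B (n + m) l Z = Y;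
        ts \<in> terms B (n + m + l) j V\<rbrakk>
      \<Longrightarrow> onT F ((arr (n + m + l) V j, arr n Z (m + l)), (arr (n + m) Z l, arr n Y m)) (Tup ts)
        = onT G ((arr (n + m + l) V j, arr n Z (m + l)), (arr (n + m) Z l, arr n Y m)) (Tup ts)"
  shows "teq (slice (eslice (B2E_obj B) (vtx n X)) (arr n Y m)) F G"
proof -
  let ?E = "B2E_obj B" and ?S = "eslice (B2E_obj B) (vtx n X)"
  have obE: "\<exists>l V. P = (arr (n + m) V l, arr n Y m) \<and> V \<in> Bo B (n + m + l) \<and> ftm B (n + m) l V = Y"
    if P: "P \<in> Ob (slice ?S (arr n Y m))" for P
  proof -
    obtain p where P: "P = (p, arr n Y m)" "p \<in> Ar ?E" "Cod ?E p = vtx (n + m) Y" using P by (cases P) auto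
    obtain k V l where p: "p = arr k V l" "V \<in> Bo B (k + l)" using B2E_obj_ArE[OF P(2)] .
    then show ?thesis using P by auto
  qed
  have arE: "\<exists>l j V Z. f = ((arr (n + m + l) V j, arr n Z (m + l)), (arr (n + m) Z l, arr n Y m)) \<and>
      V \<in> Bo B (n + m + l + j) \<and> Z = ftm B (n + m + l) j V \<and> Z \<in> Bo B (n + m + l) \<and> ftm B (n + m) l Z = Y"
    if fA: "f \<in> Ar (slice ?S (arr n Y m))" for f
  proof -
    obtain g P where f: "f = (g, P)" "P \<in> Ar ?S" "Cod ?S P = arr n Y m" "g \<in> Ar ?S" "Cod ?S g = Dom ?S P"
      using fA by (cases f) (auto simp del: eslice_simps(2))
    from obE[of P] f(2,3) obtain l Z where P: "P = (arr (n + m) Z l, arr n Y m)" "Z \<in> Bo B (n + m + l)"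
      "ftm B (n + m) l Z = Y" by auto
    obtain h where g: "g = (h, arr n Z (m + l))" "h \<in> Ar ?E" "Cod ?E h = vtx (n + m + l) Z"
      using f(4,5) P by (cases g) (auto simp: add.assoc)
    obtain k V j where h: "h = arr k V j" "V \<in> Bo B (k + j)" using B2E_obj_ArE[OF g(2)] .
    then show ?thesis using f P g by (auto simp: add.assoc)
  qed
  show ?thesis
    unfolding teq_def
  proof (intro conjI ballI)
    fix P assume "P \<in> Ob (slice ?S (arr n Y m))"
    from obE[OF this] show "onO F P = onO G P" using ob by auto
  next
    fix f assume "f \<in> Ar (slice ?S (arr n Y m))"
    from arE[OF this] show "onA F f = onA G f" using ar by auto
  next
    fix f t assume "f \<in> Ar (slice ?S (arr n Y m))" "t \<in> Tm (slice ?S (arr n Y m)) f"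
    then show "onT F f t = onT G f t" using arE[of f] tm by auto
  qed
qed

lemma terms_bslice':
  assumes "bsystem B" "Y \<in> Bo B (n + m + j)" "ftm B n m (ftm B (n + m) j Y) = X"
  shows "terms (bslice B n X) m j Y = terms B (n + m) j Y"
  using terms_bslice[OF assms(1), of Y n m j X] assms by (simp add: add.assoc ftm_add)

text \<open>The slice category has arrows of \<open>B2E_obj B\<close> as objects, whereas the
  E-system of the slice of \<open>B\<close> has vertices; substitution and weakening are defined by
  passing between the two. These passages are themselves E-homomorphisms, so composing with them
  preserves E-homomorphisms.\<close>

lemma pre_ehom_to_bslice:
  assumes B: "bsystem B" and X: "X \<in> Bo B n"
  shows "pre_ehom (eslice (B2E_obj B) (vtx n X)) (B2E_obj (bslice B n X)) to_bslice"
proof -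
  let ?E = "eslice (B2E_obj B) (vtx n X)" and ?D = "B2E_obj (bslice B n X)"
  note fr = bsystemD(1)[OF B]
  note s = is_bframe_ftm[OF fr]
  have tf: "is_tfunctor ?E ?D to_bslice"
    unfolding is_tfunctor_def is_functor_def eslice_eqs
  proof (intro conjI ballI impI)
    fix A assume "A \<in> Ob (slice (B2E_obj B) (vtx n X))"
    then obtain m Y where "A = arr n Y m" "Y \<in> Bo B (n + m)" "ftm B n m Y = X" by (rule B2E_slice_ObE)
    then show "onO to_bslice A \<in> Ob ?D"
      "onA to_bslice (Idt (slice (B2E_obj B) (vtx n X)) A) = Idt ?D (onO to_bslice A)"
      by simp_all
  next
    fix f assume f: "f \<in> Ar (slice (B2E_obj B) (vtx n X))"
    then show "onA to_bslice f \<in> Ar ?D" "Dom ?D (onA to_bslice f) = onO to_bslice (Dom (slice (B2E_obj B) (vtx n X)) f)"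
      "Cod ?D (onA to_bslice f) = onO to_bslice (Cod (slice (B2E_obj B) (vtx n X)) f)"
      by (auto elim!: B2E_slice_ArE simp: ftm_add add.assoc)
    fix t assume "t \<in> Tm (slice (B2E_obj B) (vtx n X)) f"
    with f show "onT to_bslice f t \<in> Tm ?D (onA to_bslice f)"
      by (elim B2E_slice_ArE) (simp add: terms_bslice'[OF B])
  next
    fix f g assume f: "f \<in> Ar (slice (B2E_obj B) (vtx n X))" and g: "g \<in> Ar (slice (B2E_obj B) (vtx n X))"
      and e: "Cod (slice (B2E_obj B) (vtx n X)) f = Dom (slice (B2E_obj B) (vtx n X)) g"
    obtain m j Y where f': "f = (arr (n + m) Y j, arr n (ftm B (n + m) j Y) m)" using B2E_slice_ArE[OF f] by metis
    obtain m' j' Y' where g': "g = (arr (n + m') Y' j', arr n (ftm B (n + m') j' Y') m')" using B2E_slice_ArE[OF g] by metis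
    show "onA to_bslice (Comp (slice (B2E_obj B) (vtx n X)) g f) = Comp ?D (onA to_bslice g) (onA to_bslice f)"
      using f' g' e by (auto simp: add.assoc)
  qed
  show ?thesis
    unfolding pre_ehom_def
  proof (intro conjI ballI)
    show "is_tfunctor ?E ?D to_bslice" by (rule tf)
    \<comment> \<open>This evaluates the \<open>the_elem\<close> that defines the terminal vertex
      for the slice over \<open>X\<close>.\<close>
    have "{Y. Y \<in> Bo B n \<and> Y = X} = {X}" using X by auto
    then show "onO to_bslice (Top ?E) = Top ?D" by simp
    fix a assume "a \<in> Ar ?E"
    then have "a \<in> Ar (slice (B2E_obj B) (vtx n X))" by (simp add: eslice_eqs)
    then obtain m j Y Z where a: "a = (arr (n + m) Y j, arr n Z m)" "Z = ftm B (n + m) j Y" "Y \<in> Bo B (n + m + j)"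
      "Z \<in> Bo B (n + m)" "ftm B n m Z = X" by (elim B2E_slice_ArE) auto
    {
      fix t assume "t \<in> Tm ?E a"
      then obtain ts where t: "t = Tup ts" "ts \<in> terms B (n + m) j Y" using a by auto
      have "teq (slice ?E (arr n Y (m + j))) (slice_functor to_bslice \<circ>\<^sub>T Sub ?E a t)
        (Sub ?D (onA to_bslice a) (onT to_bslice a t) \<circ>\<^sub>T slice_functor to_bslice)"
        by (rule teq_B2E_eslice) (simp_all add: a(1) t(1) add.assoc)
      then show "teq (slice ?E (Dom ?E a)) (slice_functor to_bslice \<circ>\<^sub>T Sub ?E a t)
        (Sub ?D (onA to_bslice a) (onT to_bslice a t) \<circ>\<^sub>T slice_functor to_bslice)"
        using a(1) by simp
    }
    have "teq (slice ?E (arr n Z m)) (slice_functor to_bslice \<circ>\<^sub>T Wk ?E a)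
        (Wk ?D (onA to_bslice a) \<circ>\<^sub>T slice_functor to_bslice)"
      by (rule teq_B2E_eslice) (simp_all add: a(1) add.assoc)
    then show "teq (slice ?E (Cod ?E a)) (slice_functor to_bslice \<circ>\<^sub>T Wk ?E a)
        (Wk ?D (onA to_bslice a) \<circ>\<^sub>T slice_functor to_bslice)" using a(1) by simp
    show "onT to_bslice (onO (Wk ?E a) a) (idtm ?E a) = idtm ?D (onA to_bslice a)" using a(1) by simp
  qed
qed

text \<open>Unlike \<open>to_bslice\<close>, this functor computes the codomain of an arrow, by
  \<open>ftm\<close>. So the equations for arrows require that substitution and weakening keep the
  base (the facts \<open>F\<close>) and commute with \<open>ftm\<close> (the facts
  \<open>F2\<close>).\<close>

lemma pre_ehom_from_bslice:
  assumes B: "bsystem B" and X: "X \<in> Bo B n"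
  shows "pre_ehom (B2E_obj (bslice B n X)) (eslice (B2E_obj B) (vtx n X)) (from_bslice B n)"
proof -
  let ?S = "slice (B2E_obj B) (vtx n X)"
  let ?E = "eslice (B2E_obj B) (vtx n X)" and ?D = "B2E_obj (bslice B n X)"
  note fr = bsystemD(1)[OF B] and BS = bsystem_bslice[OF B X]
  note s = is_bframe_ftm[OF fr]
  have arE: "\<exists>m Y j. f = arr m Y j \<and> Y \<in> Bo B (n + m + j) \<and> ftm B (n + m) j Y \<in> Bo B (n + m) \<and> ftm B n m (ftm B (n + m) j Y) = X"
    if "f \<in> Ar ?D" for f using that s by (auto elim!: B2E_obj_ArE simp: add.assoc ftm_add)
  have tf: "is_tfunctor ?D ?E (from_bslice B n)"
    unfolding is_tfunctor_def is_functor_def eslice_eqs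
  proof (intro conjI ballI impI)
    fix A assume "A \<in> Ob ?D"
    then show "onO (from_bslice B n) A \<in> Ob ?S" "onA (from_bslice B n) (Idt ?D A) = Idt ?S (onO (from_bslice B n) A)"
      by (auto elim!: B2E_obj_ObE)
  next
    fix f assume f: "f \<in> Ar ?D"
    from arE[OF f] show "onA (from_bslice B n) f \<in> Ar ?S"
      "Dom ?S (onA (from_bslice B n) f) = onO (from_bslice B n) (Dom ?D f)"
      "Cod ?S (onA (from_bslice B n) f) = onO (from_bslice B n) (Cod ?D f)" by auto
    fix t assume "t \<in> Tm ?D f"
    with arE[OF f] show "onT (from_bslice B n) f t \<in> Tm ?S (onA (from_bslice B n) f)"
      by (auto simp: terms_bslice'[OF B])
  next
    fix f g assume f: "f \<in> Ar ?D" and g: "g \<in> Ar ?D" and e: "Cod ?D f = Dom ?D g"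
    obtain m j Y where f': "f = arr m Y j" using arE[OF f] by metis
    obtain m' j' Y' where g': "g = arr m' Y' j'" using arE[OF g] by metis
    show "onA (from_bslice B n) (Comp ?D g f) = Comp ?S (onA (from_bslice B n) g) (onA (from_bslice B n) f)"
      using f' g' e by (auto simp: add.assoc ftm_add)
  qed
  show ?thesis
    unfolding pre_ehom_def
  proof (intro conjI ballI)
    show "is_tfunctor ?D ?E (from_bslice B n)" by (rule tf)
    have "{Y. Y \<in> Bo B n \<and> Y = X} = {X}" using X by auto
    then show "onO (from_bslice B n) (Top ?D) = Top ?E" by simp
    fix a assume ar: "a \<in> Ar ?D"
    then obtain m j Y where a: "a = arr m Y j" "Y \<in> Bo B (n + m + j)" "ftm B (n + m) j Y \<in> Bo B (n + m)"
      "ftm B n m (ftm B (n + m) j Y) = X" using arE by metis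
    have Y: "Y \<in> Bo (bslice B n X) (m + j)" using ar a(1) by simp
    {
      fix t assume "t \<in> Tm ?D a"
      then obtain ts where t: "t = Tup ts" "ts \<in> terms (bslice B n X) m j Y" using a by auto
      have fs: "frame_hom (bslice (bslice B n X) (m + j) Y) (bslice (bslice B n X) m (ftm (bslice B n X) m j Y)) (sub_list B (n + m) ts)"
        using pre_bhomD(1)[OF sub_list_hom[OF BS Y t(2)]] by simp
      have F: "ftm B (n + m) k (hB (sub_list B (n + m) ts) k V) = ftm B (n + m) j Y"
        if "V \<in> Bo (bslice B n X) (m + j + k)" "ftm B (n + (m + j)) k V = Y" for k V
        using frame_homD(1)[OF fs, of V k] that by simp
      have F2: "ftm B (n + m + k) l (hB (sub_list B (n + m) ts) (k + l) V) = hB (sub_list B (n + m) ts) k (ftm B (n + m + j + k) l V)"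
        if "V \<in> Bo (bslice B n X) (m + j + (k + l))" "ftm B (n + (m + j)) (k + l) V = Y" for k l V
        using frame_hom_ftm[OF is_bframe_bslice[OF bsystemD(1)[OF BS] Y] fs, of V k l] that by (simp add: add.assoc)
      show "teq (slice ?D (Dom ?D a)) (slice_functor (from_bslice B n) \<circ>\<^sub>T Sub ?D a t)
        (Sub ?E (onA (from_bslice B n) a) (onT (from_bslice B n) a t) \<circ>\<^sub>T slice_functor (from_bslice B n))"
        unfolding a(1) t(1) B2E_obj_simps
      proof (rule teq_B2E_slice, goal_cases)
        case (1 k V)
        then show ?case using F[of V k] by (simp add: add.assoc)
      next
        case (2 k l V)
        then show ?case using F[of V "k + l"] F[of "ftm B (n + m + j + k) l V" k] F2[of V k l] by (simp add: ftm_add add.assoc)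
      next
        case 3
        then show ?case by simp
      qed
    }
    have fs: "frame_hom (bslice (bslice B n X) m (ftm B (n + m) j Y)) (bslice (bslice B n X) (m + j) Y) (wk_list B (n + m) j Y)"
      using pre_bhomD(1)[OF wk_list_hom[OF BS Y]] by simp
    have F: "ftm B (n + (m + j)) k (hB (wk_list B (n + m) j Y) k V) = Y"
      if "V \<in> Bo (bslice B n X) (m + k)" "ftm B (n + m) k V = ftm B (n + m) j Y" for k V
      using frame_homD(1)[OF fs, of V k] that by simp
    have Z: "ftm B (n + m) j Y \<in> Bo (bslice B n X) m" using a by simp
    have F2: "ftm B (n + m + j + k) l (hB (wk_list B (n + m) j Y) (k + l) V) = hB (wk_list B (n + m) j Y) k (ftm B (n + m + k) l V)"
      if "V \<in> Bo (bslice B n X) (m + (k + l))" "ftm B (n + m) (k + l) V = ftm B (n + m) j Y" for k l V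
      using frame_hom_ftm[OF is_bframe_bslice[OF bsystemD(1)[OF BS] Z] fs, of V k l] that by (simp add: add.assoc)
    show "teq (slice ?D (Cod ?D a)) (slice_functor (from_bslice B n) \<circ>\<^sub>T Wk ?D a)
        (Wk ?E (onA (from_bslice B n) a) \<circ>\<^sub>T slice_functor (from_bslice B n))"
      unfolding a(1) B2E_obj_simps
    proof (rule teq_B2E_slice, goal_cases)
      case (1 k V)
      then show ?case using F[of V k] by (simp add: add.assoc)
    next
      case (2 k l V)
      then show ?case using F[of V "k + l"] F[of "ftm B (n + m + k) l V" k] F2[of V k l] by (simp add: ftm_add add.assoc)
    next
      case 3
      then show ?case by simp
    qed
    show "onT (from_bslice B n) (onO (Wk ?D a) a) (idtm ?D a) = idtm ?E (onA (from_bslice B n) a)" using a(1) by simp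
  qed
qed

lemma category_slice:
  assumes C: "category C"
  shows "category (slice C X)"
proof -
  have "Comp C (Idt C Z) f = f" if "f \<in> Ar C" "Cod C f = Z" for f Z using categoryD(10)[OF C] that by blast
  then show ?thesis unfolding category_def using categoryD[OF C] by (auto simp: slice_def)
qed

lemma category_eslice: "category (eslice E X) \<longleftrightarrow> category (slice E X)"
  unfolding category_def eslice_eqs ..

text \<open>Substitution and weakening of \<open>B2E_obj B\<close> have exactly this form, with
  \<open>H\<close> a \<open>sub_list\<close> or a \<open>wk_list\<close>. Hence the axioms that they
  are homomorphisms follow from the same property in \<open>B\<close>.\<close>

lemma pre_ehom_between_slices:
  assumes B: "bsystem B" and X: "X \<in> Bo B n" "Y \<in> Bo B m"
    and H: "pre_bhom (bslice B n X) (bslice B m Y) H"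
  shows "pre_ehom (eslice (B2E_obj B) (vtx n X)) (eslice (B2E_obj B) (vtx m Y)) (from_bslice B m \<circ>\<^sub>T B2E_hom H \<circ>\<^sub>T to_bslice)"
proof -
  note fr = bsystemD(1)[OF B]
  have 1: "category (eslice (B2E_obj B) (vtx n X))"
    unfolding category_eslice using category_slice[OF category_B2E_obj[OF fr]] .
  have 2: "category (B2E_obj (bslice B n X))" using category_B2E_obj[OF is_bframe_bslice[OF fr X(1)]] .
  have "pre_ehom (B2E_obj (bslice B n X)) (eslice (B2E_obj B) (vtx m Y)) (from_bslice B m \<circ>\<^sub>T B2E_hom H)"
    using pre_ehom_comp[OF 2 pre_ehom_B2E_hom[OF bsystem_bslice[OF B X(1)] bsystem_bslice[OF B X(2)] H]
      pre_ehom_from_bslice[OF B X(2)]] .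
  from pre_ehom_comp[OF 1 pre_ehom_to_bslice[OF B X(1)] this] show ?thesis by (simp add: tcomp_assoc)
qed

section \<open>The E-system axioms for tuples\<close>

lemma hT_bid: "hT bid n = id"
  by (simp add: bid_def id_def)

lemma hT_bcomp: "hT (K \<circ>\<^sub>B H) n = hT K n \<circ> hT H n"
  by (simp add: bcomp_def comp_def)

text \<open>This becomes the law W_{A.P} = W_P W_A of the E-system.\<close>

lemma wk_list_add: "wk_list B n (k + l) X = wk_list B (n + k) l X \<circ>\<^sub>B wk_list B n k (ftm B (n + k) l X)"
  by (induction l arbitrary: X) (simp_all add: add.assoc bcomp_assoc)

text \<open>S_x and W_A are homomorphisms by \<open>pre_ehom_between_slices\<close>. The law S_x W_A
  = id comes from \<open>sub_list_wk_list\<close>, the value of S_x at the generic term from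
  \<open>sub_list_id_list\<close>, and the last axiom from the second half of
  \<open>id_list_terms\<close>.\<close>

lemma stratified_esystem_B2E_obj:
  assumes B: "bsystem B"
  shows "stratified_esystem (B2E_obj B)"
proof -
  let ?E = "B2E_obj B"
  note fr = bsystemD(1)[OF B]
  note cat = category_B2E_obj[OF fr] and top = terminal_B2E_obj[OF fr] and strat = stratification_B2E_obj[OF fr]
  have Sub: "pre_ehom (eslice ?E (Dom ?E A)) (eslice ?E (Cod ?E A)) (Sub ?E A x)"
    if A: "A \<in> Ar ?E" and x: "x \<in> Tm ?E A" for A x
  proof -
    obtain n X k where X: "A = arr n X k" "X \<in> Bo B (n + k)" using B2E_obj_ArE[OF A] .
    then obtain ts where ts: "x = Tup ts" "ts \<in> terms B n k X" using x by auto
    show ?thesis using pre_ehom_between_slices[OF B X(2) is_bframe_ftm[OF fr X(2)] sub_list_hom[OF B X(2) ts(2)]] X(1) ts(1)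
      by simp
  qed
  have Wk: "pre_ehom (eslice ?E (Cod ?E A)) (eslice ?E (Dom ?E A)) (Wk ?E A)"
    if A: "A \<in> Ar ?E" for A
  proof -
    obtain n X k where X: "A = arr n X k" "X \<in> Bo B (n + k)" using B2E_obj_ArE[OF A] .
    show ?thesis using pre_ehom_between_slices[OF B is_bframe_ftm[OF fr X(2)] X(2) wk_list_hom[OF B X(2)]] X(1)
      by simp
  qed
  have pre: "pre_esystem ?E"
    unfolding pre_esystem_def
  proof (intro conjI ballI impI)
    fix A assume A: "A \<in> Ar ?E"
    then obtain n X k where X: "A = arr n X k" "X \<in> Bo B (n + k)" by (rule B2E_obj_ArE)
    show "is_tfunctor (slice ?E (Cod ?E A)) (slice ?E (Dom ?E A)) (Wk ?E A)"
      "onO (Wk ?E A) (Idt ?E (Cod ?E A)) = Idt ?E (Dom ?E A)"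
      using pre_ehomD(1,2)[OF Wk[OF A]] by (simp_all add: is_tfunctor_eslice)
    show "idtm ?E A \<in> Tm ?E (onO (Wk ?E A) A)" using X id_list_terms[OF B X(2)] by simp
    {
      fix x assume x: "x \<in> Tm ?E A"
      show "is_tfunctor (slice ?E (Dom ?E A)) (slice ?E (Cod ?E A)) (Sub ?E A x)"
        "onO (Sub ?E A x) (Idt ?E (Dom ?E A)) = Idt ?E (Cod ?E A)"
        using pre_ehomD(1,2)[OF Sub[OF A x]] by (simp_all add: is_tfunctor_eslice)
    }
    fix P assume P: "P \<in> Ar ?E" "Cod ?E P = Dom ?E A"
    then obtain Y l where Y: "P = arr (n + k) Y l" "Y \<in> Bo B (n + k + l)" "ftm B (n + k) l Y = X"
      using X by (auto elim!: B2E_obj_ArE)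
    show "teq (slice ?E (Cod ?E A)) (Wk ?E (Comp ?E A P)) (Wk ?E P \<circ>\<^sub>T Wk ?E A)"
      unfolding X(1) Y(1) B2E_obj_simps
    proof (rule teq_B2E_slice, goal_cases)
      case (2 m j V)
      note fs = pre_bhomD(1)[OF wk_list_hom[OF B X(2)]]
      have V: "V \<in> Bo B (n + (m + j))" "ftm B n (m + j) V = ftm B n k X"
        using 2 Y by (auto simp: add.assoc ftm_add)
      show ?case using frame_hom_ftm[OF is_bframe_bslice[OF fr is_bframe_ftm[OF fr X(2)]] fs, of V m j] V Y
        by (simp add: wk_list_add add.assoc)
    qed (simp_all add: wk_list_add Y add.assoc)
  next
    fix v assume "v \<in> Ob ?E"
    then obtain n X where v: "v = vtx n X" "X \<in> Bo B n" by (rule B2E_obj_ObE)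
    show "teq (slice ?E v) (Wk ?E (Idt ?E v)) tid"
      unfolding v(1) B2E_obj_simps
      by (rule teq_B2E_slice) (simp_all add: add.assoc hT_bid hT_bcomp)
  qed (rule cat top)+
  have esys: "esystem ?E"
    unfolding esystem_def
  proof (intro conjI ballI)
    show "pre_esystem ?E" by (rule pre)
    fix A assume A: "A \<in> Ar ?E"
    show "pre_ehom (eslice ?E (Cod ?E A)) (eslice ?E (Dom ?E A)) (Wk ?E A)" by (rule Wk[OF A])
    obtain n X k where X: "A = arr n X k" "X \<in> Bo B (n + k)" using A by (rule B2E_obj_ArE)
    note hW = wk_list_hom[OF B X(2)]
    note fW = pre_bhomD(1)[OF hW]
    let ?N = "ftm B n k X"
    have N: "?N \<in> Bo B n" using is_bframe_ftm[OF fr X(2)] .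
    {
      fix x assume x: "x \<in> Tm ?E A"
      show "pre_ehom (eslice ?E (Dom ?E A)) (eslice ?E (Cod ?E A)) (Sub ?E A x)" by (rule Sub[OF A x])
      obtain ts where ts: "x = Tup ts" "ts \<in> terms B n k X" using x X by auto
      note e = sub_list_wk_list[OF B X(2) ts(2)]
      note fS = pre_bhomD(1)[OF sub_list_hom[OF B X(2) ts(2)]]
      show "teq (slice ?E (Cod ?E A)) (Sub ?E A x \<circ>\<^sub>T Wk ?E A) tid"
        unfolding X(1) ts(1) B2E_obj_simps
      proof (rule teq_B2E_slice, goal_cases)
        case (1 m Y)
        then show ?case using beq_slice_ob[OF e 1] by simp
      next
        case (2 m j Y)
        have Y: "Y \<in> Bo B (n + (m + j))" "ftm B n (m + j) Y = ?N" using 2 by (auto simp: add.assoc ftm_add)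
        then show ?case using beq_slice_ob[OF e Y] by (simp add: add.assoc)
      next
        case (3 m j Y us)
        then show ?case using beq_terms[OF B e 3(1,3,4)] by (simp add: hT_bid hT_bcomp)
      qed
      show "onT (Sub ?E A x) (onO (Wk ?E A) A, Idt ?E (Dom ?E A)) (idtm ?E A) = x"
        using sub_list_id_list[OF B X(2) ts(2)] by (simp add: X(1) ts(1))
    }
    note e = conjunct2[OF id_list_terms[OF B X(2)]]
    show "teq (slice ?E (Dom ?E A))
        (Sub ?E (onO (Wk ?E A) A) (idtm ?E A) \<circ>\<^sub>T (unnest \<circ>\<^sub>T slice_functor (Wk ?E A) \<circ>\<^sub>T nest ?E A)) tid"
      unfolding X(1) B2E_obj_simps
    proof (rule teq_B2E_slice, goal_cases)
      case (1 m Y)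
      then show ?case using beq_slice_ob[OF e 1] by (simp add: add.assoc)
    next
      case (2 m j Y)
      have Y: "Y \<in> Bo B (n + k + (m + j))" "ftm B (n + k) (m + j) Y = X" using 2 by (auto simp: add.assoc ftm_add)
      then show ?case using beq_slice_ob[OF e Y] by (simp add: add.assoc)
    next
      case (3 m j Y us)
      then show ?case using beq_terms[OF B e 3(1,3,4)] by (simp add: add.assoc hT_bid hT_bcomp)
    qed
  qed
  have lev: "level ?E (vtx n X) = n" if "X \<in> Bo B n" for n X using level_B2E_obj[OF fr that] .
  show ?thesis
    unfolding stratified_esystem_def
  proof (intro conjI ballI)
    show "esystem ?E" by (rule esys)
    show "\<exists>L. stratification ?E (Top ?E) L" using strat by blast
    fix A assume A: "A \<in> Ar ?E"
    then obtain n X k where X: "A = arr n X k" "X \<in> Bo B (n + k)" by (rule B2E_obj_ArE)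
    note N = is_bframe_ftm[OF fr X(2)]
    {
      fix x P assume x: "x \<in> Tm ?E A" and P: "P \<in> Ob (slice ?E (Dom ?E A))"
      obtain ts where ts: "x = Tup ts" "ts \<in> terms B n k X" using x X by auto
      obtain m Y where Y: "P = arr (n + k) Y m" "Y \<in> Bo B (n + k + m)" "ftm B (n + k) m Y = X"
        using P X by (auto elim: B2E_slice_ObE simp del: slice_simps)
      have "hB (sub_list B n ts) m Y \<in> Bo B (n + m)"
        using frame_homD(1)[OF pre_bhomD(1)[OF sub_list_hom[OF B X(2) ts(2)]], of Y m] Y by simp
      then show "slice_level ?E (level ?E) (Cod ?E A) (onO (Sub ?E A x) P) = slice_level ?E (level ?E) (Dom ?E A) P"
        using X Y ts N by (simp add: slice_level_def lev)
    }
    fix P assume P: "P \<in> Ob (slice ?E (Cod ?E A))"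
    obtain m Y where Y: "P = arr n Y m" "Y \<in> Bo B (n + m)" "ftm B n m Y = ftm B n k X"
      using P X by (auto elim: B2E_slice_ObE simp del: slice_simps)
    have "hB (wk_list B n k X) m Y \<in> Bo B (n + k + m)"
      using frame_homD(1)[OF pre_bhomD(1)[OF wk_list_hom[OF B X(2)]], of Y m] Y by simp
    then show "slice_level ?E (level ?E) (Dom ?E A) (onO (Wk ?E A) P) = slice_level ?E (level ?E) (Cod ?E A) P"
      using X Y N by (simp add: slice_level_def lev)
  qed
qed

section \<open>The category of stratified E-systems\<close>

lemma esystemD:
  assumes "esystem E"
  shows "pre_esystem E"
    "\<lbrakk>A \<in> Ar E; x \<in> Tm E A\<rbrakk> \<Longrightarrow> pre_ehom (eslice E (Dom E A)) (eslice E (Cod E A)) (Sub E A x)"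
    "A \<in> Ar E \<Longrightarrow> pre_ehom (eslice E (Cod E A)) (eslice E (Dom E A)) (Wk E A)"
    "\<lbrakk>A \<in> Ar E; x \<in> Tm E A\<rbrakk> \<Longrightarrow> teq (slice E (Cod E A)) (Sub E A x \<circ>\<^sub>T Wk E A) tid"
    "\<lbrakk>A \<in> Ar E; x \<in> Tm E A\<rbrakk> \<Longrightarrow> onT (Sub E A x) (onO (Wk E A) A, Idt E (Dom E A)) (idtm E A) = x"
    "A \<in> Ar E \<Longrightarrow> teq (slice E (Dom E A))
        (Sub E (onO (Wk E A) A) (idtm E A) \<circ>\<^sub>T (unnest \<circ>\<^sub>T slice_functor (Wk E A) \<circ>\<^sub>T nest E A)) tid"
  using assms unfolding esystem_def by blast+

lemma pre_esystemD:
  assumes "pre_esystem E"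
  shows "category E" "terminal E (Top E)"
    "\<lbrakk>A \<in> Ar E; x \<in> Tm E A\<rbrakk> \<Longrightarrow> is_tfunctor (slice E (Dom E A)) (slice E (Cod E A)) (Sub E A x)"
    "\<lbrakk>A \<in> Ar E; x \<in> Tm E A\<rbrakk> \<Longrightarrow> onO (Sub E A x) (Idt E (Dom E A)) = Idt E (Cod E A)"
    "A \<in> Ar E \<Longrightarrow> is_tfunctor (slice E (Cod E A)) (slice E (Dom E A)) (Wk E A)"
    "A \<in> Ar E \<Longrightarrow> onO (Wk E A) (Idt E (Cod E A)) = Idt E (Dom E A)"
    "X \<in> Ob E \<Longrightarrow> teq (slice E X) (Wk E (Idt E X)) tid"
    "\<lbrakk>A \<in> Ar E; P \<in> Ar E; Cod E P = Dom E A\<rbrakk> \<Longrightarrow>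
        teq (slice E (Cod E A)) (Wk E (Comp E A P)) (Wk E P \<circ>\<^sub>T Wk E A)"
    "A \<in> Ar E \<Longrightarrow> idtm E A \<in> Tm E (onO (Wk E A) A)"
  using assms unfolding pre_esystem_def by blast+

lemma teqD:
  assumes "teq C F G"
  shows "X \<in> Ob C \<Longrightarrow> onO F X = onO G X" "f \<in> Ar C \<Longrightarrow> onA F f = onA G f"
    "\<lbrakk>f \<in> Ar C; t \<in> Tm C f\<rbrakk> \<Longrightarrow> onT F f t = onT G f t"
  using assms by (simp_all add: teq_def)

lemma is_tfunctor_cong:
  assumes "category E" "is_tfunctor E D F" "teq E F G"
  shows "is_tfunctor E D G"
  using assms(2,3) categoryD[OF assms(1)] unfolding is_tfunctor_def is_functor_def teq_def by simp

lemma teq_slice_functor: "teq E F G \<Longrightarrow> teq (slice E X) (slice_functor F) (slice_functor G)"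
  by (auto simp: teq_def)

lemma pre_ehom_cong:
  assumes E: "pre_esystem E" and F: "pre_ehom E D F" and e: "teq E F G"
  shows "pre_ehom E D G"
  unfolding pre_ehom_def
proof (intro conjI ballI)
  note cat = pre_esystemD(1)[OF E]
  show "is_tfunctor E D G" using is_tfunctor_cong[OF cat pre_ehomD(1)[OF F] e] .
  have "Top E \<in> Ob E" using pre_esystemD(2)[OF E] by (simp add: terminal_def)
  then show "onO G (Top E) = Top D" using pre_ehomD(2)[OF F] e by (simp add: teq_def)
  fix A assume A: "A \<in> Ar E"
  have eA: "onA F A = onA G A" using e A by (simp add: teq_def)
  {
    fix x assume x: "x \<in> Tm E A"
    have ex: "onT F A x = onT G A x" using e A x by (simp add: teq_def)
    have 1: "teq (slice E (Dom E A)) (slice_functor G \<circ>\<^sub>T Sub E A x) (slice_functor F \<circ>\<^sub>T Sub E A x)"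
      using teq_tcomp_left[OF pre_esystemD(3)[OF E A x] teq_slice_functor[OF teq_sym[OF e]]] .
    have 2: "teq (slice E (Dom E A)) (Sub D (onA G A) (onT G A x) \<circ>\<^sub>T slice_functor F)
      (Sub D (onA G A) (onT G A x) \<circ>\<^sub>T slice_functor G)"
      using teq_tcomp_right[OF teq_slice_functor[OF e]] .
    show "teq (slice E (Dom E A)) (slice_functor G \<circ>\<^sub>T Sub E A x) (Sub D (onA G A) (onT G A x) \<circ>\<^sub>T slice_functor G)"
      using teq_trans[OF teq_trans[OF 1 pre_ehomD(3)[OF F A x refl, unfolded eA ex]] 2] .
  }
  have 1: "teq (slice E (Cod E A)) (slice_functor G \<circ>\<^sub>T Wk E A) (slice_functor F \<circ>\<^sub>T Wk E A)"
    using teq_tcomp_left[OF pre_esystemD(5)[OF E A] teq_slice_functor[OF teq_sym[OF e]]] .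
  have 2: "teq (slice E (Cod E A)) (Wk D (onA G A) \<circ>\<^sub>T slice_functor F) (Wk D (onA G A) \<circ>\<^sub>T slice_functor G)"
    using teq_tcomp_right[OF teq_slice_functor[OF e]] .
  show "teq (slice E (Cod E A)) (slice_functor G \<circ>\<^sub>T Wk E A) (Wk D (onA G A) \<circ>\<^sub>T slice_functor G)"
    using teq_trans[OF teq_trans[OF 1 pre_ehomD(4)[OF F A refl, unfolded eA]] 2] .
  have "onO (Wk E A) A \<in> Ar E" using is_functorD(1)[OF is_tfunctorD(1)[OF pre_esystemD(5)[OF E A]], of A] A by simp
  then have "onT F (onO (Wk E A) A) (idtm E A) = onT G (onO (Wk E A) A) (idtm E A)"
    using e pre_esystemD(9)[OF E A] by (simp add: teq_def)
  then show "onT G (onO (Wk E A) A) (idtm E A) = idtm D (onA G A)"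
    using pre_ehomD(5)[OF F A] eA by simp
qed

lemma stratified_esystemD:
  assumes "stratified_esystem E"
  shows "esystem E" "pre_esystem E" "category E" "terminal E (Top E)" "stratification E (Top E) (level E)"
    "\<lbrakk>A \<in> Ar E; x \<in> Tm E A; P \<in> Ob (slice E (Dom E A))\<rbrakk> \<Longrightarrow>
      slice_level E (level E) (Cod E A) (onO (Sub E A x) P) = slice_level E (level E) (Dom E A) P"
    "\<lbrakk>A \<in> Ar E; P \<in> Ob (slice E (Cod E A))\<rbrakk> \<Longrightarrow>
      slice_level E (level E) (Dom E A) (onO (Wk E A) P) = slice_level E (level E) (Cod E A) P"
proof -
  show "esystem E" using assms unfolding stratified_esystem_def by blast
  then show p: "pre_esystem E" by (rule esystemD)
  then show c: "category E" and t: "terminal E (Top E)" by (rule pre_esystemD)+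
  obtain L where "stratification E (Top E) L" using assms unfolding stratified_esystem_def by blast
  then show "stratification E (Top E) (level E)" using level_stratification[OF c t] by simp
qed (use assms in \<open>simp_all add: stratified_esystem_def\<close>)

lemma stratified_ehom_cong:
  assumes "stratified_esystem E" "stratified_ehom E D F" "teq E F G"
  shows "stratified_ehom E D G"
  using pre_ehom_cong[OF stratified_esystemD(2)[OF assms(1)] _ assms(3)] assms(2,3)
  by (simp add: stratified_ehom_def teq_def)

lemma teq_tres: "teq E (tres E F) F"
  by (simp add: teq_def tres_def)

lemma tres_eq_iff: "tres E F = tres E G \<longleftrightarrow> teq E F G"
proof
  assume "tres E F = tres E G"
  then show "teq E F G" by (metis teq_sym teq_tres teq_trans)
next
  assume "teq E F G"
  then show "tres E F = tres E G" by (auto simp: tres_def teq_def intro!: ext restrict_ext)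
qed

lemma tres_tres [simp]: "tres E (tres E F) = tres E F"
  unfolding tres_eq_iff by (rule teq_tres)

lemma tres_comp_left: "is_tfunctor E D F \<Longrightarrow> tres E (tres D G \<circ>\<^sub>T F) = tres E (G \<circ>\<^sub>T F)"
  unfolding tres_eq_iff by (rule teq_tcomp_left[OF _ teq_tres])

lemma tres_comp_right [simp]: "tres E (G \<circ>\<^sub>T tres E F) = tres E (G \<circ>\<^sub>T F)"
  unfolding tres_eq_iff by (rule teq_tcomp_right[OF teq_tres])

lemma stratified_ehom_tres:
  "\<lbrakk>stratified_esystem E; stratified_ehom E D F\<rbrakk> \<Longrightarrow> stratified_ehom E D (tres E F)"
  using stratified_ehom_cong teq_sym[OF teq_tres] by blast

lemma stratified_ehom_comp:
  assumes E: "stratified_esystem E" and F: "stratified_ehom E D F" and G: "stratified_ehom D C G"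
  shows "stratified_ehom E C (G \<circ>\<^sub>T F)"
  using pre_ehom_comp[OF stratified_esystemD(3)[OF E]] F G
    is_functorD(1)[OF is_tfunctorD(1)[OF pre_ehomD(1)]] unfolding stratified_ehom_def by (metis tcomp_simps(1))

lemma stratified_ehom_tid: "stratified_ehom E E tid"
  by (simp add: stratified_ehom_def pre_ehom_tid)

lemma stratified_ehom_tfunctor: "stratified_ehom E D F \<Longrightarrow> is_tfunctor E D F"
  by (simp add: stratified_ehom_def pre_ehom_def)

lemma Esys_simps [simp]:
  "Ob Esys\<^sub>s = {E. stratified_esystem E}"
  "(E, F, D) \<in> Ar Esys\<^sub>s \<longleftrightarrow> stratified_esystem E \<and> stratified_esystem D \<and> stratified_ehom E D F \<and> tres E F = F"
  "Dom Esys\<^sub>s (E, F, D) = E" "Cod Esys\<^sub>s (E, F, D) = D" "Idt Esys\<^sub>s E = (E, tres E tid, E)"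
  "Comp Esys\<^sub>s (D', G, C) (E, F, D) = (E, tres E (G \<circ>\<^sub>T F), C)"
  by (simp_all add: Esys\<^sub>s_def)

lemma Esys_triple:
  "f \<in> Ar Esys\<^sub>s \<Longrightarrow> \<exists>E F D. f = (E, F, D) \<and> stratified_esystem E \<and> stratified_esystem D \<and> stratified_ehom E D F \<and> tres E F = F"
  by (auto simp: Esys\<^sub>s_def)

lemma Comp_Esys:
  assumes "(E, F, D) \<in> Ar Esys\<^sub>s" "(D, G, C) \<in> Ar Esys\<^sub>s"
  shows "(E, tres E (G \<circ>\<^sub>T F), C) \<in> Ar Esys\<^sub>s"
  using assms stratified_ehom_tres[OF _ stratified_ehom_comp] by auto

lemma category_Esys: "category Esys\<^sub>s"
  unfolding category_def
proof (intro conjI ballI impI)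
  fix f assume "f \<in> Ar Esys\<^sub>s"
  then obtain E F D where f: "f = (E, F, D)" "stratified_esystem E" "stratified_esystem D" "stratified_ehom E D F" "tres E F = F"
    using Esys_triple by blast
  then show "Dom Esys\<^sub>s f \<in> Ob Esys\<^sub>s" "Cod Esys\<^sub>s f \<in> Ob Esys\<^sub>s"
    "Comp Esys\<^sub>s f (Idt Esys\<^sub>s (Dom Esys\<^sub>s f)) = f" "Comp Esys\<^sub>s (Idt Esys\<^sub>s (Cod Esys\<^sub>s f)) f = f"
    using tres_comp_left[OF stratified_ehom_tfunctor[OF f(4)], of tid] by simp_all
next
  fix E :: "'a esystem" assume "E \<in> Ob Esys\<^sub>s"
  then show "Idt Esys\<^sub>s E \<in> Ar Esys\<^sub>s" "Dom Esys\<^sub>s (Idt Esys\<^sub>s E) = E" "Cod Esys\<^sub>s (Idt Esys\<^sub>s E) = E"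
    using stratified_ehom_tres[OF _ stratified_ehom_tid] by simp_all
next
  fix f g :: "'a emor" assume *: "f \<in> Ar Esys\<^sub>s" "g \<in> Ar Esys\<^sub>s" "Cod Esys\<^sub>s f = Dom Esys\<^sub>s g"
  then obtain E F D C G where "f = (E, F, D)" "g = (D, G, C)" using Esys_triple[of f] Esys_triple[of g] by auto
  with * show "Comp Esys\<^sub>s g f \<in> Ar Esys\<^sub>s" "Dom Esys\<^sub>s (Comp Esys\<^sub>s g f) = Dom Esys\<^sub>s f"
    "Cod Esys\<^sub>s (Comp Esys\<^sub>s g f) = Cod Esys\<^sub>s g"
    using Comp_Esys[of E F D G C] by (simp_all del: Esys_simps(2))
next
  fix f g h :: "'a emor"
  assume *: "f \<in> Ar Esys\<^sub>s" "g \<in> Ar Esys\<^sub>s" "h \<in> Ar Esys\<^sub>s" "Cod Esys\<^sub>s f = Dom Esys\<^sub>s g \<and> Cod Esys\<^sub>s g = Dom Esys\<^sub>s h"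
  then obtain E F D C G M H where "f = (E, F, D)" "g = (D, G, C)" "h = (C, H, M)" "stratified_ehom E D F"
    using Esys_triple[of f] Esys_triple[of g] Esys_triple[of h] by auto
  then show "Comp Esys\<^sub>s h (Comp Esys\<^sub>s g f) = Comp Esys\<^sub>s (Comp Esys\<^sub>s h g) f"
    using tres_comp_left[OF stratified_ehom_tfunctor, of E D F "H \<circ>\<^sub>T G"] by (simp add: tcomp_assoc)
qed

section \<open>Substitution and weakening in terms of objects\<close>

text \<open>In a stratified category there is at most one arrow between two objects, so an E-system is
  determined by the actions of substitution (\<open>so\<close>, \<open>st\<close>) and weakening (\<open>wo\<close>, \<open>wt\<close>) on objects and
  terms, together with the generic terms \<open>dt\<close>.  In this form \<open>thom E X D Y ho ht\<close> says that \<open>ho\<close> and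
  \<open>ht\<close> are a stratified homomorphism from the slice over \<open>X\<close> to the slice over \<open>Y\<close>.\<close>

definition tm :: "('o, 'm, 't) esys \<Rightarrow> 'o \<Rightarrow> 'o \<Rightarrow> 't set" where
  "tm E X Y = Tm E (arrow E X Y)"

definition so :: "('o, 'm, 't) esys \<Rightarrow> 'o \<Rightarrow> 'o \<Rightarrow> 't \<Rightarrow> 'o \<Rightarrow> 'o" where
  "so E X Y x Z = Dom E (onO (Sub E (arrow E X Y) x) (arrow E Z X))"

definition st :: "('o, 'm, 't) esys \<Rightarrow> 'o \<Rightarrow> 'o \<Rightarrow> 't \<Rightarrow> 'o \<Rightarrow> 'o \<Rightarrow> 't \<Rightarrow> 't" where
  "st E X Y x Z W = onT (Sub E (arrow E X Y) x) (arrow E Z W, arrow E W X)"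

definition wo :: "('o, 'm, 't) esys \<Rightarrow> 'o \<Rightarrow> 'o \<Rightarrow> 'o \<Rightarrow> 'o" where
  "wo E X Y Z = Dom E (onO (Wk E (arrow E X Y)) (arrow E Z Y))"

definition wt :: "('o, 'm, 't) esys \<Rightarrow> 'o \<Rightarrow> 'o \<Rightarrow> 'o \<Rightarrow> 'o \<Rightarrow> 't \<Rightarrow> 't" where
  "wt E X Y Z W = onT (Wk E (arrow E X Y)) (arrow E Z W, arrow E W Y)"

definition dt :: "('o, 'm, 't) esys \<Rightarrow> 'o \<Rightarrow> 'o \<Rightarrow> 't" where
  "dt E X Y = idtm E (arrow E X Y)"

definition thom :: "('o1, 'm1, 't1) esys \<Rightarrow> 'o1 \<Rightarrow> ('o2, 'm2, 't2) esys \<Rightarrow> 'o2 \<Rightarrow>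
    ('o1 \<Rightarrow> 'o2) \<Rightarrow> ('o1 \<Rightarrow> 'o1 \<Rightarrow> 't1 \<Rightarrow> 't2) \<Rightarrow> bool" where
  "thom E X D Y ho ht \<longleftrightarrow> X \<in> Ob E \<and> Y \<in> Ob D \<and> ho X = Y \<and>
    (\<forall>Z W. over E Z W \<longrightarrow> over E W X \<longrightarrow> over D (ho Z) (ho W)) \<and>
    (\<forall>Z. over E Z X \<longrightarrow> level D (ho Z) + level E X = level E Z + level D Y) \<and>
    (\<forall>Z W t. over E Z W \<longrightarrow> over E W X \<longrightarrow> t \<in> tm E Z W \<longrightarrow> ht Z W t \<in> tm D (ho Z) (ho W)) \<and>
    (\<forall>V W y Z. over E V W \<longrightarrow> over E W X \<longrightarrow> y \<in> tm E V W \<longrightarrow> over E Z V \<longrightarrow>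
      ho (so E V W y Z) = so D (ho V) (ho W) (ht V W y) (ho Z)) \<and>
    (\<forall>V W y Z Q t. over E V W \<longrightarrow> over E W X \<longrightarrow> y \<in> tm E V W \<longrightarrow> over E Z Q \<longrightarrow> over E Q V \<longrightarrow> t \<in> tm E Z Q \<longrightarrow>
      ht (so E V W y Z) (so E V W y Q) (st E V W y Z Q t)
        = st D (ho V) (ho W) (ht V W y) (ho Z) (ho Q) (ht Z Q t)) \<and>
    (\<forall>V W Z. over E V W \<longrightarrow> over E W X \<longrightarrow> over E Z W \<longrightarrow> ho (wo E V W Z) = wo D (ho V) (ho W) (ho Z)) \<and>
    (\<forall>V W Z Q t. over E V W \<longrightarrow> over E W X \<longrightarrow> over E Z Q \<longrightarrow> over E Q W \<longrightarrow> t \<in> tm E Z Q \<longrightarrow>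
      ht (wo E V W Z) (wo E V W Q) (wt E V W Z Q t) = wt D (ho V) (ho W) (ho Z) (ho Q) (ht Z Q t)) \<and>
    (\<forall>V W. over E V W \<longrightarrow> over E W X \<longrightarrow> ht (wo E V W V) V (dt E V W) = dt D (ho V) (ho W))"

lemma thomD:
  assumes "thom E X D Y ho ht"
  shows "X \<in> Ob E" "Y \<in> Ob D" "ho X = Y"
    "\<lbrakk>over E Z W; over E W X\<rbrakk> \<Longrightarrow> over D (ho Z) (ho W)"
    "over E Z X \<Longrightarrow> level D (ho Z) + level E X = level E Z + level D Y"
    "\<lbrakk>over E Z W; over E W X; t \<in> tm E Z W\<rbrakk> \<Longrightarrow> ht Z W t \<in> tm D (ho Z) (ho W)"
    "\<lbrakk>over E V W; over E W X; y \<in> tm E V W; over E Z V\<rbrakk> \<Longrightarrow> ho (so E V W y Z) = so D (ho V) (ho W) (ht V W y) (ho Z)"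
    "\<lbrakk>over E V W; over E W X; y \<in> tm E V W; over E Z Q; over E Q V; t \<in> tm E Z Q\<rbrakk> \<Longrightarrow>
      ht (so E V W y Z) (so E V W y Q) (st E V W y Z Q t) = st D (ho V) (ho W) (ht V W y) (ho Z) (ho Q) (ht Z Q t)"
    "\<lbrakk>over E V W; over E W X; over E Z W\<rbrakk> \<Longrightarrow> ho (wo E V W Z) = wo D (ho V) (ho W) (ho Z)"
    "\<lbrakk>over E V W; over E W X; over E Z Q; over E Q W; t \<in> tm E Z Q\<rbrakk> \<Longrightarrow>
      ht (wo E V W Z) (wo E V W Q) (wt E V W Z Q t) = wt D (ho V) (ho W) (ho Z) (ho Q) (ht Z Q t)"
    "\<lbrakk>over E V W; over E W X\<rbrakk> \<Longrightarrow> ht (wo E V W V) V (dt E V W) = dt D (ho V) (ho W)"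
  using assms by (simp_all add: thom_def)

locale strat_esys =
  fixes E :: "('o, 'm, 't) esys"
  assumes stratified: "stratified_esystem E"

sublocale strat_esys \<subseteq> strat_cat E "Top E" "level E"
  by unfold_locales (fact stratified_esystemD(3-5)[OF stratified])+

text \<open>The second component of the image of a slice arrow is its codomain and the composite of
  the components is its domain. Functoriality therefore fixes the end points of the first component,
  and thinness of \<open>D\<close> fixes the arrow.\<close>

lemma slice_functor_action:
  assumes E: "strat_esys E" and D: "strat_esys D" and F: "is_functor (slice E X) (slice D Y) F"
  defines "fo \<equiv> \<lambda>Z. Dom D (onO F (arrow E Z X))"
  shows "over E Z X \<Longrightarrow> onO F (arrow E Z X) = arrow D (fo Z) Y"
    and "over E Z X \<Longrightarrow> over D (fo Z) Y"
    and "\<lbrakk>over E Z W; over E W X\<rbrakk> \<Longrightarrow> over D (fo Z) (fo W)"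
    and "\<lbrakk>over E Z W; over E W X\<rbrakk> \<Longrightarrow> onA F (arrow E Z W, arrow E W X) = (arrow D (fo Z) (fo W), arrow D (fo W) Y)"
proof -
  interpret E: strat_esys E by (rule E)
  interpret D: strat_esys D by (rule D)
  have o: "onO F (arrow E Z X) \<in> Ar D" "Cod D (onO F (arrow E Z X)) = Y" if "over E Z X" for Z
    using is_functorD(1)[OF F, of "arrow E Z X"] E.arrow[OF that] by auto
  show 1: "onO F (arrow E Z X) = arrow D (fo Z) Y" if "over E Z X" for Z
    using D.arrow_eq[OF o(1)[OF that] _ o(2)[OF that], of "fo Z"] by (simp add: fo_def)
  show 2: "over D (fo Z) Y" if "over E Z X" for Z
    using o[OF that] unfolding over_def fo_def by blast
  show "over D (fo Z) (fo W)" "onA F (arrow E Z W, arrow E W X) = (arrow D (fo Z) (fo W), arrow D (fo W) Y)"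
    if ZW: "over E Z W" and WX: "over E W X" for Z W
  proof -
    have a: "(arrow E Z W, arrow E W X) \<in> Ar (slice E X)" using E.arrow ZW WX by simp
    obtain f P where fP: "onA F (arrow E Z W, arrow E W X) = (f, P)" by (cases "onA F (arrow E Z W, arrow E W X)")
    have P: "P = arrow D (fo W) Y" using is_functorD(4)[OF F a] fP 1[OF WX] by simp
    have f: "f \<in> Ar D" "Cod D f = Dom D P" using is_functorD(2)[OF F a] fP by auto
    have "Comp D P f = onO F (arrow E Z X)" using is_functorD(3)[OF F a] fP E.arrow_comp[OF ZW WX] by simp
    moreover have "Dom D (Comp D P f) = Dom D f"
      using categoryD(7)[OF D.cat f(1) _ f(2)] P D.arrow(1)[OF 2[OF WX]] by simp
    ultimately have df: "Dom D f = fo Z" by (simp add: fo_def)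
    have cf: "Cod D f = fo W" using f(2) P D.arrow(2)[OF 2[OF WX]] by simp
    show "over D (fo Z) (fo W)" unfolding over_def using f df cf by blast
    show "onA F (arrow E Z W, arrow E W X) = (arrow D (fo Z) (fo W), arrow D (fo W) Y)"
      using fP P D.arrow_eq[OF f(1) df cf] by simp
  qed
qed

context strat_esys
begin

lemma E_strat_esys: "strat_esys E" by unfold_locales

lemma is_functor_Sub: "\<lbrakk>over E X Y; x \<in> tm E X Y\<rbrakk> \<Longrightarrow> is_functor (slice E X) (slice E Y) (Sub E (arrow E X Y) x)"
  using pre_esystemD(3)[OF stratified_esystemD(2)[OF stratified], of "arrow E X Y" x] arrow
  by (simp add: is_tfunctor_def tm_def)

lemma is_functor_Wk: "over E X Y \<Longrightarrow> is_functor (slice E Y) (slice E X) (Wk E (arrow E X Y))"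
  using pre_esystemD(5)[OF stratified_esystemD(2)[OF stratified], of "arrow E X Y"] arrow
  by (simp add: is_tfunctor_def)

lemma Sub_action:
  assumes "over E X Y" "x \<in> tm E X Y"
  shows "over E Z X \<Longrightarrow> onO (Sub E (arrow E X Y) x) (arrow E Z X) = arrow E (so E X Y x Z) Y"
    and "over E Z X \<Longrightarrow> over E (so E X Y x Z) Y"
    and "\<lbrakk>over E Z W; over E W X\<rbrakk> \<Longrightarrow> over E (so E X Y x Z) (so E X Y x W)"
    and "\<lbrakk>over E Z W; over E W X\<rbrakk> \<Longrightarrow> onA (Sub E (arrow E X Y) x) (arrow E Z W, arrow E W X)
      = (arrow E (so E X Y x Z) (so E X Y x W), arrow E (so E X Y x W) Y)"
  using slice_functor_action[OF E_strat_esys E_strat_esys is_functor_Sub[OF assms]] unfolding so_def by blast+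

lemma Wk_action:
  assumes "over E X Y"
  shows "over E Z Y \<Longrightarrow> onO (Wk E (arrow E X Y)) (arrow E Z Y) = arrow E (wo E X Y Z) X"
    and "over E Z Y \<Longrightarrow> over E (wo E X Y Z) X"
    and "\<lbrakk>over E Z W; over E W Y\<rbrakk> \<Longrightarrow> over E (wo E X Y Z) (wo E X Y W)"
    and "\<lbrakk>over E Z W; over E W Y\<rbrakk> \<Longrightarrow> onA (Wk E (arrow E X Y)) (arrow E Z W, arrow E W Y)
      = (arrow E (wo E X Y Z) (wo E X Y W), arrow E (wo E X Y W) X)"
  using slice_functor_action[OF E_strat_esys E_strat_esys is_functor_Wk[OF assms]] unfolding wo_def by blast+

lemma arrow_inject: "\<lbrakk>arrow E X Y = arrow E Z W; over E X Y; over E Z W\<rbrakk> \<Longrightarrow> X = Z \<and> Y = W"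
  using arrow by metis

lemma wo_base: "over E X Y \<Longrightarrow> wo E X Y Y = X"
  using pre_esystemD(6)[OF stratified_esystemD(2)[OF stratified], of "arrow E X Y"] arrow[of X Y]
    arrow_id[of X] arrow_id[of Y] overD[of X Y] arrow(2)[OF over_refl, of X] by (simp add: wo_def)

lemma so_base: "\<lbrakk>over E X Y; x \<in> tm E X Y\<rbrakk> \<Longrightarrow> so E X Y x X = Y"
  using pre_esystemD(4)[OF stratified_esystemD(2)[OF stratified], of "arrow E X Y" x] arrow[of X Y]
    arrow_id[of X] arrow_id[of Y] overD[of X Y] arrow(2)[OF over_refl, of Y] by (simp add: so_def tm_def)

lemma dt_tm: "over E X Y \<Longrightarrow> dt E X Y \<in> tm E (wo E X Y X) X"
  using pre_esystemD(9)[OF stratified_esystemD(2)[OF stratified], of "arrow E X Y"] arrow(1)[of X Y]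
    Wk_action(1)[of X Y X] by (simp add: dt_def tm_def)

lemma wo_id: "over E Z X \<Longrightarrow> wo E X X Z = Z"
  and wt_id: "\<lbrakk>over E Z W; over E W X; t \<in> tm E Z W\<rbrakk> \<Longrightarrow> wt E X X Z W t = t"
proof -
  have e: "teq (slice E X) (Wk E (arrow E X X)) tid" if "over E Z X" for Z
    using pre_esystemD(7)[OF stratified_esystemD(2)[OF stratified] overD(2)[OF that]] arrow_id overD[OF that] by simp
  show "wo E X X Z = Z" if "over E Z X" for Z
    using e[OF that] arrow[OF that] by (simp add: teq_def wo_def)
  show "wt E X X Z W t = t" if "over E Z W" "over E W X" "t \<in> tm E Z W" for Z W t
    using e[OF that(2)] arrow[OF that(1)] arrow[OF that(2)] that(3) by (auto simp: teq_def wt_def tm_def)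
qed

lemma wo_comp: "\<lbrakk>over E X Y; over E Y Z; over E V Z\<rbrakk> \<Longrightarrow> wo E X Z V = wo E X Y (wo E Y Z V)"
  and wt_comp: "\<lbrakk>over E X Y; over E Y Z; over E V W; over E W Z; t \<in> tm E V W\<rbrakk>
    \<Longrightarrow> wt E X Z V W t = wt E X Y (wo E Y Z V) (wo E Y Z W) (wt E Y Z V W t)"
proof -
  have e: "teq (slice E Z) (Wk E (arrow E X Z)) (Wk E (arrow E X Y) \<circ>\<^sub>T Wk E (arrow E Y Z))"
    if "over E X Y" "over E Y Z"
    using pre_esystemD(8)[OF stratified_esystemD(2)[OF stratified], of "arrow E Y Z" "arrow E X Y"]
      arrow[OF that(1)] arrow[OF that(2)] arrow_comp[OF that] by simp
  show "wo E X Z V = wo E X Y (wo E Y Z V)" if "over E X Y" "over E Y Z" "over E V Z" for V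
    using e[OF that(1,2)] arrow[OF that(3)] Wk_action(1)[OF that(2,3)] by (simp add: teq_def wo_def)
  show "wt E X Z V W t = wt E X Y (wo E Y Z V) (wo E Y Z W) (wt E Y Z V W t)"
    if "over E X Y" "over E Y Z" "over E V W" "over E W Z" "t \<in> tm E V W" for V W t
    using e[OF that(1,2)] arrow[OF that(3)] arrow[OF that(4)] that(5) Wk_action(4)[OF that(2,3,4)]
    by (auto simp: teq_def wt_def tm_def)
qed

lemma so_wo: "\<lbrakk>over E X Y; x \<in> tm E X Y; over E Z Y\<rbrakk> \<Longrightarrow> so E X Y x (wo E X Y Z) = Z"
  and st_wt: "\<lbrakk>over E X Y; x \<in> tm E X Y; over E Z W; over E W Y; t \<in> tm E Z W\<rbrakk>
    \<Longrightarrow> st E X Y x (wo E X Y Z) (wo E X Y W) (wt E X Y Z W t) = t"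
proof -
  have e: "teq (slice E Y) (Sub E (arrow E X Y) x \<circ>\<^sub>T Wk E (arrow E X Y)) tid"
    if "over E X Y" "x \<in> tm E X Y"
    using esystemD(4)[OF stratified_esystemD(1)[OF stratified], of "arrow E X Y" x] arrow[OF that(1)] that(2)
    by (simp add: tm_def)
  show "so E X Y x (wo E X Y Z) = Z" if "over E X Y" "x \<in> tm E X Y" "over E Z Y" for Z
    using teqD(1)[OF e[OF that(1,2)], of "arrow E Z Y"] arrow[OF that(3)] Wk_action(1)[OF that(1,3)]
    by (simp add: so_def)
  show "st E X Y x (wo E X Y Z) (wo E X Y W) (wt E X Y Z W t) = t"
    if "over E X Y" "x \<in> tm E X Y" "over E Z W" "over E W Y" "t \<in> tm E Z W" for Z W t
    using teqD(3)[OF e[OF that(1,2)], of "(arrow E Z W, arrow E W Y)" t] arrow[OF that(3)] arrow[OF that(4)]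
      that(5) Wk_action(4)[OF that(1,3,4)] by (simp add: wt_def st_def tm_def)
qed

lemma st_dt: "\<lbrakk>over E X Y; x \<in> tm E X Y\<rbrakk> \<Longrightarrow> st E X Y x (wo E X Y X) X (dt E X Y) = x"
  using esystemD(5)[OF stratified_esystemD(1)[OF stratified], of "arrow E X Y" x] arrow[of X Y]
    Wk_action(1)[of X Y X] arrow_id[OF overD(1), of X Y] by (simp add: st_def dt_def tm_def)

lemma so_dt: "\<lbrakk>over E X Y; over E Z X\<rbrakk> \<Longrightarrow> so E (wo E X Y X) X (dt E X Y) (wo E X Y Z) = Z"
  and st_dt_wt: "\<lbrakk>over E X Y; over E Z W; over E W X; t \<in> tm E Z W\<rbrakk>
    \<Longrightarrow> st E (wo E X Y X) X (dt E X Y) (wo E X Y Z) (wo E X Y W) (wt E X Y Z W t) = t"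
proof -
  have e: "teq (slice E X) (Sub E (arrow E (wo E X Y X) X) (dt E X Y) \<circ>\<^sub>T
      (unnest \<circ>\<^sub>T slice_functor (Wk E (arrow E X Y)) \<circ>\<^sub>T nest E (arrow E X Y))) tid" if "over E X Y"
    using esystemD(6)[OF stratified_esystemD(1)[OF stratified], of "arrow E X Y"] arrow[OF that]
      Wk_action(1)[OF that that] by (simp add: dt_def)
  show "so E (wo E X Y X) X (dt E X Y) (wo E X Y Z) = Z" if "over E X Y" "over E Z X" for Z
    using teqD(1)[OF e[OF that(1)], of "arrow E Z X"] arrow[OF that(2)] Wk_action(4)[OF that(1,2,1)]
    by (simp add: so_def)
  show "st E (wo E X Y X) X (dt E X Y) (wo E X Y Z) (wo E X Y W) (wt E X Y Z W t) = t"
    if "over E X Y" "over E Z W" "over E W X" "t \<in> tm E Z W" for Z W t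
    using teqD(3)[OF e[OF that(1)], of "(arrow E Z W, arrow E W X)" t] arrow[OF that(2)] arrow[OF that(3)]
      arrow_comp[OF that(3) that(1)] that(4) Wk_action(4)[OF that(1,3) that(1)] Wk_action(4)[OF that(1,2) over_trans[OF that(3,1)]]
    by (simp add: wt_def st_def tm_def)
qed

end

text \<open>The homomorphism equations on slices of slices are evaluated at nested pairs of
  canonical arrows. Equal arrows have equal end points, so the equations for arrows turn into
  equations between domains (\<open>arrow_inject\<close>).\<close>

lemma thom_slice_pre_ehom:
  assumes E: "strat_esys E" and D: "strat_esys D" and X: "X \<in> Ob E" and Y: "Y \<in> Ob D"
    and F: "pre_ehom (eslice E X) (eslice D Y) F"
    and lev: "\<And>P. P \<in> Ob (slice E X) \<Longrightarrow> slice_level D (level D) Y (onO F P) = slice_level E (level E) X P"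
  shows "thom E X D Y (\<lambda>Z. Dom D (onO F (arrow E Z X))) (\<lambda>Z W. onT F (arrow E Z W, arrow E W X))"
proof -
  interpret E: strat_esys E by (rule E)
  interpret D: strat_esys D by (rule D)
  define fo where "fo Z = Dom D (onO F (arrow E Z X))" for Z
  define ht where "ht Z W = onT F (arrow E Z W, arrow E W X)" for Z W
  have tF: "is_tfunctor (slice E X) (slice D Y) F" using pre_ehomD(1)[OF F] by (simp add: is_tfunctor_eslice)
  note act = slice_functor_action[OF E D is_tfunctorD(1)[OF tF], folded fo_def]
  have base: "fo X = Y" using pre_ehomD(2)[OF F] E.arrow_id[OF X] categoryD(4)[OF D.cat Y] by (simp add: fo_def)
  have tm: "ht Z W t \<in> tm D (fo Z) (fo W)" if "over E Z W" "over E W X" "t \<in> tm E Z W" for Z W t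
    using is_tfunctorD(2)[OF tF, of "(arrow E Z W, arrow E W X)" t] E.arrow[OF that(1)] E.arrow[OF that(2)] that(3)
      act(4)[OF that(1,2)] by (simp add: tm_def ht_def)
  have ar: "(arrow E V W, arrow E W X) \<in> Ar (eslice E X)" if "over E V W" "over E W X" for V W
    using E.arrow[OF that(1)] E.arrow[OF that(2)] by simp
  have S: "teq (slice (eslice E X) (arrow E V X)) (slice_functor F \<circ>\<^sub>T nest E (arrow E W X) \<circ>\<^sub>T Sub E (arrow E V W) y \<circ>\<^sub>T unnest)
      ((nest D (arrow D (fo W) Y) \<circ>\<^sub>T Sub D (arrow D (fo V) (fo W)) (ht V W y) \<circ>\<^sub>T unnest) \<circ>\<^sub>T slice_functor F)"
    if "over E V W" "over E W X" "y \<in> tm E V W" for V W y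
    using pre_ehomD(3)[OF F ar[OF that(1,2)], of y] that(3) E.arrow_comp[OF that(1,2)] act(4)[OF that(1,2)]
    by (simp add: tm_def ht_def)
  have W: "teq (slice (eslice E X) (arrow E W X)) (slice_functor F \<circ>\<^sub>T nest E (arrow E V X) \<circ>\<^sub>T Wk E (arrow E V W) \<circ>\<^sub>T unnest)
      ((nest D (arrow D (fo V) Y) \<circ>\<^sub>T Wk D (arrow D (fo V) (fo W)) \<circ>\<^sub>T unnest) \<circ>\<^sub>T slice_functor F)"
    if "over E V W" "over E W X" for V W
    using pre_ehomD(4)[OF F ar[OF that(1,2)]] E.arrow_comp[OF that(1,2)] act(4)[OF that(1,2)]
      D.arrow_comp[OF act(3)[OF that] act(2)[OF that(2)]] by simp
  have obj: "(arrow E Z V, arrow E V X) \<in> Ob (slice (eslice E X) (arrow E V X))" if "over E Z V" "over E V X" for Z V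
    using E.arrow[OF that(1)] E.arrow[OF that(2)] by simp
  have arr: "((arrow E Z Q, arrow E Q X), (arrow E Q V, arrow E V X)) \<in> Ar (slice (eslice E X) (arrow E V X))"
    if "over E Z Q" "over E Q V" "over E V X" for Z Q V
    using E.arrow[OF that(1)] E.arrow[OF that(2)] E.arrow[OF that(3)] E.arrow_comp[OF that(2,3)]
      E.arrow[OF E.over_trans[OF that(2,3)]] by simp
  show ?thesis
    unfolding thom_def fo_def[symmetric] ht_def[symmetric]
  proof (intro conjI allI impI)
    show "X \<in> Ob E" "Y \<in> Ob D" "fo X = Y" by (fact X Y base)+
  next
    fix Z W assume "over E Z W" "over E W X"
    then show "over D (fo Z) (fo W)" by (rule act)
  next
    fix Z assume Z: "over E Z X"
    \<comment> \<open>The truncated subtractions are exact, since an object over a base has at least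
      the level of the base. This gives the additive form used in \<open>thom\<close>.\<close>
    have "level D (fo Z) - level D Y = level E Z - level E X"
      using lev[of "arrow E Z X"] E.arrow[OF Z] act(1)[OF Z] D.arrow[OF act(2)[OF Z]] by (simp add: slice_level_def)
    then show "level D (fo Z) + level E X = level E Z + level D Y"
      using E.over_level[OF Z] D.over_level[OF act(2)[OF Z]] by simp
  next
    fix Z W t assume "over E Z W" "over E W X" "t \<in> tm E Z W"
    then show "ht Z W t \<in> tm D (fo Z) (fo W)" by (rule tm)
  next
    fix V W y Z assume *: "over E V W" "over E W X" "y \<in> tm E V W" "over E Z V"
    note VX = E.over_trans[OF *(1,2)]
    note d = act(3)[OF *(1,2)] tm[OF *(1-3)] and dZ = act(3)[OF *(4) VX]
    note s = E.Sub_action[OF *(1,3)]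
    have "onA F (arrow E (so E V W y Z) W, arrow E W X)
       = (arrow D (so D (fo V) (fo W) (ht V W y) (fo Z)) (fo W), arrow D (fo W) Y)"
      using teqD(1)[OF S[OF *(1-3)] obj[OF *(4) VX]] s(1)[OF *(4)] act(4)[OF *(4) VX] D.Sub_action(1)[OF d dZ] by simp
    then have "arrow D (fo (so E V W y Z)) (fo W) = arrow D (so D (fo V) (fo W) (ht V W y) (fo Z)) (fo W)"
      using act(4)[OF s(2)[OF *(4)] *(2)] by simp
    from D.arrow_inject[OF this act(3)[OF s(2)[OF *(4)] *(2)] D.Sub_action(2)[OF d dZ]]
    show "fo (so E V W y Z) = so D (fo V) (fo W) (ht V W y) (fo Z)" by simp
  next
    fix V W y Z Q t assume *: "over E V W" "over E W X" "y \<in> tm E V W" "over E Z Q" "over E Q V" "t \<in> tm E Z Q"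
    note VX = E.over_trans[OF *(1,2)]
    note QX = E.over_trans[OF *(5) VX]
    note s = E.Sub_action[OF *(1,3)]
    show "ht (so E V W y Z) (so E V W y Q) (st E V W y Z Q t)
        = st D (fo V) (fo W) (ht V W y) (fo Z) (fo Q) (ht Z Q t)"
      using teqD(3)[OF S[OF *(1-3)] arr[OF *(4,5) VX], of t] *(6) s(4)[OF *(4,5)] E.arrow_comp[OF s(2)[OF *(5)] *(2)]
        act(4)[OF *(4) QX] act(4)[OF *(5) VX] by (simp add: tm_def ht_def st_def)
  next
    fix V W Z assume *: "over E V W" "over E W X" "over E Z W"
    note VX = E.over_trans[OF *(1,2)]
    note d = act(3)[OF *(1,2)] and dZ = act(3)[OF *(3,2)]
    note s = E.Wk_action[OF *(1)]
    have "onA F (arrow E (wo E V W Z) V, arrow E V X)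
       = (arrow D (wo D (fo V) (fo W) (fo Z)) (fo V), arrow D (fo V) Y)"
      using teqD(1)[OF W[OF *(1-2)] obj[OF *(3,2)]] s(1)[OF *(3)] act(4)[OF *(3,2)] D.Wk_action(1)[OF d dZ] by simp
    then have "arrow D (fo (wo E V W Z)) (fo V) = arrow D (wo D (fo V) (fo W) (fo Z)) (fo V)"
      using act(4)[OF s(2)[OF *(3)] VX] by simp
    from D.arrow_inject[OF this act(3)[OF s(2)[OF *(3)] VX] D.Wk_action(2)[OF d dZ]]
    show "fo (wo E V W Z) = wo D (fo V) (fo W) (fo Z)" by simp
  next
    fix V W Z Q t assume *: "over E V W" "over E W X" "over E Z Q" "over E Q W" "t \<in> tm E Z Q"
    note VX = E.over_trans[OF *(1,2)]
    note QX = E.over_trans[OF *(4,2)]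
    note s = E.Wk_action[OF *(1)]
    show "ht (wo E V W Z) (wo E V W Q) (wt E V W Z Q t) = wt D (fo V) (fo W) (fo Z) (fo Q) (ht Z Q t)"
      using teqD(3)[OF W[OF *(1-2)] arr[OF *(3,4,2)], of t] *(5) s(4)[OF *(3,4)] E.arrow_comp[OF s(2)[OF *(4)] VX]
        act(4)[OF *(3) QX] act(4)[OF *(4,2)] by (simp add: tm_def ht_def wt_def)
  next
    fix V W assume *: "over E V W" "over E W X"
    note VX = E.over_trans[OF *]
    show "ht (wo E V W V) V (dt E V W) = dt D (fo V) (fo W)"
      using pre_ehomD(5)[OF F ar[OF *]] E.Wk_action(1)[OF *(1) *(1)] E.arrow_comp[OF *] act(4)[OF *]
      by (simp add: dt_def ht_def)
  qed
qed

text \<open>Every object lies over the terminal object, so with base \<open>Top\<close> the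
  predicate for slices also describes homomorphisms between whole E-systems.\<close>

lemma thom_pre_ehom:
  assumes E: "strat_esys E" and D: "strat_esys D" and F: "pre_ehom E D F"
    and lev: "\<And>X. X \<in> Ob E \<Longrightarrow> level D (onO F X) = level E X"
  shows "thom E (Top E) D (Top D) (onO F) (\<lambda>Z W. onT F (arrow E Z W))"
    and "over E Z W \<Longrightarrow> onA F (arrow E Z W) = arrow D (onO F Z) (onO F W)"
proof -
  interpret E: strat_esys E by (rule E)
  interpret D: strat_esys D by (rule D)
  define ht where "ht Z W = onT F (arrow E Z W)" for Z W
  let ?fo = "onO F"
  note tF = pre_ehomD(1)[OF F]
  note fF = is_functorD[OF is_tfunctorD(1)[OF tF]]
  have ov: "over D (?fo Z) (?fo W)" if "over E Z W" for Z W
    unfolding over_def using fF(2-4)[of "arrow E Z W"] E.arrow[OF that] by (intro bexI[of _ "onA F (arrow E Z W)"]) simp_all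
  show act: "onA F (arrow E Z W) = arrow D (?fo Z) (?fo W)" if "over E Z W" for Z W
    using D.arrow_eq[of "onA F (arrow E Z W)" "?fo Z" "?fo W"] fF(2-4)[of "arrow E Z W"] E.arrow[OF that] by simp
  have tm: "ht Z W t \<in> tm D (?fo Z) (?fo W)" if "over E Z W" "t \<in> tm E Z W" for Z W t
    using is_tfunctorD(2)[OF tF, of "arrow E Z W" t] E.arrow[OF that(1)] that(2) act[OF that(1)]
    by (simp add: tm_def ht_def)
  have S: "teq (slice E V) (slice_functor F \<circ>\<^sub>T Sub E (arrow E V W) y)
      (Sub D (arrow D (?fo V) (?fo W)) (ht V W y) \<circ>\<^sub>T slice_functor F)"
    if "over E V W" "y \<in> tm E V W" for V W y
    using pre_ehomD(3)[OF F E.arrow(1)[OF that(1)], of y] that(2) E.arrow[OF that(1)] act[OF that(1)]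
    by (simp add: tm_def ht_def)
  have W: "teq (slice E W) (slice_functor F \<circ>\<^sub>T Wk E (arrow E V W)) (Wk D (arrow D (?fo V) (?fo W)) \<circ>\<^sub>T slice_functor F)"
    if "over E V W" for V W
    using pre_ehomD(4)[OF F E.arrow(1)[OF that(1)]] E.arrow[OF that(1)] act[OF that(1)] by simp
  have arr: "(arrow E Z Q, arrow E Q V) \<in> Ar (slice E V)" if "over E Z Q" "over E Q V" for Z Q V
    using E.arrow[OF that(1)] E.arrow[OF that(2)] by simp
  have ar: "arrow E Z Q \<in> Ob (slice E Q)" if "over E Z Q" for Z Q
    using E.arrow[OF that(1)] by simp
  show "thom E (Top E) D (Top D) (onO F) (\<lambda>Z W. onT F (arrow E Z W))"
    unfolding thom_def ht_def[symmetric]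
  proof (intro conjI allI impI)
    show "Top E \<in> Ob E" "Top D \<in> Ob D" "?fo (Top E) = Top D" by (fact E.top D.top pre_ehomD(2)[OF F])+
  next
    fix Z assume "over E Z (Top E)"
    then show "level D (?fo Z) + level E (Top E) = level E Z + level D (Top D)"
      using lev E.overD by (simp add: E.level_top D.level_top)
  next
    fix V W y Z assume *: "over E V W" "y \<in> tm E V W" "over E Z V"
    note d = ov[OF *(1)] tm[OF *(1-2)] and dZ = ov[OF *(3)]
    note s = E.Sub_action[OF *(1,2)]
    have "arrow D (?fo (so E V W y Z)) (?fo W) = arrow D (so D (?fo V) (?fo W) (ht V W y) (?fo Z)) (?fo W)"
      using teqD(1)[OF S[OF *(1-2)] ar[OF *(3)]] s(1)[OF *(3)] act[OF *(3)] D.Sub_action(1)[OF d dZ]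
        act[OF s(2)[OF *(3)]] by simp
    from D.arrow_inject[OF this ov[OF s(2)[OF *(3)]] D.Sub_action(2)[OF d dZ]]
    show "?fo (so E V W y Z) = so D (?fo V) (?fo W) (ht V W y) (?fo Z)" by simp
  next
    fix V W y Z Q t assume *: "over E V W" "y \<in> tm E V W" "over E Z Q" "over E Q V" "t \<in> tm E Z Q"
    note s = E.Sub_action[OF *(1,2)]
    show "ht (so E V W y Z) (so E V W y Q) (st E V W y Z Q t)
        = st D (?fo V) (?fo W) (ht V W y) (?fo Z) (?fo Q) (ht Z Q t)"
      using teqD(3)[OF S[OF *(1-2)] arr[OF *(3,4)], of t] *(5) s(4)[OF *(3,4)]
        act[OF *(3)] act[OF *(4)] by (simp add: tm_def ht_def st_def)
  next
    fix V W Z assume *: "over E V W" "over E Z W"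
    note d = ov[OF *(1)] and dZ = ov[OF *(2)]
    note s = E.Wk_action[OF *(1)]
    have "arrow D (?fo (wo E V W Z)) (?fo V) = arrow D (wo D (?fo V) (?fo W) (?fo Z)) (?fo V)"
      using teqD(1)[OF W[OF *(1)] ar[OF *(2)]] s(1)[OF *(2)] act[OF *(2)] D.Wk_action(1)[OF d dZ]
        act[OF s(2)[OF *(2)]] by simp
    from D.arrow_inject[OF this ov[OF s(2)[OF *(2)]] D.Wk_action(2)[OF d dZ]]
    show "?fo (wo E V W Z) = wo D (?fo V) (?fo W) (?fo Z)" by simp
  next
    fix V W Z Q t assume *: "over E V W" "over E Z Q" "over E Q W" "t \<in> tm E Z Q"
    note s = E.Wk_action[OF *(1)]
    show "ht (wo E V W Z) (wo E V W Q) (wt E V W Z Q t) = wt D (?fo V) (?fo W) (?fo Z) (?fo Q) (ht Z Q t)"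
      using teqD(3)[OF W[OF *(1)] arr[OF *(2,3)], of t] *(4) s(4)[OF *(2,3)]
        act[OF *(2)] act[OF *(3)] by (simp add: tm_def ht_def wt_def)
  next
    fix V W assume *: "over E V W"
    show "ht (wo E V W V) V (dt E V W) = dt D (?fo V) (?fo W)"
      using pre_ehomD(5)[OF F E.arrow(1)[OF *]] E.Wk_action(1)[OF * *] act[OF *]
      by (simp add: dt_def ht_def)
  qed (use ov tm in auto)
qed

text \<open>Thinness leaves no choice for the action on arrows, so suitable actions on objects and
  terms already define an E-homomorphism. It is the way back from the extension of a B-homomorphism
  to a functor.\<close>

lemma thom_stratified_ehom:
  assumes E: "strat_esys E" and D: "strat_esys D" and F: "thom E (Top E) D (Top D) ho ht"
  defines "F \<equiv> \<lparr>onO = ho, onA = \<lambda>f. arrow D (ho (Dom E f)) (ho (Cod E f)), onT = \<lambda>f. ht (Dom E f) (Cod E f)\<rparr>"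
  shows "pre_ehom E D F" "X \<in> Ob E \<Longrightarrow> level D (onO F X) = level E X"
proof -
  interpret E: strat_esys E by (rule E)
  interpret D: strat_esys D by (rule D)
  note tF = thomD[OF assms(3)]
  show "level D (onO F X) = level E X" if "X \<in> Ob E"
    using tF(5)[OF E.over_top[OF that]] by (simp add: E.level_top D.level_top F_def)
  have ov: "over D (ho Z) (ho W)" if "over E Z W" for Z W using tF(4)[OF that E.over_top] E.overD that by blast
  have tm: "ht Z W t \<in> tm D (ho Z) (ho W)" if "over E Z W" "t \<in> tm E Z W" for Z W t
    using tF(6)[OF that(1) E.over_top] E.overD that by blast
  have fO: "onO F = ho" by (simp add: F_def)
  have act: "onA F (arrow E Z W) = arrow D (ho Z) (ho W)" if "over E Z W" for Z W
    using E.arrow[OF that] by (simp add: F_def)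
  have fT: "onT F (arrow E Z W) = ht Z W" if "over E Z W" for Z W
    using E.arrow[OF that] by (simp add: F_def)
  have arE: "\<exists>Z W. f = arrow E Z W \<and> over E Z W" if "f \<in> Ar E" for f
    using E.arrow_eq[OF that] that unfolding over_def by metis
  have tfun: "is_tfunctor E D F"
    unfolding is_tfunctor_def is_functor_def
  proof (intro conjI ballI impI)
    fix X assume X: "X \<in> Ob E"
    show "onO F X \<in> Ob D" using ov[OF E.over_refl[OF X]] D.overD by (simp add: fO)
    then show "onA F (Idt E X) = Idt D (onO F X)"
      using act[OF E.over_refl[OF X]] E.arrow_id[OF X] D.arrow_id by (simp add: fO)
  next
    fix f assume f: "f \<in> Ar E"
    then obtain Z W where ZW: "f = arrow E Z W" "over E Z W" using arE by blast
    show "onA F f \<in> Ar D" "Dom D (onA F f) = onO F (Dom E f)" "Cod D (onA F f) = onO F (Cod E f)"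
      using D.arrow[OF ov[OF ZW(2)]] E.arrow[OF ZW(2)] act[OF ZW(2)] by (simp_all add: ZW(1) fO)
    fix t assume "t \<in> Tm E f"
    then show "onT F f t \<in> Tm D (onA F f)" using tm[OF ZW(2)] act[OF ZW(2)] fT[OF ZW(2)] by (simp add: ZW(1) tm_def)
  next
    fix f g assume f: "f \<in> Ar E" and g: "g \<in> Ar E" and e: "Cod E f = Dom E g"
    obtain Z W where ZW: "f = arrow E Z W" "over E Z W" using arE[OF f] by blast
    then obtain V where V: "g = arrow E W V" "over E W V" using arE[OF g] e E.arrow by metis
    show "onA F (Comp E g f) = Comp D (onA F g) (onA F f)"
      using E.arrow_comp[OF ZW(2) V(2)] D.arrow_comp[OF ov[OF ZW(2)] ov[OF V(2)]] act[OF ZW(2)] act[OF V(2)]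
        act[OF E.over_trans[OF ZW(2) V(2)]] by (simp add: ZW(1) V(1))
  qed
  \<comment> \<open>By thinness a slice over \<open>V\<close> has only objects and arrows of the
    forms displayed here, so equality of functors on it is tested on these.\<close>
  have sl: "teq (slice E V) G H"
    if ob: "\<And>Z. over E Z V \<Longrightarrow> onO G (arrow E Z V) = onO H (arrow E Z V)"
      and ar: "\<And>Z Q. \<lbrakk>over E Z Q; over E Q V\<rbrakk> \<Longrightarrow> onA G (arrow E Z Q, arrow E Q V) = onA H (arrow E Z Q, arrow E Q V)"
      and tm: "\<And>Z Q t. \<lbrakk>over E Z Q; over E Q V; t \<in> tm E Z Q\<rbrakk> \<Longrightarrow>
        onT G (arrow E Z Q, arrow E Q V) t = onT H (arrow E Z Q, arrow E Q V) t" for V and G H :: "('b, 'b \<times> 'b, 'c, 'e, 'e \<times> 'e, 'f) tftor"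
  proof -
    have obE: "\<exists>Z. A = arrow E Z V \<and> over E Z V" if "A \<in> Ob (slice E V)" for A
      using that arE[of A] E.arrow by auto
    have arE': "\<exists>Z Q. f = (arrow E Z Q, arrow E Q V) \<and> over E Z Q \<and> over E Q V" if fV: "f \<in> Ar (slice E V)" for f
    proof -
      obtain a A where f: "f = (a, A)" "A \<in> Ob (slice E V)" "a \<in> Ar E" "Cod E a = Dom E A"
        using fV by (cases f) auto
      then show ?thesis using obE[OF f(2)] arE[OF f(3)] E.arrow by metis
    qed
    show ?thesis unfolding teq_def
    proof (intro conjI ballI)
      fix A assume "A \<in> Ob (slice E V)" then show "onO G A = onO H A" using obE ob by blast
    next
      fix f assume "f \<in> Ar (slice E V)" then show "onA G f = onA H f" using arE' ar by blast
    next
      fix f t assume "f \<in> Ar (slice E V)" "t \<in> Tm (slice E V) f"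
      then show "onT G f t = onT H f t" using arE'[of f] tm by (auto simp: tm_def)
    qed
  qed
  show "pre_ehom E D F"
    unfolding pre_ehom_def
  proof (intro conjI ballI)
    show "is_tfunctor E D F" by (rule tfun)
    show "onO F (Top E) = Top D" using tF(3) by (simp add: fO)
    fix A assume A: "A \<in> Ar E"
    then obtain V W where VW: "A = arrow E V W" "over E V W" using arE by blast
    note W = E.over_top[OF E.overD(2)[OF VW(2)]]
    note aA = E.arrow[OF VW(2)] act[OF VW(2)] fT[OF VW(2)]
    {
      fix x assume "x \<in> Tm E A"
      then have x: "x \<in> tm E V W" by (simp add: VW(1) tm_def)
      note s = E.Sub_action[OF VW(2) x] and d = D.Sub_action[OF ov[OF VW(2)] tm[OF VW(2) x]]
      have "teq (slice E V) (slice_functor F \<circ>\<^sub>T Sub E A x)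
        (Sub D (arrow D (ho V) (ho W)) (ht V W x) \<circ>\<^sub>T slice_functor F)"
      proof (rule sl)
        fix Z assume Z: "over E Z V"
        show "onO (slice_functor F \<circ>\<^sub>T Sub E A x) (arrow E Z V)
          = onO (Sub D (arrow D (ho V) (ho W)) (ht V W x) \<circ>\<^sub>T slice_functor F) (arrow E Z V)"
          using s(1,2)[OF Z] d(1)[OF ov[OF Z]] act[OF Z] act[OF s(2)[OF Z]] tF(7)[OF VW(2) W x Z] by (simp add: VW(1))
      next
        fix Z Q assume Z: "over E Z Q" "over E Q V"
        note ZV = E.over_trans[OF Z]
        show "onA (slice_functor F \<circ>\<^sub>T Sub E A x) (arrow E Z Q, arrow E Q V)
          = onA (Sub D (arrow D (ho V) (ho W)) (ht V W x) \<circ>\<^sub>T slice_functor F) (arrow E Z Q, arrow E Q V)"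
          using s(4)[OF Z] d(4)[OF ov[OF Z(1)] ov[OF Z(2)]] act[OF Z(1)] act[OF Z(2)] act[OF s(3)[OF Z]] act[OF s(2)[OF Z(2)]]
            tF(7)[OF VW(2) W x ZV] tF(7)[OF VW(2) W x Z(2)] by (simp add: VW(1))
        fix t assume t: "t \<in> tm E Z Q"
        show "onT (slice_functor F \<circ>\<^sub>T Sub E A x) (arrow E Z Q, arrow E Q V) t
          = onT (Sub D (arrow D (ho V) (ho W)) (ht V W x) \<circ>\<^sub>T slice_functor F) (arrow E Z Q, arrow E Q V) t"
          using s(4)[OF Z] act[OF Z(1)] act[OF Z(2)] fT[OF Z(1)] fT[OF s(3)[OF Z]] tF(8)[OF VW(2) W x Z t]
          by (simp add: VW(1) st_def)
      qed
      then show "teq (slice E (Dom E A)) (slice_functor F \<circ>\<^sub>T Sub E A x) (Sub D (onA F A) (onT F A x) \<circ>\<^sub>T slice_functor F)"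
        using aA by (simp add: VW(1))
    }
    note s = E.Wk_action[OF VW(2)] and d = D.Wk_action[OF ov[OF VW(2)]]
    have "teq (slice E W) (slice_functor F \<circ>\<^sub>T Wk E A) (Wk D (arrow D (ho V) (ho W)) \<circ>\<^sub>T slice_functor F)"
    proof (rule sl)
      fix Z assume Z: "over E Z W"
      show "onO (slice_functor F \<circ>\<^sub>T Wk E A) (arrow E Z W)
        = onO (Wk D (arrow D (ho V) (ho W)) \<circ>\<^sub>T slice_functor F) (arrow E Z W)"
        using s(1,2)[OF Z] d(1)[OF ov[OF Z]] act[OF Z] act[OF s(2)[OF Z]] tF(9)[OF VW(2) W Z] by (simp add: VW(1))
    next
      fix Z Q assume Z: "over E Z Q" "over E Q W"
      note ZV = E.over_trans[OF Z]
      show "onA (slice_functor F \<circ>\<^sub>T Wk E A) (arrow E Z Q, arrow E Q W)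
        = onA (Wk D (arrow D (ho V) (ho W)) \<circ>\<^sub>T slice_functor F) (arrow E Z Q, arrow E Q W)"
        using s(4)[OF Z] d(4)[OF ov[OF Z(1)] ov[OF Z(2)]] act[OF Z(1)] act[OF Z(2)] act[OF s(3)[OF Z]] act[OF s(2)[OF Z(2)]]
          tF(9)[OF VW(2) W ZV] tF(9)[OF VW(2) W Z(2)] by (simp add: VW(1))
      fix t assume t: "t \<in> tm E Z Q"
      show "onT (slice_functor F \<circ>\<^sub>T Wk E A) (arrow E Z Q, arrow E Q W) t
        = onT (Wk D (arrow D (ho V) (ho W)) \<circ>\<^sub>T slice_functor F) (arrow E Z Q, arrow E Q W) t"
        using s(4)[OF Z] act[OF Z(1)] act[OF Z(2)] fT[OF Z(1)] fT[OF s(3)[OF Z]] tF(10)[OF VW(2) W Z t]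
        by (simp add: VW(1) wt_def)
    qed
    then show "teq (slice E (Cod E A)) (slice_functor F \<circ>\<^sub>T Wk E A) (Wk D (onA F A) \<circ>\<^sub>T slice_functor F)"
      using aA by (simp add: VW(1))
    show "onT F (onO (Wk E A) A) (idtm E A) = idtm D (onA F A)"
      using tF(11)[OF VW(2) W] s(1,2)[OF VW(2)] fT[of "wo E V W V" V] aA by (simp add: VW(1) dt_def)
  qed
qed

lemma thom_comp:
  assumes E: "strat_esys E" and h: "thom E X D Y ho ht" and g: "thom D Y C Z go gt"
  shows "thom E X C Z (\<lambda>V. go (ho V)) (\<lambda>V W t. gt (ho V) (ho W) (ht V W t))"
proof -
  interpret E: strat_esys E by (rule E)
  note h = thomD[OF h] and g = thomD[OF g]
  have h': "over D (ho W) Y" if "over E W X" for W using h(4)[OF that E.over_refl[OF h(1)]] h(3) by simp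
  show ?thesis
    unfolding thom_def
  proof (intro conjI allI impI)
    fix V assume V: "over E V X"
    show "level C (go (ho V)) + level E X = level E V + level C Z" using h(5)[OF V] g(5)[OF h'[OF V]] by simp
  next
    fix V W y Z assume *: "over E V W" "over E W X" "y \<in> tm E V W" "over E Z V"
    note ZV = h(4)[OF *(4) E.over_trans[OF *(1,2)]]
    show "go (ho (so E V W y Z)) = so C (go (ho V)) (go (ho W)) (gt (ho V) (ho W) (ht V W y)) (go (ho Z))"
      using h(7)[OF *] g(7)[OF h(4)[OF *(1,2)] h'[OF *(2)] h(6)[OF *(1-3)] ZV] by simp
  next
    fix V W y Z Q t assume *: "over E V W" "over E W X" "y \<in> tm E V W" "over E Z Q" "over E Q V" "t \<in> tm E Z Q"
    note VX = E.over_trans[OF *(1,2)]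
    note QX = E.over_trans[OF *(5) VX]
    show "gt (ho (so E V W y Z)) (ho (so E V W y Q)) (ht (so E V W y Z) (so E V W y Q) (st E V W y Z Q t))
      = st C (go (ho V)) (go (ho W)) (gt (ho V) (ho W) (ht V W y)) (go (ho Z)) (go (ho Q)) (gt (ho Z) (ho Q) (ht Z Q t))"
      using h(8)[OF *] h(7)[OF *(1-3) E.over_trans[OF *(4,5)]] h(7)[OF *(1-3,5)]
        g(8)[OF h(4)[OF *(1,2)] h'[OF *(2)] h(6)[OF *(1-3)] h(4)[OF *(4) QX] h(4)[OF *(5) VX] h(6)[OF *(4) QX *(6)]] by simp
  next
    fix V W Z assume *: "over E V W" "over E W X" "over E Z W"
    show "go (ho (wo E V W Z)) = wo C (go (ho V)) (go (ho W)) (go (ho Z))"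
      using h(9)[OF *] g(9)[OF h(4)[OF *(1,2)] h'[OF *(2)] h(4)[OF *(3,2)]] by simp
  next
    fix V W Z Q t assume *: "over E V W" "over E W X" "over E Z Q" "over E Q W" "t \<in> tm E Z Q"
    note QX = E.over_trans[OF *(4,2)]
    show "gt (ho (wo E V W Z)) (ho (wo E V W Q)) (ht (wo E V W Z) (wo E V W Q) (wt E V W Z Q t))
      = wt C (go (ho V)) (go (ho W)) (go (ho Z)) (go (ho Q)) (gt (ho Z) (ho Q) (ht Z Q t))"
      using h(10)[OF *] h(9)[OF *(1,2) E.over_trans[OF *(3,4)]] h(9)[OF *(1,2,4)]
        g(10)[OF h(4)[OF *(1,2)] h'[OF *(2)] h(4)[OF *(3) QX] h(4)[OF *(4,2)] h(6)[OF *(3) QX *(5)]] by simp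
  next
    fix V W assume *: "over E V W" "over E W X"
    show "gt (ho (wo E V W V)) (ho V) (ht (wo E V W V) V (dt E V W)) = dt C (go (ho V)) (go (ho W))"
      using h(11)[OF *] h(9)[OF * *(1)] g(11)[OF h(4)[OF *] h'[OF *(2)]] by simp
  qed (use h g h' in auto)
qed

text \<open>All conditions are restricted to objects over \<open>V\<close>; the level condition with
  the new base is the difference of two instances of the old one.\<close>

lemma thom_slice:
  assumes E: "strat_esys E" and D: "strat_esys D" and h: "thom E X D Y ho ht" and V: "over E V X"
  shows "thom E V D (ho V) ho ht"
proof -
  interpret E: strat_esys E by (rule E)
  interpret D: strat_esys D by (rule D)
  note h = thomD[OF h]
  have o: "over E W X" if "over E W V" for W using E.over_trans[OF that V] .
  have V': "over D (ho V) Y" using h(4)[OF V E.over_refl[OF h(1)]] h(3) by simp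
  show ?thesis
    unfolding thom_def
  proof (intro conjI allI impI)
    show "V \<in> Ob E" "ho V \<in> Ob D" using E.overD[OF V] D.overD[OF V'] by auto
    fix Z assume Z: "over E Z V"
    show "level D (ho Z) + level E V = level E Z + level D (ho V)" using h(5)[OF V] h(5)[OF o[OF Z]] by simp
  qed (simp_all add: h o)
qed

section \<open>Substitutions as the left inverses of weakening, and terms of identities\<close>

context strat_esys
begin

lemma thom_so:
  assumes "over E X Y" "x \<in> tm E X Y"
  shows "thom E X E Y (so E X Y x) (st E X Y x)"
proof -
  have P: "pre_ehom (eslice E X) (eslice E Y) (Sub E (arrow E X Y) x)"
    using esystemD(2)[OF stratified_esystemD(1)[OF stratified], of "arrow E X Y" x] arrow[OF assms(1)] assms(2)
    by (simp add: tm_def)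
  show ?thesis
    using thom_slice_pre_ehom[OF E_strat_esys E_strat_esys overD[OF assms(1)] P]
      stratified_esystemD(6)[OF stratified, of "arrow E X Y" x] arrow[OF assms(1)] assms(2)
    by (simp add: tm_def so_def[abs_def] st_def[abs_def])
qed

lemma thom_wo:
  assumes "over E X Y"
  shows "thom E Y E X (wo E X Y) (wt E X Y)"
proof -
  have P: "pre_ehom (eslice E Y) (eslice E X) (Wk E (arrow E X Y))"
    using esystemD(3)[OF stratified_esystemD(1)[OF stratified], of "arrow E X Y"] arrow[OF assms(1)] by simp
  show ?thesis
    using thom_slice_pre_ehom[OF E_strat_esys E_strat_esys overD(2,1)[OF assms(1)] P]
      stratified_esystemD(7)[OF stratified, of "arrow E X Y"] arrow[OF assms(1)]
    by (simp add: wo_def[abs_def] wt_def[abs_def])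
qed

lemmas so_thom = thomD[OF thom_so]
lemmas wo_thom = thomD[OF thom_wo]

text \<open>Since \<open>S\<^sub>x\<close> for \<open>x = H(idtm\<^sub>A)\<close> composed with \<open>W\<^sub>A/A\<close> is \<open>H \<circ> S\<^bsub>idtm\<^esub> \<circ> (W\<^sub>A/A) = H\<close>, every
  homomorphism \<open>H\<close> that is a left inverse of \<open>W\<^sub>A\<close> is a substitution.\<close>

lemma left_inverse_of_weakening:
  assumes H: "thom E X E Y ho ht" and XY: "over E X Y"
    and 1: "\<And>V. over E V Y \<Longrightarrow> ho (wo E X Y V) = V"
    and 2: "\<And>V W t. \<lbrakk>over E V W; over E W Y; t \<in> tm E V W\<rbrakk> \<Longrightarrow> ht (wo E X Y V) (wo E X Y W) (wt E X Y V W t) = t"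
  defines "x \<equiv> ht (wo E X Y X) X (dt E X Y)"
  shows "x \<in> tm E X Y"
    and "over E V X \<Longrightarrow> ho V = so E X Y x V"
    and "\<lbrakk>over E V W; over E W X; t \<in> tm E V W\<rbrakk> \<Longrightarrow> ht V W t = st E X Y x V W t"
proof -
  note h = thomD[OF H]
  note W = wo_thom[OF XY]
  have wX: "over E (wo E X Y X) X" using Wk_action(2)[OF XY XY] .
  have XX: "over E X X" using over_refl h(1) .
  show "x \<in> tm E X Y" using h(6)[OF wX XX dt_tm[OF XY]] 1[OF XY] h(3) by (simp add: x_def)
  show "ho V = so E X Y x V" if V: "over E V X" for V
  proof -
    have "ho (so E (wo E X Y X) X (dt E X Y) (wo E X Y V)) = so E (ho (wo E X Y X)) (ho X) x (ho (wo E X Y V))"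
      unfolding x_def by (rule h(7)[OF wX XX dt_tm[OF XY] W(4)[OF V XY]])
    then show ?thesis using so_dt[OF XY V] 1[OF XY] 1[OF over_trans[OF V XY]] h(3) by simp
  qed
  show "ht V W t = st E X Y x V W t" if *: "over E V W" "over E W X" "t \<in> tm E V W" for V W t
  proof -
    note WY = over_trans[OF *(2) XY]
    have "ht (so E (wo E X Y X) X (dt E X Y) (wo E X Y V)) (so E (wo E X Y X) X (dt E X Y) (wo E X Y W))
        (st E (wo E X Y X) X (dt E X Y) (wo E X Y V) (wo E X Y W) (wt E X Y V W t))
      = st E (ho (wo E X Y X)) (ho X) x (ho (wo E X Y V)) (ho (wo E X Y W)) (ht (wo E X Y V) (wo E X Y W) (wt E X Y V W t))"
      unfolding x_def by (rule h(8)[OF wX XX dt_tm[OF XY] W(4)[OF *(1) WY] W(4)[OF *(2) XY] W(6)[OF *(1) WY *(3)]])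
    then show ?thesis
      using so_dt[OF XY over_trans[OF *(1,2)]] so_dt[OF XY *(2)] st_dt_wt[OF XY *] 1[OF XY] 1[OF WY]
        1[OF over_trans[OF *(1) WY]] 2[OF *(1) WY *(3)] h(3) by simp
  qed
qed

text \<open>Weakening by an identity is the identity, so the law S_x W_A = id leaves S_x =
  id.\<close>

lemma so_id: "\<lbrakk>x \<in> tm E X X; over E Z X\<rbrakk> \<Longrightarrow> so E X X x Z = Z"
  using so_wo[of X X x Z] wo_id[of Z X] over_refl[OF overD(2)[of Z X]] by simp

lemma st_id: "\<lbrakk>x \<in> tm E X X; over E Z W; over E W X; t \<in> tm E Z W\<rbrakk> \<Longrightarrow> st E X X x Z W t = t"
  using st_wt[of X X x Z W t] wo_id[of Z X] wo_id[of W X] wt_id[of Z W X t] over_refl[OF overD(2)[of W X]]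
    over_trans[of Z W X] by simp

lemma dt_id: "X \<in> Ob E \<Longrightarrow> dt E X X \<in> tm E X X"
  using dt_tm[of X X] wo_id[of X X] over_refl by simp

text \<open>Since S_x is the identity, the law that S_x sends the generic term to \<open>x\<close>
  says that \<open>x\<close> is the generic term. These are the empty tuples at which the recursion
  on length ends.\<close>

lemma tm_id:
  assumes "X \<in> Ob E" shows "tm E X X = {dt E X X}"
proof -
  have "x = dt E X X" if "x \<in> tm E X X" for x
    using st_dt[OF over_refl[OF assms] that] st_id[OF that over_refl[OF assms] over_refl[OF assms] dt_id[OF assms]]
      wo_id[OF over_refl[OF assms]] by simp
  then show ?thesis using dt_id[OF assms] by blast
qed

end

text \<open>For \<open>A : Y \<rightarrow> Z\<close> and \<open>P : X \<rightarrow> Y\<close> these are \<open>S\<^sub>u(S\<^sub>x(idtm))\<close> for the generic term of \<open>A.P\<close>,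
  \<open>S\<^sub>t(W\<^sub>P(idtm\<^sub>A))\<close> and \<open>S\<^sub>t(idtm\<^sub>P)\<close>.\<close>

definition pair :: "('o, 'm, 't) esys \<Rightarrow> 'o \<Rightarrow> 'o \<Rightarrow> 'o \<Rightarrow> 't \<Rightarrow> 't \<Rightarrow> 't" where
  "pair E X Y Z x u = st E (so E Y Z x X) Z u (so E Y Z x (wo E X Z X)) (so E Y Z x X)
     (st E Y Z x (wo E X Z X) X (dt E X Z))"

definition pr0 :: "('o, 'm, 't) esys \<Rightarrow> 'o \<Rightarrow> 'o \<Rightarrow> 'o \<Rightarrow> 't \<Rightarrow> 't" where
  "pr0 E X Y Z t = st E X Z t (wo E X Z Y) X (wt E X Y (wo E Y Z Y) Y (dt E Y Z))"

definition pr1 :: "('o, 'm, 't) esys \<Rightarrow> 'o \<Rightarrow> 'o \<Rightarrow> 'o \<Rightarrow> 't \<Rightarrow> 't" where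
  "pr1 E X Y Z t = st E X Z t (wo E X Y X) X (dt E X Y)"

section \<open>Pairs of terms along a composite arrow A.P, with \<open>P\<close> from
  \<open>X\<close> to \<open>Y\<close> and \<open>A\<close> from \<open>Y\<close> to
  \<open>Z\<close>\<close>

locale tower = strat_esys +
  fixes X Y Z assumes XY: "over E X Y" and YZ: "over E Y Z"
begin

lemma XZ: "over E X Z" using over_trans[OF XY YZ] .

lemma XX: "over E X X" and YY: "over E Y Y" and ZZ: "over E Z Z"
  using over_refl overD XY YZ by blast+

lemmas WYZ = wo_thom[OF YZ] and WXY = wo_thom[OF XY] and WXZ = wo_thom[OF XZ]

text \<open>S_t W_P is a left inverse of W_A, because W_P W_A = W_{A.P}. So it is the substitution
  by its value at idtm_A, and this value is the first component.\<close>

lemma pr0: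
  assumes t: "t \<in> tm E X Z"
  shows "pr0 E X Y Z t \<in> tm E Y Z"
    and "over E V Y \<Longrightarrow> so E Y Z (pr0 E X Y Z t) V = so E X Z t (wo E X Y V)"
    and "\<lbrakk>over E V W; over E W Y; s \<in> tm E V W\<rbrakk> \<Longrightarrow>
      st E Y Z (pr0 E X Y Z t) V W s = st E X Z t (wo E X Y V) (wo E X Y W) (wt E X Y V W s)"
proof -
  let ?ho = "\<lambda>V. so E X Z t (wo E X Y V)"
    and ?ht = "\<lambda>V W s. st E X Z t (wo E X Y V) (wo E X Y W) (wt E X Y V W s)"
  have H: "thom E Y E Z ?ho ?ht" by (rule thom_comp[OF E_strat_esys thom_wo[OF XY] thom_so[OF XZ t]])
  have 1: "?ho (wo E Y Z V) = V" if "over E V Z" for V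
    using wo_comp[OF XY YZ that] so_wo[OF XZ t that] by simp
  have 2: "?ht (wo E Y Z V) (wo E Y Z W) (wt E Y Z V W s) = s" if "over E V W" "over E W Z" "s \<in> tm E V W" for V W s
    using wo_comp[OF XY YZ that(2)] wo_comp[OF XY YZ over_trans[OF that(1,2)]] wt_comp[OF XY YZ that] st_wt[OF XZ t that]
    by simp
  have p: "pr0 E X Y Z t = ?ht (wo E Y Z Y) Y (dt E Y Z)"
    using wo_comp[OF XY YZ YZ] wo_base[OF XY] by (simp add: pr0_def)
  note L = left_inverse_of_weakening[OF H YZ 1 2, folded p]
  show "pr0 E X Y Z t \<in> tm E Y Z" using L(1) .
  show "over E V Y \<Longrightarrow> so E Y Z (pr0 E X Y Z t) V = so E X Z t (wo E X Y V)" using L(2) by simp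
  show "\<lbrakk>over E V W; over E W Y; s \<in> tm E V W\<rbrakk> \<Longrightarrow>
      st E Y Z (pr0 E X Y Z t) V W s = st E X Z t (wo E X Y V) (wo E X Y W) (wt E X Y V W s)" using L(3) by simp
qed

text \<open>The generic term of \<open>P\<close> is a term of W_P(P), and S_t W_P is substitution by
  the first component \<open>x\<close>; the image of this term under S_t is thus a term of
  S_x(P).\<close>

lemma pr1:
  assumes t: "t \<in> tm E X Z"
  shows "pr1 E X Y Z t \<in> tm E (so E Y Z (pr0 E X Y Z t) X) Z"
  using so_thom(6)[OF XZ t Wk_action(2)[OF XY XY] XX dt_tm[OF XY]] so_base[OF XZ t] pr0(2)[OF t XY] by (simp add: pr1_def)

text \<open>S_x turns a weakening by \<open>P\<close> into one by S_x(P) while it cancels W_A; S_u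
  then cancels the weakening by S_x(P). So S_u S_x is a left inverse of W_{A.P}, hence the
  substitution by its value at idtm_{A.P}.\<close>

lemma pair:
  assumes x: "x \<in> tm E Y Z" and u: "u \<in> tm E (so E Y Z x X) Z"
  shows "pair E X Y Z x u \<in> tm E X Z"
    and "over E V X \<Longrightarrow> so E X Z (pair E X Y Z x u) V = so E (so E Y Z x X) Z u (so E Y Z x V)"
    and "\<lbrakk>over E V W; over E W X; s \<in> tm E V W\<rbrakk> \<Longrightarrow>
      st E X Z (pair E X Y Z x u) V W s
        = st E (so E Y Z x X) Z u (so E Y Z x V) (so E Y Z x W) (st E Y Z x V W s)"
proof -
  let ?X = "so E Y Z x X"
  let ?ho = "\<lambda>V. so E ?X Z u (so E Y Z x V)"
    and ?ht = "\<lambda>V W s. st E ?X Z u (so E Y Z x V) (so E Y Z x W) (st E Y Z x V W s)"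
  note S = so_thom[OF YZ x] and bS = so_base[OF YZ x]
  have XZ': "over E ?X Z" using S(4)[OF XY YY] bS by simp
  have H: "thom E X E Z ?ho ?ht"
    by (rule thom_comp[OF E_strat_esys thom_slice[OF E_strat_esys E_strat_esys thom_so[OF YZ x] XY] thom_so[OF XZ' u]])
  have 1: "?ho (wo E X Z V) = V" if V: "over E V Z" for V
  proof -
    have "so E Y Z x (wo E X Y (wo E Y Z V)) = wo E ?X Z V"
      using S(9)[OF XY YY Wk_action(2)[OF YZ V]] bS so_wo[OF YZ x V] by simp
    then show ?thesis using wo_comp[OF XY YZ V] so_wo[OF XZ' u V] by simp
  qed
  have 2: "?ht (wo E X Z V) (wo E X Z W) (wt E X Z V W s) = s" if VW: "over E V W" "over E W Z" "s \<in> tm E V W" for V W s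
  proof -
    note VZ = over_trans[OF VW(1,2)]
    have e: "so E Y Z x (wo E X Y (wo E Y Z V)) = wo E ?X Z V" if "over E V Z" for V
      using S(9)[OF XY YY Wk_action(2)[OF YZ that]] bS so_wo[OF YZ x that] by simp
    have "st E Y Z x (wo E X Y (wo E Y Z V)) (wo E X Y (wo E Y Z W)) (wt E X Y (wo E Y Z V) (wo E Y Z W) (wt E Y Z V W s))
       = wt E ?X Z V W s"
      using S(10)[OF XY YY WYZ(4)[OF VW(1,2)] Wk_action(2)[OF YZ VW(2)] WYZ(6)[OF VW]] bS so_wo[OF YZ x VZ]
        so_wo[OF YZ x VW(2)] st_wt[OF YZ x VW] by simp
    then show ?thesis
      using wo_comp[OF XY YZ VZ] wo_comp[OF XY YZ VW(2)] wt_comp[OF XY YZ VW] e[OF VZ] e[OF VW(2)] st_wt[OF XZ' u VW] by simp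
  qed
  have p: "pair E X Y Z x u = ?ht (wo E X Z X) X (dt E X Z)" by (simp add: pair_def)
  note L = left_inverse_of_weakening[OF H XZ 1 2, folded p]
  show "pair E X Y Z x u \<in> tm E X Z" using L(1) .
  show "over E V X \<Longrightarrow> so E X Z (pair E X Y Z x u) V = so E (so E Y Z x X) Z u (so E Y Z x V)" using L(2) by simp
  show "\<lbrakk>over E V W; over E W X; s \<in> tm E V W\<rbrakk> \<Longrightarrow>
      st E X Z (pair E X Y Z x u) V W s
        = st E (so E Y Z x X) Z u (so E Y Z x V) (so E Y Z x W) (st E Y Z x V W s)" using L(3) by simp
qed

text \<open>Here S_x is S_t W_P. As u = S_t(idtm_P), applying S_u after S_t amounts to applying S_t
  after substitution by idtm_P, and the latter cancels W_P. What remains of the pair is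
  S_t(idtm_{A.P}) = t.\<close>

lemma pair_pr:
  assumes t: "t \<in> tm E X Z"
  shows "pair E X Y Z (pr0 E X Y Z t) (pr1 E X Y Z t) = t"
proof -
  let ?x = "pr0 E X Y Z t" and ?u = "pr1 E X Y Z t" and ?V = "wo E X Y (wo E X Z X)" and ?W = "wo E X Y X"
  let ?d = "wt E X Y (wo E X Z X) X (dt E X Z)"
  note p = pr0[OF t]
  have wX: "over E (wo E X Z X) X" using Wk_action(2)[OF XZ XZ] .
  have W: "over E ?W X" using Wk_action(2)[OF XY XY] .
  have V: "over E ?V ?W" using WXY(4)[OF wX XY] .
  have d: "?d \<in> tm E ?V ?W" using WXY(6)[OF wX XY dt_tm[OF XZ]] .
  have 0: "so E Y Z ?x X = so E X Z t ?W" "so E Y Z ?x (wo E X Z X) = so E X Z t ?V"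
    using p(2)[OF XY] p(2)[OF over_trans[OF wX XY]] by auto
  have 1: "st E Y Z ?x (wo E X Z X) X (dt E X Z) = st E X Z t ?V ?W ?d" using p(3)[OF wX XY dt_tm[OF XZ]] .
  have "pair E X Y Z ?x ?u = st E (so E X Z t ?W) Z ?u (so E X Z t ?V) (so E X Z t ?W) (st E X Z t ?V ?W ?d)"
    by (simp add: pair_def 0 1)
  also have "\<dots> = st E X Z t (so E ?W X (dt E X Y) ?V) (so E ?W X (dt E X Y) ?W) (st E ?W X (dt E X Y) ?V ?W ?d)"
    using so_thom(8)[OF XZ t W XX dt_tm[OF XY] V over_refl[OF overD(1)[OF W]] d] so_base[OF XZ t] by (simp add: pr1_def)
  also have "\<dots> = st E X Z t (wo E X Z X) X (dt E X Z)"
    using so_dt[OF XY wX] so_dt[OF XY XX] st_dt_wt[OF XY wX XX dt_tm[OF XZ]] by simp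
  also have "\<dots> = t" using st_dt[OF XZ t] .
  finally show ?thesis .
qed

text \<open>S_x takes W_P(idtm_A) to the weakening by S_x(P) of S_x(idtm_A) = x, which S_u undoes.
  It takes idtm_P to the generic term of S_x(P), which S_u sends to \<open>u\<close>.\<close>

lemma pr_pair:
  assumes x: "x \<in> tm E Y Z" and u: "u \<in> tm E (so E Y Z x X) Z"
  shows "pr0 E X Y Z (pair E X Y Z x u) = x" "pr1 E X Y Z (pair E X Y Z x u) = u"
proof -
  let ?X = "so E Y Z x X"
  note p = pair[OF x u]
  note S = so_thom[OF YZ x] and bS = so_base[OF YZ x]
  have XZ': "over E ?X Z" using S(4)[OF XY YY] bS by simp
  have wY: "over E (wo E Y Z Y) Y" using Wk_action(2)[OF YZ YZ] .
  have w: "over E (wo E X Y (wo E Y Z Y)) X" using WXY(4)[OF wY YY] wo_base[OF XY] by simp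
  have d: "wt E X Y (wo E Y Z Y) Y (dt E Y Z) \<in> tm E (wo E X Y (wo E Y Z Y)) X"
    using WXY(6)[OF wY YY dt_tm[OF YZ]] wo_base[OF XY] by simp
  have "pr0 E X Y Z (pair E X Y Z x u)
    = st E ?X Z u (so E Y Z x (wo E X Y (wo E Y Z Y))) (so E Y Z x X)
        (st E Y Z x (wo E X Y (wo E Y Z Y)) X (wt E X Y (wo E Y Z Y) Y (dt E Y Z)))"
    using p(3)[OF w XX d] wo_comp[OF XY YZ YZ] by (simp add: pr0_def)
  also have "st E Y Z x (wo E X Y (wo E Y Z Y)) X (wt E X Y (wo E Y Z Y) Y (dt E Y Z))
    = wt E ?X Z (so E Y Z x (wo E Y Z Y)) Z (st E Y Z x (wo E Y Z Y) Y (dt E Y Z))"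
    using S(10)[OF XY YY wY YY dt_tm[OF YZ]] bS wo_base[OF XY] by simp
  also have "so E Y Z x (wo E Y Z Y) = Y" using so_wo[OF YZ x YZ] .
  also have "st E Y Z x (wo E Y Z Y) Y (dt E Y Z) = x" using st_dt[OF YZ x] .
  also have "so E Y Z x (wo E X Y (wo E Y Z Y)) = wo E ?X Z Y"
    using S(9)[OF XY YY wY] bS so_wo[OF YZ x YZ] by simp
  also have "so E Y Z x X = wo E ?X Z Z" using wo_base[OF XZ'] by simp
  finally show "pr0 E X Y Z (pair E X Y Z x u) = x"
    using st_wt[OF XZ' u YZ ZZ x] wo_base[OF XZ'] by simp
  have "pr1 E X Y Z (pair E X Y Z x u)
    = st E ?X Z u (so E Y Z x (wo E X Y X)) ?X (st E Y Z x (wo E X Y X) X (dt E X Y))"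
    using p(3)[OF Wk_action(2)[OF XY XY] XX dt_tm[OF XY]] by (simp add: pr1_def)
  also have "\<dots> = u" using S(11)[OF XY YY] S(9)[OF XY YY XY] bS st_dt[OF XZ' u] by simp
  finally show "pr1 E X Y Z (pair E X Y Z x u) = u" .
qed

lemma wo_tower: "over E (wo E X Z X) (wo E X Z Y)" "over E (wo E X Z Y) X"
  using WXZ(4)[OF XY YZ] Wk_action(2)[OF XZ YZ] by auto

text \<open>The generic term lives on the weakened tower W_{A.P}(A.P) over W_{A.P}(A) over
  \<open>X\<close>. The terms substituted into are images under W_{A.P} there, and substitution by
  idtm_{A.P} cancels this weakening by the last E-system axiom.\<close>

lemma dt_pair:
  shows "pr0 E (wo E X Z X) (wo E X Z Y) X (dt E X Z) = wt E X Y (wo E Y Z Y) Y (dt E Y Z)"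
    and "pr1 E (wo E X Z X) (wo E X Z Y) X (dt E X Z) = dt E X Y"
proof -
  let ?X = "wo E X Z X" and ?Y = "wo E X Z Y" and ?T = "dt E X Z"
  have wY: "over E (wo E Y Z Y) Y" using Wk_action(2)[OF YZ YZ] .
  have w: "over E (wo E X Y (wo E Y Z Y)) X" using WXY(4)[OF wY YY] wo_base[OF XY] by simp
  let ?d = "wt E X Y (wo E Y Z Y) Y (dt E Y Z)"
  have d: "?d \<in> tm E (wo E X Y (wo E Y Z Y)) X"
    using WXY(6)[OF wY YY dt_tm[OF YZ]] wo_base[OF XY] by simp
  have bX: "wo E X Z Z = X" using wo_base[OF XZ] .
  have 1: "dt E ?Y X = wt E X Z (wo E Y Z Y) Y (dt E Y Z)" using WXZ(11)[OF YZ ZZ] bX by simp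
  have 2: "wo E ?Y X ?Y = wo E X Z (wo E Y Z Y)" using WXZ(9)[OF YZ ZZ YZ] bX by simp
  have 3: "wt E ?X ?Y (wo E X Z (wo E Y Z Y)) ?Y (wt E X Z (wo E Y Z Y) Y (dt E Y Z))
    = wt E X Z (wo E X Y (wo E Y Z Y)) X ?d"
    using WXZ(10)[OF XY YZ wY YY dt_tm[OF YZ]] wo_base[OF XY] by simp
  have 4: "wo E ?X X ?Y = wo E X Z (wo E X Y (wo E Y Z Y))"
    using WXZ(9)[OF XZ ZZ YZ] bX wo_comp[OF XY YZ YZ] by simp
  have "pr0 E ?X ?Y X ?T = st E ?X X ?T (wo E X Z (wo E X Y (wo E Y Z Y))) ?X (wt E X Z (wo E X Y (wo E Y Z Y)) X ?d)"
    by (simp add: pr0_def 1 2 3 4)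
  also have "\<dots> = ?d" using st_dt_wt[OF XZ w XX d] .
  finally show "pr0 E ?X ?Y X ?T = ?d" .
  have wX: "over E (wo E X Y X) X" using Wk_action(2)[OF XY XY] .
  have "pr1 E ?X ?Y X ?T = st E ?X X ?T (wo E X Z (wo E X Y X)) ?X (wt E X Z (wo E X Y X) X (dt E X Y))"
    using WXZ(11)[OF XY YZ] WXZ(9)[OF XY YZ XY] by (simp add: pr1_def)
  also have "\<dots> = dt E X Y" using st_dt_wt[OF XZ wX XX dt_tm[OF XY]] .
  finally show "pr1 E ?X ?Y X ?T = dt E X Y" .
qed

lemma hom_pair:
  assumes D: "strat_esys D" and H: "thom E B D B' ho ht" and ZB: "over E Z B"
    and x: "x \<in> tm E Y Z" and u: "u \<in> tm E (so E Y Z x X) Z"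
  shows "ht X Z (pair E X Y Z x u)
    = pair D (ho X) (ho Y) (ho Z) (ht Y Z x) (ht (so E Y Z x X) Z u)"
proof -
  let ?X = "so E Y Z x X"
  note h = thomD[OF H]
  note S = so_thom[OF YZ x] and bS = so_base[OF YZ x]
  have XZ': "over E ?X Z" using S(4)[OF XY YY] bS by simp
  have wX: "over E (wo E X Z X) X" using Wk_action(2)[OF XZ XZ] .
  note YB = over_trans[OF YZ ZB]
  have s1: "over E (so E Y Z x (wo E X Z X)) ?X" using S(4)[OF wX XY] .
  have s2: "st E Y Z x (wo E X Z X) X (dt E X Z) \<in> tm E (so E Y Z x (wo E X Z X)) ?X"
    using S(6)[OF wX XY dt_tm[OF XZ]] .
  note u1 = so_wo[OF XZ' u]
  \<comment> \<open>\<open>e1\<close> and \<open>e2\<close> bring the end points back: S_u S_x sends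
    the weakening of \<open>X\<close> to \<open>X\<close>, and \<open>X\<close> to \<open>Z\<close>,
    so compatibility of \<open>ht\<close> with substitution yields a statement about a term from
    \<open>X\<close> to \<open>Z\<close>.\<close>
  have e1: "so E ?X Z u ?X = Z" using so_base[OF XZ' u] .
  have "so E Y Z x (wo E X Y (wo E Y Z X)) = wo E ?X Z X"
    using S(9)[OF XY YY Wk_action(2)[OF YZ XZ]] bS so_wo[OF YZ x XZ] by simp
  then have e2: "so E ?X Z u (so E Y Z x (wo E X Z X)) = X" using wo_comp[OF XY YZ XZ] so_wo[OF XZ' u XZ] by simp
  have "ht X Z (pair E X Y Z x u) = st D (ho ?X) (ho Z) (ht ?X Z u) (ho (so E Y Z x (wo E X Z X))) (ho ?X)
      (ht (so E Y Z x (wo E X Z X)) ?X (st E Y Z x (wo E X Z X) X (dt E X Z)))"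
    using h(8)[OF XZ' ZB u s1 over_refl[OF overD(1)[OF XZ']] s2] by (simp add: pair_def e1 e2)
  also have "ht (so E Y Z x (wo E X Z X)) ?X (st E Y Z x (wo E X Z X) X (dt E X Z))
    = st D (ho Y) (ho Z) (ht Y Z x) (ho (wo E X Z X)) (ho X) (ht (wo E X Z X) X (dt E X Z))"
    using h(8)[OF YZ ZB x wX XY dt_tm[OF XZ]] .
  also have "ht (wo E X Z X) X (dt E X Z) = dt D (ho X) (ho Z)" using h(11)[OF XZ ZB] .
  also have "ho (so E Y Z x (wo E X Z X)) = so D (ho Y) (ho Z) (ht Y Z x) (ho (wo E X Z X))"
    using h(7)[OF YZ ZB x over_trans[OF wX XY]] .
  also have "ho (wo E X Z X) = wo D (ho X) (ho Z) (ho X)" using h(9)[OF XZ ZB XZ] .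
  also have "ho ?X = so D (ho Y) (ho Z) (ht Y Z x) (ho X)" using h(7)[OF YZ ZB x XY] .
  finally show ?thesis by (simp add: pair_def)
qed

end

section \<open>The B-system of a stratified E-system\<close>

definition ftE :: "('o, 'm, 't) esys \<Rightarrow> 'o \<Rightarrow> 'o" where
  "ftE E X = Cod E (indec E (level E) X)"

definition step :: "('o, 'm, 't) esys \<Rightarrow> 'o \<Rightarrow> 'o \<Rightarrow> bool" where
  "step E X Y \<longleftrightarrow> over E X Y \<and> level E X = Suc (level E Y)"

context strat_esys
begin

lemma step_ftE: "\<lbrakk>X \<in> Ob E; level E X = Suc n\<rbrakk> \<Longrightarrow> step E X (ftE E X) \<and> level E (ftE E X) = n"
  using over_indec[of X n] indec(3)[of X n] by (simp add: step_def ftE_def)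

lemma ftE_eq: "step E X Y \<Longrightarrow> ftE E X = Y"
  using indec_eq[of X Y] arrow(3)[of X Y] by (simp add: step_def ftE_def)

lemma indec_step: "step E X Y \<Longrightarrow> indec E (level E) X = arrow E X Y"
  using indec_eq by (simp add: step_def)

lemma over_ftE: "\<lbrakk>over E X Y; level E Y < level E X\<rbrakk> \<Longrightarrow> over E (ftE E X) Y"
  using indec_cod_over by (simp add: ftE_def)

text \<open>A competing arrow of the slice has as first component an arrow of \<open>E\<close> out
  of \<open>Z\<close> that lowers the level by one, as the level of the base is subtracted on both
  sides. Such an arrow is unique in \<open>E\<close>.\<close>

lemma indec_slice:
  assumes ZX: "over E Z X" and ZQ: "step E Z Q" and QX: "over E Q X"
  shows "indec (slice E X) (slice_level E (level E) X) (arrow E Z X) = (arrow E Z Q, arrow E Q X)"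
  unfolding indec_def
proof (rule the_equality)
  have zq: "over E Z Q" "level E Z = Suc (level E Q)" using ZQ by (auto simp: step_def)
  note a = arrow[OF zq(1)] arrow[OF QX] arrow[OF ZX]
  show "(arrow E Z Q, arrow E Q X) \<in> Ar (slice E X) \<and> Dom (slice E X) (arrow E Z Q, arrow E Q X) = arrow E Z X \<and>
    slice_level E (level E) X (arrow E Z X) = slice_level E (level E) X (Cod (slice E X) (arrow E Z Q, arrow E Q X)) + 1"
    using a arrow_comp[OF zq(1) QX] zq(2) over_level[OF QX] by (simp add: slice_level_def)
  fix f assume f: "f \<in> Ar (slice E X) \<and> Dom (slice E X) f = arrow E Z X \<and>
    slice_level E (level E) X (arrow E Z X) = slice_level E (level E) X (Cod (slice E X) f) + 1"
  obtain g A where fA: "f = (g, A)" by (cases f)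
  have g: "g \<in> Ar E" "A \<in> Ar E" "Cod E A = X" "Cod E g = Dom E A" "Comp E A g = arrow E Z X" using f fA by auto
  have dg: "Dom E g = Z" using categoryD(7)[OF cat g(1,2,4)] g(5) a by simp
  let ?W = "Dom E A"
  have A: "A = arrow E ?W X" "over E ?W X"
    using arrow_eq[OF g(2) refl g(3), symmetric] g(2,3) unfolding over_def by blast+
  have gW: "g = arrow E Z ?W" "over E Z ?W"
    using arrow_eq[OF g(1) dg g(4), symmetric] g(1,4) dg unfolding over_def by blast+
  have "level E Z - level E X = Suc (level E ?W - level E X)" using f fA a by (simp add: slice_level_def)
  then have sW: "step E Z ?W" using gW(2) over_level[OF A(2)] over_level[OF ZX] zq over_level[OF QX] by (simp add: step_def)
  have W: "?W = Q" using ftE_eq[OF sW] ftE_eq[OF ZQ] by (rule trans[OF sym])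
  show "f = (arrow E Z Q, arrow E Q X)" unfolding fA using A(1)[unfolded W] gW(1)[unfolded W] by simp
qed

end

lemma E2B_obj_simps [simp]:
  "Bo (E2B_obj E) n = {X \<in> Ob E. level E X = n}"
  "ft (E2B_obj E) n X = ftE E X"
  "bd (E2B_obj E) n (Tup [X, x]) = X"
  by (simp_all add: E2B_obj_def ftE_def)

lemma E2B_hom_simps [simp]:
  "hB (E2B_hom C L F) n X = onO F X"
  "hT (E2B_hom C L F) n (Tup [X, x]) = Tup [onO F X, onT F (indec C L X) x]"
  by (simp_all add: E2B_hom_def)

locale strat_esys_univ = strat_esys E for E :: "'a esystem"
begin

lemma E2B_Bt: "Bt (E2B_obj E) n = {Tup [X, x] |X x. X \<in> Ob E \<and> level E X = Suc n \<and> x \<in> tm E X (ftE E X)}"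
  using indec_step[OF conjunct1[OF step_ftE]] by (auto simp: E2B_obj_def tm_def)

lemma E2B_BtE:
  assumes "y \<in> Bt (E2B_obj E) n"
  obtains X Y x where "y = Tup [X, x]" "step E X Y" "ftE E X = Y" "level E Y = n" "x \<in> tm E X Y"
proof -
  obtain X x where x: "y = Tup [X, x]" "X \<in> Ob E" "level E X = Suc n" "x \<in> tm E X (ftE E X)"
    using assms by (auto simp: E2B_Bt)
  from that[OF x(1) conjunct1[OF step_ftE[OF x(2,3)]] refl conjunct2[OF step_ftE[OF x(2,3)]] x(4)] show ?thesis .
qed

lemma stepD:
  assumes "step E X Y"
  shows "over E X Y" "level E X = Suc (level E Y)" "X \<in> Ob E" "Y \<in> Ob E" "ftE E X = Y"
  using assms overD ftE_eq by (auto simp: step_def)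

lemma E2B_BtI: "\<lbrakk>step E X Y; level E Y = n; x \<in> tm E X Y\<rbrakk> \<Longrightarrow> Tup [X, x] \<in> Bt (E2B_obj E) n"
  using stepD[of X Y] by (auto simp: E2B_Bt)

lemma E2B_slice_hom_hB: "hB (E2B_slice_hom E X F) n Z = Dom E (onO F (arrow E Z X))"
  by (simp add: E2B_slice_hom_def from_frame_def to_frame_def arrow_def Let_def)

lemma E2B_slice_hom_hT:
  assumes "step E Z Q" "over E Q X"
  shows "hT (E2B_slice_hom E X F) n (Tup [Z, z])
    = Tup [Dom E (onO F (arrow E Z X)), onT F (arrow E Z Q, arrow E Q X) z]"
  using indec_slice[OF over_trans[OF stepD(1)[OF assms(1)] assms(2)] assms]
  by (simp add: E2B_slice_hom_def from_frame_def to_frame_def arrow_def Let_def)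

text \<open>The identifications inside \<open>E2B_slice_hom\<close> cancel and leave the operations
  on objects and terms. For elements this uses the indecomposable arrows of the slice, known from
  \<open>indec_slice\<close>.\<close>

lemma E2B_Sb:
  assumes "step E X Y"
  shows "hB (Sb (E2B_obj E) n (Tup [X, x])) m Z = so E X Y x Z"
    and "\<lbrakk>step E Z Q; over E Q X\<rbrakk> \<Longrightarrow>
      hT (Sb (E2B_obj E) n (Tup [X, x])) m (Tup [Z, z]) = Tup [so E X Y x Z, st E X Y x Z Q z]"
  using E2B_slice_hom_hT[of Z Q X] indec_step[OF assms]
  by (simp_all add: E2B_obj_def E2B_slice_hom_hB so_def st_def)

lemma E2B_Wb:
  assumes "step E X Y"
  shows "hB (Wb (E2B_obj E) n X) m Z = wo E X Y Z"
    and "\<lbrakk>step E Z Q; over E Q Y\<rbrakk> \<Longrightarrow>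
      hT (Wb (E2B_obj E) n X) m (Tup [Z, z]) = Tup [wo E X Y Z, wt E X Y Z Q z]"
  using E2B_slice_hom_hT[of Z Q Y] indec_step[OF assms] arrow[OF stepD(1)[OF assms]]
  by (simp_all add: E2B_obj_def E2B_wk_def Let_def E2B_slice_hom_hB wo_def wt_def)

lemma E2B_dl:
  assumes "step E X Y"
  shows "dl (E2B_obj E) n X = Tup [wo E X Y X, dt E X Y]"
  using E2B_Wb(1)[OF assms, of n 1 X] indec_step[OF assms] by (simp add: E2B_obj_def dt_def)

lemma is_bframe_E2B: "is_bframe (E2B_obj E)"
  unfolding is_bframe_def
proof (intro conjI allI ballI)
  have "Bo (E2B_obj E) 0 = {Top E}" using level_zero top by auto
  then show "\<exists>s. Bo (E2B_obj E) 0 = {s}" by blast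
next
  fix n X assume "X \<in> Bo (E2B_obj E) (Suc n)"
  then show "ft (E2B_obj E) n X \<in> Bo (E2B_obj E) n"
    using step_ftE[of X n] stepD(4) by auto
next
  fix n x assume "x \<in> Bt (E2B_obj E) n"
  then show "bd (E2B_obj E) n x \<in> Bo (E2B_obj E) (Suc n)"
    by (rule E2B_BtE) (use stepD in auto)
qed

text \<open>\<open>ft\<close> follows the indecomposable arrow, and every arrow out of
  \<open>Y\<close> to a lower level factors through it (\<open>over_ftE\<close>). This translates
  slices of the B-system into the relation \<open>over\<close>.\<close>

lemma ftm_E2B:
  assumes X: "X \<in> Ob E" "level E X = n" and Y: "Y \<in> Ob E" "level E Y = n + m"
  shows "ftm (E2B_obj E) n m Y = X \<longleftrightarrow> over E Y X"
  using Y
proof (induction m arbitrary: Y)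
  case 0
  then show ?case using over_refl[OF X(1)] over_eq[of Y X] X by auto
next
  case (Suc m)
  have s: "step E Y (ftE E Y)" "level E (ftE E Y) = n + m" using step_ftE[of Y "n + m"] Suc.prems by auto
  then have "ftm (E2B_obj E) n m (ftE E Y) = X \<longleftrightarrow> over E (ftE E Y) X" using Suc.IH stepD(4) by blast
  then show ?case using over_ftE[of Y X] over_trans[OF stepD(1)[OF s(1)]] Suc.prems X by auto
qed

lemma E2B_bslice_Bo:
  assumes X: "X \<in> Ob E" "level E X = n"
  shows "Y \<in> Bo (bslice (E2B_obj E) n X) m \<longleftrightarrow> over E Y X \<and> level E Y = n + m"
  using ftm_E2B[OF X, of Y m] overD(1)[of Y X] by auto

lemma E2B_bslice_BtE:
  assumes X: "X \<in> Ob E" "level E X = n" and y: "y \<in> Bt (bslice (E2B_obj E) n X) m"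
  obtains Z Q z where "y = Tup [Z, z]" "step E Z Q" "over E Q X" "level E Q = n + m" "z \<in> tm E Z Q"
proof -
  have y': "y \<in> Bt (E2B_obj E) (n + m)" "ftm (E2B_obj E) n (Suc m) (bd (E2B_obj E) (n + m) y) = X"
    using y by auto
  obtain Z Q z where z: "y = Tup [Z, z]" "step E Z Q" "ftE E Z = Q" "level E Q = n + m" "z \<in> tm E Z Q"
    using E2B_BtE[OF y'(1)] by metis
  have "over E Q X" using y'(2) ftm_E2B[OF X, of Q m] z stepD[OF z(2)] by simp
  with z that show ?thesis by blast
qed

lemma E2B_bslice_BtI:
  assumes X: "X \<in> Ob E" "level E X = n" and z: "step E Z Q" "over E Q X" "level E Q = n + m" "z \<in> tm E Z Q"
  shows "Tup [Z, z] \<in> Bt (bslice (E2B_obj E) n X) m"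
  using E2B_BtI[OF z(1,3,4)] ftm_E2B[OF X, of Q m] z stepD[OF z(1)] by simp

end

lemma thom_step:
  assumes "strat_esys E" "strat_esys D" and h: "thom E X D Y ho ht" and s: "step E Z Q" "over E Q X"
  shows "step D (ho Z) (ho Q)"
proof -
  interpret E: strat_esys E by fact
  note h = thomD[OF h]
  have "over E Z Q" "level E Z = Suc (level E Q)" using s(1) by (auto simp: step_def)
  then show ?thesis using h(4)[of Z Q] h(5)[of Z] h(5)[OF s(2)] s(2) E.over_trans[of Z Q X] by (simp add: step_def)
qed

text \<open>\<open>K\<close> is specified only on objects and elements over \<open>X\<close>, so
  that the same lemma serves for S_x, for W_X and for the map induced by a functor. Each condition
  on \<open>K\<close> is a condition of \<open>thom\<close> at an indecomposable arrow.\<close>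

lemma thom_pre_bhom:
  fixes E D :: "'a esystem"
  assumes E: "strat_esys E" and D: "strat_esys D" and h: "thom E X D Y ho ht"
    and n: "level E X = n" and m: "level D Y = m"
    and K1: "\<And>k Z. over E Z X \<Longrightarrow> hB K k Z = ho Z"
    and K2: "\<And>k Z Q z. \<lbrakk>step E Z Q; over E Q X; z \<in> tm E Z Q\<rbrakk> \<Longrightarrow> hT K k (Tup [Z, z]) = Tup [ho Z, ht Z Q z]"
  shows "pre_bhom (bslice (E2B_obj E) n X) (bslice (E2B_obj D) m Y) K"
proof -
  interpret E: strat_esys_univ E using E by (simp add: strat_esys_univ_def)
  interpret D: strat_esys_univ D using D by (simp add: strat_esys_univ_def)
  note hs = thom_step[OF E D h]
  note h = thomD[OF h]
  let ?B = "bslice (E2B_obj E) n X" and ?A = "bslice (E2B_obj D) m Y"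
  note Bo = E.E2B_bslice_Bo[OF h(1) n] and Ao = D.E2B_bslice_Bo[OF h(2) m]
  have hX: "over D (ho Z) Y" if "over E Z X" for Z using h(4)[OF that E.over_refl[OF h(1)]] h(3) by simp
  have hl: "level D (ho Z) = m + k" if "over E Z X" "level E Z = n + k" for Z k
    using h(5)[OF that(1)] that(2) n m by simp
  have fr: "frame_hom ?B ?A K"
    unfolding frame_hom_def
  proof (intro conjI allI ballI)
    fix k Z assume "Z \<in> Bo ?B k"
    then show "hB K k Z \<in> Bo ?A k" unfolding Bo Ao using K1 hX hl by simp
  next
    fix k z assume "z \<in> Bt ?B k"
    then obtain Z Q z' where z: "z = Tup [Z, z']" "step E Z Q" "over E Q X" "level E Q = n + k" "z' \<in> tm E Z Q"
      by (rule E.E2B_bslice_BtE[OF h(1) n])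
    note zq = E.stepD[OF z(2)]
    show "hT K k z \<in> Bt ?A k"
      using K2[OF z(2,3,5), of k] D.E2B_bslice_BtI[OF h(2) m hs[OF z(2,3)] hX[OF z(3)] hl[OF z(3,4)] h(6)[OF zq(1) z(3,5)]]
      by (simp add: z(1))
    show "bd ?A k (hT K k z) = hB K (Suc k) (bd ?B k z)"
      using K2[OF z(2,3,5), of k] K1[OF E.over_trans[OF zq(1) z(3)]] by (simp add: z(1))
  next
    fix k Z assume "Z \<in> Bo ?B (Suc k)"
    then have Z: "over E Z X" "level E Z = Suc (n + k)" unfolding Bo by auto
    have s: "step E Z (ftE E Z)" using E.step_ftE[OF E.overD(1)[OF Z(1)] Z(2)] by simp
    have o: "over E (ftE E Z) X" using E.over_ftE[OF Z(1)] Z(2) n by simp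
    show "ft ?A k (hB K (Suc k) Z) = hB K k (ft ?B k Z)"
      using K1[OF Z(1)] K1[OF o] D.stepD(5)[OF hs[OF s o]] by simp
  qed
  show ?thesis
    unfolding pre_bhom_def
  proof (intro conjI allI ballI)
    show "frame_hom ?B ?A K" by (rule fr)
  next
    fix k y assume y: "y \<in> Bt ?B k"
    then obtain V W v where v: "y = Tup [V, v]" "step E V W" "over E W X" "level E W = n + k" "v \<in> tm E V W"
      by (rule E.E2B_bslice_BtE[OF h(1) n])
    note vw = E.stepD[OF v(2)]
    note VX = E.over_trans[OF vw(1) v(3)]
    have sl: "bslice ?B (Suc k) (bd ?B k y) = bslice (E2B_obj E) (Suc (n + k)) V"
      using bslice_bslice[of "E2B_obj E" n "Suc k" V X] E.ftm_E2B[OF h(1) n, of V "Suc k"] vw VX v(4) by (simp add: v(1))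
    have lV: "level E V = Suc (n + k)" using vw v(4) by simp
    have K2v: "hT K k y = Tup [ho V, ht V W v]" using K2[OF v(2,3,5)] v(1) by simp
    note sD = hs[OF v(2,3)]
    show "beq (bslice ?B (Suc k) (bd ?B k y)) (bslice_hom k K \<circ>\<^sub>B Sb ?B k y) (Sb ?A k (hT K k y) \<circ>\<^sub>B bslice_hom (Suc k) K)"
      unfolding sl
    proof (rule beqI)
      fix l Z assume "Z \<in> Bo (bslice (E2B_obj E) (Suc (n + k)) V) l"
      then have Z: "over E Z V" using E.E2B_bslice_Bo[OF vw(3) lV] by simp
      have o: "over E (so E V W v Z) X" using E.over_trans[OF E.Sub_action(2)[OF vw(1) v(5) Z] v(3)] .
      show "hB (bslice_hom k K \<circ>\<^sub>B Sb ?B k y) l Z = hB (Sb ?A k (hT K k y) \<circ>\<^sub>B bslice_hom (Suc k) K) l Z"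
        using K1[OF o] K1[OF E.over_trans[OF Z VX]] h(7)[OF vw(1) v(3,5) Z]
        by (simp add: v(1) K2v[unfolded v(1)] E.E2B_Sb(1)[OF v(2)] D.E2B_Sb(1)[OF sD])
    next
      fix l z assume "z \<in> Bt (bslice (E2B_obj E) (Suc (n + k)) V) l"
      then obtain Z Q z' where z: "z = Tup [Z, z']" "step E Z Q" "over E Q V" "z' \<in> tm E Z Q"
        by (elim E.E2B_bslice_BtE[OF vw(3) lV])
      note zq = E.stepD[OF z(2)]
      note tS = E.thom_so[OF vw(1) v(5)]
      have sS: "step E (so E V W v Z) (so E V W v Q)" using thom_step[OF E E tS z(2,3)] .
      have oS: "over E (so E V W v Q) X" using E.over_trans[OF E.Sub_action(2)[OF vw(1) v(5) z(3)] v(3)] .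
      note tmS = thomD(6)[OF tS zq(1) z(3,4)]
      note QX = E.over_trans[OF z(3) VX]
      show "hT (bslice_hom k K \<circ>\<^sub>B Sb ?B k y) l z = hT (Sb ?A k (hT K k y) \<circ>\<^sub>B bslice_hom (Suc k) K) l z"
        using K2[OF sS oS tmS] K2[OF z(2) QX z(4)] h(7)[OF vw(1) v(3,5) E.over_trans[OF zq(1) z(3)]]
          h(8)[OF vw(1) v(3,5) zq(1) z(3,4)]
        by (simp add: v(1) z(1) K2v[unfolded v(1)] E.E2B_Sb(2)[OF v(2) z(2,3)] D.E2B_Sb(2)[OF sD hs[OF z(2) QX] h(4)[OF z(3) VX]])
    qed
  next
    fix k V assume "V \<in> Bo ?B (Suc k)"
    then have V: "over E V X" "level E V = Suc (n + k)" unfolding Bo by auto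
    define W where "W = ftE E V"
    have v: "step E V W" "level E W = n + k" using E.step_ftE[OF E.overD(1)[OF V(1)] V(2)] by (auto simp: W_def)
    note vw = E.stepD[OF v(1)]
    have WX: "over E W X" using E.over_ftE[OF V(1)] V(2) n by (simp add: W_def)
    have sl: "bslice ?B k (ft ?B k V) = bslice (E2B_obj E) (n + k) W"
      using bslice_bslice[of "E2B_obj E" n k W X] E.ftm_E2B[OF h(1) n vw(4) v(2)] WX vw(5) by simp
    note sD = hs[OF v(1) WX]
    show "beq (bslice ?B k (ft ?B k V)) (bslice_hom (Suc k) K \<circ>\<^sub>B Wb ?B k V) (Wb ?A k (hB K (Suc k) V) \<circ>\<^sub>B bslice_hom k K)"
      unfolding sl
    proof (rule beqI)
      fix l Z assume "Z \<in> Bo (bslice (E2B_obj E) (n + k) W) l"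
      then have Z: "over E Z W" using E.E2B_bslice_Bo[OF vw(4) v(2)] by simp
      have o: "over E (wo E V W Z) X" using E.over_trans[OF E.Wk_action(2)[OF vw(1) Z] V(1)] .
      show "hB (bslice_hom (Suc k) K \<circ>\<^sub>B Wb ?B k V) l Z = hB (Wb ?A k (hB K (Suc k) V) \<circ>\<^sub>B bslice_hom k K) l Z"
        using K1[OF o] K1[OF E.over_trans[OF Z WX]] h(9)[OF vw(1) WX Z]
        by (simp add: K1[OF V(1)] E.E2B_Wb(1)[OF v(1)] D.E2B_Wb(1)[OF sD])
    next
      fix l z assume "z \<in> Bt (bslice (E2B_obj E) (n + k) W) l"
      then obtain Z Q z' where z: "z = Tup [Z, z']" "step E Z Q" "over E Q W" "z' \<in> tm E Z Q"
        by (elim E.E2B_bslice_BtE[OF vw(4) v(2)])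
      note zq = E.stepD[OF z(2)]
      note tW = E.thom_wo[OF vw(1)]
      have sW: "step E (wo E V W Z) (wo E V W Q)" using thom_step[OF E E tW z(2,3)] .
      have oW: "over E (wo E V W Q) X" using E.over_trans[OF E.Wk_action(2)[OF vw(1) z(3)] V(1)] .
      note tmW = thomD(6)[OF tW zq(1) z(3,4)]
      note QX = E.over_trans[OF z(3) WX]
      show "hT (bslice_hom (Suc k) K \<circ>\<^sub>B Wb ?B k V) l z = hT (Wb ?A k (hB K (Suc k) V) \<circ>\<^sub>B bslice_hom k K) l z"
        using K2[OF sW oW tmW] K2[OF z(2) QX z(4)] h(9)[OF vw(1) WX E.over_trans[OF zq(1) z(3)]]
          h(10)[OF vw(1) WX zq(1) z(3,4)]
        by (simp add: z(1) K1[OF V(1)] E.E2B_Wb(2)[OF v(1) z(2,3)] D.E2B_Wb(2)[OF sD hs[OF z(2) QX] h(4)[OF z(3) WX]])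
    qed
    have tW: "thom E W E V (wo E V W) (wt E V W)" using E.thom_wo[OF vw(1)] .
    have sW: "step E (wo E V W V) V" using thom_step[OF E E tW v(1) E.over_refl[OF vw(4)]] E.wo_base[OF vw(1)] by simp
    show "hT K (Suc k) (dl ?B k V) = dl ?A k (hB K (Suc k) V)"
      using K2[OF sW V(1) E.dt_tm[OF vw(1)]] h(9)[OF vw(1) WX vw(1)] h(11)[OF vw(1) WX]
      by (simp add: K1[OF V(1)] E.E2B_dl[OF v(1)] D.E2B_dl[OF sD])
  qed
qed

context strat_esys_univ
begin

lemma E_strat: "strat_esys E" by unfold_locales

lemma pre_bhom_E2B_Sb:
  assumes "step E X Y" "level E Y = n" "x \<in> tm E X Y"
  shows "pre_bhom (bslice (E2B_obj E) (Suc n) X) (bslice (E2B_obj E) n Y) (Sb (E2B_obj E) n (Tup [X, x]))"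
  by (rule thom_pre_bhom[OF E_strat E_strat thom_so[OF stepD(1)[OF assms(1)] assms(3)]])
    (use stepD[OF assms(1)] assms E2B_Sb[OF assms(1)] in auto)

lemma pre_bhom_E2B_Wb:
  assumes "step E X Y" "level E Y = n"
  shows "pre_bhom (bslice (E2B_obj E) n Y) (bslice (E2B_obj E) (Suc n) X) (Wb (E2B_obj E) n X)"
  by (rule thom_pre_bhom[OF E_strat E_strat thom_wo[OF stepD(1)[OF assms(1)]]])
    (use stepD[OF assms(1)] assms E2B_Wb[OF assms(1)] in auto)

lemma step_Wk: "step E X Y \<Longrightarrow> step E (wo E X Y X) X"
  using thom_step[OF E_strat E_strat thom_wo, of X Y X Y] stepD[of X Y] wo_base[of X Y] over_refl by simp

text \<open>The axioms are those of the E-system at indecomposable arrows: S_x and W_X are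
  homomorphisms by \<open>thom_pre_bhom\<close>, and the remaining laws are \<open>so_wo\<close>,
  \<open>st_wt\<close>, \<open>st_dt\<close>, \<open>so_dt\<close> and
  \<open>st_dt_wt\<close>.\<close>

lemma bsystem_E2B: "bsystem (E2B_obj E)"
proof -
  let ?B = "E2B_obj E"
  have S: "pre_bhom (bslice ?B (Suc n) (bd ?B n x)) (bslice ?B n (ft ?B n (bd ?B n x))) (Sb ?B n x)"
    if "x \<in> Bt ?B n" for n x
    using that by (rule E2B_BtE) (use pre_bhom_E2B_Sb in auto)
  have W: "pre_bhom (bslice ?B n (ft ?B n X)) (bslice ?B (Suc n) X) (Wb ?B n X)"
    if "X \<in> Bo ?B (Suc n)" for n X
    using that pre_bhom_E2B_Wb step_ftE[of X n] by auto
  have d: "dl ?B n X \<in> Bt ?B (Suc n) \<and> bd ?B (Suc n) (dl ?B n X) = hB (Wb ?B n X) 1 X"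
    if "X \<in> Bo ?B (Suc n)" for n X
  proof -
    have s: "step E X (ftE E X)" "level E X = Suc n" using that step_ftE[of X n] by auto
    show ?thesis using E2B_BtI[OF step_Wk[OF s(1)] s(2) dt_tm[OF stepD(1)[OF s(1)]]]
      by (simp add: E2B_dl[OF s(1)] E2B_Wb(1)[OF s(1)])
  qed
  have 1: "beq (bslice ?B n (ft ?B n (bd ?B n x))) (Sb ?B n x \<circ>\<^sub>B Wb ?B n (bd ?B n x)) bid \<and>
      hT (Sb ?B n x) 0 (dl ?B n (bd ?B n x)) = x" if x: "x \<in> Bt ?B n" for n x
  proof -
    obtain X Y y where y: "x = Tup [X, y]" "step E X Y" "ftE E X = Y" "level E Y = n" "y \<in> tm E X Y"
      using x by (rule E2B_BtE)
    note s = stepD[OF y(2)]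
    have "beq (bslice ?B n Y) (Sb ?B n x \<circ>\<^sub>B Wb ?B n X) bid"
    proof (rule beqI)
      fix m Z assume "Z \<in> Bo (bslice ?B n Y) m"
      then have "over E Z Y" using E2B_bslice_Bo[OF s(4) y(4)] by simp
      then show "hB (Sb ?B n x \<circ>\<^sub>B Wb ?B n X) m Z = hB bid m Z"
        using so_wo[OF s(1) y(5)] by (simp add: y(1) E2B_Sb(1)[OF y(2)] E2B_Wb(1)[OF y(2)])
    next
      fix m z assume "z \<in> Bt (bslice ?B n Y) m"
      then obtain Z Q z' where z: "z = Tup [Z, z']" "step E Z Q" "over E Q Y" "z' \<in> tm E Z Q"
        by (elim E2B_bslice_BtE[OF s(4) y(4)])
      note zq = stepD[OF z(2)]
      have "step E (wo E X Y Z) (wo E X Y Q)" using thom_step[OF E_strat E_strat thom_wo[OF s(1)] z(2,3)] .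
      then show "hT (Sb ?B n x \<circ>\<^sub>B Wb ?B n X) m z = hT bid m z"
        using so_wo[OF s(1) y(5) over_trans[OF zq(1) z(3)]] st_wt[OF s(1) y(5) zq(1) z(3,4)]
        by (simp add: y(1) z(1) E2B_Wb(2)[OF y(2) z(2,3)] E2B_Sb(2)[OF y(2) _ Wk_action(2)[OF s(1) z(3)]])
    qed
    moreover have "hT (Sb ?B n x) 0 (dl ?B n X) = x"
      using so_wo[OF s(1) y(5) s(1)] st_dt[OF s(1) y(5)]
      by (simp add: y(1) E2B_dl[OF y(2)] E2B_Sb(2)[OF y(2) step_Wk[OF y(2)] over_refl[OF s(3)]])
    ultimately show ?thesis by (simp add: y(1,3))
  qed
  have 2: "beq (bslice ?B (Suc n) X) (Sb ?B (Suc n) (dl ?B n X) \<circ>\<^sub>B bslice_hom 1 (Wb ?B n X)) bid"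
    if X: "X \<in> Bo ?B (Suc n)" for n X
  proof -
    define Y where "Y = ftE E X"
    have y: "step E X Y" "level E X = Suc n" using X step_ftE[of X n] by (auto simp: Y_def)
    note s = stepD[OF y(1)] and sW = step_Wk[OF y(1)]
    show ?thesis
    proof (rule beqI)
      fix m Z assume "Z \<in> Bo (bslice ?B (Suc n) X) m"
      then have "over E Z X" using E2B_bslice_Bo[OF s(3) y(2)] by simp
      then show "hB (Sb ?B (Suc n) (dl ?B n X) \<circ>\<^sub>B bslice_hom 1 (Wb ?B n X)) m Z = hB bid m Z"
        using so_dt[OF s(1)] by (simp add: E2B_dl[OF y(1)] E2B_Sb(1)[OF sW] E2B_Wb(1)[OF y(1)])
    next
      fix m z assume "z \<in> Bt (bslice ?B (Suc n) X) m"
      then obtain Z Q z' where z: "z = Tup [Z, z']" "step E Z Q" "over E Q X" "z' \<in> tm E Z Q"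
        by (elim E2B_bslice_BtE[OF s(3) y(2)])
      note zq = stepD[OF z(2)] and QY = over_trans[OF z(3) s(1)]
      have sZ: "step E (wo E X Y Z) (wo E X Y Q)" using thom_step[OF E_strat E_strat thom_wo[OF s(1)] z(2) QY] .
      have oZ: "over E (wo E X Y Q) (wo E X Y X)" using Wk_action(3)[OF s(1) z(3) s(1)] .
      show "hT (Sb ?B (Suc n) (dl ?B n X) \<circ>\<^sub>B bslice_hom 1 (Wb ?B n X)) m z = hT bid m z"
        using so_dt[OF s(1) over_trans[OF zq(1) z(3)]] st_dt_wt[OF s(1) zq(1) z(3,4)]
        by (simp add: z(1) E2B_dl[OF y(1)] E2B_Wb(2)[OF y(1) z(2) QY] E2B_Sb(2)[OF sW sZ oZ])
    qed
  qed
  show ?thesis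
    unfolding bsystem_def pre_bsystem_def
    using is_bframe_E2B S W d 1 2 pre_bhomD(1)[OF S] pre_bhomD(1)[OF W] by blast
qed

end

section \<open>Functoriality of \<open>E2B\<close>\<close>

lemma pre_bhom_E2B_hom:
  fixes E D :: "'a esystem"
  assumes E: "strat_esys E" and D: "strat_esys D" and F: "stratified_ehom E D F"
  shows "pre_bhom (E2B_obj E) (E2B_obj D) (E2B_hom E (level E) F)"
proof -
  interpret E: strat_esys_univ E using E by (simp add: strat_esys_univ_def)
  interpret D: strat_esys_univ D using D by (simp add: strat_esys_univ_def)
  have F': "pre_ehom E D F" "\<And>X. X \<in> Ob E \<Longrightarrow> level D (onO F X) = level E X" using F by (auto simp: stratified_ehom_def)
  note h = thom_pre_ehom(1)[OF E D F'(1) F'(2)]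
  have "pre_bhom (bslice (E2B_obj E) 0 (Top E)) (bslice (E2B_obj D) 0 (Top D)) (E2B_hom E (level E) F)"
    by (rule thom_pre_bhom[OF E D h]) (simp_all add: E.level_top D.level_top E.indec_step)
  \<comment> \<open>The slice over the terminal object is the whole B-system, which turns the
    statement on slices into the required one.\<close>
  moreover have "bslice (E2B_obj E) 0 (Top E) = E2B_obj E" "bslice (E2B_obj D) 0 (Top D) = E2B_obj D"
    using bslice_0[OF E.is_bframe_E2B] bslice_0[OF D.is_bframe_E2B] E.top D.top E.level_top D.level_top by auto
  ultimately show ?thesis by simp
qed

lemma strat_esysI: "stratified_esystem E \<Longrightarrow> strat_esys E"
  by unfold_locales

lemma E2B_simps:
  "onO E2B E = E2B_obj E"
  "onA E2B (E, F, D) = (E2B_obj E, bres (E2B_obj E) (E2B_hom E (level E) F), E2B_obj D)"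
  by (simp_all add: E2B_def)

lemma is_functor_E2B: "is_functor Esys\<^sub>s Bsys E2B"
  unfolding is_functor_def
proof (intro conjI ballI impI)
  fix E :: "'a esystem" assume "E \<in> Ob Esys\<^sub>s"
  then interpret E: strat_esys_univ E by (simp add: strat_esys_univ_def strat_esysI)
  show "onO E2B E \<in> Ob Bsys" using E.bsystem_E2B by (simp add: E2B_simps)
  have "beq (E2B_obj E) (E2B_hom E (level E) (tres E tid)) bid"
  proof (rule beqI)
    fix n x assume "x \<in> Bt (E2B_obj E) n"
    then obtain X Y y where y: "x = Tup [X, y]" "step E X Y" "y \<in> tm E X Y" by (rule E.E2B_BtE)
    then show "hT (E2B_hom E (level E) (tres E tid)) n x = hT bid n x"
      using E.stepD[OF y(2)] E.arrow[of X Y] by (simp add: E.indec_step tres_def tm_def)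
  qed (simp add: tres_def)
  then show "onA E2B (Idt Esys\<^sub>s E) = Idt Bsys (onO E2B E)" by (simp add: E2B_simps bres_eq_iff)
next
  fix f :: "'a emor" assume "f \<in> Ar Esys\<^sub>s"
  then obtain E F D where f: "f = (E, F, D)" "stratified_esystem E" "stratified_esystem D" "stratified_ehom E D F"
    using Esys_triple by blast
  interpret E: strat_esys_univ E using f by (simp add: strat_esys_univ_def strat_esysI)
  interpret D: strat_esys_univ D using f by (simp add: strat_esys_univ_def strat_esysI)
  show "onA E2B f \<in> Ar Bsys" "Dom Bsys (onA E2B f) = onO E2B (Dom Esys\<^sub>s f)" "Cod Bsys (onA E2B f) = onO E2B (Cod Esys\<^sub>s f)"
    using pre_bhom_bres[OF E.bsystem_E2B pre_bhom_E2B_hom[OF E.E_strat D.E_strat f(4)]] E.bsystem_E2B D.bsystem_E2B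
    by (simp_all add: f(1) E2B_simps)
next
  fix f g :: "'a emor" assume *: "f \<in> Ar Esys\<^sub>s" "g \<in> Ar Esys\<^sub>s" "Cod Esys\<^sub>s f = Dom Esys\<^sub>s g"
  then obtain E F D C G where f: "f = (E, F, D)" "g = (D, G, C)" "stratified_esystem E" "stratified_esystem D"
    "stratified_ehom E D F" "stratified_ehom D C G"
    using Esys_triple[of f] Esys_triple[of g] by auto
  interpret E: strat_esys_univ E using f by (simp add: strat_esys_univ_def strat_esysI)
  interpret D: strat_esys_univ D using f by (simp add: strat_esys_univ_def strat_esysI)
  have F': "pre_ehom E D F" "\<And>X. X \<in> Ob E \<Longrightarrow> level D (onO F X) = level E X" using f(5) by (auto simp: stratified_ehom_def)
  note h = thom_pre_ehom[OF E.E_strat D.E_strat F']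
  note fF = pre_bhom_E2B_hom[OF E.E_strat D.E_strat f(5)]
  have "beq (E2B_obj E) (E2B_hom E (level E) (tres E (G \<circ>\<^sub>T F))) (E2B_hom D (level D) G \<circ>\<^sub>B E2B_hom E (level E) F)"
  proof (rule beqI)
    fix n x assume "x \<in> Bt (E2B_obj E) n"
    then obtain X Y y where y: "x = Tup [X, y]" "step E X Y" "y \<in> tm E X Y" by (rule E.E2B_BtE)
    note s = E.stepD[OF y(2)]
    have "step D (onO F X) (onO F Y)"
      using thom_step[OF E.E_strat D.E_strat h(1) y(2) E.over_top[OF s(4)]] by simp
    then show "hT (E2B_hom E (level E) (tres E (G \<circ>\<^sub>T F))) n x = hT (E2B_hom D (level D) G \<circ>\<^sub>B E2B_hom E (level E) F) n x"
      using s E.arrow[OF s(1)] y(3) h(2)[OF _ s(1)] by (simp add: y(1) E.indec_step[OF y(2)] D.indec_step tres_def tm_def)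
  qed (simp add: tres_def)
  then show "onA E2B (Comp Esys\<^sub>s g f) = Comp Bsys (onA E2B g) (onA E2B f)"
    using bres_comp_left[OF fF] by (simp add: f(1,2) E2B_simps bres_eq_iff[symmetric])
qed

section \<open>Extending homomorphisms of B-systems to E-homomorphisms\<close>

text \<open>Recursion on the length \<open>k\<close> of the arrow from \<open>X\<close> to
  \<open>Z\<close>. The term is split at the indecomposable arrow out of \<open>X\<close>; its first
  component is extended recursively, the second belongs to an indecomposable arrow and is mapped by
  \<open>K\<close>, with \<open>on_pair\<close> dropping the object of the coproduct element. For
  \<open>k = 0\<close> the only possible value is the generic term of an identity.\<close>

primrec ext_tm :: "'a esystem \<Rightarrow> 'a esystem \<Rightarrow> ('a univ, 'a univ) bhom \<Rightarrow> nat \<Rightarrow> 'a univ \<Rightarrow> 'a univ \<Rightarrow> 'a univ \<Rightarrow> 'a univ" where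
  "ext_tm E D K 0 X Z t = dt D (hB K (level E X) X) (hB K (level E Z) Z)"
| "ext_tm E D K (Suc k) X Z t = pair D (hB K (level E X) X) (hB K (level E (ftE E X)) (ftE E X)) (hB K (level E Z) Z)
    (ext_tm E D K k (ftE E X) Z (pr0 E X (ftE E X) Z t))
    (on_pair (\<lambda>X x. x) (hT K (level E Z)
      (Tup [so E (ftE E X) Z (pr0 E X (ftE E X) Z t) X, pr1 E X (ftE E X) Z t])))"

locale bhom_ext = E: strat_esys_univ E + D: strat_esys_univ D for E D :: "'a esystem" +
  fixes K assumes K: "pre_bhom (E2B_obj E) (E2B_obj D) K"
begin

definition ob where "ob X = hB K (level E X) X"
text \<open>Elements over an object of level \<open>n + 1\<close> have index \<open>n\<close>, which
  is where the subtraction comes from.\<close>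

definition one where "one X u = on_pair (\<lambda>X x. x) (hT K (level E X - 1) (Tup [X, u]))"
definition ext where "ext X Z = ext_tm E D K (level E X - level E Z) X Z"

lemmas fr = frame_homD[OF pre_bhomD(1)[OF K]]

lemma ob_Ob: "X \<in> Ob E \<Longrightarrow> ob X \<in> Ob D" "X \<in> Ob E \<Longrightarrow> level D (ob X) = level E X"
  using fr(1)[of X "level E X"] by (auto simp: ob_def)

lemma ob_step: "step E X Y \<Longrightarrow> step D (ob X) (ob Y)"
  using fr(3)[of X "level E Y"] E.stepD[of X Y] D.step_ftE[of "ob X" "level E Y"] ob_Ob[of X] by (simp add: ob_def)

lemma ob_over: "over E Z W \<Longrightarrow> over D (ob Z) (ob W)"
proof (induction "level E Z" arbitrary: Z rule: less_induct)
  case less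
  show ?case
  proof (cases "level E Z = level E W")
    case True
    then have "Z = W" using E.over_eq[OF less.prems] by simp
    then show ?thesis using D.over_refl ob_Ob E.overD less.prems by auto
  next
    case False
    then have l: "level E W < level E Z" using E.over_level[OF less.prems] by simp
    then obtain n where n: "level E Z = Suc n" by (cases "level E Z") auto
    have s: "step E Z (ftE E Z)" using E.step_ftE[OF E.overD(1)[OF less.prems] n] by simp
    have "over D (ob (ftE E Z)) (ob W)"
      using less.hyps[OF _ E.over_ftE[OF less.prems l]] E.stepD(2)[OF s] by simp
    then show ?thesis using D.over_trans[OF D.stepD(1)[OF ob_step[OF s]]] by blast
  qed
qed

lemma one:
  assumes "step E X Y" "u \<in> tm E X Y"
  shows "hT K (level E Y) (Tup [X, u]) = Tup [ob X, one X u]" "one X u \<in> tm D (ob X) (ob Y)"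
proof -
  note s = E.stepD[OF assms(1)]
  have b: "Tup [X, u] \<in> Bt (E2B_obj E) (level E Y)" using E.E2B_BtI[OF assms(1) refl assms(2)] .
  obtain X' Y' x' where x: "hT K (level E Y) (Tup [X, u]) = Tup [X', x']" "step D X' Y'" "x' \<in> tm D X' Y'"
    using fr(2)[OF b] by (rule D.E2B_BtE)
  have X': "X' = ob X" using fr(4)[OF b] x s by (simp add: ob_def)
  then have Y': "Y' = ob Y" using D.stepD(5)[OF ob_step[OF assms(1)]] D.stepD(5)[OF x(2)] by simp
  have "one X u = x'" using x s by (simp add: one_def)
  then show "hT K (level E Y) (Tup [X, u]) = Tup [ob X, one X u]" "one X u \<in> tm D (ob X) (ob Y)"
    using x X' Y' by simp_all
qed

text \<open>A homomorphism of B-systems knows substitution, weakening and generic terms of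
  indecomposable arrows only. This lemma and the next four restate its conditions for objects and
  terms of the E-systems.\<close>

lemma ob_so_step:
  assumes VW: "step E V W" and y: "y \<in> tm E V W" and Z: "over E Z V"
  shows "ob (so E V W y Z) = so D (ob V) (ob W) (one V y) (ob Z)"
proof -
  note s = E.stepD[OF VW]
  \<comment> \<open>\<open>m\<close> is the height of \<open>Z\<close> above \<open>V\<close>, that
    is, its index in the slice over \<open>V\<close>, whose level is \<open>Suc ?n\<close>.\<close>
  let ?n = "level E W" define m where "m = level E Z - Suc ?n"
  have m: "level E Z = Suc ?n + m" using E.over_level[OF Z] s by (simp add: m_def)
  have l: "level E (so E V W y Z) = ?n + m" using thomD(5)[OF E.thom_so[OF s(1) y] Z] m s by simp
  have "Z \<in> Bo (bslice (E2B_obj E) (Suc ?n) V) m" using E.E2B_bslice_Bo[OF s(3,2)] Z m by simp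
  from beqD(1)[OF pre_bhomD(2)[OF K E.E2B_BtI[OF VW refl y] E2B_obj_simps(3)[symmetric]] this] show ?thesis
    using m l by (simp add: one(1)[OF VW y] E.E2B_Sb(1)[OF VW] D.E2B_Sb(1)[OF ob_step[OF VW]]) (simp add: ob_def)
qed

lemma one_st_step:
  assumes VW: "step E V W" and y: "y \<in> tm E V W" and Z: "step E Z Q" "over E Q V" and t: "t \<in> tm E Z Q"
  shows "one (so E V W y Z) (st E V W y Z Q t) = st D (ob V) (ob W) (one V y) (ob Z) (ob Q) (one Z t)"
proof -
  note s = E.stepD[OF VW] and z = E.stepD[OF Z(1)]
  let ?n = "level E W" define m where "m = level E Q - Suc ?n"
  have m: "level E Q = Suc ?n + m" using E.over_level[OF Z(2)] s by (simp add: m_def)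
  note T = E.thom_so[OF s(1) y]
  have l: "level E (so E V W y Q) = ?n + m" using thomD(5)[OF T Z(2)] m s by simp
  note sS = thom_step[OF E.E_strat E.E_strat T Z] and tS = thomD(6)[OF T z(1) Z(2) t]
  have b: "Tup [Z, t] \<in> Bt (bslice (E2B_obj E) (Suc ?n) V) m" using E.E2B_bslice_BtI[OF s(3,2) Z m t] .
  have "hT K (?n + m) (Tup [so E V W y Z, st E V W y Z Q t]) = hT (Sb (E2B_obj D) ?n (Tup [ob V, one V y])) m (hT K (Suc ?n + m) (Tup [Z, t]))"
    using beqD(2)[OF pre_bhomD(2)[OF K E.E2B_BtI[OF VW refl y] E2B_obj_simps(3)[symmetric]] b]
    by (simp add: one(1)[OF VW y] E.E2B_Sb(2)[OF VW Z])
  then show ?thesis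
    using one(1)[OF sS tS] one(1)[OF Z(1) t] D.E2B_Sb(2)[OF ob_step[OF VW] ob_step[OF Z(1)] ob_over[OF Z(2)]]
    by (simp add: l m)
qed

lemma ob_wo_step:
  assumes VW: "step E V W" and Z: "over E Z W"
  shows "ob (wo E V W Z) = wo D (ob V) (ob W) (ob Z)"
proof -
  note s = E.stepD[OF VW]
  let ?n = "level E W" define m where "m = level E Z - ?n"
  have m: "level E Z = ?n + m" using E.over_level[OF Z] s by (simp add: m_def)
  have l: "level E (wo E V W Z) = Suc ?n + m" using thomD(5)[OF E.thom_wo[OF s(1)] Z] m s by simp
  have b: "Z \<in> Bo (bslice (E2B_obj E) ?n W) m" using E.E2B_bslice_Bo[OF s(4) refl] Z m by simp
  have V: "V \<in> Bo (E2B_obj E) (Suc ?n)" "W = ft (E2B_obj E) ?n V" using s by auto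
  have oV: "hB K (Suc ?n) V = ob V" using s(2) by (simp add: ob_def)
  show ?thesis
    using beqD(1)[OF pre_bhomD(3)[OF K V] b] m l
    by (simp add: E.E2B_Wb(1)[OF VW] oV D.E2B_Wb(1)[OF ob_step[OF VW]]) (simp add: ob_def)
qed

lemma one_wt_step:
  assumes VW: "step E V W" and Z: "step E Z Q" "over E Q W" and t: "t \<in> tm E Z Q"
  shows "one (wo E V W Z) (wt E V W Z Q t) = wt D (ob V) (ob W) (ob Z) (ob Q) (one Z t)"
proof -
  note s = E.stepD[OF VW] and z = E.stepD[OF Z(1)]
  let ?n = "level E W" define m where "m = level E Q - ?n"
  have m: "level E Q = ?n + m" using E.over_level[OF Z(2)] s by (simp add: m_def)
  note T = E.thom_wo[OF s(1)]
  have l: "level E (wo E V W Q) = Suc ?n + m" using thomD(5)[OF T Z(2)] m s by simp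
  note sS = thom_step[OF E.E_strat E.E_strat T Z] and tS = thomD(6)[OF T z(1) Z(2) t]
  have b: "Tup [Z, t] \<in> Bt (bslice (E2B_obj E) ?n W) m" using E.E2B_bslice_BtI[OF s(4) refl Z m t] .
  have V: "V \<in> Bo (E2B_obj E) (Suc ?n)" "W = ft (E2B_obj E) ?n V" using s by auto
  have oV: "hB K (Suc ?n) V = ob V" using s(2) by (simp add: ob_def)
  have "hT K (Suc ?n + m) (Tup [wo E V W Z, wt E V W Z Q t]) = hT (Wb (E2B_obj D) ?n (ob V)) m (hT K (?n + m) (Tup [Z, t]))"
    using beqD(2)[OF pre_bhomD(3)[OF K V] b] by (simp add: oV E.E2B_Wb(2)[OF VW Z])
  then show ?thesis
    using one(1)[OF sS tS] one(1)[OF Z(1) t] D.E2B_Wb(2)[OF ob_step[OF VW] ob_step[OF Z(1)] ob_over[OF Z(2)]]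
    unfolding l m by simp
qed

lemma one_dt_step:
  assumes VW: "step E V W"
  shows "one (wo E V W V) (dt E V W) = dt D (ob V) (ob W)"
proof -
  note s = E.stepD[OF VW]
  have oV: "hB K (Suc (level E W)) V = ob V" using s(2) by (simp add: ob_def)
  show ?thesis
    using pre_bhomD(4)[OF K, of V "level E W"] s one(1)[OF E.step_Wk[OF VW] E.dt_tm[OF s(1)]]
    by (simp add: E.E2B_dl[OF VW] oV D.E2B_dl[OF ob_step[OF VW]])
qed

lemma ext_id: "X \<in> Ob E \<Longrightarrow> ext X X t = dt D (ob X) (ob X)"
  by (simp add: ext_def ob_def)

lemma tower_step: "\<lbrakk>step E X Y; over E Y Z\<rbrakk> \<Longrightarrow> tower E X Y Z"
  by unfold_locales (use E.stepD in auto)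

lemma D_tower: "\<lbrakk>step E X Y; over E Y Z\<rbrakk> \<Longrightarrow> tower D (ob X) (ob Y) (ob Z)"
  by unfold_locales (use E.stepD ob_over in auto)

lemma so_step: "\<lbrakk>step E X Y; over E Y Z; x \<in> tm E Y Z\<rbrakk> \<Longrightarrow> step E (so E Y Z x X) Z"
  using thom_step[OF E.E_strat E.E_strat E.thom_so, of Y Z x X Y] E.so_base[of Y Z x] E.over_refl E.overD by simp

text \<open>One stage of the recursion. The second component lives on an object one level above
  \<open>Z\<close>, so the index \<open>level E Z\<close> in \<open>ext_tm\<close> agrees with the
  shifted level in \<open>one\<close>.\<close>

lemma ext_step:
  assumes XY: "step E X Y" and YZ: "over E Y Z" and t: "t \<in> tm E X Z"
  shows "ext X Z t = pair D (ob X) (ob Y) (ob Z) (ext Y Z (pr0 E X Y Z t)) (one (so E Y Z (pr0 E X Y Z t) X) (pr1 E X Y Z t))"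
proof -
  interpret T: tower E X Y Z using tower_step XY YZ .
  note s = E.stepD[OF XY]
  have k: "level E X - level E Z = Suc (level E Y - level E Z)" using E.over_level[OF YZ] s by simp
  have l: "level E (so E Y Z (pr0 E X Y Z t) X) = Suc (level E Z)"
    using E.stepD(2)[OF so_step[OF XY YZ T.pr0(1)[OF t]]] .
  show ?thesis unfolding ext_def k ext_tm.simps one_def by (simp add: s(5) ob_def l)
qed

lemma ext_pair:
  assumes XY: "step E X Y" and YZ: "over E Y Z" and x: "x \<in> tm E Y Z" and u: "u \<in> tm E (so E Y Z x X) Z"
  shows "ext X Z (pair E X Y Z x u) = pair D (ob X) (ob Y) (ob Z) (ext Y Z x) (one (so E Y Z x X) u)"
proof -
  interpret T: tower E X Y Z using tower_step XY YZ .
  show ?thesis using ext_step[OF XY YZ T.pair(1)[OF x u]] T.pr_pair[OF x u] by simp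
qed

text \<open>Arrows are shortened at their domain by the indecomposable arrow, as in the recursion of
  \<open>ext_tm\<close>.\<close>

lemma level_induct [consumes 1, case_names base step]:
  assumes "over E X Z" and base: "\<And>X. X \<in> Ob E \<Longrightarrow> P X X"
    and st: "\<And>X Y Z. \<lbrakk>step E X Y; over E Y Z; P Y Z\<rbrakk> \<Longrightarrow> P X Z"
  shows "P X Z"
  using assms(1)
proof (induction "level E X" arbitrary: X rule: less_induct)
  case less
  show ?case
  proof (cases "level E X = level E Z")
    case True
    then show ?thesis using E.over_eq[OF less.prems] base E.overD[OF less.prems] by auto
  next
    case False
    then have l: "level E Z < level E X" using E.over_level[OF less.prems] by simp
    then obtain n where n: "level E X = Suc n" by (cases "level E X") auto
    have s: "step E X (ftE E X)" using E.step_ftE[OF E.overD(1)[OF less.prems] n] by simp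
    note o = E.over_ftE[OF less.prems l]
    show ?thesis using st[OF s o less.hyps[OF _ o]] E.stepD(2)[OF s] by simp
  qed
qed

text \<open>The claims need each other: the second component of \<open>y\<close> lives on S_x(V), so
  its image lies on the right object only if the first component \<open>x\<close> is known to act
  correctly. The induction uses S_y = S_u S_x, with the lemmas for indecomposable arrows applied to
  \<open>u\<close>. The terms \<open>t\<close> are still those of indecomposable arrows; longer ones
  are left to \<open>ext_intertwines\<close>.\<close>

lemma ext_so:
  assumes "over E V W" "y \<in> tm E V W"
  shows "ext V W y \<in> tm D (ob V) (ob W) \<and>
    (\<forall>Z. over E Z V \<longrightarrow> ob (so E V W y Z) = so D (ob V) (ob W) (ext V W y) (ob Z)) \<and>
    (\<forall>Z Q t. step E Z Q \<longrightarrow> over E Q V \<longrightarrow> t \<in> tm E Z Q \<longrightarrow>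
      one (so E V W y Z) (st E V W y Z Q t) = st D (ob V) (ob W) (ext V W y) (ob Z) (ob Q) (one Z t))"
  using assms
proof (induction arbitrary: y rule: level_induct)
  case (base X)
  have y: "dt D (ob X) (ob X) \<in> tm D (ob X) (ob X)" using D.dt_id[OF ob_Ob(1)[OF base(1)]] .
  show ?case
    unfolding ext_id[OF base(1)]
  proof (intro conjI allI impI)
    fix Z assume "over E Z X"
    then show "ob (so E X X y Z) = so D (ob X) (ob X) (dt D (ob X) (ob X)) (ob Z)"
      using E.so_id[OF base(2)] D.so_id[OF y] ob_over by simp
  next
    fix Z Q t assume *: "step E Z Q" "over E Q X" "t \<in> tm E Z Q"
    note z = E.stepD[OF *(1)]
    show "one (so E X X y Z) (st E X X y Z Q t) = st D (ob X) (ob X) (dt D (ob X) (ob X)) (ob Z) (ob Q) (one Z t)"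
      using E.so_id[OF base(2) E.over_trans[OF z(1) *(2)]] E.st_id[OF base(2) z(1) *(2,3)]
        D.st_id[OF y ob_over[OF z(1)] ob_over[OF *(2)] one(2)[OF *(1,3)]] by simp
  qed (rule y)
next
  case (step V W' W)
  interpret T: tower E V W' W using tower_step step(1,2) .
  interpret U: tower D "ob V" "ob W'" "ob W" using D_tower step(1,2) .
  note s = E.stepD[OF step(1)]
  let ?x = "pr0 E V W' W y" and ?u = "pr1 E V W' W y"
  let ?V = "so E W' W ?x V"
  have x: "?x \<in> tm E W' W" using T.pr0(1)[OF step(4)] .
  have u: "?u \<in> tm E ?V W" using T.pr1[OF step(4)] .
  have y: "pair E V W' W ?x ?u = y" using T.pair_pr[OF step(4)] .
  have sV: "step E ?V W" using so_step[OF step(1,2) x] .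
  from step(3)[OF x] have ex: "ext W' W ?x \<in> tm D (ob W') (ob W)"
    and ex2: "\<And>Z. over E Z W' \<Longrightarrow> ob (so E W' W ?x Z) = so D (ob W') (ob W) (ext W' W ?x) (ob Z)"
    and ex3: "\<And>Z Q t. \<lbrakk>step E Z Q; over E Q W'; t \<in> tm E Z Q\<rbrakk> \<Longrightarrow>
      one (so E W' W ?x Z) (st E W' W ?x Z Q t) = st D (ob W') (ob W) (ext W' W ?x) (ob Z) (ob Q) (one Z t)"
    by blast+
  have oV: "ob ?V = so D (ob W') (ob W) (ext W' W ?x) (ob V)" using ex2[OF s(1)] .
  have ou: "one ?V ?u \<in> tm D (so D (ob W') (ob W) (ext W' W ?x) (ob V)) (ob W)" using one(2)[OF sV u] oV by simp
  have e: "ext V W y = pair D (ob V) (ob W') (ob W) (ext W' W ?x) (one ?V ?u)"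
    using ext_pair[OF step(1,2) x u] y by simp
  \<comment> \<open>Both substitutions are decomposed as S_u S_x, by \<open>p\<close> in
    \<open>E\<close> and by \<open>q\<close> in \<open>D\<close>; the factors are then compared
    separately.\<close>
  note p = T.pair[OF x u, unfolded y] and q = U.pair[OF ex ou, folded e oV]
  show ?case
  proof (intro conjI allI impI)
    show "ext V W y \<in> tm D (ob V) (ob W)" using q(1) .
  next
    fix Z assume Z: "over E Z V"
    have o: "over E (so E W' W ?x Z) ?V" using E.Sub_action(3)[OF step(2) x Z s(1)] .
    show "ob (so E V W y Z) = so D (ob V) (ob W) (ext V W y) (ob Z)"
      using p(2)[OF Z] q(2)[OF ob_over[OF Z]] ob_so_step[OF sV u o] ex2[OF E.over_trans[OF Z s(1)]] by simp
  next
    fix Z Q t assume *: "step E Z Q" "over E Q V" "t \<in> tm E Z Q"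
    note z = E.stepD[OF *(1)]
    note QW = E.over_trans[OF *(2) s(1)]
    note S = E.thom_so[OF step(2) x]
    have o: "over E (so E W' W ?x Q) ?V" using E.Sub_action(3)[OF step(2) x *(2) s(1)] .
    have sZ: "step E (so E W' W ?x Z) (so E W' W ?x Q)" using thom_step[OF E.E_strat E.E_strat S *(1) QW] .
    have tt: "st E W' W ?x Z Q t \<in> tm E (so E W' W ?x Z) (so E W' W ?x Q)" using thomD(6)[OF S z(1) QW *(3)] .
    show "one (so E V W y Z) (st E V W y Z Q t) = st D (ob V) (ob W) (ext V W y) (ob Z) (ob Q) (one Z t)"
      using p(2)[OF E.over_trans[OF z(1) *(2)]] p(3)[OF z(1) *(2,3)] one_st_step[OF sV u sZ o tt]
        ex2[OF E.over_trans[OF z(1) QW]] ex2[OF QW] ex3[OF *(1) QW *(3)]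
        q(3)[OF ob_over[OF z(1)] ob_over[OF *(2)] one(2)[OF *(1,3)]] by simp
  qed
qed

text \<open>Weakening by the composite is weakening by the indecomposable arrow after weakening by
  the rest, so \<open>ob_wo_step\<close> and \<open>one_wt_step\<close> treat the outer factor and
  induction the inner one.\<close>

lemma ob_wo:
  assumes "over E V W"
  shows "(\<forall>Z. over E Z W \<longrightarrow> ob (wo E V W Z) = wo D (ob V) (ob W) (ob Z)) \<and>
    (\<forall>Z Q t. step E Z Q \<longrightarrow> over E Q W \<longrightarrow> t \<in> tm E Z Q \<longrightarrow>
      one (wo E V W Z) (wt E V W Z Q t) = wt D (ob V) (ob W) (ob Z) (ob Q) (one Z t))"
  using assms
proof (induction rule: level_induct)
  case (base X)
  show ?case
  proof (intro conjI allI impI)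
    fix Z assume "over E Z X"
    then show "ob (wo E X X Z) = wo D (ob X) (ob X) (ob Z)" using E.wo_id D.wo_id ob_over by simp
  next
    fix Z Q t assume *: "step E Z Q" "over E Q X" "t \<in> tm E Z Q"
    note z = E.stepD[OF *(1)]
    show "one (wo E X X Z) (wt E X X Z Q t) = wt D (ob X) (ob X) (ob Z) (ob Q) (one Z t)"
      using E.wo_id[OF E.over_trans[OF z(1) *(2)]] E.wt_id[OF z(1) *(2,3)]
        D.wt_id[OF ob_over[OF z(1)] ob_over[OF *(2)] one(2)[OF *(1,3)]] by simp
  qed
next
  case (step V W' W)
  note s = E.stepD[OF step(1)]
  show ?case
  proof (intro conjI allI impI)
    fix Z assume Z: "over E Z W"
    show "ob (wo E V W Z) = wo D (ob V) (ob W) (ob Z)"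
      using E.wo_comp[OF s(1) step(2) Z] D.wo_comp[OF ob_over[OF s(1)] ob_over[OF step(2)] ob_over[OF Z]]
        ob_wo_step[OF step(1) E.Wk_action(2)[OF step(2) Z]] step(3) Z by simp
  next
    fix Z Q t assume *: "step E Z Q" "over E Q W" "t \<in> tm E Z Q"
    note z = E.stepD[OF *(1)]
    note T = E.thom_wo[OF step(2)]
    have sZ: "step E (wo E W' W Z) (wo E W' W Q)" using thom_step[OF E.E_strat E.E_strat T *(1,2)] .
    have tt: "wt E W' W Z Q t \<in> tm E (wo E W' W Z) (wo E W' W Q)" using thomD(6)[OF T z(1) *(2,3)] .
    show "one (wo E V W Z) (wt E V W Z Q t) = wt D (ob V) (ob W) (ob Z) (ob Q) (one Z t)"
      using E.wo_comp[OF s(1) step(2) E.over_trans[OF z(1) *(2)]] E.wt_comp[OF s(1) step(2) z(1) *(2,3)]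
        D.wt_comp[OF ob_over[OF s(1)] ob_over[OF step(2)] ob_over[OF z(1)] ob_over[OF *(2)] one(2)[OF *(1,3)]]
        one_wt_step[OF step(1) sZ E.Wk_action(2)[OF step(2) *(2)] tt] step(3) * E.over_trans[OF z(1) *(2)] by simp
  qed
qed

text \<open>A term is a tuple of terms of indecomposable arrows, and homomorphisms preserve tuples, so that
  compatibility with two homomorphisms has to be checked on indecomposable arrows only.\<close>

lemma ext_intertwines:
  assumes p: "thom E A E B po pt" and q: "thom D (ob A) D (ob B) qo qt"
    and 1: "\<And>Z. over E Z A \<Longrightarrow> ob (po Z) = qo (ob Z)"
    and 2: "\<And>Z Q t. \<lbrakk>step E Z Q; over E Q A; t \<in> tm E Z Q\<rbrakk> \<Longrightarrow> one (po Z) (pt Z Q t) = qt (ob Z) (ob Q) (one Z t)"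
    and Z: "over E Z Q" "over E Q A" "t \<in> tm E Z Q"
  shows "ext (po Z) (po Q) (pt Z Q t) = qt (ob Z) (ob Q) (ext Z Q t)"
  using Z
proof (induction arbitrary: t rule: level_induct)
  case (base X)
  note P = thomD[OF p] and Q = thomD[OF q]
  have pX: "po X \<in> Ob E" using E.overD[OF P(4)[OF E.over_refl[OF base(1)] base(2)]] by simp
  have oX: "over D (ob X) (ob X)" using ob_over[OF E.over_refl[OF base(1)]] .
  \<comment> \<open>\<open>qt\<close> sends a term of an identity to a term of an identity, and
    there is only one such term.\<close>
  have q': "qt (ob X) (ob X) (dt D (ob X) (ob X)) \<in> tm D (qo (ob X)) (qo (ob X))"
    using Q(6)[OF oX ob_over[OF base(2)] D.dt_id] D.overD[OF oX] by simp
  have "qo (ob X) \<in> Ob D" using ob_Ob(1)[OF pX] 1[OF base(2)] by simp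
  from q' D.tm_id[OF this] have "qt (ob X) (ob X) (dt D (ob X) (ob X)) = dt D (qo (ob X)) (qo (ob X))" by simp
  then show ?case using ext_id[OF pX] ext_id[OF base(1)] 1[OF base(2)] by simp
next
  case (step X Y Z)
  interpret T: tower E X Y Z using tower_step step(1,2) .
  interpret U: tower D "ob X" "ob Y" "ob Z" using D_tower step(1,2) .
  note P = thomD[OF p]
  note s = E.stepD[OF step(1)]
  note YA = E.over_trans[OF step(2,4)]
  let ?x = "pr0 E X Y Z t" and ?u = "pr1 E X Y Z t"
  let ?X = "so E Y Z ?x X"
  have x: "?x \<in> tm E Y Z" using T.pr0(1)[OF step(5)] .
  have u: "?u \<in> tm E ?X Z" using T.pr1[OF step(5)] .
  have t: "pair E X Y Z ?x ?u = t" using T.pair_pr[OF step(5)] .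
  have sX: "step E ?X Z" using so_step[OF step(1,2) x] .
  have e: "ob ?X = so D (ob Y) (ob Z) (ext Y Z ?x) (ob X)" and ex: "ext Y Z ?x \<in> tm D (ob Y) (ob Z)"
    using ext_so[OF step(2) x] s(1) by blast+
  have ou: "one ?X ?u \<in> tm D (so D (ob Y) (ob Z) (ext Y Z ?x) (ob X)) (ob Z)" using one(2)[OF sX u] e by simp
  have sP: "step E (po X) (po Y)" using thom_step[OF E.E_strat E.E_strat p step(1) YA] .
  have pS: "po ?X = so E (po Y) (po Z) (pt Y Z ?x) (po X)" using P(7)[OF step(2,4) x s(1)] .
  have px: "pt Y Z ?x \<in> tm E (po Y) (po Z)" using P(6)[OF step(2,4) x] .
  have pu: "pt ?X Z ?u \<in> tm E (so E (po Y) (po Z) (pt Y Z ?x) (po X)) (po Z)"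
    using P(6)[OF E.stepD(1)[OF sX] step(4) u] pS by simp
  \<comment> \<open>\<open>p\<close> preserves the pair, \<open>ext\<close> maps it componentwise,
    induction and assumption \<open>2\<close> treat the two components, and \<open>q\<close>
    reassembles them.\<close>
  have "ext (po X) (po Z) (pt X Z t) = ext (po X) (po Z) (pair E (po X) (po Y) (po Z) (pt Y Z ?x) (pt ?X Z ?u))"
    using T.hom_pair[OF E.E_strat p step(4) x u] t by simp
  also have "\<dots> = pair D (qo (ob X)) (qo (ob Y)) (qo (ob Z)) (qt (ob Y) (ob Z) (ext Y Z ?x)) (qt (ob ?X) (ob Z) (one ?X ?u))"
    using ext_pair[OF sP P(4)[OF step(2,4)] px pu] step(3)[OF step(4) x] 2[OF sX step(4) u] pS
      1[OF E.over_trans[OF s(1) YA]] 1[OF YA] 1[OF step(4)] by simp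
  also have "\<dots> = qt (ob X) (ob Z) (pair D (ob X) (ob Y) (ob Z) (ext Y Z ?x) (one ?X ?u))"
    using U.hom_pair[OF D.E_strat q ob_over[OF step(4)] ex ou] e by simp
  also have "pair D (ob X) (ob Y) (ob Z) (ext Y Z ?x) (one ?X ?u) = ext X Z t"
    using ext_pair[OF step(1,2) x u] t by simp
  finally show ?case .
qed

text \<open>The recursion splits even an indecomposable arrow, into itself and an identity. The
  component at the identity is the generic term, substitution by it is the identity, and pairing
  with it changes nothing.\<close>

lemma ext_one:
  assumes XY: "step E X Y" and t: "t \<in> tm E X Y"
  shows "ext X Y t = one X t"
proof -
  note s = E.stepD[OF XY]
  have YY: "over E Y Y" using E.over_refl[OF s(4)] .
  interpret T: tower E X Y Y using tower_step XY YY .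
  interpret U: tower D "ob X" "ob Y" "ob Y" using D_tower XY YY .
  note oY = ob_Ob(1)[OF s(4)]
  have x: "pr0 E X Y Y t \<in> tm E Y Y" using T.pr0(1)[OF t] .
  have p: "pr1 E X Y Y t = t" using E.st_dt[OF s(1) t] by (simp add: pr1_def)
  have d: "dt D (ob Y) (ob Y) \<in> tm D (ob Y) (ob Y)" using D.dt_id[OF oY] .
  have o: "one X t \<in> tm D (so D (ob Y) (ob Y) (dt D (ob Y) (ob Y)) (ob X)) (ob Y)"
    using one(2)[OF XY t] D.so_id[OF d ob_over[OF s(1)]] by simp
  have "pr1 D (ob X) (ob Y) (ob Y) (one X t) = one X t"
    using D.st_dt[OF ob_over[OF s(1)] one(2)[OF XY t]] by (simp add: pr1_def)
  moreover have "pr0 D (ob X) (ob Y) (ob Y) (one X t) = dt D (ob Y) (ob Y)"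
    using U.pr0(1)[OF one(2)[OF XY t]] D.tm_id[OF oY] by simp
  ultimately have "pair D (ob X) (ob Y) (ob Y) (dt D (ob Y) (ob Y)) (one X t) = one X t"
    using U.pair_pr[OF one(2)[OF XY t]] by simp
  then show ?thesis using ext_step[OF XY YY t] ext_id[OF s(4)] E.so_id[OF x s(1)] p by simp
qed

text \<open>By \<open>dt_pair\<close> the components of idtm_{A.P} are W_P(idtm_A) and idtm_P.
  Induction together with \<open>ext_intertwines\<close> for W_P handles the former,
  \<open>one_dt_step\<close> the latter, and \<open>dt_pair\<close> in \<open>D\<close> reassembles
  them.\<close>

lemma ext_dt:
  assumes "over E V W"
  shows "ext (wo E V W V) V (dt E V W) = dt D (ob V) (ob W)"
  using assms
proof (induction rule: level_induct)
  case (base X)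
  then show ?case using E.wo_id[OF E.over_refl[OF base]] ext_id by simp
next
  case (step V Y W)
  interpret T: tower E V Y W using tower_step step(1,2) .
  interpret U: tower D "ob V" "ob Y" "ob W" using D_tower step(1,2) .
  note s = E.stepD[OF step(1)]
  let ?X = "wo E V W V" and ?Y = "wo E V W Y"
  have oX: "ob ?X = wo D (ob V) (ob W) (ob V)" and oY: "ob ?Y = wo D (ob V) (ob W) (ob Y)"
    using ob_wo[OF T.XZ] T.XZ step(2) by blast+
  have sX: "step E ?X ?Y" using thom_step[OF E.E_strat E.E_strat E.thom_wo[OF T.XZ] step(1,2)] .
  have YV: "over E ?Y V" using T.wo_tower(2) .
  interpret T': tower E ?X ?Y V using tower_step sX YV .
  interpret U': tower D "ob ?X" "ob ?Y" "ob V" using D_tower sX YV .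
  have d: "dt E V W \<in> tm E ?X V" using E.dt_tm[OF T.XZ] .
  let ?x = "wt E V Y (wo E Y W Y) Y (dt E Y W)"
  have wY: "over E (wo E Y W Y) Y" using E.Wk_action(2)[OF step(2,2)] .
  have Yeq: "?Y = wo E V Y (wo E Y W Y)" using E.wo_comp[OF s(1) step(2,2)] .
  \<comment> \<open>The second component idtm_P is a term of W_P(P); substitution by the first
    component has to send the weakened \<open>V\<close> to exactly this object.\<close>
  have X': "so E ?Y V ?x ?X = wo E V Y V"
  proof -
    have "so E ?Y V ?x ?X = so E ?X V (dt E V W) (wo E ?X ?Y ?X)" using T'.pr0(2)[OF d T'.XY] T.dt_pair(1) by simp
    also have "wo E ?X ?Y ?X = wo E V W (wo E V Y V)"
      using T.WXZ(9)[OF s(1) step(2) s(1)] by simp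
    also have "so E ?X V (dt E V W) \<dots> = wo E V Y V" using E.so_dt[OF T.XZ E.Wk_action(2)[OF s(1,1)]] .
    finally show ?thesis .
  qed
  have ex: "ext ?Y V ?x = wt D (ob V) (ob Y) (ob (wo E Y W Y)) (ob Y) (dt D (ob Y) (ob W))"
  proof -
    have "ext (wo E V Y (wo E Y W Y)) (wo E V Y Y) (wt E V Y (wo E Y W Y) Y (dt E Y W))
      = wt D (ob V) (ob Y) (ob (wo E Y W Y)) (ob Y) (ext (wo E Y W Y) Y (dt E Y W))"
      using ob_wo[OF s(1)] by (intro ext_intertwines[OF E.thom_wo[OF s(1)] D.thom_wo[OF ob_over[OF s(1)]] _ _ wY T.YY E.dt_tm[OF step(2)]]) blast+
    then show ?thesis using E.wo_base[OF s(1)] Yeq step(3) by simp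
  qed
  have "ext ?X V (dt E V W) = pair D (ob ?X) (ob ?Y) (ob V)
      (wt D (ob V) (ob Y) (ob (wo E Y W Y)) (ob Y) (dt D (ob Y) (ob W))) (dt D (ob V) (ob Y))"
    using ext_step[OF sX YV d] one_dt_step[OF step(1)] by (simp add: T.dt_pair X' ex)
  also have "\<dots> = dt D (ob V) (ob W)"
  proof -
    have oW: "ob (wo E Y W Y) = wo D (ob Y) (ob W) (ob Y)" using ob_wo[OF step(2)] step(2) by blast
    have "dt D (ob V) (ob W) \<in> tm D (ob ?X) (ob V)" using D.dt_tm[OF U.XZ] oX by simp
    from U'.pair_pr[OF this] show ?thesis using U.dt_pair by (simp add: oX oY oW)
  qed
  finally show ?case .
qed

text \<open>The conditions on objects are \<open>ext_so\<close> and \<open>ob_wo\<close>. Those on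
  arbitrary terms are instances of \<open>ext_intertwines\<close>, with substitution by
  \<open>y\<close> in \<open>E\<close> facing substitution by its extension in \<open>D\<close>, or
  weakening facing weakening.\<close>

lemma thom_ext: "thom E (Top E) D (Top D) ob ext"
  unfolding thom_def
proof (intro conjI allI impI)
  show "Top E \<in> Ob E" "Top D \<in> Ob D" by (fact E.top D.top)+
  show "ob (Top E) = Top D" using ob_Ob[OF E.top(1)] E.level_top D.level_zero by simp
  fix Z assume "over E Z (Top E)"
  then show "level D (ob Z) + level E (Top E) = level E Z + level D (Top D)"
    using ob_Ob(2) E.overD by (simp add: E.level_top D.level_top)
next
  fix V W y Z Q t assume *: "over E V W" "over E W (Top E)" "y \<in> tm E V W" "over E Z Q" "over E Q V" "t \<in> tm E Z Q"
  note e = ext_so[OF *(1,3)]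
  show "ext (so E V W y Z) (so E V W y Q) (st E V W y Z Q t) = st D (ob V) (ob W) (ext V W y) (ob Z) (ob Q) (ext Z Q t)"
    using e by (intro ext_intertwines[OF E.thom_so[OF *(1,3)] D.thom_so[OF ob_over[OF *(1)] conjunct1[OF e]] _ _ *(4-6)]) blast+
next
  fix V W Z Q t assume *: "over E V W" "over E W (Top E)" "over E Z Q" "over E Q W" "t \<in> tm E Z Q"
  show "ext (wo E V W Z) (wo E V W Q) (wt E V W Z Q t) = wt D (ob V) (ob W) (ob Z) (ob Q) (ext Z Q t)"
    using ob_wo[OF *(1)] by (intro ext_intertwines[OF E.thom_wo[OF *(1)] D.thom_wo[OF ob_over[OF *(1)]] _ _ *(3-5)]) blast+
qed (use ob_over ext_so ob_wo ext_dt in blast)+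

text \<open>A homomorphism preserves pairs and has no choice at identities, so induction along the
  arrow reduces the comparison to indecomposable arrows, where assumption \<open>2\<close> decides
  it.\<close>

lemma ext_unique:
  assumes h: "thom E (Top E) D (Top D) ho ht"
    and 1: "\<And>X. X \<in> Ob E \<Longrightarrow> ho X = ob X" and 2: "\<And>X Y t. \<lbrakk>step E X Y; t \<in> tm E X Y\<rbrakk> \<Longrightarrow> ht X Y t = one X t"
    and X: "over E X Z" "t \<in> tm E X Z"
  shows "ht X Z t = ext X Z t"
  using X
proof (induction arbitrary: t rule: level_induct)
  case (base X)
  have "ht X X t \<in> tm D (ob X) (ob X)"
    using thomD(6)[OF h E.over_refl[OF base(1)] E.over_top[OF base(1)] base(2)] 1 base(1) by simp
  then show ?case using D.tm_id[OF ob_Ob(1)[OF base(1)]] ext_id[OF base(1)] by simp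
next
  case (step X Y Z)
  interpret T: tower E X Y Z using tower_step step(1,2) .
  note s = E.stepD[OF step(1)]
  note x = T.pr0(1)[OF step(4)] and u = T.pr1[OF step(4)]
  have Z: "Z \<in> Ob E" using E.overD[OF step(2)] by simp
  show ?case
    using T.hom_pair[OF D.E_strat h E.over_top[OF Z] x u] T.pair_pr[OF step(4)] step(3)[OF x]
      2[OF so_step[OF step(1,2) x] u] ext_step[OF step(1,2,4)] 1[OF s(3)] 1[OF s(4)] 1[OF Z] by simp
qed

end

section \<open>\<open>E2B\<close> is full and faithful\<close>

lemma E2B_faithful:
  fixes E D :: "'a esystem"
  assumes f: "(E, F, D) \<in> Ar Esys\<^sub>s" and g: "(E, G, D) \<in> Ar Esys\<^sub>s"
    and eq: "bres (E2B_obj E) (E2B_hom E (level E) F) = bres (E2B_obj E) (E2B_hom E (level E) G)"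
  shows "F = G"
proof -
  have E: "stratified_esystem E" and D: "stratified_esystem D" using f by auto
  interpret E: strat_esys_univ E using E by (simp add: strat_esys_univ_def strat_esysI)
  interpret D: strat_esys_univ D using D by (simp add: strat_esys_univ_def strat_esysI)
  \<comment> \<open>\<open>K\<close> is the common image of \<open>F\<close> and \<open>G\<close>;
    each of them agrees with the extension of \<open>K\<close>, hence with the other.\<close>
  define K where "K = bres (E2B_obj E) (E2B_hom E (level E) F)"
  have hF: "stratified_ehom E D F" and hG: "stratified_ehom E D G" using f g by auto
  have "pre_bhom (E2B_obj E) (E2B_obj D) K"
    unfolding K_def using pre_bhom_bres[OF E.bsystem_E2B pre_bhom_E2B_hom[OF E.E_strat D.E_strat hF]] .
  then interpret bhom_ext E D K by unfold_locales
  have F: "stratified_ehom E D F" "bres (E2B_obj E) (E2B_hom E (level E) F) = K"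
    and G: "stratified_ehom E D G" "bres (E2B_obj E) (E2B_hom E (level E) G) = K"
    using hF hG eq by (simp_all add: K_def)
  have 1: "onO H X = ob X"
    if H: "bres (E2B_obj E) (E2B_hom E (level E) H) = K" and X: "X \<in> Ob E" for H X
  proof -
    have "ob X = hB (bres (E2B_obj E) (E2B_hom E (level E) H)) (level E X) X" by (simp add: ob_def H)
    then show ?thesis using X by simp
  qed
  have 2: "onT H (arrow E X Y) t = one X t"
    if H: "bres (E2B_obj E) (E2B_hom E (level E) H) = K" and s: "step E X Y" "t \<in> tm E X Y" for H X Y t
  proof -
    have "one X t = on_pair (\<lambda>X x. x) (hT (bres (E2B_obj E) (E2B_hom E (level E) H)) (level E X - 1) (Tup [X, t]))"
      by (simp add: one_def H)
    then show ?thesis using E.E2B_BtI[OF s(1) refl s(2)] E.stepD[OF s(1)] by (simp add: E.indec_step[OF s(1)])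
  qed
  have 3: "onA H (arrow E Z W) = arrow D (ob Z) (ob W)" "t \<in> tm E Z W \<Longrightarrow> onT H (arrow E Z W) t = ext Z W t"
    if H: "stratified_ehom E D H" "bres (E2B_obj E) (E2B_hom E (level E) H) = K" and ZW: "over E Z W" for H Z W t
  proof -
    have H': "pre_ehom E D H" "\<And>X. X \<in> Ob E \<Longrightarrow> level D (onO H X) = level E X" using H by (auto simp: stratified_ehom_def)
    note h = thom_pre_ehom[OF E.E_strat D.E_strat H']
    show "onA H (arrow E Z W) = arrow D (ob Z) (ob W)" using h(2)[OF _ ZW] 1[OF H(2)] E.overD[OF ZW] by simp
    show "onT H (arrow E Z W) t = ext Z W t" if "t \<in> tm E Z W"
      using ext_unique[OF h(1) 1[OF H(2)] 2[OF H(2)] ZW that] by simp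
  qed
  have arE: "\<exists>Z W. f = arrow E Z W \<and> over E Z W" if "f \<in> Ar E" for f
    using E.arrow_eq[OF that refl refl, symmetric] that unfolding over_def by blast
  have "teq E F G"
    unfolding teq_def
  proof (intro conjI ballI)
    fix X assume X: "X \<in> Ob E"
    then show "onO F X = onO G X" using 1[OF F(2)] 1[OF G(2)] by simp
  next
    fix f assume "f \<in> Ar E"
    then obtain Z W where z: "f = arrow E Z W" "over E Z W" using arE by blast
    then show "onA F f = onA G f" using 3(1)[OF F] 3(1)[OF G] by simp
    fix t assume "t \<in> Tm E f"
    then have "t \<in> tm E Z W" by (simp add: z(1) tm_def)
    then show "onT F f t = onT G f t" using 3(2)[OF F z(2)] 3(2)[OF G z(2)] z(1) by simp
  qed
  then have "tres E F = tres E G" by (simp add: tres_eq_iff)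
  then show ?thesis using f g by simp
qed

lemma E2B_full:
  fixes E D :: "'a esystem"
  assumes E: "stratified_esystem E" and D: "stratified_esystem D" and K: "(E2B_obj E, K, E2B_obj D) \<in> Ar Bsys"
  shows "\<exists>F. (E, F, D) \<in> Ar Esys\<^sub>s \<and> bres (E2B_obj E) (E2B_hom E (level E) F) = K"
proof -
  interpret E: strat_esys_univ E using E by (simp add: strat_esys_univ_def strat_esysI)
  interpret D: strat_esys_univ D using D by (simp add: strat_esys_univ_def strat_esysI)
  have K': "pre_bhom (E2B_obj E) (E2B_obj D) K" "bres (E2B_obj E) K = K" using K by auto
  interpret bhom_ext E D K using K' by unfold_locales
  define F where "F = \<lparr>onO = ob, onA = \<lambda>f. arrow D (ob (Dom E f)) (ob (Cod E f)), onT = \<lambda>f. ext (Dom E f) (Cod E f)\<rparr>"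
  have F: "stratified_ehom E D F"
    unfolding stratified_ehom_def F_def using thom_stratified_ehom[OF E.E_strat D.E_strat thom_ext] by blast
  \<comment> \<open>The extension restricts to \<open>K\<close> again: on elements this is
    \<open>ext_one\<close>.\<close>
  have "beq (E2B_obj E) (E2B_hom E (level E) (tres E F)) K"
  proof (rule beqI)
    fix n X assume "X \<in> Bo (E2B_obj E) n"
    then show "hB (E2B_hom E (level E) (tres E F)) n X = hB K n X" by (auto simp: tres_def F_def ob_def)
  next
    fix n x assume "x \<in> Bt (E2B_obj E) n"
    then obtain X Y y where y: "x = Tup [X, y]" "step E X Y" "level E Y = n" "y \<in> tm E X Y" by (rule E.E2B_BtE)
    note s = E.stepD[OF y(2)]
    show "hT (E2B_hom E (level E) (tres E F)) n x = hT K n x"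
      using s E.arrow[OF s(1)] y(4) one(1)[OF y(2,4)]
      by (simp add: y(1) y(3)[symmetric] E.indec_step[OF y(2)] tres_def F_def tm_def ext_one[OF y(2,4)])
  qed
  then have "bres (E2B_obj E) (E2B_hom E (level E) (tres E F)) = K" using K'(2) by (metis bres_eq_iff)
  moreover have "(E, tres E F, D) \<in> Ar Esys\<^sub>s" using E D stratified_ehom_tres[OF E F] by simp
  ultimately show ?thesis by blast
qed

section \<open>The equivalence\<close>

lemma B2E_simps:
  "onO B2E B = B2E_obj B" "onA B2E (B, H, A) = (B2E_obj B, tres (B2E_obj B) (B2E_hom H), B2E_obj A)"
  by (simp_all add: B2E_def)

section \<open>Functoriality of \<open>B2E\<close>\<close>

lemma teq_B2E_hom:
  assumes "beq B H K"
  shows "teq (B2E_obj B) (B2E_hom H) (B2E_hom K)"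
  unfolding teq_def
proof (intro conjI ballI)
  fix v assume "v \<in> Ob (B2E_obj B)"
  then show "onO (B2E_hom H) v = onO (B2E_hom K) v" using beqD(1)[OF assms] by (elim B2E_obj_ObE) simp
next
  fix f assume f: "f \<in> Ar (B2E_obj B)"
  then show "onA (B2E_hom H) f = onA (B2E_hom K) f" using beqD(1)[OF assms] by (elim B2E_obj_ArE) simp
  fix t assume t: "t \<in> Tm (B2E_obj B) f"
  obtain n X k where X: "f = arr n X k" using f by (rule B2E_obj_ArE)
  then obtain ts where ts: "t = Tup ts" "ts \<in> terms B n k X" using t by auto
  then show "onT (B2E_hom H) f t = onT (B2E_hom K) f t"
    using beqD(2)[OF assms] set_terms[OF ts(2)] by (auto simp: X)
qed

lemma stratified_ehom_B2E_hom:
  assumes "bsystem B" "bsystem A" "pre_bhom B A H"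
  shows "stratified_ehom (B2E_obj B) (B2E_obj A) (B2E_hom H)"
  unfolding stratified_ehom_def
proof (intro conjI ballI)
  show "pre_ehom (B2E_obj B) (B2E_obj A) (B2E_hom H)" by (rule pre_ehom_B2E_hom[OF assms])
  fix v assume "v \<in> Ob (B2E_obj B)"
  then obtain n X where v: "v = vtx n X" "X \<in> Bo B n" by (rule B2E_obj_ObE)
  then show "level (B2E_obj A) (onO (B2E_hom H) v) = level (B2E_obj B) v"
    using level_B2E_obj[OF bsystemD(1)[OF assms(1)]] level_B2E_obj[OF bsystemD(1)[OF assms(2)]]
      frame_homD(1)[OF pre_bhomD(1)[OF assms(3)]] by simp
qed

lemma is_functor_B2E: "is_functor Bsys Esys\<^sub>s B2E"
  unfolding is_functor_def
proof (intro conjI ballI impI)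
  fix B :: "'a bsystem" assume B: "B \<in> Ob Bsys"
  then show "onO B2E B \<in> Ob Esys\<^sub>s" using stratified_esystem_B2E_obj by (simp add: B2E_simps)
  have "teq (B2E_obj B) (B2E_hom bid) tid"
    unfolding teq_def by (auto elim!: B2E_obj_ObE B2E_obj_ArE simp: hT_bid)
  then show "onA B2E (Idt Bsys B) = Idt Esys\<^sub>s (onO B2E B)"
    using teq_trans[OF teq_B2E_hom[OF beq_bres]] by (simp add: B2E_simps tres_eq_iff)
next
  fix f :: "'a bmor" assume "f \<in> Ar Bsys"
  then obtain B H A where f: "f = (B, H, A)" "bsystem B" "bsystem A" "pre_bhom B A H" using Bsys_triple by blast
  note S = stratified_esystem_B2E_obj[OF f(2)] stratified_esystem_B2E_obj[OF f(3)]
  show "onA B2E f \<in> Ar Esys\<^sub>s" "Dom Esys\<^sub>s (onA B2E f) = onO B2E (Dom Bsys f)" "Cod Esys\<^sub>s (onA B2E f) = onO B2E (Cod Bsys f)"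
    using S stratified_ehom_tres[OF S(1) stratified_ehom_B2E_hom[OF f(2-4)]] by (simp_all add: f(1) B2E_simps)
next
  fix f g :: "'a bmor" assume *: "f \<in> Ar Bsys" "g \<in> Ar Bsys" "Cod Bsys f = Dom Bsys g"
  then obtain B H A C K where f: "f = (B, H, A)" "g = (A, K, C)" "bsystem B" "bsystem A" "pre_bhom B A H"
    using Bsys_triple[of f] Bsys_triple[of g] by auto
  have "teq (B2E_obj B) (B2E_hom (K \<circ>\<^sub>B H)) (B2E_hom K \<circ>\<^sub>T B2E_hom H)"
    unfolding teq_def by (auto elim!: B2E_obj_ObE B2E_obj_ArE)
  from teq_trans[OF teq_B2E_hom[OF beq_bres] this]
  show "onA B2E (Comp Bsys g f) = Comp Esys\<^sub>s (onA B2E g) (onA B2E f)"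
    using tres_comp_left[OF is_tfunctor_B2E_hom[OF f(3-5)], of "B2E_hom K"]
    by (simp add: f(1,2) B2E_simps) (simp add: tres_eq_iff[symmetric])
qed

text \<open>A term of an edge is encoded as a tuple of length one, and an element of the coproduct
  carries its object. Hence the one-entry tuple of \<open>x\<close> is tagged with the vertex of its
  boundary, which has level \<open>Suc n\<close>.\<close>

definition unit_hom :: "'a bsystem \<Rightarrow> ('a univ, 'a univ) bhom" where
  "unit_hom B = \<lparr>hB = vtx, hT = \<lambda>n x. Tup [vtx (Suc n) (bd B n x), Tup [x]]\<rparr>"

lemma unit_hom_simps [simp]:
  "hB (unit_hom B) n X = vtx n X" "hT (unit_hom B) n x = Tup [vtx (Suc n) (bd B n x), Tup [x]]"
  by (simp_all add: unit_hom_def)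

section \<open>The unit is a natural isomorphism\<close>

locale bsystem_esys =
  fixes B :: "'a bsystem"
  assumes B: "bsystem B"
begin

abbreviation "E \<equiv> B2E_obj B"

sublocale E: strat_esys_univ E
  using stratified_esystem_B2E_obj[OF B] by (simp add: strat_esys_univ_def strat_esysI)

lemmas fr = bsystemD(1)[OF B]

lemma arrow_vtx: "X \<in> Bo B (n + k) \<Longrightarrow> arrow E (vtx (n + k) X) (vtx n (ftm B n k X)) = arr n X k"
  by (rule E.arrow_eq) simp_all

lemma arrow_vtx': "\<lbrakk>X \<in> Bo B (n + k); Y = ftm B n k X\<rbrakk> \<Longrightarrow> arrow E (vtx (n + k) X) (vtx n Y) = arr n X k"
  using arrow_vtx by simp

lemma over_vtx: "\<lbrakk>X \<in> Bo B (n + k); Y = ftm B n k X\<rbrakk> \<Longrightarrow> over E (vtx (n + k) X) (vtx n Y)"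
  unfolding over_def by (rule bexI[of _ "arr n X k"]) simp_all

lemma arrow_vtx_ft: "X \<in> Bo B (Suc n) \<Longrightarrow> arrow E (vtx (Suc n) X) (vtx n (ft B n X)) = arr n X 1"
  using arrow_vtx[of X n 1] by simp

lemma step_vtx: "X \<in> Bo B (Suc n) \<Longrightarrow> step E (vtx (Suc n) X) (vtx n (ft B n X))"
  using over_vtx[of X n 1] is_bframe_ft[OF fr] by (simp add: step_def level_B2E_obj[OF fr])

lemma sub_list_single [simp]: "sub_list B n [x] = Sb B n x"
  using sub_list_snoc[of B n "[]" x] by simp

lemma tm_vtx: "X \<in> Bo B (Suc n) \<Longrightarrow> tm E (vtx (Suc n) X) (vtx n (ft B n X)) = {Tup [x] |x. x \<in> Bt B n \<and> bd B n x = X}"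
  by (auto simp: tm_def arrow_vtx_ft)

lemma so_vtx:
  assumes "X \<in> Bo B (Suc n)" "Z \<in> Bo B (Suc (n + m))" "ftm B (Suc n) m Z = X"
  shows "so E (vtx (Suc n) X) (vtx n (ft B n X)) (Tup [x]) (vtx (Suc (n + m)) Z) = vtx (n + m) (hB (Sb B n x) m Z)"
  using arrow_vtx'[of Z "Suc n" m X] assms by (simp add: so_def arrow_vtx_ft)

lemma wo_vtx:
  assumes "X \<in> Bo B (Suc n)" "Z \<in> Bo B (n + m)" "ftm B n m Z = ft B n X"
  shows "wo E (vtx (Suc n) X) (vtx n (ft B n X)) (vtx (n + m) Z) = vtx (Suc (n + m)) (hB (Wb B n X) m Z)"
  using arrow_vtx'[of Z n m "ft B n X"] assms by (simp add: wo_def arrow_vtx_ft)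

lemma st_vtx:
  assumes "X \<in> Bo B (Suc n)" "Z \<in> Bo B (Suc (Suc (n + m)))" "ftm B (Suc n) m (ft B (Suc (n + m)) Z) = X"
  shows "st E (vtx (Suc n) X) (vtx n (ft B n X)) (Tup [x]) (vtx (Suc (Suc (n + m))) Z)
    (vtx (Suc (n + m)) (ft B (Suc (n + m)) Z)) (Tup [z]) = Tup [hT (Sb B n x) m z]"
  using arrow_vtx'[of "ft B (Suc (n + m)) Z" "Suc n" m X] arrow_vtx_ft[of Z "Suc (n + m)"] is_bframe_ft[OF fr, of Z "Suc (n + m)"] assms
  by (simp add: st_def arrow_vtx_ft)

lemma wt_vtx:
  assumes "X \<in> Bo B (Suc n)" "Z \<in> Bo B (Suc (n + m))" "ftm B n m (ft B (n + m) Z) = ft B n X"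
  shows "wt E (vtx (Suc n) X) (vtx n (ft B n X)) (vtx (Suc (n + m)) Z)
    (vtx (n + m) (ft B (n + m) Z)) (Tup [z]) = Tup [hT (Wb B n X) m z]"
  using arrow_vtx'[of "ft B (n + m) Z" n m "ft B n X"] arrow_vtx_ft[of Z "n + m"] is_bframe_ft[OF fr, of Z "n + m"] assms
  by (simp add: wt_def arrow_vtx_ft)

lemma dt_vtx: "X \<in> Bo B (Suc n) \<Longrightarrow> dt E (vtx (Suc n) X) (vtx n (ft B n X)) = Tup [dl B n X]"
  by (simp add: dt_def arrow_vtx_ft)

lemma frame_hom_unit: "frame_hom B (E2B_obj E) (unit_hom B)"
  unfolding frame_hom_def
proof (intro conjI allI ballI)
  fix n x assume x: "x \<in> Bt B n"
  note b = is_bframe_bd[OF fr x]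
  show "hT (unit_hom B) n x \<in> Bt (E2B_obj E) n"
    using E.E2B_BtI[OF step_vtx[OF b], of n "Tup [x]"] tm_vtx[OF b] x is_bframe_ft[OF fr b] by (auto simp: level_B2E_obj[OF fr])
qed (use E.stepD(5)[OF step_vtx] level_B2E_obj[OF fr] in auto)

text \<open>At a single edge \<open>sub_list\<close> and \<open>wk_list\<close> are just S_x and
  W_X, so after both functors the operations of \<open>B\<close> reappear, relabelled by vertices
  and one-entry tuples.\<close>

lemma pre_bhom_unit: "pre_bhom B (E2B_obj E) (unit_hom B)"
  unfolding pre_bhom_def
proof (intro conjI allI ballI)
  show "frame_hom B (E2B_obj E) (unit_hom B)" by (rule frame_hom_unit)
next
  fix n x assume x: "x \<in> Bt B n"
  let ?X = "bd B n x"
  note X = is_bframe_bd[OF fr x]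
  note sX = step_vtx[OF X]
  note fS = frame_homD[OF pre_bhomD(1)[OF bsystemD(2)[OF B x refl refl]]]
  show "beq (bslice B (Suc n) ?X) (bslice_hom n (unit_hom B) \<circ>\<^sub>B Sb B n x)
     (Sb (E2B_obj E) n (hT (unit_hom B) n x) \<circ>\<^sub>B bslice_hom (Suc n) (unit_hom B))"
  proof (rule beqI)
    fix m Z assume "Z \<in> Bo (bslice B (Suc n) ?X) m"
    then show "hB (bslice_hom n (unit_hom B) \<circ>\<^sub>B Sb B n x) m Z
      = hB (Sb (E2B_obj E) n (hT (unit_hom B) n x) \<circ>\<^sub>B bslice_hom (Suc n) (unit_hom B)) m Z"
      using so_vtx[OF X, of Z m x] by (simp add: E.E2B_Sb(1)[OF sX])
  next
    fix m z assume z: "z \<in> Bt (bslice B (Suc n) ?X) m"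
    define Z where "Z = bd B (Suc (n + m)) z"
    have z': "z \<in> Bt B (Suc (n + m))" "ftm B (Suc n) m (ft B (Suc (n + m)) Z) = ?X" using z by (auto simp: Z_def)
    have Z: "Z \<in> Bo B (Suc (Suc (n + m)))" using is_bframe_bd[OF fr z'(1)] by (simp add: Z_def)
    have o: "over E (vtx (Suc (n + m)) (ft B (Suc (n + m)) Z)) (vtx (Suc n) ?X)"
      using over_vtx[of "ft B (Suc (n + m)) Z" "Suc n" m ?X] is_bframe_ft[OF fr Z] z'(2) by simp
    \<comment> \<open>The unit tags an element with the vertex of its boundary, so the boundary of
      the substituted element has to be known.\<close>
    have "bd B (n + m) (hT (Sb B n x) m z) = hB (Sb B n x) (Suc m) Z" using fS(4)[OF z] by (simp add: Z_def)
    then show "hT (bslice_hom n (unit_hom B) \<circ>\<^sub>B Sb B n x) m z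
      = hT (Sb (E2B_obj E) n (hT (unit_hom B) n x) \<circ>\<^sub>B bslice_hom (Suc n) (unit_hom B)) m z"
      using so_vtx[OF X, of Z "Suc m" x] st_vtx[OF X Z z'(2), of x z] Z z'(2)
      by (simp add: Z_def[symmetric] E.E2B_Sb(2)[OF sX step_vtx[OF Z] o])
  qed
next
  fix n X assume X: "X \<in> Bo B (Suc n)"
  note sX = step_vtx[OF X]
  note fW = frame_homD[OF pre_bhomD(1)[OF bsystemD(3)[OF B X refl]]]
  show "beq (bslice B n (ft B n X)) (bslice_hom (Suc n) (unit_hom B) \<circ>\<^sub>B Wb B n X)
     (Wb (E2B_obj E) n (hB (unit_hom B) (Suc n) X) \<circ>\<^sub>B bslice_hom n (unit_hom B))"
  proof (rule beqI)
    fix m Z assume "Z \<in> Bo (bslice B n (ft B n X)) m"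
    then show "hB (bslice_hom (Suc n) (unit_hom B) \<circ>\<^sub>B Wb B n X) m Z
      = hB (Wb (E2B_obj E) n (hB (unit_hom B) (Suc n) X) \<circ>\<^sub>B bslice_hom n (unit_hom B)) m Z"
      using wo_vtx[OF X, of Z m] by (simp add: E.E2B_Wb(1)[OF sX])
  next
    fix m z assume z: "z \<in> Bt (bslice B n (ft B n X)) m"
    define Z where "Z = bd B (n + m) z"
    have z': "z \<in> Bt B (n + m)" "ftm B n m (ft B (n + m) Z) = ft B n X" using z by (auto simp: Z_def)
    have Z: "Z \<in> Bo B (Suc (n + m))" using is_bframe_bd[OF fr z'(1)] by (simp add: Z_def)
    have o: "over E (vtx (n + m) (ft B (n + m) Z)) (vtx n (ft B n X))"
      using over_vtx[of "ft B (n + m) Z" n m "ft B n X"] is_bframe_ft[OF fr Z] z'(2) by simp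
    have "bd B (Suc (n + m)) (hT (Wb B n X) m z) = hB (Wb B n X) (Suc m) Z" using fW(4)[OF z] by (simp add: Z_def)
    then show "hT (bslice_hom (Suc n) (unit_hom B) \<circ>\<^sub>B Wb B n X) m z
      = hT (Wb (E2B_obj E) n (hB (unit_hom B) (Suc n) X) \<circ>\<^sub>B bslice_hom n (unit_hom B)) m z"
      using wo_vtx[OF X, of Z "Suc m"] wt_vtx[OF X Z z'(2), of z] Z z'(2)
      by (simp add: Z_def[symmetric] E.E2B_Wb(2)[OF sX step_vtx[OF Z] o])
  qed
  show "hT (unit_hom B) (Suc n) (dl B n X) = dl (E2B_obj E) n (hB (unit_hom B) (Suc n) X)"
    using wo_vtx[OF X, of X 1] X bsystemD(8)[OF B X] by (simp add: E.E2B_dl[OF sX] dt_vtx)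
qed

text \<open>The level recovers the sort from a vertex, and the terms of an edge are exactly the
  one-entry tuples (\<open>tm_vtx\<close>). A homomorphism that is bijective in each sort is
  invertible by \<open>iso_Bsys\<close>.\<close>

lemma iso_unit: "iso Bsys (B, bres B (unit_hom B), E2B_obj E)"
proof (rule iso_Bsys[OF B E.bsystem_E2B pre_bhom_unit])
  fix n
  show "bij_betw (hB (unit_hom B) n) (Bo B n) (Bo (E2B_obj E) n)"
    unfolding bij_betw_def
  proof (intro conjI subset_antisym subsetI)
    show "inj_on (hB (unit_hom B) n) (Bo B n)" by (simp add: inj_on_def)
    fix v assume "v \<in> hB (unit_hom B) n ` Bo B n"
    then show "v \<in> Bo (E2B_obj E) n" using frame_homD(1)[OF frame_hom_unit] by blast
  next
    fix v assume v: "v \<in> Bo (E2B_obj E) n"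
    then have "v \<in> Ob E" by simp
    then obtain m X where X: "v = vtx m X" "X \<in> Bo B m" by (rule B2E_obj_ObE)
    then show "v \<in> hB (unit_hom B) n ` Bo B n" using v by (auto simp: level_B2E_obj[OF fr])
  qed
  show "bij_betw (hT (unit_hom B) n) (Bt B n) (Bt (E2B_obj E) n)"
    unfolding bij_betw_def
  proof (intro conjI subset_antisym subsetI)
    show "inj_on (hT (unit_hom B) n) (Bt B n)" by (simp add: inj_on_def)
    fix v assume "v \<in> hT (unit_hom B) n ` Bt B n"
    then show "v \<in> Bt (E2B_obj E) n" using frame_homD(2)[OF frame_hom_unit] by blast
  next
    fix v assume "v \<in> Bt (E2B_obj E) n"
    then obtain Z Q y where y: "v = Tup [Z, y]" "step E Z Q" "level E Q = n" "y \<in> tm E Z Q" by (rule E.E2B_BtE)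
    note s = E.stepD[OF y(2)]
    obtain m X where X: "Z = vtx m X" "X \<in> Bo B m" using s(3) by (rule B2E_obj_ObE)
    then have m: "m = Suc n" using s(2) y(3) by (simp add: level_B2E_obj[OF fr])
    have Q: "Q = vtx n (ft B n X)" using s(5) E.stepD(5)[OF step_vtx[of X n]] X m by simp
    show "v \<in> hT (unit_hom B) n ` Bt B n" using y(1,4) X m tm_vtx[of X n] by (auto simp: Q)
  qed
qed

end

lemma unit_natural:
  assumes B: "bsystem B" and A: "bsystem A" and H: "pre_bhom B A H"
  shows "beq B (unit_hom A \<circ>\<^sub>B H) (E2B_hom (B2E_obj B) (level (B2E_obj B)) (tres (B2E_obj B) (B2E_hom H)) \<circ>\<^sub>B unit_hom B)"
proof (rule beqI)
  interpret B: bsystem_esys B using B by unfold_locales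
  fix n X assume "X \<in> Bo B n"
  then show "hB (unit_hom A \<circ>\<^sub>B H) n X
    = hB (E2B_hom (B2E_obj B) (level (B2E_obj B)) (tres (B2E_obj B) (B2E_hom H)) \<circ>\<^sub>B unit_hom B) n X"
    by (simp add: tres_def)
next
  interpret B: bsystem_esys B using B by unfold_locales
  fix n x assume x: "x \<in> Bt B n"
  note X = is_bframe_bd[OF B.fr x]
  \<comment> \<open>The restricted functor computes on carriers only, so the one-entry tuple must be
    known to be a term of its edge before \<open>tres\<close> can be evaluated.\<close>
  have "Tup [x] \<in> Tm (B2E_obj B) (arr n (bd B n x) 1)" using x by auto
  then show "hT (unit_hom A \<circ>\<^sub>B H) n x
    = hT (E2B_hom (B2E_obj B) (level (B2E_obj B)) (tres (B2E_obj B) (B2E_hom H)) \<circ>\<^sub>B unit_hom B) n x"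
    using X frame_homD(4)[OF pre_bhomD(1)[OF H] x]
    by (simp add: tres_def B.E.indec_step[OF B.step_vtx[OF X]] B.arrow_vtx_ft[OF X] del: B2E_obj_simps(8) terms.simps)
qed

theorem theorem4p90:
  shows "equivalence_of_categories
     (Bsys :: ('a bsystem, 'a bmor) cat) (Esys\<^sub>s :: ('a esystem, 'a emor) cat) B2E E2B"
proof (rule equivalence_if_fully_faithful[OF category_Bsys category_Esys is_functor_B2E is_functor_E2B])
  let ?\<eta> = "\<lambda>B :: 'a bsystem. (B, bres B (unit_hom B), E2B_obj (B2E_obj B))"
  show "natural_iso Bsys Bsys id_ftor (comp_ftor E2B B2E) ?\<eta>"
    unfolding natural_iso_def
  proof (intro conjI ballI)
    fix B :: "'a bsystem" assume "B \<in> Ob Bsys"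
    then interpret bsystem_esys B by unfold_locales simp
    show "iso Bsys (?\<eta> B)" by (rule iso_unit)
    show "Dom Bsys (?\<eta> B) = onO id_ftor B" "Cod Bsys (?\<eta> B) = onO (comp_ftor E2B B2E) B"
      by (simp_all add: id_ftor_def comp_ftor_def E2B_simps B2E_simps)
  next
    fix f :: "'a bmor" assume "f \<in> Ar Bsys"
    then obtain B H A where f: "f = (B, H, A)" "bsystem B" "bsystem A" "pre_bhom B A H" using Bsys_triple by blast
    interpret B: bsystem_esys B using f(2) by unfold_locales
    have "bres B (bres A (unit_hom A) \<circ>\<^sub>B H)
      = bres B (E2B_hom (B2E_obj B) (level (B2E_obj B)) (tres (B2E_obj B) (B2E_hom H)) \<circ>\<^sub>B unit_hom B)"
      using bres_comp_left[OF f(4)] unit_natural[OF f(2-4)] by (simp add: bres_eq_iff[symmetric])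
    then show "Comp Bsys (?\<eta> (Cod Bsys f)) (onA id_ftor f) = Comp Bsys (onA (comp_ftor E2B B2E) f) (?\<eta> (Dom Bsys f))"
      using bres_comp_left[OF B.pre_bhom_unit]
      by (simp add: f(1) id_ftor_def comp_ftor_def E2B_simps B2E_simps)
  qed
next
  fix f g :: "'a emor"
  assume "f \<in> Ar Esys\<^sub>s" "g \<in> Ar Esys\<^sub>s" "Dom Esys\<^sub>s f = Dom Esys\<^sub>s g" "Cod Esys\<^sub>s f = Cod Esys\<^sub>s g" "onA E2B f = onA E2B g"
  then show "f = g" using E2B_faithful by (cases f, cases g) (auto simp: E2B_simps simp del: Esys_simps(2))
next
  fix E D :: "'a esystem" and h :: "'a bmor"
  assume *: "E \<in> Ob Esys\<^sub>s" "D \<in> Ob Esys\<^sub>s" "h \<in> Ar Bsys" "Dom Bsys h = onO E2B E" "Cod Bsys h = onO E2B D"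
  then obtain K where K: "h = (E2B_obj E, K, E2B_obj D)" by (cases h) (auto simp: E2B_simps)
  obtain F where "(E, F, D) \<in> Ar Esys\<^sub>s" "bres (E2B_obj E) (E2B_hom E (level E) F) = K"
    using E2B_full[of E D K] * K by (auto simp del: Bsys_simps(2) Esys_simps(2))
  then show "\<exists>f\<in>Ar Esys\<^sub>s. Dom Esys\<^sub>s f = E \<and> Cod Esys\<^sub>s f = D \<and> onA E2B f = h"
    using K by (intro bexI[of _ "(E, F, D)"]) (simp_all add: E2B_simps)
qed

end
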